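(* There is a positive constant $C$, not depending on the solution, such that the following holds. Let $T>0$, $M>0$, $K>0$. For any smooth solution $(\mathcal D,v,B,p)$ for $0\le t\le T$ of the free boundary problem of incompressible inviscid MHD (described in the context) satisfying, for $0\le t\le T$, $$|\partial P|\le M,\quad |\partial v|\le M\quad\text{in }\mathcal D_t,$$ $$|\theta|+|\partial v|+\frac1{\iota_0}\le K\quad\text{on }\partial\mathcal D_t,$$ we have, for all $t\in[0,T]$, $$E_1(t)\le 2e^{CMt}E_1(0)+CK^2\left(\mathrm{Vol}\,\mathcal D_t+E_0(0)\right)\left(e^{CMt}-1\right).$$
   Context: Let $n\in\{2,3\}$ and use the Einstein summation convention; indices are raised and lowered with the Euclidean metric $\delta_{ij}$. Free boundary problem: given a simply connected bounded domain $\mathcal D_0\subset\mathbb R^n$ and initial data $v_0,B_0$ with $\mathrm{div}\,v_0=\mathrm{div}\,B_0=0$, the unknowns are a set $\mathcal D\subset[0,T]\times\mathbb R^n$ with time slices $\mathcal D_t=\{x:(t,x)\in\mathcal D\}$, vector fields $v,B$ and a pressure $p$ on $\mathcal D$, with $\{x:(0,x)\in\mathcal D\}=\mathcal D_0$ and $(v,B)=(v_0,B_0)$ at $t=0$. Put $D_t=\partial_t+v^k\partial_k$ (material derivative) and $P=p+\frac1{8\pi}|B|^2$ (total pressure). Let $\mathcal N$ be the exterior unit normal to $\partial\mathcal D_t$, $\nabla_{\mathcal N}=\mathcal N^i\partial_i$, $v_{\mathcal N}=\mathcal N^iv_i$, $\kappa$ the normal velocity of $\partial\mathcal D_t$, and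 $\varsigma\ge0$ a constant. The equations are: $D_tv_j+\partial_jP=\frac1{4\pi}B^k\partial_kB_j$ and $D_tB_j=B^k\partial_kv_j$ in $\mathcal D$; $\partial_jv^j=0$ in $\mathcal D$; $\partial_jB^j=0$ on $\{t=0\}\times\mathcal D_0$; $v_{\mathcal N}=\kappa$ on $\partial\mathcal D_t$ for $t\in[0,T]$; $|B|=\varsigma$ and $p=0$ on $\partial\mathcal D_t$ for $t\in[0,T]$; $B_j\mathcal N^j=0$ on $\{t=0\}\times\partial\mathcal D_0$; $\nabla_{\mathcal N}P<0$ on $\{t=0\}\times\partial\mathcal D_0$. Geometry: $\theta_{ij}=\bar\partial_i\mathcal N_j$ is the second fundamental form of $\partial\mathcal D_t$, where $\bar\partial_i=\Pi_i^j\partial_j$, $\Pi_i^j=\delta_i^j-\mathcal N_i\mathcal N^j$. $\iota_0$ is the injectivity radius of the normal exponential map of $\partial\mathcal D_t$: the largest number such that $\partial\mathcal D_t\times(-\iota_0,\iota_0)\to\{x\in\mathbb R^n:\mathrm{dist}(x,\partial\mathcal D_t)<\iota_0\}$, $(\bar x,\iota)\mapsto\bar x+\iota\mathcal N(\bar x)$, is an injection. Energies: $E_0(t)=\int_{\mathcal D_t}\left(\frac12|v|^2+\frac1{8\pi}|B|^2\right)dx$, and $$E_1(t)=\int_{\mathcal D_t}\delta^{ij}\left(Q(\partial v_i,\partial v_j)+\frac1{4\pi}Q(\partial B_i,\partial B_j)\right)dx+\int_{\mathcal D_t}\left(|\mathrm{curl}\,v|^2+\frac1{4\pi}|\mathrm{curl}\,B|^2\right)dx,$$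 where $(\mathrm{curl}\,v)_{ij}=\partial_iv_j-\partial_jv_i$ and, for covectors, $Q(\alpha,\beta)=q^{ij}\alpha_i\beta_j$ with $q^{ij}=\delta^{ij}-\eta(d)^2\mathcal N^i\mathcal N^j$, $d(x)=\mathrm{dist}(x,\partial\mathcal D_t)$, $\mathcal N^i=-\delta^{ij}\partial_jd$ (extending the normal inside). Here $\eta$ is a smooth cutoff function with $0\le\eta(d)\le1$, $\eta(d)=1$ for $d<d_0/4$, $\eta(d)=0$ for $d>d_0/2$, and $d_0$ is a fixed number smaller than $\iota_0$. The constant $C$ may depend on $n$ and on these fixed choices. *)

theory Defs
  imports "HOL-Analysis.Analysis"
begin

primrec Ck_on :: "nat \<Rightarrow> 'a::real_normed_vector set \<Rightarrow> ('a \<Rightarrow> 'b::real_normed_vector) \<Rightarrow> bool" where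
  "Ck_on 0 S f \<longleftrightarrow> continuous_on S f"
| "Ck_on (Suc k) S f \<longleftrightarrow> (\<forall>x\<in>S. f differentiable (at x)) \<and>
     (\<forall>h. Ck_on k S (\<lambda>x. frechet_derivative f (at x) h))"

(* Only meaningful for open S. *)
definition smooth_on :: "'a::real_normed_vector set \<Rightarrow> ('a \<Rightarrow> 'b::real_normed_vector) \<Rightarrow> bool" where
  "smooth_on S f \<longleftrightarrow> (\<forall>k. Ck_on k S f)"

definition pd :: "'n \<Rightarrow> (real^'n \<Rightarrow> 'b::real_normed_vector) \<Rightarrow> real^'n::finite \<Rightarrow> 'b" where
  "pd k f x = frechet_derivative f (at x) (axis k 1)"

(* For a vector field f, grad f x $ k $ j is the derivative of the j-th component in the
   direction k, and the norm on real^'n^'n is the Euclidean (Frobenius) norm. *)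
definition grad :: "(real^'n \<Rightarrow> 'b::real_normed_vector) \<Rightarrow> real^'n::finite \<Rightarrow> 'b^'n" where
  "grad f x = (\<chi> k. pd k f x)"

definition divergence :: "(real^'n \<Rightarrow> real^'n) \<Rightarrow> real^'n::finite \<Rightarrow> real" where
  "divergence f x = (\<Sum>k\<in>UNIV. pd k f x $ k)"

definition curl :: "(real^'n \<Rightarrow> real^'n) \<Rightarrow> real^'n::finite \<Rightarrow> real^'n^'n" where
  "curl f x = (\<chi> i j. pd i f x $ j - pd j f x $ i)"

definition material_deriv ::
  "(real \<Rightarrow> real^'n \<Rightarrow> real^'n) \<Rightarrow> (real \<Rightarrow> real^'n \<Rightarrow> 'b::real_normed_vector) \<Rightarrow> real \<Rightarrow> real^'n::finite \<Rightarrow> 'b" where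
  "material_deriv v f t x =
     vector_derivative (\<lambda>s. f s x) (at t) + (\<Sum>k\<in>UNIV. (v t x $ k) *\<^sub>R pd k (f t) x)"

definition total_pressure ::
  "(real \<Rightarrow> real^'n \<Rightarrow> real) \<Rightarrow> (real \<Rightarrow> real^'n \<Rightarrow> real^'n) \<Rightarrow> real \<Rightarrow> real^'n::finite \<Rightarrow> real" where
  "total_pressure p B t x = p t x + (norm (B t x))\<^sup>2 / (8 * pi)"

definition slice :: "(real \<times> 'a) set \<Rightarrow> real \<Rightarrow> 'a set" where
  "slice D t = {x. (t, x) \<in> D}"

(* Defining function of the smooth set \<Omega> near its boundary point x. *)
definition local_defining_fun ::
  "(real^'n) set \<Rightarrow> real^'n \<Rightarrow> (real^'n) set \<Rightarrow> (real^'n::finite \<Rightarrow> real) \<Rightarrow> bool" where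
  "local_defining_fun \<Omega> x W \<phi> \<longleftrightarrow> open W \<and> x \<in> W \<and> smooth_on W \<phi> \<and> grad \<phi> x \<noteq> 0 \<and>
     (\<forall>y\<in>W. y \<in> \<Omega> \<longleftrightarrow> \<phi> y < 0)"

(* For x on the (smooth) boundary of \<Omega>; the value does not depend on the choice of \<phi>. *)
definition ext_normal :: "(real^'n) set \<Rightarrow> real^'n \<Rightarrow> real^'n::finite" where
  "ext_normal \<Omega> x = (THE \<nu>. \<exists>W \<phi>. local_defining_fun \<Omega> x W \<phi> \<and>
     \<nu> = grad \<phi> x /\<^sub>R norm (grad \<phi> x))"

(* Space-time version, for a subset D of [0,T] x R^n: the spatial gradient is required not to
   vanish, so that the time slices of D are smooth domains that move smoothly. *)
definition moving_defining_fun ::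
  "real \<Rightarrow> (real \<times> (real^'n)) set \<Rightarrow> real \<times> (real^'n) \<Rightarrow> (real \<times> (real^'n)) set \<Rightarrow> (real \<times> (real^'n::finite) \<Rightarrow> real) \<Rightarrow> bool" where
  "moving_defining_fun T D z W \<phi> \<longleftrightarrow> open W \<and> z \<in> W \<and> smooth_on W \<phi> \<and>
     grad (\<lambda>y. \<phi> (fst z, y)) (snd z) \<noteq> 0 \<and>
     (\<forall>w\<in>W. 0 \<le> fst w \<and> fst w \<le> T \<longrightarrow> (w \<in> D \<longleftrightarrow> \<phi> w < 0))"

(* If x(t) stays on the boundary {\<phi> = 0}, then x'(t) \<bullet> N = - (d/dt \<phi>) / |grad \<phi>|. *)
definition normal_velocity ::
  "real \<Rightarrow> (real \<times> (real^'n)) set \<Rightarrow> real \<Rightarrow> real^'n::finite \<Rightarrow> real" where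
  "normal_velocity T D t x = (THE \<kappa>. \<exists>W \<phi>. moving_defining_fun T D (t, x) W \<phi> \<and>
     \<kappa> = - vector_derivative (\<lambda>s. \<phi> (s, x)) (at t) / norm (grad (\<lambda>y. \<phi> (t, y)) x))"

(* closure D - D consists of the pairs (t,x) with x on the boundary of the slice at time t. *)
definition smooth_moving_domain :: "real \<Rightarrow> (real \<times> (real^'n::finite)) set \<Rightarrow> bool" where
  "smooth_moving_domain T D \<longleftrightarrow> bounded D \<and>
     openin (top_of_set ({0..T} \<times> UNIV)) D \<and>
     (\<forall>z\<in>closure D - D. \<exists>W \<phi>. moving_defining_fun T D z W \<phi>)"

(* Smoothness of the solution is understood up to the boundary: v, B, p denote smooth
   extensions to a space-time neighbourhood of the closure of D. The closure of D is the closure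
   of its interior, so only the values of v, B, p on the closure of D enter; in particular the
   derivatives on the boundary and at the end points of [0,T] do not depend on the extension. *)
definition mhd_solution ::
  "real \<Rightarrow> real \<Rightarrow> (real^'n) set \<Rightarrow> (real^'n \<Rightarrow> real^'n) \<Rightarrow> (real^'n \<Rightarrow> real^'n) \<Rightarrow>
   (real \<times> (real^'n)) set \<Rightarrow> (real \<Rightarrow> real^'n \<Rightarrow> real^'n) \<Rightarrow> (real \<Rightarrow> real^'n \<Rightarrow> real^'n) \<Rightarrow>
   (real \<Rightarrow> real^'n::finite \<Rightarrow> real) \<Rightarrow> bool" where
  "mhd_solution T \<sigma> D0 v0 B0 D v B p \<longleftrightarrow>
     \<comment> \<open>initial data; a simply connected set is connected in the library's sense\<close>
     open D0 \<and> bounded D0 \<and> D0 \<noteq> {} \<and> simply_connected D0 \<and>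
     (\<forall>x\<in>D0. divergence v0 x = 0 \<and> divergence B0 x = 0) \<and>
     slice D 0 = D0 \<and> (\<forall>x\<in>D0. v 0 x = v0 x \<and> B 0 x = B0 x) \<and>
     \<comment> \<open>smoothness\<close>
     smooth_moving_domain T D \<and>
     (\<exists>U. open U \<and> closure D \<subseteq> U \<and> smooth_on U (\<lambda>(t, x). v t x) \<and>
        smooth_on U (\<lambda>(t, x). B t x) \<and> smooth_on U (\<lambda>(t, x). p t x)) \<and>
     \<comment> \<open>equations in the interior\<close>
     (\<forall>(t, x)\<in>D. \<forall>j.
        material_deriv v v t x $ j + pd j (total_pressure p B t) x =
          (\<Sum>k\<in>UNIV. B t x $ k * pd k (B t) x $ j) / (4 * pi) \<and>
        material_deriv v B t x $ j = (\<Sum>k\<in>UNIV. B t x $ k * pd k (v t) x $ j)) \<and>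
     (\<forall>(t, x)\<in>D. divergence (v t) x = 0) \<and>
     (\<forall>x\<in>D0. divergence (B 0) x = 0) \<and>
     \<comment> \<open>boundary conditions\<close>
     (\<forall>t\<in>{0..T}. \<forall>x\<in>frontier (slice D t).
        v t x \<bullet> ext_normal (slice D t) x = normal_velocity T D t x \<and>
        norm (B t x) = \<sigma> \<and> p t x = 0) \<and>
     (\<forall>x\<in>frontier D0. B 0 x \<bullet> ext_normal D0 x = 0) \<and>
     (\<forall>x\<in>frontier D0. ext_normal D0 x \<bullet> grad (total_pressure p B 0) x < 0)"

definition tangential_proj :: "(real^'n) set \<Rightarrow> real^'n \<Rightarrow> real^'n^'n::finite" where
  "tangential_proj \<Omega> x =
     (\<chi> i j. (if i = j then 1 else 0) - ext_normal \<Omega> x $ i * ext_normal \<Omega> x $ j)"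

(* The normal is only given on the boundary, so it is differentiated within the boundary. This
   determines the derivative on tangent vectors, and every row of the projection is tangent. *)
definition second_ff :: "(real^'n) set \<Rightarrow> real^'n \<Rightarrow> real^'n^'n::finite" where
  "second_ff \<Omega> x = (\<chi> i j.
     frechet_derivative (ext_normal \<Omega>) (at x within frontier \<Omega>) (tangential_proj \<Omega> x $ i) $ j)"

definition inj_radius :: "(real^'n::finite) set \<Rightarrow> real" where
  "inj_radius \<Omega> = Sup {r. 0 \<le> r \<and>
     inj_on (\<lambda>(x, s). x + s *\<^sub>R ext_normal \<Omega> x) (frontier \<Omega> \<times> {-r<..<r})}"

definition cutoff :: "real \<Rightarrow> (real \<Rightarrow> real) \<Rightarrow> bool" where
  "cutoff d0 \<eta> \<longleftrightarrow> smooth_on UNIV \<eta> \<and> (\<forall>d. 0 \<le> \<eta> d \<and> \<eta> d \<le> 1) \<and>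
     (\<forall>d. d < d0 / 4 \<longrightarrow> \<eta> d = 1) \<and> (\<forall>d. d > d0 / 2 \<longrightarrow> \<eta> d = 0)"

abbreviation bdist :: "(real^'n) set \<Rightarrow> real^'n::finite \<Rightarrow> real" where
  "bdist \<Omega> x \<equiv> infdist x (frontier \<Omega>)"

(* The distance need not be differentiable everywhere in \<Omega>, but if d0 is smaller than the
   injectivity radius it is smooth wherever \<eta> does not vanish. *)
definition q_coeff :: "(real \<Rightarrow> real) \<Rightarrow> (real^'n) set \<Rightarrow> real^'n \<Rightarrow> real^'n^'n::finite" where
  "q_coeff \<eta> \<Omega> x = (\<chi> i j. (if i = j then 1 else 0) -
     (\<eta> (bdist \<Omega> x))\<^sup>2 * (- pd i (bdist \<Omega>) x) * (- pd j (bdist \<Omega>) x))"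

definition Q_form ::
  "(real \<Rightarrow> real) \<Rightarrow> (real^'n) set \<Rightarrow> real^'n \<Rightarrow> real^'n \<Rightarrow> real^'n::finite \<Rightarrow> real" where
  "Q_form \<eta> \<Omega> x \<alpha> \<beta> = (\<Sum>i\<in>UNIV. \<Sum>j\<in>UNIV. q_coeff \<eta> \<Omega> x $ i $ j * \<alpha> $ i * \<beta> $ j)"

definition energy0 ::
  "(real^'n) set \<Rightarrow> (real^'n \<Rightarrow> real^'n) \<Rightarrow> (real^'n::finite \<Rightarrow> real^'n) \<Rightarrow> real" where
  "energy0 \<Omega> v B = integral \<Omega> (\<lambda>x. (norm (v x))\<^sup>2 / 2 + (norm (B x))\<^sup>2 / (8 * pi))"

definition energy1 ::
  "(real \<Rightarrow> real) \<Rightarrow> (real^'n) set \<Rightarrow> (real^'n \<Rightarrow> real^'n) \<Rightarrow> (real^'n::finite \<Rightarrow> real^'n) \<Rightarrow> real" where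
  "energy1 \<eta> \<Omega> v B =
     integral \<Omega> (\<lambda>x. \<Sum>i\<in>UNIV.
       Q_form \<eta> \<Omega> x (grad (\<lambda>y. v y $ i) x) (grad (\<lambda>y. v y $ i) x) +
       Q_form \<eta> \<Omega> x (grad (\<lambda>y. B y $ i) x) (grad (\<lambda>y. B y $ i) x) / (4 * pi)) +
     integral \<Omega> (\<lambda>x. (norm (curl v x))\<^sup>2 + (norm (curl B x))\<^sup>2 / (4 * pi))"

end

theory Submission
  imports Defs "HOL-Analysis.Analysis"
begin

text \<open>Differentiating the density of \<open>E\<^sub>1\<close> along the flow and integrating by parts, all terms are
  \<open>O(M)\<close> times \<open>|\<partial>v|\<^sup>2 + |\<partial>B|\<^sup>2 + K\<^sup>2 (1 + |B|\<^sup>2)\<close>, except those in which the cutoff \<open>\<eta>\<close> is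
  differentiated: their size is governed by \<open>d0\<close> and not by \<open>K\<close>, which may be small. They are supported
  in the strip \<open>d0/4 \<le> d \<le> d0/2\<close> and involve only \<open>\<partial>P\<close> and \<open>B \<bullet> \<N>\<close>. There \<open>\<partial>P\<close> is controlled in \<open>L\<^sup>1\<close> by
  \<open>\<Delta>P = - \<partial>\<^sub>iv\<^sub>k \<partial>\<^sub>kv\<^sub>i + \<partial>\<^sub>iB\<^sub>k \<partial>\<^sub>kB\<^sub>i / (4\<pi>)\<close> (Kato's inequality with a weight in \<open>d\<close>, using that \<open>P\<close> is
  constant on the boundary), and \<open>B \<bullet> \<N>\<close>, which vanishes on the boundary, by a Poincare inequality. Vanishing of
  \<open>div B\<close> and of \<open>B \<bullet> \<N>\<close> propagates by a maximum principle. Neither flow maps nor surface integrals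
  are needed: boundary terms are removed by cutting off in \<open>d\<close>, since the relevant fields are tangential
  up to \<open>O(d)\<close>. Gronwall's inequality and conservation of volume and of \<open>E\<^sub>0\<close> conclude.\<close>

text \<open>Near the boundary the density of the energy sees only tangential derivatives, but for
  divergence free fields these together with the curl control the whole gradient
  (\<open>coercivity\<close>); this is what lets the quadratic remainder be absorbed. Second
  derivatives never have to be estimated: those of the pressure, and those coupling the velocity
  with the magnetic field, form exact divergences. Two kinds of constants are kept apart. Bounds
  obtained from compactness of the closure of \<open>D\<close> depend on the solution; they only
  show that fluxes are tangential to first order or that integrals exist. The constants of the final
  estimate are defined outside the locales from the dimension, \<open>d0\<close> and the cutoff
  alone. Kato's and Poincare's inequality come from one flux along the normal, weighted by a high
  power of \<open>bb - bd\<close>. The exponent is large because the derivative of the weight must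
  dominate the Laplacian of the distance, which is of size \<open>1 / d0\<close>. The regularity
  required of the distance is C2 in the strip; it follows from C1 regularity of the foot and the
  normal, since both appear in the first derivatives of the distance.\<close>

abbreviation (input) sum_all :: "('i => 'a) => 'a::comm_monoid_add" (binder "SUMU " 10) where
 "sum_all f \<equiv> sum f UNIV"

section \<open>Functions of class Ck\<close>

text \<open>The direction comes first so that \<open>dd h f\<close> is again a function of the point
  and derivatives iterate as \<open>dd h (dd k f)\<close>. On space-time, \<open>dd (1, 0)\<close>
  is the time derivative and \<open>dd (1, V z)\<close> the material derivative.\<close>

definition dd :: "'a::real_normed_vector => ('a => 'b::real_normed_vector) => 'a => 'b" where
 "dd h f x = frechet_derivative f (at x) h"

lemma Ck_on_Suc:
 "Ck_on (Suc k) S f \<longleftrightarrow> (ALL x:S. f differentiable (at x)) & (\<forall>h. Ck_on k S (dd h f))"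
 by (simp add: dd_def[abs_def])

declare Ck_on.simps(2) [simp del]

lemma dd_eq: "(f has_derivative f') (at x) ==> dd h f x = f' h"
 unfolding dd_def using frechet_derivative_at by metis

lemma has_derivative_dd: "f differentiable at x ==> (f has_derivative (%h. dd h f x)) (at x)"
 unfolding dd_def by (simp add: frechet_derivative_works)

lemma linear_dd: "f differentiable at x ==> linear (%h. dd h f x)"
 using has_derivative_dd has_derivative_linear by blast

lemma Ck_on_subset: "Ck_on k S f ==> T \<subseteq> S ==> Ck_on k T f"
 by (induction k arbitrary: f) (auto simp: Ck_on_Suc intro: continuous_on_subset)

text \<open>No differentiability is required: functions that agree near \<open>x\<close> have the
  same candidates for a derivative, so \<open>frechet_derivative\<close> makes the same choice for
  both.\<close>

lemma dd_cong_open: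
 assumes "open S" "x : S" "!!y. y : S ==> f y = g y"
 shows "dd h f x = dd h g x"
proof -
 have "(f has_derivative F) (at x) \<longleftrightarrow> (g has_derivative F) (at x)" for F
  using assms has_derivative_transform_within_open[of f F x UNIV S g]
   has_derivative_transform_within_open[of g F x UNIV S f] by auto
 then show ?thesis unfolding dd_def frechet_derivative_def by presburger
qed

lemma differentiable_cong_open:
 assumes "open S" "x : S" "!!y. y : S ==> f y = g y" "f differentiable at x"
 shows "g differentiable at x"
 using assms has_derivative_transform_within_open[of f _ x UNIV S g]
 unfolding differentiable_def by metis

lemma Ck_on_cong:
 assumes "open S" "!!y. y : S ==> f y = g y" "Ck_on k S f"
 shows "Ck_on k S g"
 using assms(2,3)
proof (induction k arbitrary: f g)
 case 0
 then show ?case using continuous_on_cong[of S S f g] by simp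
next
 case (Suc k)
 have "g differentiable at x" if "x : S" for x
  using Suc.prems that differentiable_cong_open[OF assms(1) that, of f g] by (auto simp: Ck_on_Suc)
 moreover have "Ck_on k S (dd h g)" for h
 proof (rule Suc.IH[of "dd h f"])
  show "dd h f y = dd h g y" if "y : S" for y
   using dd_cong_open[OF assms(1) that, of f g h] Suc.prems(1) by blast
  show "Ck_on k S (dd h f)" using Suc.prems by (simp add: Ck_on_Suc)
 qed
 ultimately show ?case by (simp add: Ck_on_Suc)
qed

text \<open>All derivatives are taken at full neighbourhoods, so the class is a local property. This
  allows functions of the distance to be glued from the strip and the region where they are
  constant.\<close>

lemma Ck_on_local:
 assumes "!!x. x : S ==> \<exists>U. open U & x : U & Ck_on k U f"
 shows "Ck_on k S f"
 using assms
proof (induction k arbitrary: f)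
 case 0
 have "isCont f x" if "x : S" for x
  using 0[OF that] continuous_on_eq_continuous_at by fastforce
 then show ?case by (simp add: continuous_at_imp_continuous_on)
next
 case (Suc k)
 have "f differentiable at x" if "x : S" for x using Suc.prems[OF that] by (auto simp: Ck_on_Suc)
 moreover have "Ck_on k S (dd h f)" for h
 proof (rule Suc.IH)
  fix x assume "x : S"
  then show "\<exists>U. open U & x : U & Ck_on k U (dd h f)"
   using Suc.prems[of x] unfolding Ck_on_Suc by blast
 qed
 ultimately show ?case by (simp add: Ck_on_Suc)
qed

lemma Ck_on_UN: "(!!i. i : I ==> open (U i) & Ck_on k (U i) f) ==> S \<subseteq> (\<Union>i\<in>I. U i) ==> Ck_on k S f"
 by (rule Ck_on_local) blast

lemma Ck_on_Suc_imp: "Ck_on (Suc k) S f ==> Ck_on k S f"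
proof (induction k arbitrary: f)
 case 0
 then show ?case
  by (auto simp: Ck_on_Suc intro!: continuous_at_imp_continuous_on differentiable_imp_continuous_within)
next
 case (Suc k)
 then show ?case by (subst Ck_on_Suc) (auto simp: Ck_on_Suc[of "Suc k"])
qed

lemma Ck_on_le: "Ck_on k S f ==> j <= k ==> Ck_on j S f"
 by (induction k) (auto simp: le_Suc_eq intro: Ck_on_Suc_imp)

lemma Ck_on_cont: "Ck_on k S f ==> continuous_on S f"
 using Ck_on_le[of k S f 0] by simp

lemma Ck_on_diff: "Ck_on (Suc k) S f ==> x : S ==> f differentiable at x"
 by (simp add: Ck_on_Suc)

lemma Ck_on_dd: "Ck_on (Suc k) S f ==> Ck_on k S (dd h f)"
 by (simp add: Ck_on_Suc)

lemma smooth_on_Ck: "smooth_on S f ==> Ck_on k S f"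
 by (simp add: smooth_on_def)

lemma dd_const [simp]: "dd h (%x. c) x = 0"
 by (rule dd_eq) (rule has_derivative_const)

lemma Ck_on_const [simp]: "Ck_on k S (%x. c)"
 by (induction k arbitrary: c) (auto simp: Ck_on_Suc dd_const[abs_def])

lemma dd_bounded_linear: "bounded_linear L ==> dd h L x = L h"
 using bounded_linear_imp_has_derivative dd_eq by blast

lemma Ck_on_bounded_linear: "bounded_linear L ==> Ck_on k S L"
proof (cases k)
 case (Suc j)
 assume L: "bounded_linear L"
 then have "dd h L = (%x. L h)" for h by (simp add: dd_bounded_linear fun_eq_iff)
 then show ?thesis using Suc L by (simp add: Ck_on_Suc bounded_linear_imp_differentiable)
qed (simp add: linear_continuous_on)

lemma dd_add: "f differentiable at x ==> g differentiable at x ==> dd h (%x. f x + g x) x = dd h f x + dd h g x"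
 using dd_eq[OF has_derivative_add[OF has_derivative_dd has_derivative_dd]] by blast

lemma Ck_on_add:
 assumes "open S" "Ck_on k S f" "Ck_on k S g"
 shows "Ck_on k S (%x. f x + g x)"
 using assms(2,3)
proof (induction k arbitrary: f g)
 case 0
 then show ?case by (simp add: continuous_on_add)
next
 case (Suc k)
 have "Ck_on k S (dd h (%x. f x + g x))" for h
  by (rule Ck_on_cong[OF assms(1) _ Suc.IH[of "dd h f" "dd h g"]])
   (use Suc.prems in \<open>auto simp: Ck_on_Suc dd_add\<close>)
 then show ?case using Suc.prems by (auto simp: Ck_on_Suc)
qed

lemma Ck_on_sum:
 assumes "open S" "!!i. i : I ==> Ck_on k S (f i)"
 shows "Ck_on k S (%x. \<Sum>i\<in>I. f i x)"
 using assms(2) by (induction I rule: infinite_finite_induct) (auto intro: Ck_on_add[OF assms(1)])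

lemma dd_bilinear:
 assumes "bounded_bilinear b" "f differentiable at x" "g differentiable at x"
 shows "dd h (%x. b (f x) (g x)) x = b (f x) (dd h g x) + b (dd h f x) (g x)"
 using dd_eq[OF bounded_bilinear.FDERIV[OF assms(1) has_derivative_dd[OF assms(2)] has_derivative_dd[OF assms(3)]]]
 by blast

lemma Ck_on_bilinear:
 assumes b: "bounded_bilinear b" and "open S" "Ck_on k S f" "Ck_on k S g"
 shows "Ck_on k S (%x. b (f x) (g x))"
 using assms(3,4)
proof (induction k arbitrary: f g)
 case 0
 then show ?case using bounded_bilinear.continuous_on[OF b] by auto
next
 case (Suc k)
 have "Ck_on k S (dd h (%x. b (f x) (g x)))" for h
 proof (rule Ck_on_cong[OF assms(2)])
  show "Ck_on k S (%x. b (f x) (dd h g x) + b (dd h f x) (g x))"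
   using Suc by (intro Ck_on_add[OF assms(2)] Suc.IH) (auto intro: Ck_on_dd Ck_on_Suc_imp)
  show "b (f y) (dd h g y) + b (dd h f y) (g y) = dd h (%x. b (f x) (g x)) y" if "y : S" for y
   using dd_bilinear[OF b, of f y g h] Suc.prems that by (simp add: Ck_on_Suc)
 qed
 moreover have "(%x. b (f x) (g x)) differentiable at x" if "x : S" for x
  using bounded_bilinear.FDERIV[OF b has_derivative_dd has_derivative_dd, of f x g] Suc.prems that
  by (auto simp: Ck_on_Suc differentiable_def)
 ultimately show ?case by (auto simp: Ck_on_Suc)
qed

lemmas Ck_on_mult = Ck_on_bilinear[OF bounded_bilinear_mult]
lemmas Ck_on_scaleR = Ck_on_bilinear[OF bounded_bilinear_scaleR]
lemmas Ck_on_inner = Ck_on_bilinear[OF bounded_bilinear_inner]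
lemmas dd_mult = dd_bilinear[OF bounded_bilinear_mult]
lemmas dd_scaleR = dd_bilinear[OF bounded_bilinear_scaleR]
lemmas dd_inner = dd_bilinear[OF bounded_bilinear_inner]

lemma dd_compose:
 assumes "f differentiable at x" "g differentiable at (f x)"
 shows "dd h (%x. g (f x)) x = dd (dd h f x) g (f x)"
 using dd_eq[OF has_derivative_compose[OF has_derivative_dd[OF assms(1)] has_derivative_dd[OF assms(2)]]]
 by simp

lemma dd_expand:
 fixes f :: "'a::euclidean_space => 'b::real_normed_vector"
 assumes "f differentiable at x"
 shows "dd h f x = (\<Sum>b\<in>Basis. (h \<bullet> b) *\<^sub>R dd b f x)"
proof -
 interpret linear "%h. dd h f x" by (rule linear_dd[OF assms])
 have "dd h f x = dd (\<Sum>b\<in>Basis. (h \<bullet> b) *\<^sub>R b) f x" by (simp add: euclidean_representation)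
 then show ?thesis using sum[of "%b. (h \<bullet> b) *\<^sub>R b" Basis] by (simp add: scale)
qed

text \<open>The chain rule produces \<open>dd (dd h f x) g\<close>, whose direction moves with the
  point, so the induction hypothesis does not apply to it. Expanding over \<open>Basis\<close>
  leaves finitely many fixed directions; this is why the middle space is Euclidean.\<close>

lemma Ck_on_compose:
 fixes f :: "'a::real_normed_vector => 'b::euclidean_space" and g :: "'b => 'c::real_normed_vector"
 assumes "open S" "Ck_on k S f" "Ck_on k T g" "f ` S \<subseteq> T"
 shows "Ck_on k S (%x. g (f x))"
 using assms(2,3)
proof (induction k arbitrary: g)
 case 0
 then show ?case using continuous_on_compose2[of T g S f] assms(4) by simp
next
 case (Suc k)
 have dif: "f differentiable at x" "g differentiable at (f x)" if "x : S" for x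
  using Suc.prems that assms(4) by (auto simp: Ck_on_Suc)
 have "Ck_on k S (dd h (%x. g (f x)))" for h
 proof (rule Ck_on_cong[OF assms(1)])
  show "Ck_on k S (%x. \<Sum>b\<in>Basis. (dd h f x \<bullet> b) *\<^sub>R dd b g (f x))"
   using Suc by (intro Ck_on_sum Ck_on_scaleR Ck_on_inner Suc.IH assms(1) Ck_on_const)
    (auto intro: Ck_on_dd Ck_on_Suc_imp)
  show "(\<Sum>b\<in>Basis. (dd h f y \<bullet> b) *\<^sub>R dd b g (f y)) = dd h (%x. g (f x)) y" if "y : S" for y
   using dd_compose[OF dif[OF that], of h] dd_expand[OF dif(2)[OF that], of "dd h f y"] by simp
 qed
 moreover have "(%x. g (f x)) differentiable at x" if "x : S" for x
  using differentiable_compose[of g f x UNIV] dif[OF that] by simp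
 ultimately show ?case by (auto simp: Ck_on_Suc)
qed

lemma Ck_on_bounded_linear_compose:
 assumes "open S" "Ck_on k S f" "bounded_linear L"
 shows "Ck_on k S (%x. L (f x))"
 using assms(2)
proof (induction k arbitrary: f)
 case 0
 then show ?case by (simp add: bounded_linear.continuous_on[OF assms(3)])
next
 case (Suc k)
 have D: "((%x. L (f x)) has_derivative (%h. L (dd h f x))) (at x)" if "x : S" for x
  using bounded_linear.has_derivative[OF assms(3) has_derivative_dd] Suc.prems that by (auto simp: Ck_on_Suc)
 have "Ck_on k S (dd h (%x. L (f x)))" for h
  by (rule Ck_on_cong[OF assms(1) _ Suc.IH[of "dd h f"]]) (use D dd_eq Suc.prems in \<open>fastforce simp: Ck_on_Suc\<close>)+
 with D show ?case by (auto simp: Ck_on_Suc differentiable_def)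
qed

lemma Ck_on_minus: "open S ==> Ck_on k S f ==> Ck_on k S (%x. - f x)"
 by (rule Ck_on_bounded_linear_compose[OF _ _ bounded_linear_minus[OF bounded_linear_ident]])

lemma Ck_on_diff_fun: "open S ==> Ck_on k S f ==> Ck_on k S g ==> Ck_on k S (%x. f x - g x)"
 using Ck_on_add[of S k f "%x. - g x"] Ck_on_minus[of S k g] by simp

lemma Ck_on_ident [simp]: "Ck_on k S (%x. x)"
 by (rule Ck_on_bounded_linear) (rule bounded_linear_ident)

lemma Ck_on_power: "open S ==> Ck_on k S f ==> Ck_on k S (%x. f x ^ m :: real)"
proof (induction m)
 case (Suc m)
 then show ?case using Ck_on_mult[of S k f "%x. f x ^ m"] by simp
qed simp

lemma Ck_on_Pair:
 assumes "open S" "Ck_on k S f" "Ck_on k S g"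
 shows "Ck_on k S (%x. (f x, g x))"
proof -
 have "Ck_on k S (%x. (f x, 0) + (0, g x))"
  by (intro Ck_on_add assms(1)
    Ck_on_bounded_linear_compose[OF assms(1,2) bounded_linear_Pair[OF bounded_linear_ident bounded_linear_zero]]
    Ck_on_bounded_linear_compose[OF assms(1,3) bounded_linear_Pair[OF bounded_linear_zero bounded_linear_ident]])
 then show ?thesis by simp
qed

lemma Ck_on_fst: "open S ==> Ck_on k S f ==> Ck_on k S (%x. fst (f x))"
 by (rule Ck_on_bounded_linear_compose[OF _ _ bounded_linear_fst])

lemma Ck_on_snd: "open S ==> Ck_on k S f ==> Ck_on k S (%x. snd (f x))"
 by (rule Ck_on_bounded_linear_compose[OF _ _ bounded_linear_snd])

lemma Ck_on_vec_nth: "open S ==> Ck_on k S f ==> Ck_on k S (%x. f x $ i)"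
 by (rule Ck_on_bounded_linear_compose[OF _ _ bounded_linear_vec_nth])

lemma Ck_on_vec_lambda:
 fixes f :: "'a::real_normed_vector => real^'n"
 assumes "open S" "!!i. Ck_on k S (%x. f x $ i)"
 shows "Ck_on k S f"
proof -
 have "Ck_on k S (%x. SUMU i. (f x $ i) *\<^sub>R axis i (1::real))"
  using assms by (intro Ck_on_sum Ck_on_scaleR Ck_on_const)
 moreover have "(%x. SUMU i. (f x $ i) *\<^sub>R axis i (1::real)) = f"
  by (auto simp: fun_eq_iff vec_eq_iff axis_def if_distrib cong: if_cong)
 ultimately show ?thesis by simp
qed

lemma Ck_on_deriv:
 fixes g :: "real => real"
 assumes "open T" "!!x. x : T ==> (g has_field_derivative g' x) (at x)" "Ck_on k T g'"
 shows "Ck_on (Suc k) T g"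
proof -
 have D: "(g has_derivative (%h. h * g' x)) (at x)" if "x : T" for x
  using assms(2)[OF that] by (simp add: has_field_derivative_def mult.commute[of _ "g' x"])
 have "Ck_on k T (dd h g)" for h
  by (rule Ck_on_cong[OF assms(1) _ Ck_on_mult[OF assms(1) Ck_on_const[of k T h] assms(3)]])
   (use D dd_eq in fastforce)
 with D show ?thesis by (auto simp: Ck_on_Suc differentiable_def)
qed

lemma Ck_on_inverse: "Ck_on k {x::real. x ~= 0} inverse"
proof (induction k)
 case 0
 then show ?case by (auto intro!: continuous_intros)
next
 case (Suc k)
 have o: "open {x::real. x ~= 0}" by (simp add: open_Collect_neq)
 show ?case
  by (rule Ck_on_deriv[OF o, of _ "%x. - (inverse x * inverse x)"])
   (auto intro!: derivative_eq_intros Ck_on_minus Ck_on_mult o Suc simp: power2_eq_square)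
qed

lemma Ck_on_sqrt: "Ck_on k {x::real. x > 0} sqrt"
proof (induction k)
 case 0
 then show ?case by (auto intro!: continuous_intros)
next
 case (Suc k)
 have o: "open {x::real. x > 0}" by (simp add: open_Collect_less)
 have "Ck_on k {x::real. x > 0} (%x. inverse (sqrt x) * (1/2))"
  by (intro Ck_on_mult Ck_on_compose[OF o Suc Ck_on_inverse] Ck_on_const o) auto
 then show ?case
  by (rule Ck_on_deriv[OF o, rotated]) (auto intro!: derivative_eq_intros simp: field_simps)
qed

lemma dd_minus: "f differentiable at x ==> dd h (%x. - f x) x = - dd h f x"
 using dd_eq[OF has_derivative_minus[OF has_derivative_dd]] by blast

lemma dd_diff: "f differentiable at x ==> g differentiable at x ==> dd h (%x. f x - g x) x = dd h f x - dd h g x"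
 using dd_eq[OF has_derivative_diff[OF has_derivative_dd has_derivative_dd]] by blast

lemma dd_sum:
 assumes "!!i. i : I ==> f i differentiable at x"
 shows "dd h (%x. \<Sum>i\<in>I. f i x) x = (\<Sum>i\<in>I. dd h (f i) x)"
proof -
 have "((%x. \<Sum>i\<in>I. f i x) has_derivative (%h. \<Sum>i\<in>I. dd h (f i) x)) (at x)"
  using assms by (intro has_derivative_sum has_derivative_dd)
 then show ?thesis by (rule dd_eq)
qed

lemma dd_cmult: "f differentiable at x ==> dd h (%x. c * f x) x = c * (dd h f x :: real)"
 using dd_mult[of "%x. c" x f h] by simp

lemma dd_real_compose:
 fixes g :: "real => real"
 assumes "f differentiable at x" "(g has_field_derivative g') (at (f x))"
 shows "dd h (%x. g (f x)) x = g' * dd h f x"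
 using dd_eq[OF has_derivative_compose[OF has_derivative_dd[OF assms(1)] assms(2)[unfolded has_field_derivative_def]]]
 by simp

lemma dd_add_dir: "f differentiable at x ==> dd (h + k) f x = dd h f x + dd k f x"
 using linear_add[OF linear_dd] by blast

lemma dd_scale_dir: "f differentiable at x ==> dd (c *\<^sub>R h) f x = c *\<^sub>R dd h f x"
 using linear_scale[OF linear_dd] by blast

lemma has_field_derivative_line:
 fixes f :: "'a::real_normed_vector => real"
 assumes "f differentiable at (y + b *\<^sub>R k)"
 shows "((%b. f (y + b *\<^sub>R k)) has_field_derivative dd k f (y + b *\<^sub>R k)) (at b)"
proof -
 have 1: "((%b. y + b *\<^sub>R k) has_derivative (%t. t *\<^sub>R k)) (at b)"
  by (auto intro!: derivative_eq_intros)
 have "((%b. f (y + b *\<^sub>R k)) has_derivative (%t. dd (t *\<^sub>R k) f (y + b *\<^sub>R k))) (at b)"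
  using has_derivative_compose[OF 1, of f] has_derivative_dd[OF assms] by blast
 then show ?thesis
  using dd_scale_dir[OF assms]
  by (simp add: has_field_derivative_def mult.commute[of _ "dd k f (y + b *\<^sub>R k)"])
qed

text \<open>Schwarz: both mixed derivatives are limits of the second difference
 \<open>f (x + sh + sk) - f (x + sh) - f (x + sk) + f x\<close> divided by \<open>s\<^sup>2\<close>.\<close>

lemma second_difference_limit:
 fixes f :: "'a::real_normed_vector => real"
 assumes "open S" "x : S" "Ck_on 2 S f"
 shows "((%s. (f (x + s *\<^sub>R h + s *\<^sub>R k) - f (x + s *\<^sub>R h) - f (x + s *\<^sub>R k) + f x) / s\<^sup>2)
      \<longlongrightarrow> dd h (dd k f) x) (at_right 0)"
proof -
 have diff: "f differentiable at y" "dd k f differentiable at y" if "y : S" for y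
  using assms(3) that by (auto simp: Ck_on_Suc numeral_2_eq_2)
 have cont: "continuous_on S (dd h (dd k f))"
  using assms(3) by (auto simp: Ck_on_Suc numeral_2_eq_2)
 show ?thesis
 proof (rule tendstoI)
  fix e :: real assume "e > 0"
  have "isCont (dd h (dd k f)) x" using cont assms(1,2) continuous_on_eq_continuous_at by blast
  then obtain r1 where r1: "r1 > 0" "!!y. dist y x < r1 ==> dist (dd h (dd k f) y) (dd h (dd k f) x) < e"
   using \<open>e > 0\<close> unfolding continuous_at_eps_delta by blast
  obtain r2 where r2: "r2 > 0" "ball x r2 \<subseteq> S" using assms(1,2) open_contains_ball by blast
  define r where "r = min r1 r2"
  define c where "c = norm h + norm k + 1"
  have c: "c > 0" by (simp add: c_def add_nonneg_pos)
  have "dist ((f (x + s *\<^sub>R h + s *\<^sub>R k) - f (x + s *\<^sub>R h) - f (x + s *\<^sub>R k) + f x) / s\<^sup>2)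
    (dd h (dd k f) x) < e" if s: "0 < s" "s < r / c" for s
  proof -
   have inS: "dist (x + a *\<^sub>R h + b *\<^sub>R k) x < r" if "0 <= a" "a <= s" "0 <= b" "b <= s" for a b
   proof -
    have "dist (x + a *\<^sub>R h + b *\<^sub>R k) x <= a * norm h + b * norm k"
     using that norm_triangle_ineq[of "a *\<^sub>R h" "b *\<^sub>R k"] by (simp add: dist_norm add.assoc)
    also have "... <= s * norm h + s * norm k" using that by (intro add_mono mult_right_mono) auto
    also have "... < s * c" using s by (simp add: c_def algebra_simps)
    also have "... < r" using s c by (simp add: field_simps)
    finally show ?thesis .
   qed
   then have inS': "x + a *\<^sub>R h + b *\<^sub>R k : S" if "0 <= a" "a <= s" "0 <= b" "b <= s" for a b
    using that r2 inS[OF that] by (force simp: r_def dist_commute)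
   \<comment> \<open>The mean value theorem is used twice, in the direction \<open>k\<close> for the
     increment in \<open>h\<close> and then in the direction \<open>h\<close> for
     \<open>dd k f\<close>. The quotient becomes an exact value of \<open>dd h (dd k f)\<close> at a
     nearby point, so only continuity of that one function is used.\<close>
   define F where "F b = f (x + s *\<^sub>R h + b *\<^sub>R k) - f (x + b *\<^sub>R k)" for b
   have "\<exists>b. 0 < b & b < s & F s - F 0 = (s - 0) * (dd k f (x + s *\<^sub>R h + b *\<^sub>R k) - dd k f (x + b *\<^sub>R k))"
   proof (rule MVT2)
    fix b assume b: "0 <= b" "b <= s"
    show "(F has_real_derivative dd k f (x + s *\<^sub>R h + b *\<^sub>R k) - dd k f (x + b *\<^sub>R k)) (at b)"
     unfolding F_def using inS'[of s b] inS'[of 0 b] b s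
     by (intro DERIV_diff has_field_derivative_line diff(1)) auto
   qed (use s in auto)
   then obtain b where b: "0 < b" "b < s"
    "F s - F 0 = s * (dd k f (x + s *\<^sub>R h + b *\<^sub>R k) - dd k f (x + b *\<^sub>R k))" by auto
   define g where "g a = dd k f (x + a *\<^sub>R h + b *\<^sub>R k)" for a
   have "\<exists>a. 0 < a & a < s & g s - g 0 = (s - 0) * dd h (dd k f) (x + a *\<^sub>R h + b *\<^sub>R k)"
   proof (rule MVT2)
    fix a assume a: "0 <= a" "a <= s"
    have in1: "x + a *\<^sub>R h + b *\<^sub>R k : S" using inS'[of a b] a b by auto
    then have "((%a. dd k f ((x + b *\<^sub>R k) + a *\<^sub>R h)) has_field_derivative
      dd h (dd k f) ((x + b *\<^sub>R k) + a *\<^sub>R h)) (at a)"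
     by (intro has_field_derivative_line diff(2)) (simp add: add_ac)
    then show "(g has_real_derivative dd h (dd k f) (x + a *\<^sub>R h + b *\<^sub>R k)) (at a)"
     unfolding g_def by (simp add: add_ac)
   qed (use s in auto)
   then obtain a where a: "0 < a" "a < s" "g s - g 0 = s * dd h (dd k f) (x + a *\<^sub>R h + b *\<^sub>R k)" by auto
   have "F s - F 0 = s\<^sup>2 * dd h (dd k f) (x + a *\<^sub>R h + b *\<^sub>R k)"
    using a(3) b(3) by (simp add: g_def power2_eq_square)
   then have "(f (x + s *\<^sub>R h + s *\<^sub>R k) - f (x + s *\<^sub>R h) - f (x + s *\<^sub>R k) + f x) / s\<^sup>2
     = dd h (dd k f) (x + a *\<^sub>R h + b *\<^sub>R k)"
    using s by (simp add: F_def field_simps)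
   then show ?thesis using r1(2)[of "x + a *\<^sub>R h + b *\<^sub>R k"] inS[of a b] a b by (auto simp: r_def)
  qed
  moreover have "eventually (%s. 0 < s & s < r / c) (at_right 0)"
   using r1 r2 c by (auto simp: r_def eventually_at_right_field intro!: exI[of _ "min r1 r2 / c"])
  ultimately show "\<forall>\<^sub>F s in at_right 0. dist ((f (x + s *\<^sub>R h + s *\<^sub>R k) - f (x + s *\<^sub>R h) - f (x + s *\<^sub>R k) + f x) / s\<^sup>2)
    (dd h (dd k f) x) < e"
   by (auto elim: eventually_mono)
 qed
qed

lemma dd_commute:
 fixes f :: "'a::real_normed_vector => real"
 assumes "open S" "x : S" "Ck_on 2 S f"
 shows "dd h (dd k f) x = dd k (dd h f) x"
proof -
 have "((%s. (f (x + s *\<^sub>R h + s *\<^sub>R k) - f (x + s *\<^sub>R h) - f (x + s *\<^sub>R k) + f x) / s\<^sup>2)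
      \<longlongrightarrow> dd k (dd h f) x) (at_right 0)"
  using second_difference_limit[OF assms, of k h] by (simp add: algebra_simps)
 then show ?thesis
  using second_difference_limit[OF assms, of h k] tendsto_unique trivial_limit_at_right_real by blast
qed

section \<open>The tube around the boundary of a smooth domain\<close>

lemma grad_inner:
 fixes f :: "real^'n::finite => real"
 assumes "f differentiable at x"
 shows "dd h f x = grad f x \<bullet> h"
proof -
 interpret linear "%h. dd h f x" by (rule linear_dd[OF assms])
 have "dd h f x = dd (SUMU i. h $ i *\<^sub>R axis i 1) f x"
  using basis_expansion[of h] by (simp add: scalar_mult_eq_scaleR)
 also have "... = (SUMU i. h $ i * dd (axis i 1) f x)"
  by (simp add: sum scale)
 also have "... = grad f x \<bullet> h"
  by (simp add: grad_def pd_def dd_def inner_vec_def mult.commute)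
 finally show ?thesis .
qed

text \<open>Unless the two unit vectors agree, their difference is a direction strictly inside the
  open half-space of \<open>a\<close> and strictly outside the closed one of \<open>b\<close>.
  Normals are recovered from one-sided information in this way.\<close>

lemma halfspace_unique:
 fixes a b :: "'a::real_inner"
 assumes "a ~= 0" "b ~= 0" "!!h. a \<bullet> h < 0 ==> b \<bullet> h <= 0"
 shows "a /\<^sub>R norm a = b /\<^sub>R norm b"
proof -
 define u w where "u = a /\<^sub>R norm a" and "w = b /\<^sub>R norm b"
 have n: "u \<bullet> u = 1" "w \<bullet> w = 1"
  using assms by (simp_all add: u_def w_def dot_square_norm power2_eq_square)
 have "u \<bullet> w <= 1" using norm_cauchy_schwarz[of u w] n by (simp add: norm_eq_sqrt_inner)
 moreover have "\<not> u \<bullet> w < 1"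
 proof
  assume l: "u \<bullet> w < 1"
  have "a = norm a *\<^sub>R u" "b = norm b *\<^sub>R w" using assms by (simp_all add: u_def w_def)
  then have "a \<bullet> (w - u) = norm a * (u \<bullet> w - 1)" "b \<bullet> (w - u) = norm b * (1 - u \<bullet> w)"
   using n by (metis inner_scaleR_left inner_diff_right, metis inner_scaleR_left inner_diff_right inner_commute)
  then show False using assms(3)[of "w - u"] l assms(1,2)
   by (simp add: mult_less_0_iff mult_le_0_iff)
 qed
 ultimately have "u \<bullet> w = 1" by simp
 then have "(u - w) \<bullet> (u - w) = 0" using n by (simp add: inner_diff_left inner_diff_right inner_commute)
 then show ?thesis by (simp add: u_def w_def)
qed

lemma eventually_neg_direction:
 fixes f :: "'a::real_normed_vector => real"
 assumes "f differentiable at x" "f x = 0" "dd h f x < 0"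
 shows "\<forall>\<^sub>F s in at_right 0. f (x + s *\<^sub>R h) < 0"
proof -
 have "((%s. f (x + s *\<^sub>R h)) has_real_derivative dd h f x) (at 0)"
  using has_field_derivative_line[of f x 0 h] assms(1) by simp
 from has_real_derivative_neg_dec_right[OF this assms(3)] obtain d where
  "d > 0" "\<forall>s>0. s < d --> f (x + s *\<^sub>R h) < f x" by auto
 then show ?thesis using assms(2) by (auto simp: eventually_at_right_field)
qed

lemma eventually_pos_direction:
 fixes f :: "'a::real_normed_vector => real"
 assumes "f differentiable at x" "f x = 0" "dd h f x > 0"
 shows "\<forall>\<^sub>F s in at_right 0. f (x + s *\<^sub>R h) > 0"
 using eventually_neg_direction[of "%x. - f x" x h] assms by (simp add: dd_minus)

lemma eventually_in_open_direction:
 fixes x :: "'a::real_normed_vector"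
 assumes "open S" "x : S"
 shows "\<forall>\<^sub>F s in at_right (0::real). x + s *\<^sub>R h : S"
proof -
 have "((%s. x + s *\<^sub>R h) \<longlongrightarrow> x + 0 *\<^sub>R h) (at_right 0)"
  by (rule tendsto_add[OF tendsto_const tendsto_scaleR[OF tendsto_ident_at tendsto_const]])
 then show ?thesis using topological_tendstoD[of _ _ _ S] assms by auto
qed

lemma local_defining_fun_zero:
 assumes "open Om" "x : frontier Om" "local_defining_fun Om x W ph"
 shows "ph x = 0"
proof -
 have W: "open W" "x : W" "!!y. y : W ==> y : Om \<longleftrightarrow> ph y < 0" "continuous_on W ph"
  using assms(3) Ck_on_cont[OF smooth_on_Ck] unfolding local_defining_fun_def by blast+
 have "x \<notin> Om" "x : closure Om" using assms(1,2) by (auto simp: frontier_def interior_open)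
 then have "ph x \<ge> 0" using W by force
 moreover have "\<not> ph x > 0"
 proof
  assume "ph x > 0"
  then have "open (W \<inter> ph -` {0<..})" "x : W \<inter> ph -` {0<..}"
   using continuous_open_preimage[OF W(4,1)] W(2) by auto
  then have "W \<inter> ph -` {0<..} \<inter> Om ~= {}"
   using open_Int_closure_eq_empty[of "W \<inter> ph -` {0<..}" Om] \<open>x : closure Om\<close> by blast
  then show False using W(3) by force
 qed
 ultimately show ?thesis by simp
qed

lemma local_defining_fun_differentiable:
 "local_defining_fun Om x W ph ==> y : W ==> ph differentiable at y"
 using Ck_on_diff[OF smooth_on_Ck] unfolding local_defining_fun_def by blast

text \<open>This is the uniqueness behind the \<open>THE\<close> in \<open>ext_normal\<close>: along
  a direction in which one defining function decreases the other cannot increase, since both decide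
  membership in \<open>Om\<close>.\<close>

lemma ext_normal_eq:
 assumes "open Om" "x : frontier Om" "local_defining_fun Om x W ph"
 shows "ext_normal Om x = grad ph x /\<^sub>R norm (grad ph x)"
 unfolding ext_normal_def
proof (rule the_equality)
 fix \<nu> assume "\<exists>W' ph'. local_defining_fun Om x W' ph' & \<nu> = grad ph' x /\<^sub>R norm (grad ph' x)"
 then obtain W' ph' where l: "local_defining_fun Om x W' ph'" and \<nu>: "\<nu> = grad ph' x /\<^sub>R norm (grad ph' x)" by blast
 have W: "open W" "x : W" "!!y. y : W ==> y : Om \<longleftrightarrow> ph y < 0" "grad ph x ~= 0"
  using assms(3) unfolding local_defining_fun_def by blast+
 have W': "open W'" "x : W'" "!!y. y : W' ==> y : Om \<longleftrightarrow> ph' y < 0" "grad ph' x ~= 0"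
  using l unfolding local_defining_fun_def by blast+
 note d = local_defining_fun_differentiable[OF assms(3) W(2)]
 note d' = local_defining_fun_differentiable[OF l W'(2)]
 have "grad ph' x \<bullet> h <= 0" if h: "grad ph x \<bullet> h < 0" for h
 proof (rule ccontr)
  assume "\<not> grad ph' x \<bullet> h <= 0"
  then have "\<forall>\<^sub>F s in at_right 0. ph' (x + s *\<^sub>R h) > 0"
   using eventually_pos_direction[OF d'] local_defining_fun_zero[OF assms(1,2) l] grad_inner[OF d'] by simp
  moreover have "\<forall>\<^sub>F s in at_right 0. ph (x + s *\<^sub>R h) < 0"
   using eventually_neg_direction[OF d] local_defining_fun_zero[OF assms] grad_inner[OF d] h by simp
  moreover have "\<forall>\<^sub>F s in at_right 0. x + s *\<^sub>R h : W \<inter> W'"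
   using W W' by (intro eventually_in_open_direction) auto
  ultimately have "\<forall>\<^sub>F s in at_right (0::real). False"
   by eventually_elim (use W(3) W'(3) in force)
  then show False by simp
 qed
 from halfspace_unique[OF W(4) W'(4) this] show "\<nu> = grad ph x /\<^sub>R norm (grad ph x)" by (simp add: \<nu>)
qed (use assms in blast)

lemma disjoint_balls_dist:
 fixes a b :: "'a::real_normed_vector"
 assumes "ball a R \<inter> ball b R = {}"
 shows "dist a b \<ge> 2 * R"
proof (rule ccontr)
 assume "\<not> ?thesis"
 then have "midpoint a b : ball a R \<inter> ball b R" by (simp add: dist_midpoint)
 then show False using assms by simp
qed

text \<open>A ball is connected, so if it met both \<open>Om\<close> and the complement it would
  meet the frontier, at less than the distance to the frontier.\<close>

lemma ball_infdist_frontier_subset: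
 fixes y :: "'a::real_normed_vector"
 assumes "y : Om"
 shows "ball y (infdist y (frontier Om)) \<subseteq> Om"
proof (rule ccontr)
 assume n: "\<not> ?thesis"
 then obtain z where z: "z : ball y (infdist y (frontier Om))" "z \<notin> Om" by blast
 then have "y : ball y (infdist y (frontier Om))" using le_less_trans[OF zero_le_dist[of y z]] by simp
 then have "ball y (infdist y (frontier Om)) \<inter> frontier Om ~= {}"
  by (intro connected_Int_frontier connected_ball) (use assms z in blast)+
 then show False using infdist_le[of _ "frontier Om" y] by force
qed

lemma ball_infdist_frontier_disjoint:
 fixes y :: "'a::real_normed_vector"
 assumes "y \<notin> Om"
 shows "ball y (infdist y (frontier Om)) \<inter> Om = {}"
 using ball_infdist_frontier_subset[of y "- Om"] assms by (auto simp: frontier_complement)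

definition foot :: "(real^'n) set => real^'n => real^'n::finite" where
 "foot Om y = (SOME x. x : frontier Om & dist y x = infdist y (frontier Om))"

text \<open>The quantitative assumption is injectivity of the normal map. The metric properties of
  the tube, including a Lipschitz bound for the normal, are derived from it by comparing tangent
  balls, without a curvature computation.\<close>

locale smooth_tube =
 fixes Om :: "(real^'n::finite) set" and r :: real
 assumes open_Om: "open Om" and bounded_Om: "bounded Om"
  and defining: "!!x. x : frontier Om ==> \<exists>W ph. local_defining_fun Om x W ph"
  and inj: "inj_on (%(x, s). x + s *\<^sub>R ext_normal Om x) (frontier Om \<times> {-r<..<r})"
begin

lemma norm_normal: "x : frontier Om ==> norm (ext_normal Om x) = 1"
 using defining[of x] ext_normal_eq[OF open_Om, of x] by (auto simp: local_defining_fun_def)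

lemma frontier_notin: "x : frontier Om ==> x \<notin> Om"
 using open_Om by (simp add: frontier_def interior_open)

lemma frontier_nonempty: "y : Om ==> frontier Om ~= {}"
 using bounded_Om frontier_eq_empty[of Om] not_bounded_UNIV by auto

text \<open>\<open>c = 1\<close> stands for a ball inside the domain and \<open>c = -1\<close> for
  one outside. A direction that enters the ball cannot increase \<open>c * ph\<close> to first
  order, so the ball and the level set of \<open>ph\<close> share their tangent half-space at
  \<open>x\<close>.\<close>

lemma nearest_point_sphere:
 assumes "x : frontier Om" "dist y x = s" "s > 0"
  and sub: "ball y s \<subseteq> Om & c = 1 \<or> ball y s \<inter> Om = {} & c = -1"
 shows "x = y + (c * s) *\<^sub>R ext_normal Om x"
proof -
 obtain W ph where l: "local_defining_fun Om x W ph" using defining assms(1) by blast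
 have W: "open W" "x : W" "!!y. y : W ==> y : Om \<longleftrightarrow> ph y < 0" "grad ph x ~= 0"
  using l unfolding local_defining_fun_def by blast+
 note d = local_defining_fun_differentiable[OF l W(2)]
 have c: "c * c = 1" "c ~= 0" using sub by auto
 have ne: "x - y ~= 0" using assms(2,3) by auto
 have nxy: "norm (x - y) = s" using assms(2) by (simp add: dist_norm norm_minus_commute)
 have "(c *\<^sub>R grad ph x) \<bullet> h <= 0" if h: "(x - y) \<bullet> h < 0" for h
 proof (rule ccontr)
  assume "\<not> (c *\<^sub>R grad ph x) \<bullet> h <= 0"
  then have "c * dd h ph x > 0" using grad_inner[OF d] by simp
  moreover have "(c = 1 \<or> c = -1)" using sub by auto
  ultimately have 1: "\<forall>\<^sub>F s in at_right 0. c * ph (x + s *\<^sub>R h) > 0"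
   using eventually_pos_direction[OF d, of h] eventually_neg_direction[OF d, of h]
    local_defining_fun_zero[OF open_Om assms(1) l] by fastforce
  have 2: "\<forall>\<^sub>F ep in at_right 0. x + ep *\<^sub>R h : ball y s"
  proof -
   \<comment> \<open>For \<open>ep < e\<close> the expansion of \<open>norm (x - y + ep h)\<close>
     squared shows that it stays below \<open>s\<close> squared. The summand 1 in the denominator
     makes it positive without a case distinction.\<close>
   define e where "e = - 2 * ((x - y) \<bullet> h) / (norm h ^ 2 + 1)"
   have np: "norm h ^ 2 + 1 > 0" by (smt (verit) zero_le_power2)
   have "x + ep *\<^sub>R h : ball y s" if "0 < ep" "ep < e" for ep
   proof -
    have "ep * (norm h ^ 2 + 1) < - 2 * ((x - y) \<bullet> h)"
     using that(2) np by (simp add: e_def field_simps)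
    then have "2 * ((x - y) \<bullet> h) + ep * norm h ^ 2 < 0" using that by (simp add: algebra_simps)
    then have "ep * (2 * ((x - y) \<bullet> h) + ep * norm h ^ 2) < 0" using that by (simp add: mult_less_0_iff)
    moreover have "norm ((x - y) + ep *\<^sub>R h) ^ 2 = norm (x - y) ^ 2 + ep * (2 * ((x - y) \<bullet> h) + ep * norm h ^ 2)"
     by (simp only: power2_norm_eq_inner)
      (simp add: inner_add_left inner_add_right inner_commute algebra_simps)
    ultimately have "norm ((x - y) + ep *\<^sub>R h) ^ 2 < s ^ 2" using nxy by simp
    then have "norm ((x - y) + ep *\<^sub>R h) < s" using assms(3) by (simp add: power_less_imp_less_base)
    then show ?thesis by (simp add: dist_norm norm_minus_commute algebra_simps)
   qed
   moreover have "e > 0" using h np by (simp add: e_def divide_neg_pos)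
   ultimately show ?thesis by (auto simp: eventually_at_right_field)
  qed
  have 3: "\<forall>\<^sub>F s in at_right 0. x + s *\<^sub>R h : W"
   using W by (intro eventually_in_open_direction) auto
  from 1 2 3 have "\<forall>\<^sub>F s in at_right (0::real). False"
   by eventually_elim (use W(3) sub in force)
  then show False by simp
 qed
 from halfspace_unique[OF ne _ this] W(4) c(2)
 have "(x - y) /\<^sub>R norm (x - y) = (c *\<^sub>R grad ph x) /\<^sub>R norm (c *\<^sub>R grad ph x)" by simp
 also have "norm (c *\<^sub>R grad ph x) = norm (grad ph x)" using sub by auto
 also have "(c *\<^sub>R grad ph x) /\<^sub>R norm (grad ph x) = c *\<^sub>R ext_normal Om x"
  using ext_normal_eq[OF open_Om assms(1) l] by (simp add: mult.commute)
 finally have "s *\<^sub>R ((x - y) /\<^sub>R s) = s *\<^sub>R c *\<^sub>R ext_normal Om x" using nxy by simp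
 then show ?thesis using assms(3) by (simp add: algebra_simps)
qed

lemma foot:
 assumes "y : Om"
 shows foot_frontier: "foot Om y : frontier Om"
  and dist_foot: "dist y (foot Om y) = infdist y (frontier Om)"
proof -
 have "\<exists>x. x : frontier Om & dist y x = infdist y (frontier Om)"
  using infdist_attains_inf[of "frontier Om" y] frontier_nonempty[OF assms] by (metis frontier_closed)
 from someI_ex[OF this] show "foot Om y : frontier Om" "dist y (foot Om y) = infdist y (frontier Om)"
  by (auto simp: foot_def)
qed

lemma infdist_pos: "y : Om ==> infdist y (frontier Om) > 0"
 using foot[of y] frontier_notin by (metis dist_eq_0_iff infdist_nonneg less_eq_real_def)

lemma foot_eq:
 assumes "y : Om"
 shows "foot Om y = y + infdist y (frontier Om) *\<^sub>R ext_normal Om (foot Om y)"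
 using nearest_point_sphere[OF foot(1)[OF assms] foot(2)[OF assms] infdist_pos[OF assms], of 1]
  ball_infdist_frontier_subset[OF assms] by simp

text \<open>A nearest boundary point \<open>x'\<close> gives a second representation of the same
  point in normal coordinates, with a parameter of absolute value at most that of \<open>s\<close>.
  Injectivity identifies the two, and the side is read off from the sign.\<close>

lemma tube_point:
 assumes "x : frontier Om" "-r < s" "s < r" "s ~= 0"
 shows "infdist (x + s *\<^sub>R ext_normal Om x) (frontier Om) = \<bar>s\<bar> & (x + s *\<^sub>R ext_normal Om x : Om \<longleftrightarrow> s < 0)"
proof -
 define y where "y = x + s *\<^sub>R ext_normal Om x"
 define t where "t = infdist y (frontier Om)"
 obtain x' where x': "x' : frontier Om" "dist y x' = t"
  using infdist_attains_inf[of "frontier Om" y] assms(1) unfolding t_def by (metis empty_iff frontier_closed)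
 have "t <= \<bar>s\<bar>" using infdist_le[OF assms(1), of y] norm_normal[OF assms(1)] by (simp add: y_def t_def dist_norm)
 have inj': "a = a' & b = b'" if "a + b *\<^sub>R ext_normal Om a = a' + b' *\<^sub>R ext_normal Om a'"
  "a : frontier Om" "a' : frontier Om" "\<bar>b\<bar> < r" "\<bar>b'\<bar> < r" for a b a' b'
  using inj_onD[OF inj, of "(a, b)" "(a', b')"] that by (simp add: abs_less_iff)
 have sr: "\<bar>s\<bar> < r" using assms by linarith
 show ?thesis
 proof (cases "t = 0")
  case True
  then have "x' = y" using x' by simp
  then have "s = 0" using inj'[of x s x' 0] x' sr assms(1) by (simp add: y_def)
  then show ?thesis using assms by simp
 next
  case False
  then have t: "t > 0" using infdist_nonneg[of y "frontier Om"] unfolding t_def by linarith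
  define c :: real where "c = (if y : Om then 1 else -1)"
  have "x' = y + (c * t) *\<^sub>R ext_normal Om x'"
   using nearest_point_sphere[OF x' t, of c] ball_infdist_frontier_subset[of y Om] ball_infdist_frontier_disjoint[of y Om]
   unfolding t_def[symmetric] c_def by auto
  then have "x' + (- (c * t)) *\<^sub>R ext_normal Om x' = x + s *\<^sub>R ext_normal Om x"
   by (simp add: y_def algebra_simps)
  from inj'[OF this x'(1) assms(1)] sr \<open>t <= \<bar>s\<bar>\<close> t have "- (c * t) = s" by (auto simp: c_def)
  then show ?thesis using t unfolding y_def[symmetric] t_def[symmetric] by (auto simp: c_def split: if_splits)
 qed
qed

lemma foot_unique:
 assumes "x : frontier Om" "0 < s" "s < r"
 shows "x - s *\<^sub>R ext_normal Om x : Om"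
  and "infdist (x - s *\<^sub>R ext_normal Om x) (frontier Om) = s"
  and "foot Om (x - s *\<^sub>R ext_normal Om x) = x"
proof -
 let ?y = "x - s *\<^sub>R ext_normal Om x"
 show 1: "?y : Om" "infdist ?y (frontier Om) = s"
  using tube_point[of x "-s"] assms by auto
 show "foot Om ?y = x"
  using foot_eq[OF 1(1)] foot(1)[OF 1(1)] inj_onD[OF inj, of "(foot Om ?y, -s)" "(x, -s)"] 1(2) assms
  by (auto simp: algebra_simps)
qed

text \<open>For \<open>R < r\<close> the interior tangent ball at one point is disjoint from the
  exterior tangent ball at the other, so their centres are at least \<open>2 R\<close> apart, for
  both choices of the roles. Adding the two squared distances cancels the mixed terms, and the
  parallelogram law for the unit normals does the rest.\<close>

lemma normal_lipschitz:
 assumes "x : frontier Om" "y : frontier Om"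
 shows "r * norm (ext_normal Om x - ext_normal Om y) <= norm (x - y)"
proof -
 define N N' where "N = ext_normal Om x" and "N' = ext_normal Om y"
 have R: "R * norm (N - N') <= norm (x - y)" if R: "0 < R" "R < r" for R
 proof -
  have b: "ball (a - R *\<^sub>R ext_normal Om a) R \<subseteq> Om" "ball (a + R *\<^sub>R ext_normal Om a) R \<inter> Om = {}"
   if "a : frontier Om" for a
   using tube_point[OF that, of R] tube_point[OF that, of "- R"] R
    ball_infdist_frontier_subset[of "a - R *\<^sub>R ext_normal Om a" Om]
    ball_infdist_frontier_disjoint[of "a + R *\<^sub>R ext_normal Om a" Om] by auto
  have "dist (x - R *\<^sub>R N) (y + R *\<^sub>R N') \<ge> 2 * R" "dist (y - R *\<^sub>R N') (x + R *\<^sub>R N) \<ge> 2 * R"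
   using b[OF assms(1)] b[OF assms(2)] unfolding N_def N'_def
   by (intro disjoint_balls_dist; blast)+
  then have "(2 * R)\<^sup>2 <= norm ((x - y) - R *\<^sub>R (N + N')) ^ 2" "(2 * R)\<^sup>2 <= norm ((x - y) + R *\<^sub>R (N + N')) ^ 2"
   using R power_mono[of "2 * R" _ 2] by (simp_all add: dist_norm algebra_simps norm_minus_commute)
  then have "8 * R\<^sup>2 <= norm ((x - y) - R *\<^sub>R (N + N')) ^ 2 + norm ((x - y) + R *\<^sub>R (N + N')) ^ 2"
   by (simp add: power_mult_distrib)
  also have "... = 2 * norm (x - y) ^ 2 + 2 * R\<^sup>2 * norm (N + N') ^ 2"
   by (simp only: power2_norm_eq_inner)
    (simp add: inner_add_left inner_add_right inner_diff_left inner_diff_right inner_commute algebra_simps power2_eq_square)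
  also have "norm (N + N') ^ 2 = 4 - norm (N - N') ^ 2"
  proof -
   have "N \<bullet> N = 1" "N' \<bullet> N' = 1" using norm_normal assms by (simp_all add: N_def N'_def dot_square_norm)
   then show ?thesis by (simp only: power2_norm_eq_inner)
    (simp add: inner_add_left inner_add_right inner_diff_left inner_diff_right inner_commute)
  qed
  finally have "(R * norm (N - N'))\<^sup>2 <= norm (x - y) ^ 2" by (simp add: algebra_simps power_mult_distrib)
  then show ?thesis by (rule power2_le_imp_le) simp
 qed
 show ?thesis
 proof (cases "r > 0 & N ~= N'")
  case True
  then have p: "norm (N - N') > 0" by simp
  have "r <= norm (x - y) / norm (N - N')"
  proof (rule dense_le_bounded[of 0])
   show "0 < r" using True by simp
   fix R assume "0 < R" "R < r"
   then show "R <= norm (x - y) / norm (N - N')" using R[of R] p by (simp add: pos_le_divide_eq)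
  qed
  then show ?thesis using p by (simp add: N_def N'_def pos_le_divide_eq)
 next
  case False
  then have "r * norm (N - N') <= 0" by (auto simp: mult_nonpos_nonneg)
  then show ?thesis using norm_ge_zero[of "x - y"] unfolding N_def N'_def by linarith
 qed
qed

text \<open>The feet differ by \<open>x - y\<close>, plus \<open>s\<close> times the difference of
  the normals, plus a multiple of \<open>N'\<close> of length at most \<open>norm (x - y)\<close>.
  The middle term is absorbed on the left, which costs the factor \<open>r - s\<close>.\<close>

lemma normal_foot_lipschitz:
 assumes "x : Om" "y : Om"
 shows "(r - infdist x (frontier Om)) * norm (ext_normal Om (foot Om x) - ext_normal Om (foot Om y)) <= 2 * norm (x - y)"
proof -
 define N N' s s' where "N = ext_normal Om (foot Om x)" and "N' = ext_normal Om (foot Om y)"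
  and "s = infdist x (frontier Om)" and "s' = infdist y (frontier Om)"
 have "r * norm (N - N') <= norm (foot Om x - foot Om y)"
  unfolding N_def N'_def by (intro normal_lipschitz foot assms)
 also have "foot Om x - foot Om y = (x - y) + (s *\<^sub>R (N - N') + (s - s') *\<^sub>R N')"
  using foot_eq[OF assms(1)] foot_eq[OF assms(2)] unfolding N_def N'_def s_def s'_def
  by (simp add: algebra_simps)
 also have "norm ... <= norm (x - y) + (s * norm (N - N') + \<bar>s - s'\<bar> * norm N')"
  using infdist_nonneg[of x "frontier Om"]
  by (intro norm_triangle_mono order.refl) (simp_all add: s_def)
 also have "norm N' = 1" unfolding N'_def by (intro norm_normal foot assms)
 also have "\<bar>s - s'\<bar> <= norm (x - y)"
  using infdist_triangle_abs[of x "frontier Om" y] by (simp add: s_def s'_def dist_norm)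
 finally have "(r - s) * norm (N - N') <= 2 * norm (x - y)" by (simp add: algebra_simps)
 then show ?thesis by (simp add: N_def N'_def s_def)
qed

end

section \<open>Moving domains\<close>

lemma linear_inj_bounded_below:
 fixes L :: "'a::euclidean_space => 'b::euclidean_space"
 assumes "linear L" "!!h. L h = 0 ==> h = 0"
 obtains c where "c > 0" "!!h. c * norm h <= norm (L h)"
 using linear_inj_bounded_below_pos[OF assms(1)] linear_injective_0[OF assms(1)] assms(2)
 by (metis mult.commute)

text \<open>The point is continuity of the derivative of \<open>g\<close>. For the difference
  \<open>k\<close> of two values of \<open>dd h g\<close>, the derivative of \<open>f\<close> at
  \<open>g y\<close> maps \<open>k\<close> to the difference of two derivatives of \<open>f\<close>
  applied to the fixed vector \<open>dd h g y0\<close>. This tends to zero, and the derivative at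
  \<open>g y0\<close> is bounded below by \<open>c\<close>; half of \<open>c\<close> is spent on
  moving from \<open>g y0\<close> to \<open>g y\<close>.\<close>

lemma Ck1_inverse_function:
 fixes f :: "'a::euclidean_space => 'a"
 assumes "open U" "Ck_on 1 U f" "x0 : U" and ker: "!!h. dd h f x0 = 0 ==> h = 0"
 obtains U' V g where "open U'" "U' \<subseteq> U" "x0 : U'" "open V" "f x0 : V" "homeomorphism U' V f g" "Ck_on 1 V g"
proof -
 define f' where "f' x = Blinfun (%h. dd h f x)" for x
 have dif: "f differentiable at x" if "x : U" for x using assms(2) that by (simp add: Ck_on_Suc)
 have f'[simp]: "blinfun_apply (f' x) h = dd h f x" if "x : U" for x h
  unfolding f'_def using has_derivative_bounded_linear[OF has_derivative_dd[OF dif[OF that]]]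
  by (simp add: bounded_linear_Blinfun_apply)
 have der: "(f has_derivative blinfun_apply (f' x)) (at x)" if "x : U" for x
  using has_derivative_dd[OF dif[OF that]] f'[OF that] by (metis (no_types, lifting) ext)
 have cont: "continuous_on U f'"
 proof (rule continuous_on_blinfun_componentwise)
  fix i :: 'a
  have "continuous_on U (dd i f)" using assms(2) by (simp add: Ck_on_Suc)
  then show "continuous_on U (%x. blinfun_apply (f' x) i)" by (rule continuous_on_eq) simp
 qed
 have lin: "linear (%h. dd h f x0)" by (rule linear_dd[OF dif[OF assms(3)]])
 obtain B where B: "linear B" "B \<circ> (%h. dd h f x0) = id"
  using linear_injective_left_inverse[OF lin] linear_injective_0[OF lin] ker by auto
 have inv: "Blinfun B o\<^sub>L f' x0 = id_blinfun"
  using B f'[OF assms(3)] linear_conv_bounded_linear[of B]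
  by (intro blinfun_eqI) (simp add: bounded_linear_Blinfun_apply o_def id_def fun_eq_iff)
 obtain U' V g g' where H: "open U'" "U' \<subseteq> U" "x0 : U'" "open V" "f x0 : V" "homeomorphism U' V f g"
  and g: "!!y. y : V ==> (g has_derivative (g' y)) (at y)"
   "!!y. y : V ==> g' y = inv (blinfun_apply (f'(g y)))"
   "!!y. y : V ==> bij (blinfun_apply (f'(g y)))"
  using inverse_function_theorem[OF assms(1) der cont assms(3) inv] by blast
 have gU: "g y : U'" if "y : V" for y using H(6) that by (auto simp: homeomorphism_def)
 then have gU': "g y : U" if "y : V" for y using that H(2) by blast
 have ddg: "dd h g y = g' y h" if "y : V" for y h using g(1)[OF that] by (rule dd_eq)
 have fg: "dd (dd h g y) f (g y) = h" if "y : V" for h y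
  using bij_is_surj[OF g(3)[OF that]] g(2)[OF that] f'[OF gU'[OF that]] ddg[OF that] surj_f_inv_f by metis
 have gf: "dd (dd h f (g y)) g y = h" if "y : V" for h y
  using bij_is_inj[OF g(3)[OF that]] g(2)[OF that] f'[OF gU'[OF that]] ddg[OF that] inv_f_f by metis
 have "continuous_on V (dd h g)" for h
 proof (rule continuous_at_imp_continuous_on, rule ballI)
  fix y0 assume y0: "y0 : V"
  have lin0: "linear (%h. dd h f (g y0))" using linear_dd dif gU' y0 by blast
  obtain c where c: "c > 0" "!!h. c * norm h <= norm (dd h f (g y0))"
   using linear_inj_bounded_below[OF lin0] gf[OF y0] linear_0[OF linear_dd[of g y0]] g(1)[OF y0]
   unfolding differentiable_def by metis
  have contg: "continuous_on V g" using H(6) by (simp add: homeomorphism_def)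
  have "continuous_on V (%y. f' (g y))"
   using continuous_on_compose2[OF cont contg] gU' by blast
  then have "isCont (%y. f' (g y)) y0" using H(4) y0 continuous_on_eq_continuous_at by blast
  then have lim: "((%y. norm (f' (g y) - f' (g y0))) \<longlongrightarrow> 0) (at y0)"
   by (simp add: LIM_zero isCont_def tendsto_norm_zero)
  have ev: "\<forall>\<^sub>F y in at y0. y : V" using H(4) y0 eventually_at_topological by blast
  have "\<forall>\<^sub>F y in at y0. norm (dd h g y - dd h g y0) <= (2 / c) * norm (dd h g y0) * norm (f' (g y) - f' (g y0))"
   using ev order_tendstoD(2)[OF lim half_gt_zero[OF c(1)]]
  proof eventually_elim
   case (elim y)
   define k where "k = dd h g y - dd h g y0"
   have A: "norm (dd u f (g y) - dd u f (g y0)) <= norm (f' (g y) - f' (g y0)) * norm u" for u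
    using norm_blinfun[of "f' (g y) - f' (g y0)" u] gU' elim(1) y0 by (simp add: blinfun.diff_left)
   have "c * norm k <= norm (dd k f (g y0))" by (rule c)
   also have "... <= norm (dd k f (g y)) + norm (dd k f (g y) - dd k f (g y0))"
    using norm_triangle_ineq4[of "dd k f (g y)" "dd k f (g y) - dd k f (g y0)"] by simp
   also have "... <= norm (dd k f (g y)) + c / 2 * norm k"
    using A[of k] elim(2) mult_right_mono[of "norm (f' (g y) - f' (g y0))" "c/2" "norm k"] by simp
   finally have "c / 2 * norm k <= norm (dd k f (g y))" by (simp add: field_simps)
   also have "dd k f (g y) = dd (dd h g y0) f (g y0) - dd (dd h g y0) f (g y)"
    unfolding k_def using linear_diff[OF linear_dd[OF dif[OF gU'[OF elim(1)]]]] fg[OF elim(1)] fg[OF y0] by simp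
   also have "norm ... <= norm (f' (g y) - f' (g y0)) * norm (dd h g y0)"
    using A[of "dd h g y0"] by (simp add: norm_minus_commute)
   finally show ?case using c(1) by (simp add: k_def field_simps)
  qed
  then have "((%y. dd h g y - dd h g y0) \<longlongrightarrow> 0) (at y0)"
  proof (rule Lim_null_comparison)
   show "((%y. (2 / c) * norm (dd h g y0) * norm (f' (g y) - f' (g y0))) \<longlongrightarrow> 0) (at y0)"
    using tendsto_mult_right_zero[OF lim] by blast
  qed
  then show "isCont (dd h g) y0" using LIM_zero_cancel isCont_def by blast
 qed
 then have "Ck_on 1 V g" using g(1) by (auto simp: Ck_on_Suc differentiable_def)
 with H show ?thesis using that by blast
qed

lemma slice_differentiable:
 assumes "f differentiable at (t, x)"
 shows "((%y. f (t, y)) has_derivative (%h. dd (0, h) f (t, x))) (at x)"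
  "((%s. f (s, x)) has_vector_derivative dd (1, 0) f (t, x)) (at t)"
proof -
 have 1: "((%y. (t, y)) has_derivative (%h. (0, h))) (at x)"
  and 2: "((%s. (s, x)) has_derivative (%h. (h, 0))) (at t)"
  by (auto intro!: derivative_eq_intros)
 show "((%y. f (t, y)) has_derivative (%h. dd (0, h) f (t, x))) (at x)"
  using has_derivative_compose[OF 1, of f] has_derivative_dd[OF assms] by blast
 have "((%s. f (s, x)) has_derivative (%h. dd (h, 0) f (t, x))) (at t)"
  using has_derivative_compose[OF 2, of f] has_derivative_dd[OF assms] by blast
 moreover have "(%h. dd (h, 0) f (t, x)) = (%h. h *\<^sub>R dd (1, 0) f (t, x))"
 proof
  show "dd (h, 0) f (t, x) = h *\<^sub>R dd (1, 0) f (t, x)" for h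
   using dd_scale_dir[OF assms, of h "(1, 0)"] by simp
 qed
 ultimately show "((%s. f (s, x)) has_vector_derivative dd (1, 0) f (t, x)) (at t)"
  unfolding has_vector_derivative_def by (simp only:)
qed

lemma dd_slice:
 fixes f :: "real \<times> 'a::real_normed_vector => 'b::real_normed_vector"
 shows "f differentiable at (t, x) ==> dd h (%y. f (t, y)) x = dd (0, h) f (t, x)"
 using dd_eq[OF slice_differentiable(1)] by blast

lemma Ck_on_slice:
 fixes f :: "real \<times> 'a::euclidean_space => 'b::real_normed_vector"
 assumes "open W" "Ck_on k W f"
 shows "Ck_on k {y. (t, y) : W} (%y. f (t, y))"
proof -
 have "open {y. (t, y) : W}" using open_vimage[OF assms(1), of "Pair t"] by (simp add: vimage_def continuous_on_Pair)
 then show ?thesis using Ck_on_compose[OF _ Ck_on_Pair[OF _ Ck_on_const Ck_on_ident] assms(2)] by blast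
qed

lemma infdist_frontier_le:
 fixes x :: "'a::real_normed_vector"
 shows "x : Om ==> y \<notin> Om ==> infdist x (frontier Om) <= dist x y"
 using ball_infdist_frontier_subset[of x Om] by (auto simp: subset_iff not_less[symmetric])

lemma le_infdist_frontier:
 fixes x :: "'a::real_normed_vector"
 assumes "open Om" "frontier Om ~= {}" "ball x rh \<subseteq> Om"
 shows "rh <= infdist x (frontier Om)"
proof -
 have "rh <= dist x y" if "y : frontier Om" for y
  using that assms(1,3) by (force simp: frontier_def interior_open)
 then show ?thesis using assms(2) by (auto simp: infdist_def intro!: cINF_greatest)
qed

locale moving_domain =
 fixes T :: real and D :: "(real \<times> (real^'n::finite)) set" and d0 :: real
 assumes smooth_D: "smooth_moving_domain T D" and d0: "d0 > 0"
  and inj_radius_D: "!!t. t : {0..T} ==> d0 < inj_radius (slice D t)"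
begin

definition bd :: "real \<times> (real^'n) => real" where
 "bd z = infdist (snd z) (frontier (slice D (fst z)))"

definition ft :: "real \<times> (real^'n) => real^'n" where
 "ft z = foot (slice D (fst z)) (snd z)"

definition nn :: "real \<times> (real^'n) => real^'n" where
 "nn z = ext_normal (slice D (fst z)) (ft z)"

text \<open>\<open>D\<close> is only relatively open in the time slab. Restricting to times strictly
  between 0 and \<open>T\<close> gives an open set, on which space-time derivatives see only points
  of \<open>D\<close>.\<close>

definition G :: "(real \<times> (real^'n)) set" where
 "G = {z\<in>D. 0 < fst z & fst z < T}"

lemma mem_slice [simp]: "x : slice D t \<longleftrightarrow> (t, x) : D" by (simp add: slice_def)

lemma bounded_D: "bounded D" and openin_D: "openin (top_of_set ({0..T} \<times> UNIV)) D"
 and defining_D: "!!z. z : closure D - D ==> \<exists>W ph. moving_defining_fun T D z W ph"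
 using smooth_D by (auto simp: smooth_moving_domain_def)

lemma D_subset: "z : D ==> fst z : {0..T}"
 using openin_imp_subset[OF openin_D] by auto

lemma closure_D_subset: "z : closure D ==> fst z : {0..T}"
 using closure_minimal[of D "{0..T} \<times> UNIV"] openin_imp_subset[OF openin_D]
 by (auto simp: closed_Times)

lemma compact_closure_D: "compact (closure D)"
 using bounded_D by (simp add: compact_closure)

lemma G_D: "z : G ==> z : D" by (simp add: G_def)

lemma D_open_ex: obtains O' where "open O'" "D = ({0..T} \<times> UNIV) \<inter> O'"
 using openin_D by (auto simp: openin_open)

lemma open_G: "open G"
proof -
 obtain O' where O': "open O'" "D = ({0..T} \<times> UNIV) \<inter> O'" by (rule D_open_ex)
 then have "G = ({0<..<T} \<times> UNIV) \<inter> O'" unfolding G_def by auto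
 then show ?thesis using O'(1) by (simp add: open_Int open_Times)
qed

lemma open_slice: "open (slice D t)"
proof (cases "t : {0..T}")
 case True
 obtain O' where O': "open O'" "D = ({0..T} \<times> UNIV) \<inter> O'" by (rule D_open_ex)
 then have "slice D t = Pair t -` O'" using True by (auto simp: slice_def)
 then show ?thesis using open_vimage[OF O'(1), of "Pair t"] by (simp add: continuous_on_Pair)
next
 case False
 then have "slice D t = {}" using D_subset by (force simp: slice_def)
 then show ?thesis by simp
qed

lemma bounded_slice: "bounded (slice D t)"
proof -
 have "slice D t \<subseteq> snd ` D" by (force simp: slice_def)
 then show ?thesis using bounded_snd[OF bounded_D] bounded_subset by blast
qed

lemma closure_slice: "x : closure (slice D t) ==> (t, x) : closure D"
proof -
 have "closed {x. (t, x) : closure D}"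
  using closed_vimage[OF closed_closure, of "Pair t" D] by (simp add: continuous_on_Pair vimage_def)
 moreover have "slice D t \<subseteq> {x. (t, x) : closure D}" using closure_subset by (auto simp: slice_def)
 ultimately show "x : closure (slice D t) ==> (t, x) : closure D" using closure_minimal by blast
qed

lemma frontier_slice_closure: "x : frontier (slice D t) ==> (t, x) : closure D - D"
 using closure_slice open_slice[of t] by (auto simp: frontier_def interior_open)

lemma moving_defining_funD:
 assumes "moving_defining_fun T D z W ph"
 shows "open W" "z : W" "Ck_on k W ph" "w : W ==> ph differentiable at w"
  "grad (%y. ph (fst z, y)) (snd z) ~= 0"
  "[|w : W; fst w : {0..T}|] ==> w : D \<longleftrightarrow> ph w < 0"
proof -
 show 1: "Ck_on k W ph" for k using assms smooth_on_Ck by (auto simp: moving_defining_fun_def)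
 show "w : W ==> ph differentiable at w" using 1[of 1] by (auto simp: Ck_on_Suc)
qed (use assms in \<open>auto simp: moving_defining_fun_def\<close>)

lemma grad_slice:
 fixes ph :: "real \<times> (real^'n) => real"
 assumes "ph differentiable at (t, x)"
 shows "grad (%y. ph (t, y)) x \<bullet> h = dd (0, h) ph (t, x)"
 using grad_inner[OF differentiableI[OF slice_differentiable(1)[OF assms]], of h] dd_slice[OF assms, of h] by simp

lemma moving_imp_local:
 assumes "moving_defining_fun T D (t, x) W ph" "(t, y) : W" "t : {0..T}"
  "grad (%y. ph (t, y)) y ~= 0"
 shows "local_defining_fun (slice D t) y {y. (t, y) : W} (%y. ph (t, y))"
proof -
 note m = moving_defining_funD[OF assms(1)]
 have "open {y. (t, y) : W}" using open_vimage[OF m(1), of "Pair t"] by (simp add: vimage_def continuous_on_Pair)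
 moreover have "smooth_on {y. (t, y) : W} (%y. ph (t, y))"
  using Ck_on_slice[OF m(1) m(3)] by (simp add: smooth_on_def)
 ultimately show ?thesis using assms m(6) by (auto simp: local_defining_fun_def)
qed

lemma zero_set_frontier:
 assumes "moving_defining_fun T D (t0, x0) W ph" "(t, y) : W" "t : {0..T}" "ph (t, y) = 0"
  "grad (%y. ph (t, y)) y ~= 0"
 shows "y : frontier (slice D t)"
proof -
 note m = moving_defining_funD[OF assms(1)]
 define h where "h = - grad (%y. ph (t, y)) y"
 have "dd (0, h) ph (t, y) < 0"
  using assms(5) by (simp add: h_def grad_slice[OF m(4)[OF assms(2)], symmetric])
 then have 1: "\<forall>\<^sub>F s in at_right 0. ph ((t, y) + s *\<^sub>R (0, h)) < 0"
  using eventually_neg_direction m(4) assms by blast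
 have 2: "\<forall>\<^sub>F s in at_right 0. (t, y) + s *\<^sub>R (0, h) : W"
  using m(1) assms(2) by (rule eventually_in_open_direction)
 have "y : closure (slice D t)"
  unfolding closure_approachable
 proof (intro allI impI)
  fix e :: real assume "e > 0"
  then have 3: "\<forall>\<^sub>F s in at_right 0. y + s *\<^sub>R h : ball y e" by (intro eventually_in_open_direction) auto
  from 1 2 3 have "\<forall>\<^sub>F s in at_right (0::real). \<exists>z\<in>slice D t. dist z y < e"
  proof eventually_elim
   case (elim s)
   then show ?case using m(6)[of "(t, y + s *\<^sub>R h)"] assms(3) by (intro bexI[of _ "y + s *\<^sub>R h"]) (auto simp: dist_commute)
  qed
  then show "\<exists>z\<in>slice D t. dist z y < e" using eventually_happens'[OF trivial_limit_at_right_real] by blast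
 qed
 moreover have "(t, y) \<notin> D" using m(6)[OF assms(2)] assms by auto
 ultimately show ?thesis using open_slice[of t] by (simp add: frontier_def interior_open)
qed

lemma moving_defining_fun_zero:
 assumes "moving_defining_fun T D (t, x) W ph" "(t, x) : closure D - D"
 shows "ph (t, x) = 0"
proof -
 note m = moving_defining_funD[OF assms(1)]
 have t: "t : {0..T}" using closure_D_subset assms(2) by fastforce
 have "\<not> ph (t, x) > 0"
 proof
  assume "ph (t, x) > 0"
  then have "open (W \<inter> ph -` {0<..})" "(t, x) : W \<inter> ph -` {0<..}"
   using continuous_open_preimage[OF Ck_on_cont[OF m(3)[of 0]] m(1)] m(2) by auto
  then have "W \<inter> ph -` {0<..} \<inter> D ~= {}"
   using open_Int_closure_eq_empty[of "W \<inter> ph -` {0<..}" D] assms(2) by blast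
  then obtain w where "w : W" "ph w > 0" "w : D" by auto
  then show False using m(6)[of w] D_subset[of w] by auto
 qed
 moreover have "\<not> ph (t, x) < 0" using m(6)[OF m(2)] t assms(2) by auto
 ultimately show ?thesis by simp
qed

text \<open>The supremum in \<open>inj_radius\<close> need not be attained, so a radius above
  \<open>d0\<close> and at least half of the supremum is selected. The half reappears as a factor 2
  when \<open>1 / inj_radius\<close> is replaced by \<open>1 / r\<close>.\<close>

definition tube_radius :: "real => real" where
 "tube_radius t = (SOME r. d0 < r & inj_radius (slice D t) <= 2 * r & smooth_tube (slice D t) r)"

lemma tube_radius:
 assumes "t : {0..T}"
 shows "d0 < tube_radius t" "inj_radius (slice D t) <= 2 * tube_radius t"
  "smooth_tube (slice D t) (tube_radius t)"
proof -
 let ?S = "{r. 0 <= r & inj_on (%(x, s). x + s *\<^sub>R ext_normal (slice D t) x) (frontier (slice D t) \<times> {-r<..<r})}"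
 have "0 : ?S" by simp
 moreover have "max d0 (Sup ?S / 2) < Sup ?S"
  using inj_radius_D[OF assms] d0 unfolding inj_radius_def by auto
 ultimately obtain r where r: "r : ?S" "max d0 (Sup ?S / 2) < r" using less_cSupD[of ?S] by blast
 have "smooth_tube (slice D t) r"
 proof
  fix x assume x: "x : frontier (slice D t)"
  obtain W ph where m: "moving_defining_fun T D (t, x) W ph"
   using defining_D frontier_slice_closure[OF x] by blast
  show "\<exists>W ph. local_defining_fun (slice D t) x W ph"
   using moving_imp_local[OF m] moving_defining_funD(2,5)[OF m] assms by fastforce
 qed (use r open_slice bounded_slice in auto)
 then have "\<exists>r. d0 < r & inj_radius (slice D t) <= 2 * r & smooth_tube (slice D t) r"
  using r by (intro exI[of _ r]) (auto simp: inj_radius_def)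
 from someI_ex[OF this] show "d0 < tube_radius t" "inj_radius (slice D t) <= 2 * tube_radius t"
  "smooth_tube (slice D t) (tube_radius t)" unfolding tube_radius_def by blast+
qed

lemma bd_pos: "z : D ==> bd z > 0"
 and ft_frontier: "z : D ==> ft z : frontier (slice D (fst z))"
 and ft_closure: "z : D ==> (fst z, ft z) : closure D - D"
 and ft_eq: "z : D ==> ft z = snd z + bd z *\<^sub>R nn z"
 and norm_nn: "z : D ==> norm (nn z) = 1"
 using smooth_tube.infdist_pos[OF tube_radius(3), of "fst z" "snd z"]
  smooth_tube.foot(1)[OF tube_radius(3), of "fst z" "snd z"]
  smooth_tube.foot_eq[OF tube_radius(3), of "fst z" "snd z"]
  smooth_tube.norm_normal[OF tube_radius(3), of "fst z" "ft z"] D_subset[of z]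
  frontier_slice_closure[of "ft z" "fst z"]
 by (auto simp: bd_def ft_def nn_def)

lemma nn_lipschitz:
 assumes "(t, x) : D" "(t, y) : D"
 shows "(tube_radius t - bd (t, x)) * norm (nn (t, x) - nn (t, y)) <= 2 * norm (x - y)"
 using smooth_tube.normal_foot_lipschitz[OF tube_radius(3), of t x y] D_subset[OF assms(1)] assms
 by (simp add: bd_def nn_def ft_def)

text \<open>A boundary point itself may be swallowed by the domain at once. Moved slightly in the
  direction of the gradient it satisfies \<open>ph > 0\<close>, which is an open condition in
  space-time and persists for nearby times.\<close>

lemma outside_point:
 assumes "t : {0..T}" "(t, y) \<notin> D" "ep > 0"
 obtains y1 dl where "dist y1 y < ep" "dl > 0" "!!s. \<bar>s - t\<bar> < dl ==> (s, y1) \<notin> D"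
proof -
 have "\<exists>V y1. open V & (t, y1) : V & dist y1 y < ep & V \<inter> D = {}"
 proof (cases "(t, y) : closure D")
  case False
  then show ?thesis using assms(3) closure_subset[of D] by (intro exI[of _ "- closure D"] exI[of _ y]) auto
 next
  case True
  then obtain W ph where m0: "moving_defining_fun T D (t, y) W ph" using defining_D assms(2) by blast
  note m = moving_defining_funD[OF m0]
  define h where "h = grad (%y. ph (t, y)) y"
  have "dd (0, h) ph (t, y) > 0"
   using m(5) by (simp add: h_def grad_slice[OF m(4)[OF m(2)], symmetric])
  then have 1: "\<forall>\<^sub>F s in at_right 0. ph ((t, y) + s *\<^sub>R (0, h)) > 0"
   using eventually_pos_direction m(4)[OF m(2)] moving_defining_fun_zero[OF m0] True assms(2) by blast
  have 2: "\<forall>\<^sub>F s in at_right 0. (t, y) + s *\<^sub>R (0, h) : W"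
   using m(1,2) by (rule eventually_in_open_direction)
  have 3: "\<forall>\<^sub>F s in at_right 0. y + s *\<^sub>R h : ball y ep"
   using assms(3) by (intro eventually_in_open_direction) auto
  obtain s where s: "ph (t, y + s *\<^sub>R h) > 0" "(t, y + s *\<^sub>R h) : W" "dist y (y + s *\<^sub>R h) < ep"
   using eventually_happens'[OF trivial_limit_at_right_real eventually_conj[OF 1 eventually_conj[OF 2 3]]] by auto
  have "open (W \<inter> ph -` {0<..})"
   using continuous_open_preimage[OF Ck_on_cont[OF m(3)[of 0]] m(1)] by auto
  moreover have "W \<inter> ph -` {0<..} \<inter> D = {}" using m(6) D_subset by fastforce
  ultimately show ?thesis using s by (intro exI[of _ "W \<inter> ph -` {0<..}"] exI[of _ "y + s *\<^sub>R h"]) (auto simp: dist_commute)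
 qed
 then obtain V y1 where V: "open V" "(t, y1) : V" "dist y1 y < ep" "V \<inter> D = {}" by blast
 obtain e where e: "e > 0" "ball (t, y1) e \<subseteq> V" using V open_contains_ball by blast
 have "(s, y1) \<notin> D" if "\<bar>s - t\<bar> < e" for s
 proof -
  have "(s, y1) : ball (t, y1) e" using that by (simp add: dist_Pair_Pair dist_real_def abs_minus_commute)
  then show ?thesis using e V by blast
 qed
 then show ?thesis using that[of y1 e] V e by blast
qed

lemma bd_le: "(t, x) : D ==> (t, y) \<notin> D ==> bd (t, x) <= dist x y"
 using infdist_frontier_le[of x "slice D t" y] by (simp add: bd_def)

lemma bd_small_near_boundary:
 assumes "t : {0..T}" "(t, x) \<notin> D" "ep > 0"
 obtains U where "open U" "(t, x) : U" "!!z. z : U ==> z : D ==> bd z < ep"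
proof -
 obtain y1 dl where y1: "dist y1 x < ep / 2" "dl > 0" "!!s. \<bar>s - t\<bar> < dl ==> (s, y1) \<notin> D"
  using outside_point[OF assms(1,2) half_gt_zero[OF assms(3)]] by blast
 show ?thesis
 proof (rule that[of "ball t dl \<times> ball x (ep / 2)"])
  fix z assume z: "z : ball t dl \<times> ball x (ep / 2)" "z : D"
  then obtain s y where zs: "z = (s, y)" by (cases z)
  have "bd (s, y) <= dist y y1"
   using bd_le y1(3)[of s] z by (auto simp: zs dist_real_def abs_minus_commute)
  also have "... < ep" using z y1(1) dist_triangle[of y y1 x] by (simp add: zs dist_commute)
  finally show "bd z < ep" by (simp add: zs)
 qed (use y1 assms in \<open>auto simp: open_Times\<close>)
qed

text \<open>The distance at nearby times is bounded above by an exterior point near the foot that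
  stays exterior, and below by the tube lemma: a compact ball inside the slice stays inside for a
  while. Differentiability of the distance is not involved, so this holds away from the boundary
  too.\<close>

lemma continuous_on_bd: "continuous_on D bd"
 unfolding continuous_on_iff
proof (intro ballI allI impI)
 fix z0 :: "real \<times> (real^'n)" and e :: real
 assume z0: "z0 : D" and e: "e > 0"
 obtain t0 x0 where z: "z0 = (t0, x0)" by (cases z0)
 have t0: "t0 : {0..T}" using D_subset[OF z0] z by simp
 have ff: "ft z0 : frontier (slice D t0)" using ft_frontier[OF z0] z by simp
 obtain y1 dl1 where y1: "dist y1 (ft z0) < e / 2" "dl1 > 0" "!!s. \<bar>s - t0\<bar> < dl1 ==> (s, y1) \<notin> D"
  using outside_point[of t0 "ft z0" "e / 2"] frontier_slice_closure[OF ff] t0 e by auto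
 have dft: "dist x0 (ft z0) = bd z0"
  using smooth_tube.foot(2)[OF tube_radius(3)[OF t0], of x0] z0 by (simp add: bd_def ft_def z)
 \<comment> \<open>If \<open>a\<close> is negative the ball is empty and the lower bound below is
   trivially true.\<close>
 define a where "a = bd z0 - e / 2"
 obtain O' where O': "open O'" "D = ({0..T} \<times> UNIV) \<inter> O'" by (rule D_open_ex)
 have sub: "{t0} \<times> cball x0 a \<subseteq> O'"
 proof -
  have "cball x0 a \<subseteq> ball x0 (bd z0)" using e by (auto simp: a_def)
  also have "... \<subseteq> slice D t0" using ball_infdist_frontier_subset[of x0 "slice D t0"] z0 by (simp add: bd_def z)
  finally show ?thesis using O' by (auto simp: slice_def)
 qed
 obtain X0 where X0: "t0 : X0" "open X0" "X0 \<times> cball x0 a \<subseteq> O'"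
  using Elementary_Topology.tube_lemma[OF compact_cball O'(1) sub] by blast
 then obtain dl2 where dl2: "dl2 > 0" "ball t0 dl2 \<subseteq> X0" using open_contains_ball by blast
 define dl where "dl = min (e / 2) (min dl1 dl2)"
 have "dist (bd z') (bd z0) < e" if z': "z' : D" "dist z' z0 < dl" for z'
 proof -
  obtain t x where zz: "z' = (t, x)" by (cases z')
  have dt: "dist t t0 < dl" "dist x x0 < dl"
   using dist_fst_le[of z' z0] dist_snd_le[of z' z0] z'(2) by (simp_all add: zz z)
  have "bd z' <= dist x y1" using bd_le[of t x y1] y1(3)[of t] dt z'(1) by (simp add: zz dist_real_def dl_def)
  also have "... <= dist x x0 + dist x0 (ft z0) + dist (ft z0) y1"
   using dist_triangle[of x y1 x0] dist_triangle[of x0 y1 "ft z0"] by linarith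
  also have "... < bd z0 + e" using dt y1(1) dft by (simp add: dl_def dist_commute)
  finally have up: "bd z' < bd z0 + e" .
  have "ball x (a - dist x x0) \<subseteq> slice D t"
  proof
   fix y assume "y : ball x (a - dist x x0)"
   then have "y : cball x0 a" using dist_triangle[of x0 y x] by (simp add: dist_commute)
   moreover have "t : X0" using dl2(2) dt(1) by (auto simp: dl_def dist_commute)
   ultimately have "(t, y) : O'" using X0(3) by blast
   then show "y : slice D t" using O'(2) D_subset[OF z'(1)] by (auto simp: zz slice_def)
  qed
  then have "a - dist x x0 <= bd z'"
   using le_infdist_frontier[OF open_slice, of t x] smooth_tube.frontier_nonempty[OF tube_radius(3), of t x]
    D_subset[OF z'(1)] z'(1) by (simp add: bd_def zz)
  then have "bd z0 - e < bd z'" using dt(2) by (simp add: a_def dl_def)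
  with up show ?thesis by (simp add: dist_real_def)
 qed
 moreover have "dl > 0" using e y1 dl2 by (simp add: dl_def)
 ultimately show "\<exists>d>0. \<forall>x'\<in>D. dist x' z0 < d --> dist (bd x') (bd z0) < e" by blast
qed

end

section \<open>Spatial gradients and unit normals of space-time defining functions\<close>

definition sgrad :: "(real \<times> (real^'n) => real) => real \<times> (real^'n::finite) => real^'n" where
 "sgrad ph w = grad (%y. ph (fst w, y)) (snd w)"

text \<open>The normals of the level sets of \<open>ph\<close> extend the boundary normal to a
  space-time neighbourhood, where it can be differentiated in every direction, unlike
  \<open>ext_normal\<close>.\<close>

definition nrm :: "(real \<times> (real^'n) => real) => real \<times> (real^'n::finite) => real^'n" where
 "nrm ph w = sgrad ph w /\<^sub>R norm (sgrad ph w)"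

lemma sgrad_inner:
 assumes "ph differentiable at w"
 shows "dd (0, h) ph w = sgrad ph w \<bullet> h"
proof -
 obtain t x where w: "w = (t, x)" by (cases w)
 show ?thesis
  using grad_inner[OF differentiableI[OF slice_differentiable(1)], of ph t x h] dd_slice[of ph t x h] assms
  by (simp add: w sgrad_def)
qed

lemma norm_nrm: "sgrad ph w ~= 0 ==> nrm ph w \<bullet> nrm ph w = 1"
 by (simp add: nrm_def dot_square_norm power2_eq_square)

lemma sgrad_nrm: "sgrad ph w = norm (sgrad ph w) *\<^sub>R nrm ph w"
 by (cases "sgrad ph w = 0") (simp_all add: nrm_def)

lemma Ck_on_sgrad:
 assumes "open W" "!!k. Ck_on k W ph"
 shows "Ck_on k W (sgrad ph)"
proof (rule Ck_on_vec_lambda[OF assms(1)])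
 fix i
 have "Ck_on k W (dd (0, axis i 1) ph)" by (rule Ck_on_dd[OF assms(2)])
 moreover have "dd (0, axis i 1) ph w = sgrad ph w $ i" if "w : W" for w
 proof -
  have "ph differentiable at w" using assms(2)[of 1] that by (simp add: Ck_on_Suc)
  from sgrad_inner[OF this, of "axis i 1"] show ?thesis by (simp only: inner_axis inner_real_def mult_1_right)
 qed
 ultimately show "Ck_on k W (%w. sgrad ph w $ i)" 
  using Ck_on_cong[OF assms(1), of "dd (0, axis i 1) ph" "%w. sgrad ph w $ i" k] by blast
qed

lemma open_sgrad_nonzero:
 assumes "open W" "!!k. Ck_on k W ph"
 shows "open {w : W. sgrad ph w ~= 0}"
proof -
 have "{w : W. sgrad ph w ~= 0} = W \<inter> sgrad ph -` (- {0})" by auto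
 moreover have "open (- {0::real^'n})" by (simp add: open_Compl)
 ultimately show ?thesis
  using continuous_open_preimage[OF Ck_on_cont[OF Ck_on_sgrad[OF assms, of 0]] assms(1)] by metis
qed

lemma Ck_on_nrm:
 assumes "open W" "!!k. Ck_on k W ph"
 shows "Ck_on k {w : W. sgrad ph w ~= 0} (nrm ph)"
proof -
 let ?S = "{w : W. sgrad ph w ~= 0}"
 note o = open_sgrad_nonzero[OF assms]
 have 1: "Ck_on k ?S (sgrad ph)" by (rule Ck_on_subset[OF Ck_on_sgrad[OF assms]]) auto
 have 2: "Ck_on k ?S (%w. sqrt (sgrad ph w \<bullet> sgrad ph w))"
  by (rule Ck_on_compose[OF o Ck_on_inner[OF o 1 1] Ck_on_sqrt]) auto
 have 3: "Ck_on k ?S (%w. inverse (sqrt (sgrad ph w \<bullet> sgrad ph w)))"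
  by (rule Ck_on_compose[OF o 2 Ck_on_inverse]) auto
 show ?thesis using Ck_on_scaleR[OF o 3 1] by (simp add: nrm_def[abs_def] norm_eq_sqrt_inner)
qed

lemma dd_bounded_linear_compose:
 assumes "bounded_linear L" "f differentiable at x"
 shows "dd h (%x. L (f x)) x = L (dd h f x)"
 using dd_eq[OF bounded_linear.has_derivative[OF assms(1) has_derivative_dd[OF assms(2)]]] .

lemmas dd_fst = dd_bounded_linear_compose[OF bounded_linear_fst]
lemmas dd_snd = dd_bounded_linear_compose[OF bounded_linear_snd]

context moving_domain
begin

lemma ext_normal_nrm:
 assumes "moving_defining_fun T D (t, x0) W ph" "(t, x) : W" "t : {0..T}" "ph (t, x) = 0" "sgrad ph (t, x) ~= 0"
 shows "x : frontier (slice D t)" "ext_normal (slice D t) x = nrm ph (t, x)"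
proof -
 show 1: "x : frontier (slice D t)" using zero_set_frontier assms by (simp add: sgrad_def)
 show "ext_normal (slice D t) x = nrm ph (t, x)"
  using ext_normal_eq[OF open_slice 1 moving_imp_local[OF assms(1-3)]] assms(5) by (simp add: nrm_def sgrad_def)
qed

text \<open>Leaving the boundary point with a normal speed \<open>c\<close> strictly between the two
  candidates, the point would be outside according to \<open>ph1\<close> and inside according to
  \<open>ph2\<close>. The argument moves forward in time, hence \<open>t < T\<close>.\<close>

lemma moving_velocity_le:
 assumes "t : {0..<T}" "(t, x) : closure D - D"
  "moving_defining_fun T D (t, x) W1 ph1" "moving_defining_fun T D (t, x) W2 ph2"
 shows "- dd (1, 0) ph2 (t, x) / norm (sgrad ph2 (t, x)) <= - dd (1, 0) ph1 (t, x) / norm (sgrad ph1 (t, x))"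
proof (rule ccontr)
 define k1 where "k1 = - dd (1, 0) ph1 (t, x) / norm (sgrad ph1 (t, x))"
 define k2 where "k2 = - dd (1, 0) ph2 (t, x) / norm (sgrad ph2 (t, x))"
 define c where "c = (k1 + k2) / 2"
 define n where "n = ext_normal (slice D t) x"
 assume "\<not> ?thesis"
 then have k: "k1 < c" "c < k2" by (simp_all add: k1_def k2_def c_def)
 note m1 = moving_defining_funD[OF assms(3)] and m2 = moving_defining_funD[OF assms(4)]
 have g: "sgrad ph1 (t, x) ~= 0" "sgrad ph2 (t, x) ~= 0" using m1(5) m2(5) by (auto simp: sgrad_def)
 have z: "ph1 (t, x) = 0" "ph2 (t, x) = 0" using moving_defining_fun_zero assms by blast+
 have n: "n = nrm ph1 (t, x)" "n = nrm ph2 (t, x)"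
  using ext_normal_nrm(2)[OF assms(3) m1(2) _ z(1) g(1)] ext_normal_nrm(2)[OF assms(4) m2(2) _ z(2) g(2)] assms(1)
  by (auto simp: n_def)
 have D: "dd (1, c *\<^sub>R n) ph (t, x) = dd (1, 0) ph (t, x) + c * norm (sgrad ph (t, x))"
  if "ph differentiable at (t, x)" "n = nrm ph (t, x)" "sgrad ph (t, x) ~= 0" for ph
 proof -
  have "dd (1, c *\<^sub>R n) ph (t, x) = dd (1, 0) ph (t, x) + dd (0, c *\<^sub>R n) ph (t, x)"
   using dd_add_dir[OF that(1), of "(1, 0)" "(0, c *\<^sub>R n)"] by simp
  also have "dd (0, c *\<^sub>R n) ph (t, x) = c * (sgrad ph (t, x) \<bullet> n)" using sgrad_inner[OF that(1)] by simp
  also have "sgrad ph (t, x) \<bullet> n = norm (sgrad ph (t, x))"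
   using sgrad_nrm[of ph "(t, x)"] norm_nrm[OF that(3)] that(2) by (metis inner_scaleR_left mult.right_neutral)
  finally show ?thesis .
 qed
 have 1: "dd (1, c *\<^sub>R n) ph1 (t, x) > 0"
  using D[OF m1(4)[OF m1(2)] n(1) g(1)] k(1) g(1) by (simp add: k1_def field_simps)
 have 2: "dd (1, c *\<^sub>R n) ph2 (t, x) < 0"
  using D[OF m2(4)[OF m2(2)] n(2) g(2)] k(2) g(2) by (simp add: k2_def field_simps)
 have e1: "\<forall>\<^sub>F s in at_right 0. ph1 ((t, x) + s *\<^sub>R (1, c *\<^sub>R n)) > 0"
  using eventually_pos_direction[OF m1(4)[OF m1(2)] z(1) 1] .
 have e2: "\<forall>\<^sub>F s in at_right 0. ph2 ((t, x) + s *\<^sub>R (1, c *\<^sub>R n)) < 0"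
  using eventually_neg_direction[OF m2(4)[OF m2(2)] z(2) 2] .
 have e3: "\<forall>\<^sub>F s in at_right 0. (t, x) + s *\<^sub>R (1, c *\<^sub>R n) : W1 \<inter> W2 \<inter> ({..<T} \<times> UNIV)"
  using m1(1,2) m2(1,2) assms(1) by (intro eventually_in_open_direction) (auto simp: open_Times)
 have e4: "\<forall>\<^sub>F s in at_right (0::real). s > 0" by (simp add: eventually_at_right_less)
 from e1 e2 e3 e4 have "\<forall>\<^sub>F s in at_right (0::real). False"
 proof eventually_elim
  case (elim s)
  then show ?case
   using m1(6)[of "(t, x) + s *\<^sub>R (1, c *\<^sub>R n)"] m2(6)[of "(t, x) + s *\<^sub>R (1, c *\<^sub>R n)"] assms(1) by auto
 qed
 then show False by simp
qed

lemma normal_velocity_eq: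
 assumes "t : {0..<T}" "(t, x) : closure D - D" "moving_defining_fun T D (t, x) W ph"
 shows "normal_velocity T D t x = - dd (1, 0) ph (t, x) / norm (sgrad ph (t, x))"
proof -
 have e: "- vector_derivative (%s. ph (s, x)) (at t) / norm (grad (%y. ph (t, y)) x)
   = - dd (1, 0) ph (t, x) / norm (sgrad ph (t, x))" if "moving_defining_fun T D (t, x) W ph" for W ph
  using vector_derivative_at[OF slice_differentiable(2)[of ph t x]] moving_defining_funD(2,4)[OF that]
  by (simp add: sgrad_def)
 show ?thesis
  unfolding normal_velocity_def
 proof (rule the_equality)
  show "\<exists>W ph'. moving_defining_fun T D (t, x) W ph' & - dd (1, 0) ph (t, x) / norm (sgrad ph (t, x)) =
    - vector_derivative (%s. ph' (s, x)) (at t) / norm (grad (%y. ph' (t, y)) x)"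
   using assms(3) e by metis
  fix \<kappa> assume "\<exists>W ph. moving_defining_fun T D (t, x) W ph &
     \<kappa> = - vector_derivative (%s. ph (s, x)) (at t) / norm (grad (%y. ph (t, y)) x)"
  then obtain W' ph' where m: "moving_defining_fun T D (t, x) W' ph'"
   and "\<kappa> = - dd (1, 0) ph' (t, x) / norm (sgrad ph' (t, x))" using e by auto
  then show "\<kappa> = - dd (1, 0) ph (t, x) / norm (sgrad ph (t, x))"
   using moving_velocity_le[OF assms(1,2,3) m] moving_velocity_le[OF assms(1,2) m assms(3)] by simp
 qed
qed

text \<open>Infinitesimal form of \<open>normal_lipschitz\<close>. For tangent \<open>y\<close> the
  point \<open>x + s y\<close> usually misses the boundary; the intermediate value theorem between
  \<open>y - c n0\<close> and \<open>y + c n0\<close> supplies a boundary point nearby, and the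
  error disappears as \<open>c\<close> tends to 0.\<close>

lemma normal_derivative_bound:
 assumes t: "t : {0..T}" and z: "(t, x) : closure D - D" and m0: "moving_defining_fun T D (t, x) W ph"
  and ort: "sgrad ph (t, x) \<bullet> y = 0"
 shows "tube_radius t * norm (dd (0, y) (nrm ph) (t, x)) <= norm y"
proof -
 note m = moving_defining_funD[OF m0]
 define w where "w = (t, x)"
 define n0 where "n0 = nrm ph w"
 define W0 where "W0 = {w : W. sgrad ph w ~= 0}"
 define r where "r = tube_radius t"
 have r: "r > 0" using tube_radius(1)[OF t] d0 by (simp add: r_def)
 have W0: "open W0" "w : W0" "Ck_on 1 W0 (nrm ph)" "W0 \<subseteq> W"
  using open_sgrad_nonzero[OF m(1,3)] Ck_on_nrm[OF m(1,3)] m(2,5) by (auto simp: W0_def w_def sgrad_def)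
 have dn: "nrm ph differentiable at w" using W0 by (auto simp: Ck_on_Suc)
 have dph: "ph differentiable at w" using m(4)[OF m(2)] by (simp add: w_def)
 have z0: "ph w = 0" using moving_defining_fun_zero[OF m0 z] by (simp add: w_def)
 have g0: "sgrad ph w ~= 0" using W0 by (simp add: W0_def)
 have n1: "norm n0 = 1" using norm_nrm[OF g0] by (simp add: n0_def norm_eq_sqrt_inner)
 have gn: "sgrad ph w \<bullet> n0 > 0"
  using sgrad_nrm[of ph w] norm_nrm[OF g0] g0 unfolding n0_def by (metis inner_scaleR_left mult.right_neutral zero_less_norm_iff)
 define A where "A = dd (0, y) (nrm ph) w"
 define A2 where "A2 = dd (0, n0) (nrm ph) w"
 have key: "r * (norm A - c * norm A2 - c * (norm y + c)) <= norm y + c" if c: "c > 0" for c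
 proof -
  obtain e1 where e1: "e1 > 0" "!!w'. norm (w' - w) < e1 ==>
    norm (nrm ph w' - nrm ph w - dd (w' - w) (nrm ph) w) <= c * norm (w' - w)"
   using has_derivative_dd[OF dn] c unfolding has_derivative_at_alt by blast
  obtain e2 where e2: "e2 > 0" "ball w e2 \<subseteq> W0" using W0 open_contains_ball by blast
  have yc: "norm y + c > 0" using c by (simp add: add_nonneg_pos)
  have p: "\<forall>\<^sub>F s in at_right 0. ph (w + s *\<^sub>R (0, y + c *\<^sub>R n0)) > 0"
   using c gn ort by (intro eventually_pos_direction dph z0) (use sgrad_inner[OF dph] in \<open>simp add: inner_add_right w_def\<close>)
  have q: "\<forall>\<^sub>F s in at_right 0. ph (w + s *\<^sub>R (0, y + (-c) *\<^sub>R n0)) < 0"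
   using c gn ort by (intro eventually_neg_direction dph z0) (use sgrad_inner[OF dph] in \<open>simp add: inner_diff_right w_def\<close>)
  have "min e1 e2 / (norm y + c) > 0" using e1(1) e2(1) yc by simp
  then have s: "\<forall>\<^sub>F s in at_right 0. 0 < s & s < min e1 e2 / (norm y + c)"
   by (auto simp: eventually_at_right_field)
  obtain s where s: "ph (w + s *\<^sub>R (0, y + c *\<^sub>R n0)) > 0" "ph (w + s *\<^sub>R (0, y + (-c) *\<^sub>R n0)) < 0"
   "0 < s" "s < min e1 e2 / (norm y + c)"
   using eventually_happens'[OF trivial_limit_at_right_real eventually_conj[OF p eventually_conj[OF q s]]] by auto
  have nb: "norm (s *\<^sub>R (0::real, y + c' *\<^sub>R n0)) <= s * (norm y + c)" "s * (norm y + c) < min e1 e2" if "\<bar>c'\<bar> <= c" for c'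
  proof -
   have "norm (y + c' *\<^sub>R n0) <= norm y + c" using norm_triangle_ineq[of y "c' *\<^sub>R n0"] n1 that by simp
   then show "norm (s *\<^sub>R (0::real, y + c' *\<^sub>R n0)) <= s * (norm y + c)" using s(3) by (simp add: norm_Pair)
   show "s * (norm y + c) < min e1 e2" using s(4) yc by (simp add: pos_less_divide_eq)
  qed
  have inW: "w + s *\<^sub>R (0, y + c' *\<^sub>R n0) : W0" if "\<bar>c'\<bar> <= c" for c'
  proof -
   have "dist w (w + s *\<^sub>R (0, y + c' *\<^sub>R n0)) < e2" using nb[OF that] by (simp add: dist_norm)
   then show ?thesis using e2(2) by auto
  qed
  have "continuous_on {-c..c} (%c'. ph (w + s *\<^sub>R (0, y + c' *\<^sub>R n0)))"
   by (rule continuous_on_compose2[OF Ck_on_cont[OF Ck_on_subset[OF m(3)[of 0] W0(4)]]])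
    (use inW in \<open>auto intro!: continuous_intros\<close>)
  then obtain c' where c': "-c <= c'" "c' <= c" "ph (w + s *\<^sub>R (0, y + c' *\<^sub>R n0)) = 0"
   using IVT'[of "%c'. ph (w + s *\<^sub>R (0, y + c' *\<^sub>R n0))" "-c" 0 c] s c by auto
  then have ac: "\<bar>c'\<bar> <= c" by auto
  define v where "v = y + c' *\<^sub>R n0"
  have nv: "norm v <= norm y + c" using norm_triangle_ineq[of y "c' *\<^sub>R n0"] n1 ac by (simp add: v_def)
  have wv: "w + s *\<^sub>R (0, v) = (t, x + s *\<^sub>R v)" by (simp add: w_def)
  have w1: "(t, x + s *\<^sub>R v) : W" "sgrad ph (t, x + s *\<^sub>R v) ~= 0" "ph (t, x + s *\<^sub>R v) = 0"
   using inW[OF ac] c'(3) wv W0_def by (auto simp: v_def)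
  note en = ext_normal_nrm[OF m0 w1(1) t w1(3,2)]
  have z0': "ph (t, x) = 0" "sgrad ph (t, x) ~= 0" using z0 g0 by (auto simp: w_def)
  note en0 = ext_normal_nrm[OF m0 m(2) t z0']
  have "r * norm (nrm ph (t, x + s *\<^sub>R v) - nrm ph (t, x)) <= norm (s *\<^sub>R v)"
   using smooth_tube.normal_lipschitz[OF tube_radius(3)[OF t] en(1) en0(1)] by (simp add: en(2) en0(2) r_def)
  also have "... <= s * (norm y + c)" using nv s(3) by simp
  finally have 1: "r * norm (nrm ph (t, x + s *\<^sub>R v) - nrm ph (t, x)) <= s * (norm y + c)" .
  have "norm (nrm ph (t, x + s *\<^sub>R v) - nrm ph (t, x) - dd (s *\<^sub>R (0, v)) (nrm ph) w) <= c * norm (s *\<^sub>R (0::real, v))"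
   using e1(2)[of "w + s *\<^sub>R (0, v)"] nb[OF ac] by (simp add: v_def w_def)
  also have "... <= c * (s * (norm y + c))" using nb(1)[OF ac] c by (intro mult_left_mono) (auto simp: v_def)
  finally have 2: "norm (nrm ph (t, x + s *\<^sub>R v) - nrm ph (t, x) - dd (s *\<^sub>R (0, v)) (nrm ph) w) <= c * (s * (norm y + c))" .
  have "(0, v) = (0, y) + c' *\<^sub>R (0::real, n0)" by (simp add: v_def)
  then have "dd (s *\<^sub>R (0, v)) (nrm ph) w = s *\<^sub>R (A + c' *\<^sub>R A2)"
   by (simp only: dd_scale_dir[OF dn] dd_add_dir[OF dn] A_def A2_def)
  then have 3: "norm (dd (s *\<^sub>R (0, v)) (nrm ph) w) = s * norm (A + c' *\<^sub>R A2)" using s(3) by simp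
  have "norm A - c * norm A2 <= norm (A + c' *\<^sub>R A2)"
   using norm_triangle_ineq4[of "A + c' *\<^sub>R A2" "c' *\<^sub>R A2"] mult_right_mono[OF ac, of "norm A2"] by simp
  then have "s * (norm A - c * norm A2) <= s * norm (A + c' *\<^sub>R A2)" using s(3) by simp
  also have "... <= norm (nrm ph (t, x + s *\<^sub>R v) - nrm ph (t, x)) + c * (s * (norm y + c))"
   using 2 3 norm_triangle_ineq3[of "nrm ph (t, x + s *\<^sub>R v) - nrm ph (t, x)" "dd (s *\<^sub>R (0, v)) (nrm ph) w"] by linarith
  finally have "r * (s * (norm A - c * norm A2) - c * (s * (norm y + c))) <=
    r * norm (nrm ph (t, x + s *\<^sub>R v) - nrm ph (t, x))"
   using r by (intro mult_left_mono) auto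
  then have "s * (r * (norm A - c * norm A2 - c * (norm y + c))) <= s * (norm y + c)"
   using 1 by (simp add: algebra_simps)
  then show ?thesis using s(3) by simp
 qed
 have "((%c. r * (norm A - c * norm A2 - c * (norm y + c))) \<longlongrightarrow> r * (norm A - 0 * norm A2 - 0 * (norm y + 0))) (at_right 0)"
  by (intro tendsto_intros)
 moreover have "((%c. norm y + c) \<longlongrightarrow> norm y + 0) (at_right 0)" by (intro tendsto_intros)
 moreover have "\<forall>\<^sub>F c in at_right 0. r * (norm A - c * norm A2 - c * (norm y + c)) <= norm y + c"
  using key by (intro eventually_at_rightI[of 0 1]) auto
 ultimately have "r * (norm A - 0 * norm A2 - 0 * (norm y + 0)) <= norm y + 0"
  by (intro tendsto_le[OF trivial_limit_at_right_real])
 then show ?thesis by (simp add: A_def r_def w_def)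
qed

text \<open>The boundary is known only implicitly, so the map \<open>H\<close> keeps
  \<open>ph\<close> as an extra component: it sends \<open>(t, y, s)\<close> to
  \<open>(t, y - s n, ph)\<close> and is inverted over \<open>ph = 0\<close>. As \<open>ph\<close>
  lives in a full neighbourhood, the coordinates also exist across the times 0 and \<open>T\<close>.
  The derivative of \<open>S\<close> is then found by differentiating the two equations that define
  \<open>S\<close> and \<open>Y\<close>.\<close>

lemma local_tube_coordinates:
 assumes z0: "z0 : D" "bd z0 < d0"
 obtains V S Y N where "open V" "z0 : V" "Ck_on 1 V S" "Ck_on 1 V Y" "Ck_on 1 V N"
  "!!z. z : V ==> z : D ==> bd z = S z & ft z = Y z & nn z = N z"
  "!!z. z : V ==> z : D ==> \<exists>k. (\<forall>\<tau> \<xi>. dd (\<tau>, \<xi>) S z = \<tau> * k - nn z \<bullet> \<xi>) &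
    (fst z < T --> k = normal_velocity T D (fst z) (ft z))"
proof -
 obtain t0 x0 where z0e: "z0 = (t0, x0)" by (cases z0)
 have t0: "t0 : {0..T}" using D_subset[OF z0(1)] by (simp add: z0e)
 define y0 s0 where "y0 = ft z0" and "s0 = bd z0"
 obtain W ph where m0: "moving_defining_fun T D (t0, y0) W ph"
  using defining_D[OF ft_closure[OF z0(1)]] by (auto simp: z0e y0_def)
 note m = moving_defining_funD[OF m0]
 define W0 where "W0 = {w : W. sgrad ph w ~= 0}"
 define n where "n = nrm ph"
 have W0: "open W0" "(t0, y0) : W0" "Ck_on 1 W0 n" "W0 \<subseteq> W" "Ck_on 1 W0 ph"
  using open_sgrad_nonzero[OF m(1,3)] Ck_on_nrm[OF m(1,3)] m(2,5) Ck_on_subset[OF m(3), of W0]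
  by (auto simp: W0_def sgrad_def n_def)
 have dn: "n differentiable at w" and dp: "ph differentiable at w" if "w : W0" for w
  using W0(3,5) that by (auto simp: Ck_on_Suc)
 have zf: "(t0, y0) : closure D - D" using ft_closure[OF z0(1)] by (simp add: z0e y0_def)
 have phi0: "ph (t0, y0) = 0" using moving_defining_fun_zero[OF m0 zf] .
 have en0: "ext_normal (slice D t0) y0 = n (t0, y0)"
  using ext_normal_nrm(2)[OF m0 m(2) t0 phi0] W0(2) by (simp add: W0_def n_def)
 define pr :: "real \<times> (real^'n) \<times> real => real \<times> (real^'n)" where "pr p = (fst p, fst (snd p))" for p
 have blpr: "bounded_linear pr"
  unfolding pr_def by (intro bounded_linear_Pair bounded_linear_fst bounded_linear_fst_comp bounded_linear_snd)
 define U where "U = pr -` W0"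
 have oU: "open U"
  unfolding U_def by (intro open_vimage W0(1)) (simp add: linear_continuous_on blpr)
 have bl2: "bounded_linear (%p::real \<times> (real^'n) \<times> real. fst (snd p))" "bounded_linear (%p::real \<times> (real^'n) \<times> real. snd (snd p))"
  by (auto intro: bounded_linear_fst_comp bounded_linear_snd_comp bounded_linear_snd)
 have npr: "Ck_on 1 U (%p. n (pr p))" "Ck_on 1 U (%p. ph (pr p))"
  using Ck_on_compose[OF oU Ck_on_bounded_linear[OF blpr] W0(3)]
   Ck_on_compose[OF oU Ck_on_bounded_linear[OF blpr] W0(5)] by (auto simp: U_def)
 define H where "H p = (fst p, fst (snd p) - snd (snd p) *\<^sub>R n (pr p), ph (pr p))" for p
 have H1: "Ck_on 1 U (%p. fst (snd p) - snd (snd p) *\<^sub>R n (pr p))"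
  by (intro Ck_on_diff_fun oU Ck_on_scaleR npr Ck_on_bounded_linear[OF bl2(1)] Ck_on_bounded_linear[OF bl2(2)])
 have CH: "Ck_on 1 U H"
  unfolding H_def by (intro Ck_on_Pair oU H1 npr Ck_on_bounded_linear bounded_linear_fst)
 define p0 where "p0 = (t0, y0, s0)"
 have p0U: "p0 : U" using W0(2) by (simp add: U_def p0_def pr_def)
 have x0: "x0 = y0 - s0 *\<^sub>R n (t0, y0)"
 proof -
  have "nn z0 = n (t0, y0)" using en0 by (simp add: nn_def y0_def z0e)
  then have "y0 = x0 + s0 *\<^sub>R n (t0, y0)" using ft_eq[OF z0(1)] by (metis s0_def snd_conv y0_def z0e)
  then show ?thesis by (metis add_diff_cancel_right')
 qed
 have Hp0: "H p0 = (t0, x0, 0)" using x0 phi0 by (simp add: H_def p0_def pr_def)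
 have s0: "0 < s0" "s0 < d0" using z0 bd_pos by (auto simp: s0_def)
 \<comment> \<open>The component \<open>ph\<close> makes \<open>y'\<close> tangent, and pairing the
   middle component with \<open>n\<close> gives \<open>s' = 0\<close>. What is left,
   \<open>y' = s0 dN(y')\<close>, contradicts the bound \<open>1 / r\<close> on the derivative of
   the normal unless \<open>y' = 0\<close>, because \<open>s0 < r\<close>.\<close>
 have ker: "h = 0" if h: "dd h H p0 = 0" for h
 proof -
  obtain \<tau> y' s' where hh: "h = (\<tau>, y', s')" by (cases h)
  have dH: "H differentiable at p0" using CH p0U by (simp add: Ck_on_Suc)
  have dnp: "(%p. n (pr p)) differentiable at p0" using npr(1) p0U by (simp add: Ck_on_Suc)
  have w0: "pr p0 = (t0, y0)" "dd h pr p0 = (\<tau>, y')"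
   using dd_bounded_linear[OF blpr] by (auto simp: pr_def p0_def hh)
  have dpr: "pr differentiable at p0" using bounded_linear_imp_differentiable[OF blpr] .
  have "dd h (%p. fst (H p)) p0 = 0" using dd_fst[OF dH] h by simp
  then have tau: "\<tau> = 0" using dd_bounded_linear[OF bounded_linear_fst, of h p0] by (simp add: H_def hh)
  have "dd h (%p. snd (snd (H p))) p0 = 0"
   using dd_bounded_linear_compose[OF bounded_linear_snd_comp[OF bounded_linear_snd] dH] h by simp
  then have "dd (0, y') ph (t0, y0) = 0"
   using dd_compose[OF dpr, of ph h] dp[OF W0(2)] w0 by (simp add: H_def tau)
  then have ort: "sgrad ph (t0, y0) \<bullet> y' = 0" using sgrad_inner[OF dp[OF W0(2)]] by simp
  have "dd h (%p. fst (snd (H p))) p0 = 0"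
   using dd_bounded_linear_compose[OF bounded_linear_fst_comp[OF bounded_linear_snd] dH] h by simp
  moreover have "dd h (%p. fst (snd p) - snd (snd p) *\<^sub>R n (pr p)) p0 = y' - (s0 *\<^sub>R dd (0, y') n (t0, y0) + s' *\<^sub>R n (t0, y0))"
  proof -
   have "dd h (%p. fst (snd p) - snd (snd p) *\<^sub>R n (pr p)) p0 =
     dd h (%p. fst (snd p)) p0 - dd h (%p. snd (snd p) *\<^sub>R n (pr p)) p0"
    using dnp bounded_linear_imp_differentiable[OF bl2(1)] bounded_linear_imp_differentiable[OF bl2(2)]
    by (intro dd_diff differentiable_scaleR) auto
   also have "dd h (%p. snd (snd p) *\<^sub>R n (pr p)) p0 = s0 *\<^sub>R dd h (%p. n (pr p)) p0 + s' *\<^sub>R n (t0, y0)"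
    using dd_scaleR[OF bounded_linear_imp_differentiable[OF bl2(2)] dnp, of h] w0(1)
     dd_bounded_linear[OF bl2(2), of h p0] by (simp add: p0_def hh)
   also have "dd h (%p. n (pr p)) p0 = dd (0, y') n (t0, y0)"
    using dd_compose[OF dpr, of n h] dn[OF W0(2)] w0 by (simp add: tau)
   finally show ?thesis using dd_bounded_linear[OF bl2(1), of h p0] by (simp add: hh)
  qed
  ultimately have e: "y' = s0 *\<^sub>R dd (0, y') n (t0, y0) + s' *\<^sub>R n (t0, y0)" by (simp add: H_def)
  have nn1: "n w \<bullet> n w = 1" if "w : W0" for w using norm_nrm[of ph w] that by (simp add: W0_def n_def)
  have "dd (0, y') (%w. n w \<bullet> n w) (t0, y0) = dd (0, y') (%w. 1::real) (t0, y0)"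
   by (rule dd_cong_open[OF W0(1,2)]) (simp add: nn1)
  then have nd: "n (t0, y0) \<bullet> dd (0, y') n (t0, y0) = 0"
   using dd_inner[OF dn[OF W0(2)] dn[OF W0(2)]] by (simp add: inner_commute)
  have "n (t0, y0) \<bullet> y' = 0"
   using ort sgrad_nrm[of ph "(t0, y0)"] W0(2) unfolding W0_def n_def
   by (metis (mono_tags, lifting) inner_scaleR_left mem_Collect_eq mult_eq_0_iff norm_eq_zero)
  moreover have "n (t0, y0) \<bullet> y' = s0 * (n (t0, y0) \<bullet> dd (0, y') n (t0, y0)) + s' * (n (t0, y0) \<bullet> n (t0, y0))"
   by (subst e) (simp add: inner_add_right)
  ultimately have s': "s' = 0" using nn1[OF W0(2)] nd by simp
  have "tube_radius t0 * norm (dd (0, y') n (t0, y0)) <= norm y'"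
   unfolding n_def by (rule normal_derivative_bound[OF t0 zf m0 ort])
  moreover have "norm y' = s0 * norm (dd (0, y') n (t0, y0))"
   using arg_cong[OF e, of norm] s0(1) s' by simp
  ultimately have "(tube_radius t0 - s0) * norm (dd (0, y') n (t0, y0)) <= 0" by (simp add: algebra_simps)
  moreover have "tube_radius t0 - s0 > 0" using tube_radius(1)[OF t0] s0 by simp
  ultimately have "dd (0, y') n (t0, y0) = 0" by (simp add: mult_le_0_iff)
  then show "h = 0" using e s' tau by (simp add: hh zero_prod_def)
 qed
 obtain U' V g where U': "open U'" "U' \<subseteq> U" "p0 : U'" "open V" "H p0 : V" "homeomorphism U' V H g" "Ck_on 1 V g"
  using Ck1_inverse_function[OF oU CH p0U ker] by blast
 have gV: "H (g v) = v" "g v : U'" if "v : V" for v using U'(6) that by (auto simp: homeomorphism_def)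
 define E where "E z = (fst z, snd z, 0::real)" for z :: "real \<times> (real^'n)"
 have blE: "bounded_linear E"
  unfolding E_def by (intro bounded_linear_Pair bounded_linear_fst bounded_linear_snd bounded_linear_zero)
 define O1 where "O1 = E -` V"
 have o1: "open O1" unfolding O1_def by (intro open_vimage U'(4)) (simp add: linear_continuous_on blE)
 define gg where "gg z = g (E z)" for z
 have Cgg: "Ck_on 1 O1 gg" unfolding gg_def
  by (rule Ck_on_compose[OF o1 Ck_on_bounded_linear[OF blE] U'(7)]) (auto simp: O1_def)
 define Y S where "Y z = fst (snd (gg z))" and "S z = snd (snd (gg z))" for z
 have CY: "Ck_on 1 O1 Y" and CS: "Ck_on 1 O1 S"
  unfolding Y_def S_def by (intro Ck_on_fst Ck_on_snd o1 Cgg)+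
 have ggE: "fst (gg z) = fst z" "Y z - S z *\<^sub>R n (fst z, Y z) = snd z" "ph (fst z, Y z) = 0" "(fst z, Y z) : W0"
  if "z : O1" for z
 proof -
  have "E z : V" using that by (simp add: O1_def)
  from gV[OF this] have "H (gg z) = E z" "gg z : U" using U'(2) by (auto simp: gg_def)
  then show "fst (gg z) = fst z" "Y z - S z *\<^sub>R n (fst z, Y z) = snd z" "ph (fst z, Y z) = 0" "(fst z, Y z) : W0"
   by (auto simp: H_def E_def Y_def S_def pr_def U_def)
 qed
 define N where "N z = n (fst z, Y z)" for z
 have CfY: "Ck_on 1 O1 (%z. (fst z, Y z))"
  by (intro Ck_on_Pair o1 CY Ck_on_bounded_linear bounded_linear_fst)
 have CN: "Ck_on 1 O1 N" unfolding N_def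
  by (rule Ck_on_compose[OF o1 CfY W0(3)]) (use ggE(4) in auto)
 \<comment> \<open>On \<open>V'\<close> the parameter \<open>S\<close> lies between 0 and
   \<open>d0\<close>, below the tube radius, so that \<open>foot_unique\<close> identifies
   \<open>S\<close> with the distance and \<open>Y\<close> with the foot.\<close>
 define V' where "V' = O1 \<inter> S -` {0<..<d0}"
 have oV': "open V'" unfolding V'_def
  by (rule continuous_open_preimage[OF Ck_on_cont[OF CS] o1 open_greaterThanLessThan])
 have Ez0: "E z0 = H p0" by (simp add: E_def z0e Hp0)
 then have "gg z0 = p0" using U'(3,6) by (auto simp: gg_def homeomorphism_def)
 then have z0V: "z0 : V'" using U'(5) Ez0 s0 by (simp add: V'_def O1_def S_def p0_def)
 have mm: "moving_defining_fun T D w W ph" if "w : W0" for w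
  using m0 that by (simp add: moving_defining_fun_def W0_def sgrad_def)
 have main: "bd z = S z & ft z = Y z & nn z = N z" if z: "z : V'" "z : D" for z
 proof -
  obtain t x where ze: "z = (t, x)" by (cases z)
  have t: "t : {0..T}" using D_subset[OF z(2)] by (simp add: ze)
  have zO: "z : O1" and Sz: "0 < S z" "S z < d0" using z(1) by (auto simp: V'_def)
  have w: "(t, Y z) : W" "ph (t, Y z) = 0" "sgrad ph (t, Y z) ~= 0" using ggE[OF zO] by (auto simp: ze W0_def)
  have wW: "(t, Y z) : W0" using w by (simp add: W0_def)
  note en = ext_normal_nrm[OF mm[OF wW] w(1) t w(2,3)]
  have xe: "x = Y z - S z *\<^sub>R ext_normal (slice D t) (Y z)"
   using ggE(2)[OF zO] en(2) by (simp add: ze n_def)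
  have "S z < tube_radius t" using Sz tube_radius(1)[OF t] by simp
  note fu = smooth_tube.foot_unique[OF tube_radius(3)[OF t] en(1) Sz(1) this]
  show ?thesis using fu en(2) unfolding xe[symmetric] by (simp add: bd_def ft_def nn_def ze N_def n_def)
 qed
 have deriv: "\<exists>k. (\<forall>\<tau> \<xi>. dd (\<tau>, \<xi>) S z = \<tau> * k - nn z \<bullet> \<xi>) &
    (fst z < T --> k = normal_velocity T D (fst z) (ft z))" if z: "z : V'" "z : D" for z
 proof -
  have zO: "z : O1" using z(1) by (auto simp: V'_def)
  define w where "w = (fst z, Y z)"
  have wW: "w : W0" using ggE(4)[OF zO] by (simp add: w_def)
  have g: "sgrad ph w ~= 0" using wW by (simp add: W0_def)
  have dY: "Y differentiable at z" and dS: "S differentiable at z" and dN: "N differentiable at z"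
   and dfY: "(%z. (fst z, Y z)) differentiable at z"
   using CY CS CN CfY zO by (auto simp: Ck_on_Suc)
  define k where "k = - dd (1, 0) ph w / norm (sgrad ph w)"
  have N1: "N y \<bullet> N y = 1" if "y : O1" for y
   using norm_nrm[of ph "(fst y, Y y)"] ggE(4)[OF that] by (simp add: N_def n_def W0_def)
  have "dd (\<tau>, \<xi>) S z = \<tau> * k - nn z \<bullet> \<xi>" for \<tau> \<xi>
  proof -
   let ?h = "(\<tau>, \<xi>)"
   \<comment> \<open>Pairing the derivative of \<open>Y - S N = snd\<close> with \<open>N\<close>
     removes the derivative of \<open>N\<close>, which is orthogonal to \<open>N\<close>. The
     remaining \<open>N . dY\<close> is the normal motion of the boundary, found from
     \<open>ph = 0\<close> along \<open>Y\<close>.\<close>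
   have "dd ?h (%z. N z \<bullet> N z) z = dd ?h (%z. 1::real) z"
    by (rule dd_cong_open[OF o1 zO]) (simp add: N1)
   then have nd: "N z \<bullet> dd ?h N z = 0" using dd_inner[OF dN dN] by (simp add: inner_commute)
   have "dd ?h (%z. Y z - S z *\<^sub>R N z) z = dd ?h snd z"
    by (rule dd_cong_open[OF o1 zO]) (simp add: ggE N_def)
   moreover have "dd ?h (%z. Y z - S z *\<^sub>R N z) z = dd ?h Y z - (S z *\<^sub>R dd ?h N z + dd ?h S z *\<^sub>R N z)"
    using dd_diff[OF dY differentiable_scaleR[OF dS dN]] dd_scaleR[OF dS dN] by simp
   ultimately have "\<xi> = dd ?h Y z - (S z *\<^sub>R dd ?h N z + dd ?h S z *\<^sub>R N z)"
    using dd_bounded_linear[OF bounded_linear_snd, of ?h z] by simp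
   then have "N z \<bullet> \<xi> = N z \<bullet> (dd ?h Y z - (S z *\<^sub>R dd ?h N z + dd ?h S z *\<^sub>R N z))" by simp
   also have "... = N z \<bullet> dd ?h Y z - dd ?h S z"
    using nd N1[OF zO] by (simp add: inner_diff_right inner_add_right)
   finally have 1: "dd ?h S z = N z \<bullet> dd ?h Y z - N z \<bullet> \<xi>" by simp
   have "dd ?h (%z. (fst z, Y z)) z = (\<tau>, dd ?h Y z)"
    using dd_fst[OF dfY, of ?h] dd_snd[OF dfY, of ?h] dd_bounded_linear[OF bounded_linear_fst, of ?h z]
    by (simp add: prod_eq_iff)
   then have "dd (\<tau>, dd ?h Y z) ph w = dd ?h (%z. ph (fst z, Y z)) z"
    using dd_compose[OF dfY, of ph ?h] dp[OF wW] by (simp add: w_def)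
   also have "... = dd ?h (%z. 0::real) z" by (rule dd_cong_open[OF o1 zO]) (simp add: ggE)
   finally have "dd (\<tau>, dd ?h Y z) ph w = 0" by simp
   moreover have "(\<tau>, dd ?h Y z) = \<tau> *\<^sub>R (1, 0) + (0, dd ?h Y z)" by simp
   ultimately have "\<tau> * dd (1, 0) ph w + sgrad ph w \<bullet> dd ?h Y z = 0"
    by (simp only: dd_add_dir[OF dp[OF wW]] dd_scale_dir[OF dp[OF wW]] sgrad_inner[OF dp[OF wW]] real_scaleR_def)
   moreover have "sgrad ph w \<bullet> dd ?h Y z = norm (sgrad ph w) * (N z \<bullet> dd ?h Y z)"
    using sgrad_nrm[of ph w] by (metis N_def inner_scaleR_left n_def w_def)
   ultimately have "N z \<bullet> dd ?h Y z = \<tau> * k" using g by (simp add: k_def field_simps)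
   then show ?thesis using 1 main[OF z] by simp
  qed
  moreover have "k = normal_velocity T D (fst z) (ft z)" if "fst z < T"
   using normal_velocity_eq[of "fst z" "ft z" W ph] ft_closure[OF z(2)] D_subset[OF z(2)] that mm[OF wW] main[OF z]
   by (simp add: k_def w_def)
  ultimately show ?thesis by blast
 qed
 have sub: "V' \<subseteq> O1" by (auto simp: V'_def)
 show ?thesis
  by (rule that[OF oV' z0V Ck_on_subset[OF CS sub] Ck_on_subset[OF CY sub] Ck_on_subset[OF CN sub] main deriv])
qed

end

section \<open>Kinematics of the tube\<close>

abbreviation px :: "'n => (real \<times> (real^'n::finite) => 'b::real_normed_vector) => real \<times> (real^'n) => 'b" where
 "px k \<equiv> dd (0, axis k 1)"

lemma dd_space_expand:
 fixes f :: "real \<times> (real^'n::finite) => 'b::real_normed_vector"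
 assumes "f differentiable at z"
 shows "dd (0, h) f z = (SUMU k. h $ k *\<^sub>R px k f z)"
proof -
 note l = linear_dd[OF assms]
 have e: "(SUMU k. h $ k *\<^sub>R (0::real, axis k (1::real))) = (0, h)"
  using basis_expansion[of h] by (simp add: prod_eq_iff fst_sum snd_sum scalar_mult_eq_scaleR)
 show ?thesis
  using linear_sum[OF l, of "%k. h $ k *\<^sub>R (0::real, axis k (1::real))" UNIV]
  unfolding linear_scale[OF l] e .
qed

lemma norm_dd_space_le:
 fixes f :: "real \<times> (real^'n::finite) => 'b::real_normed_vector"
 assumes "f differentiable at z"
 shows "norm (dd (0, h) f z) <= (SUMU k. norm (px k f z)) * norm h"
proof -
 have "norm (dd (0, h) f z) <= (SUMU k. norm (h $ k *\<^sub>R px k f z))"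
  by (subst dd_space_expand[OF assms]) (rule norm_sum)
 also have "... <= (SUMU k. norm h * norm (px k f z))"
  by (intro sum_mono) (simp add: mult_right_mono component_le_norm_cart)
 also have "... = norm h * (SUMU k. norm (px k f z))" by (rule sum_distrib_left[symmetric])
 finally show ?thesis by (simp only: mult.commute)
qed

text \<open>The Lipschitz condition is one-sided in \<open>s\<close> and \<open>c\<close> stays on
  the left, where it will be the difference of the tube radius and the distance.\<close>

lemma norm_dd_le_of_lipschitz:
 fixes f :: "'a::real_normed_vector => 'b::real_normed_vector"
 assumes "f differentiable at z" "c \<ge> 0"
  and "\<forall>\<^sub>F s in at_right 0. c * norm (f (z + s *\<^sub>R h) - f z) <= s * L"
 shows "c * norm (dd h f z) <= L"
proof -
 have 1: "((%s. z + s *\<^sub>R h) has_derivative (%t. t *\<^sub>R h)) (at 0)"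
  by (auto intro!: derivative_eq_intros)
 have "((%s. f (z + s *\<^sub>R h)) has_derivative (%s. dd (s *\<^sub>R h) f z)) (at 0)"
  using has_derivative_compose[OF 1, of f "%h. dd h f z"] has_derivative_dd[OF assms(1)] by simp
 then have "((%s. f (z + s *\<^sub>R h)) has_derivative (%s. dd (s *\<^sub>R h) f z)) (at_right 0)"
  by (rule has_derivative_at_withinI)
 then have lim: "((%s. norm (f (z + s *\<^sub>R h) - f z - s *\<^sub>R dd h f z) / norm s) \<longlongrightarrow> 0) (at_right 0)"
  by (simp add: has_derivative_iff_norm dd_scale_dir[OF assms(1)])
 have "((%s. L + c * (norm (f (z + s *\<^sub>R h) - f z - s *\<^sub>R dd h f z) / norm s)) \<longlongrightarrow> L + c * 0) (at_right 0)"
  by (intro tendsto_intros lim)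
 moreover have "\<forall>\<^sub>F s in at_right (0::real). s > 0" by (rule eventually_at_right_less)
 with assms(3) have "\<forall>\<^sub>F s in at_right 0. c * norm (dd h f z) <=
   L + c * (norm (f (z + s *\<^sub>R h) - f z - s *\<^sub>R dd h f z) / norm s)"
 proof eventually_elim
  case (elim s)
  define u w where "u = f (z + s *\<^sub>R h) - f z" and "w = dd h f z"
  have "norm (s *\<^sub>R w) <= norm u + norm (u - s *\<^sub>R w)" using norm_triangle_ineq4[of u "u - s *\<^sub>R w"] by simp
  then have "c * (s * norm w) <= c * (norm u + norm (u - s *\<^sub>R w))"
   using elim(2) assms(2) by (intro mult_left_mono) auto
  also have "... <= s * L + c * norm (u - s *\<^sub>R w)" using elim(1) by (simp add: u_def algebra_simps)
  finally show ?case using elim(2) unfolding u_def[symmetric] w_def[symmetric] by (simp add: field_simps)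
 qed
 ultimately have "c * norm (dd h f z) <= L + c * 0"
  using tendsto_lowerbound trivial_limit_at_right_real by blast
 then show ?thesis by simp
qed

section \<open>The solution, its smooth extension and the a priori bounds up to the boundary\<close>

locale mhd_flow = moving_domain T D d0
 for T :: real and D :: "(real \<times> (real^'n::finite)) set" and d0 :: real +
 fixes \<sigma> M K :: real and \<eta> :: "real => real" and D0 :: "(real^'n) set" and v0 B0 :: "real^'n => real^'n"
  and v B :: "real => real^'n => real^'n" and p :: "real => real^'n => real"
 assumes sol: "mhd_solution T \<sigma> D0 v0 B0 D v B p"
  and T_pos: "T > 0" and M_pos: "M > 0" and K_pos: "K > 0" and cutoff_\<eta>: "cutoff d0 \<eta>"
  and interior_bound: "!!t x. t : {0..T} ==> x : slice D t ==>
    norm (grad (total_pressure p B t) x) <= M & norm (grad (v t) x) <= M"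
  and boundary_bound: "!!t x. t : {0..T} ==> x : frontier (slice D t) ==>
    norm (second_ff (slice D t) x) + norm (grad (v t) x) + 1 / inj_radius (slice D t) <= K"
begin

definition V :: "real \<times> (real^'n) => real^'n" where "V z = v (fst z) (snd z)"
definition Bm :: "real \<times> (real^'n) => real^'n" where "Bm z = B (fst z) (snd z)"
definition P :: "real \<times> (real^'n) => real" where "P z = total_pressure p B (fst z) (snd z)"

definition dom :: "(real \<times> (real^'n)) set" where
 "dom = (SOME U. open U & closure D \<subseteq> U & smooth_on U (%(t, x). v t x) &
    smooth_on U (%(t, x). B t x) & smooth_on U (%(t, x). p t x))"

lemma dom: "open dom" "closure D \<subseteq> dom"
 and Ck_V: "Ck_on k dom V" and Ck_B: "Ck_on k dom Bm" and Ck_P: "Ck_on k dom P"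
proof -
 have "\<exists>U. open U & closure D \<subseteq> U & smooth_on U (%(t, x). v t x) &
    smooth_on U (%(t, x). B t x) & smooth_on U (%(t, x). p t x)"
  using sol unfolding mhd_solution_def by blast
 from someI_ex[OF this] have U: "open dom" "closure D \<subseteq> dom" "smooth_on dom (%(t, x). v t x)"
    "smooth_on dom (%(t, x). B t x)" "smooth_on dom (%(t, x). p t x)" unfolding dom_def by blast+
 show 1: "open dom" "closure D \<subseteq> dom" by fact+
 show "Ck_on k dom V" using smooth_on_Ck[OF U(3)] by (simp add: V_def[abs_def] case_prod_beta')
 show 2: "Ck_on k dom Bm" using smooth_on_Ck[OF U(4)] by (simp add: Bm_def[abs_def] case_prod_beta')
 have "Ck_on k dom (%z. p (fst z) (snd z))" using smooth_on_Ck[OF U(5)] by (simp add: case_prod_beta')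
 then have "Ck_on k dom (%z. p (fst z) (snd z) + (Bm z \<bullet> Bm z) * (1 / (8 * pi)))"
  by (intro Ck_on_add Ck_on_mult Ck_on_inner Ck_on_const 1 2)
 then show "Ck_on k dom P"
  by (simp add: P_def[abs_def] total_pressure_def power2_norm_eq_inner Bm_def)
qed

lemma D_dom: "z : D ==> z : dom" and closure_dom: "z : closure D ==> z : dom"
 and G_dom: "z : G ==> z : dom"
 using dom(2) closure_subset[of D] G_D[of z] by blast+

lemma diff_dom:
 assumes "!!k. Ck_on k dom f" "z : dom"
 shows "f differentiable at z"
 using assms(1)[of 1] assms(2) by (simp add: Ck_on_Suc)

lemmas diff_V = diff_dom[OF Ck_V] and diff_B = diff_dom[OF Ck_B] and diff_P = diff_dom[OF Ck_P]

lemma bounded_on_closure: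
 assumes "continuous_on dom f"
 obtains C where "C > 0" "!!z. z : closure D ==> norm (f z) <= C"
proof -
 have "compact (f ` closure D)"
  using compact_continuous_image[OF continuous_on_subset[OF assms dom(2)] compact_closure_D] .
 then show ?thesis using that compact_imp_bounded bounded_pos by (metis image_eqI)
qed

lemma cball_closure:
 assumes "(t, x) : D" "y : cball x (bd (t, x))"
 shows "(t, y) : closure D"
proof -
 have "cball x (bd (t, x)) \<subseteq> closure (slice D t)"
 proof -
  have "cball x (bd (t, x)) = closure (ball x (bd (t, x)))" using bd_pos[OF assms(1)] by simp
  also have "... \<subseteq> closure (slice D t)"
   using ball_infdist_frontier_subset[of x "slice D t"] assms(1) by (intro closure_mono) (simp add: bd_def)
  finally show ?thesis .
 qed
 then show ?thesis using assms(2) closure_slice by blast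
qed

definition fz :: "real \<times> (real^'n) => real \<times> (real^'n)" where "fz z = (fst z, ft z)"

lemma fz_closure: "z : D ==> fz z : closure D" and fz_dom: "z : D ==> fz z : dom"
 using ft_closure[of z] closure_dom by (auto simp: fz_def)

text \<open>A slice need not be convex, so the mean value inequality is used on the closed ball of
  radius \<open>bd z\<close>: it is convex, contains the foot, and lies in the closure, where the
  derivative bounds hold.\<close>

lemma foot_lipschitz_bound:
 assumes "Ck_on 1 dom f" "z : D" and L: "!!w h. w : closure D ==> norm (dd (0, h) f w) <= L * norm h"
 shows "norm (f z - f (fz z)) <= L * bd z"
proof -
 obtain t x where z: "z = (t, x)" by (cases z)
 let ?S = "cball x (bd z)"
 have "norm (f (t, x) - f (t, ft z)) <= L * norm (x - ft z)"
 proof (rule differentiable_bound[of ?S "%y. f (t, y)" "%y h. dd (0, h) f (t, y)"])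
  fix y assume y: "y : ?S"
  then have c: "(t, y) : closure D" using cball_closure assms(2) by (simp add: z)
  then have d: "f differentiable at (t, y)" using assms(1) closure_dom by (simp add: Ck_on_Suc)
  show "((%y. f (t, y)) has_derivative (%h. dd (0, h) f (t, y))) (at y within ?S)"
   using has_derivative_at_withinI[OF slice_differentiable(1)[OF d]] .
  show "onorm (%h. dd (0, h) f (t, y)) <= L"
   using L[OF c] by (intro onorm_le) auto
 next
  have "ft z = x + bd z *\<^sub>R nn z" "norm (nn z) = 1" "bd z > 0"
   using ft_eq[OF assms(2)] norm_nn[OF assms(2)] bd_pos[OF assms(2)] by (auto simp: z)
  then show "x : ?S" "ft z : ?S" by (auto simp: dist_norm)
 qed auto
 also have "norm (x - ft z) = bd z"
  using ft_eq[OF assms(2)] norm_nn[OF assms(2)] bd_pos[OF assms(2)] by (simp add: z)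
 finally show ?thesis by (simp add: z fz_def)
qed

lemma foot_lipschitz:
 fixes f :: "real \<times> (real^'n) => 'b::real_normed_vector"
 assumes "Ck_on 1 dom f"
 obtains L where "L > 0" "!!z. z : D ==> norm (f z - f (fz z)) <= L * bd z"
proof -
 have "continuous_on dom (%z. SUMU k. norm (px k f z))"
  using assms by (intro continuous_on_sum continuous_on_norm) (simp add: Ck_on_Suc)
 then obtain C where C: "C > 0" "!!z. z : closure D ==> norm (SUMU k. norm (px k f z)) <= C"
  using bounded_on_closure by blast
 have "norm (dd (0, h) f z) <= C * norm h" if "z : closure D" for z h
 proof -
  have d: "f differentiable at z" using assms closure_dom[OF that] by (simp add: Ck_on_Suc)
  have "(SUMU k. norm (px k f z)) <= C" using C(2)[OF that] by (simp add: sum_nonneg)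
  then show ?thesis using norm_dd_space_le[OF d, of h] mult_right_mono[of _ C "norm h"] by fastforce
 qed
 from foot_lipschitz_bound[OF assms _ this] C(1) that show ?thesis by blast
qed

lemma grad_slice_V: "(t, x) : dom ==> grad (v t) x = (\<chi> k. px k V (t, x))"
 using dd_slice[OF diff_V, of t x] by (simp add: grad_def pd_def dd_def[symmetric] V_def)

lemma grad_slice_P: "(t, x) : dom ==> grad (total_pressure p B t) x = (\<chi> k. px k P (t, x))"
 using dd_slice[OF diff_P, of t x] by (simp add: grad_def pd_def dd_def[symmetric] P_def)

lemma grad_V_le: "z : closure D ==> norm (\<chi> k. px k V z) <= M"
 and grad_P_le: "z : closure D ==> norm (\<chi> k. px k P z) <= M"
proof -
 have cV: "continuous_on (closure D) (%z. norm (\<chi> k. px k V z))"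
  and cP: "continuous_on (closure D) (%z. norm (\<chi> k. px k P z))"
  by (intro continuous_on_norm continuous_on_vec_lambda
    continuous_on_subset[OF Ck_on_cont[OF Ck_on_dd[OF Ck_V[of "Suc 0"]]] dom(2)]
    continuous_on_subset[OF Ck_on_cont[OF Ck_on_dd[OF Ck_P[of "Suc 0"]]] dom(2)])+
 have "norm (\<chi> k. px k V z) <= M & norm (\<chi> k. px k P z) <= M" if z: "z : D" for z
 proof -
  obtain t x where ze: "z = (t, x)" by (cases z)
  show ?thesis
   using interior_bound[of t x] D_subset[OF z] z D_dom[OF z] grad_slice_V[of t x] grad_slice_P[of t x] by (simp add: ze)
 qed
 then show "z : closure D ==> norm (\<chi> k. px k V z) <= M" "z : closure D ==> norm (\<chi> k. px k P z) <= M"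
  using continuous_le_on_closure[OF cV, of z M] continuous_le_on_closure[OF cP, of z M] by blast+
qed

lemma norm_dd_V: 
 assumes "z : closure D"
 shows "norm (dd (0, h) V z) <= M * norm h"
proof -
 have "norm (dd (0, h) V z) <= (SUMU k. norm (h $ k *\<^sub>R px k V z))"
  by (subst dd_space_expand[OF diff_V[OF closure_dom[OF assms]]]) (rule norm_sum)
 also have "... = (SUMU k. \<bar>h $ k\<bar> * \<bar>norm (px k V z)\<bar>)" by simp
 also have "... <= L2_set (%k. h $ k) UNIV * L2_set (%k. norm (px k V z)) UNIV" by (rule L2_set_mult_ineq)
 also have "L2_set (%k. h $ k) UNIV = norm h" by (simp add: norm_vec_def L2_set_def)
 also have "L2_set (%k. norm (px k V z)) UNIV = norm (\<chi> k. px k V z)" by (simp add: norm_vec_def)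
 finally show ?thesis using mult_left_mono[OF grad_V_le[OF assms], of "norm h"] by (simp add: mult.commute)
qed

lemma V_foot: "z : D ==> norm (V z - V (fz z)) <= M * bd z"
 using foot_lipschitz_bound[OF Ck_V] norm_dd_V by blast

section \<open>Distance, foot and normal in the strip: regularity and material derivatives\<close>

definition strip :: "(real \<times> (real^'n)) set" where "strip = {z\<in>G. bd z < d0}"

lemma strip_G: "z : strip ==> z : G" and strip_D: "z : strip ==> z : D" and strip_dom: "z : strip ==> z : dom"
 using G_D D_dom by (auto simp: strip_def)

lemma open_sublevel: "open {z\<in>G. bd z < c}" and open_superlevel: "open {z\<in>G. c < bd z}"
proof -
 have 1: "continuous_on G bd" using continuous_on_subset[OF continuous_on_bd] G_D by blast
 have "{z\<in>G. bd z < c} = G \<inter> bd -` {..<c}" "{z\<in>G. c < bd z} = G \<inter> bd -` {c<..}" by auto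
 then show "open {z\<in>G. bd z < c}" "open {z\<in>G. c < bd z}"
  using continuous_open_preimage[OF 1 open_G] by auto
qed

lemma open_strip: "open strip" unfolding strip_def by (rule open_sublevel)

lemma foot_velocity:
 assumes "z : D"
 shows "normal_velocity T D (fst z) (ft z) = nn z \<bullet> V (fz z)"
proof -
 have "v (fst z) (ft z) \<bullet> ext_normal (slice D (fst z)) (ft z) = normal_velocity T D (fst z) (ft z)"
  using sol D_subset[OF assms] ft_frontier[OF assms] unfolding mhd_solution_def by blast
 then show ?thesis by (simp add: nn_def V_def fz_def inner_commute)
qed

text \<open>The time derivative of the distance is the normal velocity of the boundary at the foot;
  the kinematic boundary condition replaces it by the normal component of the fluid velocity
  there.\<close>

lemma Ck1_strip: "Ck_on 1 strip bd" "Ck_on 1 strip ft" "Ck_on 1 strip nn"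
 and dd_bd: "z : strip ==> dd (\<tau>, \<xi>) bd z = \<tau> * (nn z \<bullet> V (fz z)) - nn z \<bullet> \<xi>"
proof -
 have loc: "\<exists>U. open U & z : U & Ck_on 1 U bd & Ck_on 1 U ft & Ck_on 1 U nn &
   (\<forall>\<tau> \<xi>. dd (\<tau>, \<xi>) bd z = \<tau> * (nn z \<bullet> V (fz z)) - nn z \<bullet> \<xi>)" if z: "z : strip" for z
 proof -
  have z': "z : D" "bd z < d0" using z strip_D by (auto simp: strip_def)
  obtain W S Y N where W: "open W" "z : W" "Ck_on 1 W S" "Ck_on 1 W Y" "Ck_on 1 W N"
   "!!z. z : W ==> z : D ==> bd z = S z & ft z = Y z & nn z = N z"
   "!!z. z : W ==> z : D ==> \<exists>k. (\<forall>\<tau> \<xi>. dd (\<tau>, \<xi>) S z = \<tau> * k - nn z \<bullet> \<xi>) &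
    (fst z < T --> k = normal_velocity T D (fst z) (ft z))"
   by (rule local_tube_coordinates[OF z']) blast
  define U where "U = W \<inter> G"
  have U: "open U" "z : U" "U \<subseteq> W" "!!w. w : U ==> w : D" using W(1,2) open_G z strip_G G_D by (auto simp: U_def)
  have "Ck_on 1 U bd" by (rule Ck_on_cong[OF U(1) _ Ck_on_subset[OF W(3) U(3)]]) (use W(6) U in auto)
  moreover have "Ck_on 1 U ft" by (rule Ck_on_cong[OF U(1) _ Ck_on_subset[OF W(4) U(3)]]) (use W(6) U in auto)
  moreover have "Ck_on 1 U nn" by (rule Ck_on_cong[OF U(1) _ Ck_on_subset[OF W(5) U(3)]]) (use W(6) U in auto)
  moreover have "dd (\<tau>, \<xi>) bd z = \<tau> * (nn z \<bullet> V (fz z)) - nn z \<bullet> \<xi>" for \<tau> \<xi>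
  proof -
   have "dd (\<tau>, \<xi>) bd z = dd (\<tau>, \<xi>) S z" by (rule dd_cong_open[OF U(1,2)]) (use W(6) U in auto)
   moreover have "fst z < T" using z by (auto simp: strip_def G_def)
   ultimately show ?thesis using W(7)[OF W(2) z'(1)] foot_velocity[OF z'(1)] by auto
  qed
  ultimately show ?thesis using U by blast
 qed
 show "Ck_on 1 strip bd" by (rule Ck_on_local) (use loc in blast)
 show "Ck_on 1 strip ft" by (rule Ck_on_local) (use loc in blast)
 show "Ck_on 1 strip nn" by (rule Ck_on_local) (use loc in blast)
 show "z : strip ==> dd (\<tau>, \<xi>) bd z = \<tau> * (nn z \<bullet> V (fz z)) - nn z \<bullet> \<xi>" using loc by blast
qed

lemma diff_strip: "z : strip ==> bd differentiable at z" "z : strip ==> ft differentiable at z"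
  "z : strip ==> nn differentiable at z"
 using Ck1_strip by (auto simp: Ck_on_Suc)

lemma Ck_fz: "Ck_on 1 strip fz"
 unfolding fz_def by (intro Ck_on_Pair open_strip Ck1_strip Ck_on_bounded_linear bounded_linear_fst)

lemma diff_fz: "z : strip ==> fz differentiable at z" using Ck_fz by (simp add: Ck_on_Suc)

lemma Ck_comp_fz: "Ck_on 1 dom f ==> Ck_on 1 strip (%z. f (fz z))"
 by (rule Ck_on_compose[OF open_strip Ck_fz]) (use fz_dom strip_D in auto)

lemma Ck_strip_dom: "Ck_on k dom f ==> Ck_on k strip f"
 using Ck_on_subset strip_dom by blast

text \<open>One derivative is gained: by \<open>dd_bd\<close> all first derivatives of the distance
  are expressed through \<open>nn\<close> and the velocity at the foot, which are of class
  C1.\<close>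

lemma Ck2_bd: "Ck_on 2 strip bd"
proof -
 have "Ck_on 1 strip (dd h bd)" for h
 proof (rule Ck_on_cong[OF open_strip])
  show "Ck_on 1 strip (%z. fst h * (nn z \<bullet> V (fz z)) - nn z \<bullet> snd h)"
   by (intro Ck_on_diff_fun Ck_on_mult Ck_on_inner open_strip Ck_on_const Ck1_strip Ck_comp_fz Ck_V)
  show "fst h * (nn z \<bullet> V (fz z)) - nn z \<bullet> snd h = dd h bd z" if "z : strip" for z
   using dd_bd[OF that, of "fst h" "snd h"] by simp
 qed
 then show ?thesis using diff_strip by (simp add: numeral_2_eq_2 Ck_on_Suc[of "Suc 0"])
qed

text \<open>The velocity of the foot in the time derivative of the distance meets the velocity at
  the point itself. Only the variation of \<open>V\<close> along the normal segment survives, so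
  particles approach the boundary at most at an exponential rate.\<close>

lemma abs_material_bd:
 assumes "z : strip"
 shows "\<bar>dd (1, V z) bd z\<bar> <= M * bd z"
proof -
 have "dd (1, V z) bd z = - (nn z \<bullet> (V z - V (fz z)))"
  by (simp add: dd_bd[OF assms] inner_diff_right)
 then have "\<bar>dd (1, V z) bd z\<bar> <= norm (nn z) * norm (V z - V (fz z))"
  using Cauchy_Schwarz_ineq2[of "nn z"] by simp
 also have "... <= M * bd z" using V_foot[OF strip_D[OF assms]] norm_nn[OF strip_D[OF assms]] by simp
 finally show ?thesis .
qed

lemma norm_dd_nn:
 assumes "z : strip"
 shows "(tube_radius (fst z) - bd z) * norm (dd (0, \<xi>) nn z) <= 2 * norm \<xi>"
proof (rule norm_dd_le_of_lipschitz)
 show "nn differentiable at z" using diff_strip assms by blast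
 have "d0 < tube_radius (fst z)" using tube_radius(1) D_subset strip_D[OF assms] by blast
 then show "tube_radius (fst z) - bd z \<ge> 0" using assms by (simp add: strip_def)
 have "\<forall>\<^sub>F s in at_right 0. z + s *\<^sub>R (0, \<xi>) : G"
  using eventually_in_open_direction[OF open_G strip_G[OF assms]] .
 moreover have "\<forall>\<^sub>F s in at_right (0::real). s > 0" by (rule eventually_at_right_less)
 ultimately show "\<forall>\<^sub>F s in at_right 0. (tube_radius (fst z) - bd z) * norm (nn (z + s *\<^sub>R (0, \<xi>)) - nn z) <= s * (2 * norm \<xi>)"
 proof eventually_elim
  case (elim s)
  obtain t x where z: "z = (t, x)" by (cases z)
  show ?case using nn_lipschitz[of t x "x + s *\<^sub>R \<xi>"] G_D[OF elim(1)] strip_D[OF assms] elim(2)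
   by (simp add: z norm_minus_commute)
 qed
qed

text \<open>In the three cases \<open>r - bd z\<close> is at least \<open>3/8 * d0\<close>,
  \<open>bd z\<close> and \<open>r / 2\<close>. For the last one, \<open>inj_radius <= 2 * r\<close>
  and \<open>1 / inj_radius <= K\<close> give \<open>1 / r <= 2 * K\<close>, and
  \<open>4 / r\<close> becomes \<open>8 * K\<close>.\<close>

lemma norm_dd_nn':
 assumes "z : strip"
 shows "bd z <= 5/8 * d0 ==> norm (dd (0, \<xi>) nn z) <= 16 / (3 * d0) * norm \<xi>"
  and "bd z <= d0 / 2 ==> bd z * norm (dd (0, \<xi>) nn z) <= 2 * norm \<xi>"
  and "bd z <= d0 / 2 ==> norm (dd (0, \<xi>) nn z) <= 8 * K * norm \<xi>"
proof -
 define r where "r = tube_radius (fst z)"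
 have z: "z : D" "fst z : {0..T}" using strip_D[OF assms] D_subset by auto
 have r: "d0 < r" using tube_radius(1)[OF z(2)] by (simp add: r_def)
 have *: "c * norm (dd (0, \<xi>) nn z) <= 2 * norm \<xi>" if "c <= r - bd z" for c
  using norm_dd_nn[OF assms, of \<xi>] mult_right_mono[OF that norm_ge_zero] unfolding r_def by (meson order.trans)
 show "norm (dd (0, \<xi>) nn z) <= 16 / (3 * d0) * norm \<xi>" if "bd z <= 5/8 * d0"
  using *[of "3/8 * d0"] that r d0 by (simp add: field_simps)
 show "bd z * norm (dd (0, \<xi>) nn z) <= 2 * norm \<xi>" if "bd z <= d0 / 2" using *[of "bd z"] that r by simp
 show "norm (dd (0, \<xi>) nn z) <= 8 * K * norm \<xi>" if "bd z <= d0 / 2"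
 proof -
  have inj: "inj_radius (slice D (fst z)) > 0" using inj_radius_D[OF z(2)] d0 by simp
  have "1 / inj_radius (slice D (fst z)) <= K"
   using boundary_bound[OF z(2) ft_frontier[OF z(1)]] norm_ge_zero[of "second_ff (slice D (fst z)) (ft z)"]
    norm_ge_zero[of "grad (v (fst z)) (ft z)"] by linarith
  then have "1 <= K * inj_radius (slice D (fst z))" using inj by (simp add: field_simps)
  also have "... <= K * (2 * r)" using tube_radius(2)[OF z(2)] K_pos by (simp add: r_def)
  finally have Kr: "1 <= 2 * K * r" by simp
  have "r / 2 * norm (dd (0, \<xi>) nn z) <= 2 * norm \<xi>" using *[of "r/2"] that r by simp
  then have "(4 * K) * (r / 2 * norm (dd (0, \<xi>) nn z)) <= (4 * K) * (2 * norm \<xi>)"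
   using K_pos by (intro mult_left_mono) auto
  moreover have "1 * norm (dd (0, \<xi>) nn z) <= 2 * K * r * norm (dd (0, \<xi>) nn z)"
   by (rule mult_right_mono[OF Kr]) simp
  ultimately show ?thesis by simp
 qed
qed

lemma dd_ft:
 assumes "z : strip"
 shows "dd (0, \<xi>) ft z = \<xi> + bd z *\<^sub>R dd (0, \<xi>) nn z - (nn z \<bullet> \<xi>) *\<^sub>R nn z"
proof -
 have "dd (0, \<xi>) ft z = dd (0, \<xi>) (%z. snd z + bd z *\<^sub>R nn z) z"
  by (rule dd_cong_open[OF open_strip assms]) (use ft_eq strip_D in blast)
 also have "... = dd (0, \<xi>) snd z + dd (0, \<xi>) (%z. bd z *\<^sub>R nn z) z"
  by (intro dd_add differentiable_scaleR diff_strip[OF assms] bounded_linear_imp_differentiable bounded_linear_snd)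
 also have "dd (0, \<xi>) (%z. bd z *\<^sub>R nn z) z = bd z *\<^sub>R dd (0, \<xi>) nn z - (nn z \<bullet> \<xi>) *\<^sub>R nn z"
  using dd_scaleR[OF diff_strip(1)[OF assms] diff_strip(3)[OF assms]] dd_bd[OF assms] by simp
 finally show ?thesis by (simp add: dd_bounded_linear[OF bounded_linear_snd])
qed

lemma dd_fz: "z : strip ==> dd (0, \<xi>) fz z = (0, dd (0, \<xi>) ft z)"
 using dd_fst[OF diff_fz, of z "(0, \<xi>)"] dd_snd[OF diff_fz, of z "(0, \<xi>)"] dd_bounded_linear[OF bounded_linear_fst, of "(0, \<xi>)" z]
 by (simp add: prod_eq_iff fz_def)

lemma nn_dd_nn: "z : strip ==> nn z \<bullet> dd h nn z = 0"
proof -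
 assume z: "z : strip"
 have "dd h (%z. nn z \<bullet> nn z) z = dd h (%z. 1::real) z"
  by (rule dd_cong_open[OF open_strip z]) (use norm_nn strip_D in \<open>simp add: dot_square_norm\<close>)
 then show ?thesis using dd_inner[OF diff_strip(3)[OF z] diff_strip(3)[OF z], of h] by (simp add: inner_commute)
qed

text \<open>Since \<open>nn\<close> is minus the spatial gradient of \<open>bd\<close>, its material
  derivative is a spatial derivative of the explicit first derivatives of \<open>bd\<close>; only C2
  regularity of the distance enters.\<close>

lemma material_nn:
 assumes z: "z : strip"
 shows "dd (1, V z) nn z \<bullet> \<xi> =
  - (dd (0, \<xi>) nn z \<bullet> (V (fz z) - V z) + nn z \<bullet> dd (0, dd (0, \<xi>) ft z) V (fz z))"
proof -
 let ?w = "(1, V z)"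
 have dV: "(%z. V (fz z)) differentiable at z"
  using differentiable_compose[OF diff_V[OF fz_dom[OF strip_D[OF z]]] diff_fz[OF z]] .
 have "dd ?w nn z \<bullet> \<xi> = dd ?w (%z. nn z \<bullet> \<xi>) z"
  using dd_inner[OF diff_strip(3)[OF z] differentiable_const[of \<xi>], of ?w] by simp
 also have "... = dd ?w (%z. - dd (0, \<xi>) bd z) z"
  by (rule dd_cong_open[OF open_strip z]) (simp add: dd_bd)
 also have "... = - dd ?w (dd (0, \<xi>) bd) z"
  using Ck2_bd z by (intro dd_minus) (simp add: numeral_2_eq_2 Ck_on_Suc)
 \<comment> \<open>The vector \<open>?w\<close> is \<open>(1, V z)\<close> with the velocity frozen
   at the base point, so symmetry of the second derivative applies without a commutator. Accordingly
   \<open>V z\<close> stays constant in the next equation.\<close>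
 also have "dd ?w (dd (0, \<xi>) bd) z = dd (0, \<xi>) (dd ?w bd) z"
  by (rule dd_commute[OF open_strip z Ck2_bd])
 also have "... = dd (0, \<xi>) (%y. nn y \<bullet> (V (fz y) - V z)) z"
  by (rule dd_cong_open[OF open_strip z]) (simp add: dd_bd inner_diff_right)
 also have "... = nn z \<bullet> dd (0, \<xi>) (%y. V (fz y) - V z) z + dd (0, \<xi>) nn z \<bullet> (V (fz z) - V z)"
  by (rule dd_inner[OF diff_strip(3)[OF z] differentiable_diff[OF dV differentiable_const]])
 also have "dd (0, \<xi>) (%y. V (fz y) - V z) z = dd (0, \<xi>) (%y. V (fz y)) z"
  using dd_diff[OF dV differentiable_const[of "V z"]] by simp
 also have "... = dd (0, dd (0, \<xi>) ft z) V (fz z)"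
  using dd_compose[OF diff_fz[OF z] diff_V[OF fz_dom[OF strip_D[OF z]]]] dd_fz[OF z] by simp
 finally show ?thesis by simp
qed

text \<open>The constant is 2 + 4, the second number being 1 + 2 + 1 for the derivative of the foot.
  Neither \<open>K\<close> nor \<open>d0\<close> enters, because every derivative of
  \<open>nn\<close> comes with a factor \<open>bd\<close>.\<close>

lemma norm_material_nn:
 assumes z: "z : strip" and "bd z <= d0 / 2"
 shows "norm (dd (1, V z) nn z) <= 6 * M"
proof -
 have b: "\<bar>dd (1, V z) nn z \<bullet> \<xi>\<bar> <= 6 * M * norm \<xi>" for \<xi>
 proof -
  have zD: "z : D" and n1: "norm (nn z) = 1" and bp: "bd z > 0" using strip_D[OF z] norm_nn bd_pos by auto
  have 1: "norm (dd (0, \<xi>) ft z) <= 4 * norm \<xi>"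
  proof -
   have "norm (dd (0, \<xi>) ft z) <= norm \<xi> + norm (bd z *\<^sub>R dd (0, \<xi>) nn z) + norm ((nn z \<bullet> \<xi>) *\<^sub>R nn z)"
    unfolding dd_ft[OF z]
    by (rule order.trans[OF norm_triangle_ineq4]) (simp only: add_le_cancel_right norm_triangle_ineq)
   moreover have "norm (bd z *\<^sub>R dd (0, \<xi>) nn z) <= 2 * norm \<xi>"
    using norm_dd_nn'(2)[OF z assms(2)] bp by simp
   moreover have "norm ((nn z \<bullet> \<xi>) *\<^sub>R nn z) <= norm \<xi>"
    using Cauchy_Schwarz_ineq2[of "nn z" \<xi>] n1 by simp
   ultimately show ?thesis by simp
  qed
  have "\<bar>dd (0, \<xi>) nn z \<bullet> (V (fz z) - V z)\<bar> <= norm (dd (0, \<xi>) nn z) * norm (V z - V (fz z))"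
   using Cauchy_Schwarz_ineq2[of "dd (0, \<xi>) nn z" "V (fz z) - V z"] by (simp add: norm_minus_commute)
  also have "... <= norm (dd (0, \<xi>) nn z) * (M * bd z)" by (intro mult_left_mono V_foot zD) simp
  also have "... = M * (bd z * norm (dd (0, \<xi>) nn z))" by simp
  also have "... <= M * (2 * norm \<xi>)" using norm_dd_nn'(2)[OF z assms(2)] M_pos by (intro mult_left_mono) auto
  finally have 2: "\<bar>dd (0, \<xi>) nn z \<bullet> (V (fz z) - V z)\<bar> <= M * (2 * norm \<xi>)" .
  have "\<bar>nn z \<bullet> dd (0, dd (0, \<xi>) ft z) V (fz z)\<bar> <= norm (nn z) * norm (dd (0, dd (0, \<xi>) ft z) V (fz z))"
   by (rule Cauchy_Schwarz_ineq2)
  also have "... <= M * norm (dd (0, \<xi>) ft z)" using norm_dd_V[OF fz_closure[OF zD]] n1 by simp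
  also have "... <= M * (4 * norm \<xi>)" using 1 M_pos by simp
  finally show ?thesis using 2 unfolding material_nn[OF z] by (simp add: algebra_simps)
 qed
 show ?thesis
 proof (cases "dd (1, V z) nn z = 0")
  case False
  have "norm (dd (1, V z) nn z) * norm (dd (1, V z) nn z) <= 6 * M * norm (dd (1, V z) nn z)"
   using b[of "dd (1, V z) nn z"] by (simp add: dot_square_norm power2_eq_square)
  then show ?thesis using False by simp
 qed (use M_pos in simp)
qed

end

lemma Ck1_continuous_dd: "Ck_on 1 S f ==> continuous_on S (dd h f)"
 using Ck_on_dd[of 0 S f h] by simp

lemma Ck1_differentiable: "Ck_on 1 S f ==> x : S ==> f differentiable at x"
 using Ck_on_diff[of 0 S f x] by simp

section \<open>Divergence and transport theorems without boundary terms\<close>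

text \<open>The integral of \<open>h (x + s e)\<close> does not depend on \<open>s\<close>;
  differentiating under the integral at \<open>s = 0\<close> gives the claim. The box exceeds the
  support by 1 so that it contains all translates with \<open>s\<close> between -1 and 1.\<close>

lemma has_integral_dd_zero:
 fixes h :: "'a::euclidean_space => real"
 assumes h: "Ck_on 1 UNIV h" and R: "!!x. h x ~= 0 ==> norm x <= R" and e: "norm e <= 1"
 shows "(dd e h has_integral 0) UNIV"
proof -
 define c where "c = (R + 1) *\<^sub>R (One::'a)"
 have diff: "h differentiable at x" and cont: "continuous_on UNIV (dd e h)" "continuous_on UNIV h" for x
  using h Ck_on_cont[OF h] by (auto simp: Ck_on_Suc)
 have sub: "x + s *\<^sub>R e : cbox (-c) c" if "norm x <= R" "\<bar>s\<bar> <= 1" for x s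
 proof -
  have "\<bar>(x + s *\<^sub>R e) \<bullet> i\<bar> <= R + 1" if i: "i : Basis" for i
  proof -
   have "\<bar>s\<bar> * \<bar>e \<bullet> i\<bar> <= 1 * 1"
    using \<open>\<bar>s\<bar> <= 1\<close> e Basis_le_norm[OF i, of e] by (intro mult_mono) auto
   then have "\<bar>x \<bullet> i + s * (e \<bullet> i)\<bar> <= R + 1"
    using Basis_le_norm[OF i, of x] \<open>norm x <= R\<close> abs_triangle_ineq[of "x \<bullet> i" "s * (e \<bullet> i)"] by (simp add: abs_mult)
   then show ?thesis by (simp add: inner_add_left)
  qed
  then show ?thesis by (simp add: mem_box c_def abs_le_iff) force
 qed
 have int: "((%x. h (x + s *\<^sub>R e)) has_integral integral UNIV h) (cbox (-c) c)" if s: "\<bar>s\<bar> <= 1" for s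
 proof -
  have "h integrable_on cbox (-c) c" using cont(2) by (intro integrable_continuous) (auto intro: continuous_on_subset)
  then have "(h has_integral integral (cbox (-c) c) h) (cbox (-c) c)" by (rule integrable_integral)
  then have U: "(h has_integral integral (cbox (-c) c) h) UNIV"
   by (rule has_integral_on_superset) (use R sub[of _ 0] in force)+
  then have i: "integral UNIV h = integral (cbox (-c) c) h" by (rule integral_unique)
  have "h integrable_on cbox (-c + s *\<^sub>R e) (c + s *\<^sub>R e)"
   using cont(2) by (intro integrable_continuous) (auto intro: continuous_on_subset)
  then have I: "(h has_integral integral (cbox (-c + s *\<^sub>R e) (c + s *\<^sub>R e)) h) (cbox (-c + s *\<^sub>R e) (c + s *\<^sub>R e))"
   by (rule integrable_integral)
  moreover have "(h has_integral integral (cbox (-c + s *\<^sub>R e) (c + s *\<^sub>R e)) h) UNIV"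
  proof (rule has_integral_on_superset[OF I])
   fix x assume x: "x \<notin> cbox (-c + s *\<^sub>R e) (c + s *\<^sub>R e)"
   show "h x = 0"
   proof (rule ccontr)
    assume "h x ~= 0"
    then have "x - s *\<^sub>R e : cbox (-c) c" using sub[of x "-s"] R s by simp
    then show False using x by (auto simp: mem_box inner_diff_left inner_add_left algebra_simps)
   qed
  qed simp
  ultimately have "(h has_integral integral UNIV h) (cbox (-c + s *\<^sub>R e) (c + s *\<^sub>R e))"
   using integral_unique by metis
  then have "((h \<circ> ((+) (s *\<^sub>R e))) has_integral integral UNIV h) (cbox (-c) c)"
   by (simp only: has_integral_shift_cbox_iff)
  then show ?thesis by (simp add: o_def add.commute)
 qed
 let ?fx = "%s x. dd e h (x + s *\<^sub>R e)"
 have A: "((%s. integral (cbox (-c) c) (%x. h (x + s *\<^sub>R e))) has_vector_derivative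
   integral (cbox (-c) c) (?fx 0)) (at 0 within {-1<..<1})"
 proof (rule leibniz_rule_vector_derivative)
  fix s :: real and x assume "s : {-1<..<1}" "x : cbox (-c) c"
  show "((%s. h (x + s *\<^sub>R e)) has_vector_derivative ?fx s x) (at s within {-1<..<1})"
   using has_field_derivative_line[OF diff] has_real_derivative_iff_has_vector_derivative has_field_derivative_at_within by blast
 next
  fix s :: real assume "s : {-1<..<1}"
  then show "(%x. h (x + s *\<^sub>R e)) integrable_on cbox (-c) c"
   using has_integral_integrable[OF int[of s]] by auto
 next
  have "continuous_on ({-1<..<1} \<times> cbox (-c) c) (%w. dd e h (snd w + fst w *\<^sub>R e))"
   by (rule continuous_on_compose2[OF cont(1)]) (auto intro!: continuous_intros)
  then show "continuous_on ({-1<..<1} \<times> cbox (-c) c) (%(s, x). ?fx s x)" by (simp add: case_prod_beta')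
 qed auto
 have B: "integral UNIV h = integral (cbox (-c) c) (%x. h (x + s *\<^sub>R e))" if "s : {-1<..<1}" for s
  using integral_unique[OF int[of s]] that by auto
 have "((%s. integral UNIV h) has_vector_derivative integral (cbox (-c) c) (?fx 0)) (at 0 within {-1<..<1})"
  by (rule has_vector_derivative_transform[OF _ B A]) auto
 then have "((%s. integral UNIV h) has_vector_derivative integral (cbox (-c) c) (?fx 0)) (at (0::real))"
  by (subst (asm) at_within_open) auto
 then have z: "integral (cbox (-c) c) (dd e h) = 0"
  using vector_derivative_unique_at[of "%s. integral UNIV h" _ 0 0] by (auto intro: has_vector_derivative_const)
 have "dd e h integrable_on cbox (-c) c" using cont(1) by (intro integrable_continuous) (auto intro: continuous_on_subset)
 then have "(dd e h has_integral 0) (cbox (-c) c)" using integrable_integral z by metis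
 then show ?thesis
 proof (rule has_integral_on_superset)
  fix x assume x: "x \<notin> cbox (-c) c"
  have "dd e h x = dd e (%x. 0::real) x"
   by (rule dd_cong_open[of "- cbox (-c) c"]) (use x R sub[of _ 0] in \<open>auto simp: open_Compl\<close>)
  then show "dd e h x = 0" by simp
 qed simp
qed

lemma cutoff_Ck: "cutoff d0 \<eta> ==> Ck_on k UNIV \<eta>"
 by (simp add: cutoff_def smooth_on_Ck)

lemma cutoff_DERIV:
 assumes "cutoff d0 \<eta>"
 shows "(\<eta> has_field_derivative dd 1 \<eta> s) (at s)"
proof -
 have "\<eta> differentiable at s" using cutoff_Ck[OF assms, of 1] by (simp add: Ck_on_Suc)
 then show ?thesis using has_field_derivative_line[of \<eta> 0 s 1] by simp
qed

lemma cutoff_deriv_zero: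
 assumes "cutoff d0 \<eta>" "s < d0 / 4 \<or> s > d0 / 2"
 shows "dd 1 \<eta> s = 0"
proof -
 have "dd 1 \<eta> s = dd 1 (%_. if s < d0/4 then 1 else 0::real) s"
  by (rule dd_cong_open[of "if s < d0/4 then {..<d0/4} else {d0/2<..}"])
   (use assms in \<open>auto simp: cutoff_def split: if_splits\<close>)
 then show ?thesis by simp
qed

lemma cutoff_deriv_bound:
 assumes "cutoff d0 \<eta>"
 obtains c where "c > 0" "!!s. \<bar>dd 1 \<eta> s\<bar> <= c"
proof -
 have "continuous_on {d0/4..d0/2} (dd 1 \<eta>)"
  using cutoff_Ck[OF assms, of 1] by (auto simp: Ck_on_Suc intro: continuous_on_subset)
 then have "compact (dd 1 \<eta> ` {d0/4..d0/2})" by (intro compact_continuous_image compact_Icc)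
 then obtain c where c: "c > 0" "!!s. s : {d0/4..d0/2} ==> norm (dd 1 \<eta> s) <= c"
  using compact_imp_bounded bounded_pos by (metis image_eqI)
 have "\<bar>dd 1 \<eta> s\<bar> <= c" for s
  using c cutoff_deriv_zero[OF assms, of s] by (cases "s : {d0/4..d0/2}") auto
 then show ?thesis using c(1) that by blast
qed

lemma absolutely_integrable_on_open:
 fixes f :: "'a::euclidean_space => real"
 assumes "open S" "bounded S" "continuous_on S f" "!!x. x : S ==> \<bar>f x\<bar> <= C"
 shows "f absolutely_integrable_on S"
proof (rule measurable_bounded_by_integrable_imp_absolutely_integrable)
 show "S : sets lebesgue" using assms(1) by auto
 then show "f : borel_measurable (lebesgue_on S)"
  using continuous_imp_measurable_on_sets_lebesgue assms(3) by blast
 have "S : lmeasurable" using lmeasurable_open assms by blast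
 then show "(%x. C) integrable_on S" by (simp add: integrable_on_const)
qed (use assms in auto)

context mhd_flow
begin

text \<open>The given cutoff is reused: its transition layer from \<open>d0/4\<close> to
  \<open>d0/2\<close> is rescaled to the layer from \<open>ep\<close> to \<open>2 ep\<close>, and
  the complement is taken, so that \<open>chi\<close> vanishes next to the boundary.\<close>

definition chi :: "real => real => real" where "chi ep s = 1 - \<eta> (d0 * s / (4 * ep))"
definition chi1 :: "real => real => real" where "chi1 ep s = - (d0 / (4 * ep)) * dd 1 \<eta> (d0 * s / (4 * ep))"

lemma chi_small: "ep > 0 ==> s < ep ==> chi ep s = 0"
 and chi_large: "ep > 0 ==> s > 2 * ep ==> chi ep s = 1"
 and chi1_zero: "ep > 0 ==> s < ep \<or> s > 2 * ep ==> chi1 ep s = 0"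
proof -
 have *: "d0 * s / (4 * ep) < d0 / 4 \<longleftrightarrow> s < ep" "d0 * s / (4 * ep) > d0 / 2 \<longleftrightarrow> s > 2 * ep"
  if "ep > 0" using that d0 by (simp_all add: field_simps)
 show "ep > 0 ==> s < ep ==> chi ep s = 0" "ep > 0 ==> s > 2 * ep ==> chi ep s = 1"
  "ep > 0 ==> s < ep \<or> s > 2 * ep ==> chi1 ep s = 0"
  using cutoff_\<eta> cutoff_deriv_zero[OF cutoff_\<eta>, of "d0 * s / (4 * ep)"] *
  by (auto simp: chi_def chi1_def cutoff_def)
qed

lemma chi_range: "0 <= chi ep s & chi ep s <= 1"
 using cutoff_\<eta> by (auto simp: chi_def cutoff_def)

lemma chi_DERIV: "(chi ep has_field_derivative chi1 ep s) (at s)"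
proof -
 have 1: "((%s. d0 * s / (4 * ep)) has_field_derivative d0 / (4 * ep)) (at s)"
  using DERIV_cmult[OF DERIV_ident, of "d0 / (4 * ep)" s] by simp
 have "((%s. 1 - \<eta> (d0 * s / (4 * ep))) has_field_derivative 0 - dd 1 \<eta> (d0 * s / (4 * ep)) * (d0 / (4 * ep))) (at s)"
  by (rule DERIV_diff[OF DERIV_const DERIV_chain2[OF cutoff_DERIV[OF cutoff_\<eta>] 1]])
 then show ?thesis by (simp add: chi_def[abs_def] chi1_def mult.commute)
qed

lemma Ck_chi: "Ck_on k UNIV (chi ep)"
proof -
 have "Ck_on k UNIV (%s. \<eta> ((d0 / (4 * ep)) * s))"
  using Ck_on_compose[OF open_UNIV Ck_on_mult[OF open_UNIV Ck_on_const Ck_on_ident] cutoff_Ck[OF cutoff_\<eta>]]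
  by blast
 then have "Ck_on k UNIV (%s. 1 - \<eta> ((d0 / (4 * ep)) * s))"
  by (rule Ck_on_diff_fun[OF open_UNIV Ck_on_const])
 then show ?thesis by (simp add: chi_def[abs_def])
qed

text \<open>The derivative is of size \<open>1 / ep\<close>, but it lives where
  \<open>s <= 2 * ep\<close>; the product with \<open>s\<close> is scale invariant. A flux that is
  \<open>O(bd)\<close> therefore leaves a bounded error.\<close>

lemma chi1_bound: obtains c where "c > 0" "!!ep s. ep > 0 ==> s > 0 ==> \<bar>chi1 ep s\<bar> * s <= c"
proof -
 obtain c where c: "c > 0" "!!s. \<bar>dd 1 \<eta> s\<bar> <= c" using cutoff_deriv_bound[OF cutoff_\<eta>] by blast
 have "\<bar>chi1 ep s\<bar> * s <= d0 * c / 2" if e: "ep > 0" "s > 0" for ep s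
 proof (cases "s > 2 * ep")
  case True
  then show ?thesis using chi1_zero[of ep s] e c d0 by simp
 next
  case False
  have "\<bar>chi1 ep s\<bar> = (d0 / (4 * ep)) * \<bar>dd 1 \<eta> (d0 * s / (4 * ep))\<bar>"
   using e d0 by (simp add: chi1_def abs_mult)
  also have "... <= (d0 / (4 * ep)) * c" using e d0 c by (intro mult_left_mono) auto
  finally have "\<bar>chi1 ep s\<bar> * s <= (d0 / (4 * ep)) * c * (2 * ep)"
   using False e d0 c by (intro mult_mono) auto
  then show ?thesis using e by (simp add: mult.commute)
 qed
 moreover have "d0 * c / 2 > 0" using d0 c by simp
 ultimately show ?thesis using that by blast
qed

text \<open>Beyond the strip the distance may fail to be differentiable; there
  \<open>g (bd z)\<close> is constant.\<close>

lemma Ck_bd_compose: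
 assumes "Ck_on k UNIV g" "!!s. s > c ==> g s = e" "c < d0" "k <= 2"
 shows "Ck_on k G (%z. g (bd z) :: real)"
proof (rule Ck_on_UN[of "UNIV :: bool set" "%b. if b then strip else {z\<in>G. c < bd z}"])
 fix b :: bool
 have "Ck_on k strip (%z. g (bd z))"
  by (rule Ck_on_compose[OF open_strip Ck_on_le[OF Ck2_bd assms(4)] assms(1)]) auto
 moreover have "Ck_on k {z\<in>G. c < bd z} (%z. g (bd z))"
  by (rule Ck_on_cong[OF open_superlevel _ Ck_on_const[of k _ e]]) (simp add: assms(2))
 ultimately show "open (if b then strip else {z\<in>G. c < bd z}) & Ck_on k (if b then strip else {z\<in>G. c < bd z}) (%z. g (bd z))"
  using open_strip open_superlevel by auto
next
 show "G \<subseteq> (\<Union>b\<in>UNIV. if b then strip else {z\<in>G. c < bd z})"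
  using assms(3) by (auto simp: strip_def)
qed

definition cut :: "real => (real \<times> (real^'n) => real) => real \<times> (real^'n) => real" where
 "cut ep F z = (if z : D then chi ep (bd z) * F z else 0)"

abbreviation slab :: "(real \<times> (real^'n)) set" where "slab \<equiv> {0<..<T} \<times> UNIV"

lemma open_slab: "open slab" by (simp add: open_Times)

lemma Ck_cut:
 assumes F: "Ck_on k G F" and "k <= 2" "0 < ep" "2 * ep < d0"
 shows "Ck_on k slab (cut ep F)"
proof (rule Ck_on_local)
 fix z :: "real \<times> (real^'n)" assume z: "z : slab"
 show "\<exists>U. open U & z : U & Ck_on k U (cut ep F)"
 proof (cases "z : D")
  case True
  have "Ck_on k G (%z. chi ep (bd z) * F z)"
   by (intro Ck_on_mult open_G F Ck_bd_compose[of _ _ "2 * ep" 1] Ck_chi) (use assms chi_large in auto)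
  then have "Ck_on k G (cut ep F)"
   by (rule Ck_on_cong[OF open_G, rotated]) (simp add: cut_def G_D)
  then show ?thesis using z True open_G by (intro exI[of _ G]) (auto simp: G_def)
 next
  case False
  obtain t x where zz: "z = (t, x)" by (cases z)
  obtain U where U: "open U" "(t, x) : U" "!!z. z : U ==> z : D ==> bd z < ep"
   using bd_small_near_boundary[of t x ep] False z assms by (auto simp: zz)
  have "Ck_on k U (cut ep F)"
   by (rule Ck_on_cong[OF U(1) _ Ck_on_const[of k U 0]]) (use U chi_small assms in \<open>auto simp: cut_def\<close>)
  then show ?thesis using U zz by blast
 qed
qed

text \<open>The closed time interval matters: initial and final values of the transported integrals
  are reached by continuity. At the end times \<open>D\<close> is only relatively open, so the two
  pieces are shown to be relatively open in the slab.\<close>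

lemma continuous_on_cut:
 assumes F: "continuous_on D F" and "0 < ep"
 shows "continuous_on ({0..T} \<times> UNIV) (cut ep F)"
proof -
 define S where "S = {0..T} \<times> (UNIV :: (real^'n) set)"
 define E where "E = S - {z\<in>D. ep <= bd z}"
 have SU: "D \<union> E = S" using openin_imp_subset[OF openin_D] by (auto simp: E_def S_def)
 have "openin (top_of_set S) E"
  unfolding openin_subopen[of _ E]
 proof
  fix z assume z: "z : E"
  show "\<exists>T. openin (top_of_set S) T & z : T & T \<subseteq> E"
  proof (cases "z : D")
   case True
   have "openin (top_of_set D) (D \<inter> bd -` {..<ep})"
    using continuous_on_bd by (simp add: continuous_openin_preimage_gen)
   then have "openin (top_of_set S) (D \<inter> bd -` {..<ep})" using openin_D openin_trans S_def by blast
   then show ?thesis using z True openin_imp_subset[OF openin_D]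
    by (intro exI[of _ "D \<inter> bd -` {..<ep}"]) (auto simp: E_def S_def)
  next
   case False
   obtain t x where zz: "z = (t, x)" by (cases z)
   obtain U where U: "open U" "(t, x) : U" "!!z. z : U ==> z : D ==> bd z < ep"
    using bd_small_near_boundary[of t x ep] False z assms by (auto simp: zz E_def S_def)
   then show ?thesis using z by (intro exI[of _ "S \<inter> U"]) (force simp: zz E_def)
  qed
 qed
 moreover have "continuous_on D (%z. chi ep (bd z) * F z)"
  by (intro continuous_on_mult F continuous_on_compose2[OF Ck_on_cont[OF Ck_chi[of 0]] continuous_on_bd]) auto
 ultimately have "continuous_on (D \<union> E) (%z. if z : D then chi ep (bd z) * F z else 0)"
  using openin_D SU unfolding S_def
  by (intro continuous_on_cases_local_open) (auto simp: E_def chi_small assms)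
 then show ?thesis by (simp add: cut_def[abs_def] SU S_def)
qed

lemma dd_cut:
 assumes z: "z : G" and F: "Ck_on 1 G F" and e: "0 < ep" "2 * ep < d0"
 shows "dd h (cut ep F) z = chi ep (bd z) * dd h F z + chi1 ep (bd z) * (dd h bd z * F z)"
proof -
 have dF: "F differentiable at z" using F z by (simp add: Ck_on_Suc)
 have "dd h (cut ep F) z = dd h (%z. chi ep (bd z) * F z) z"
  by (rule dd_cong_open[OF open_G z]) (simp add: cut_def G_D)
 also have "... = chi ep (bd z) * dd h F z + chi1 ep (bd z) * (dd h bd z * F z)"
 proof (cases "bd z < d0")
  case True
  then have zs: "z : strip" using z by (simp add: strip_def)
  have "(%z. chi ep (bd z)) differentiable at z"
   using differentiable_compose[OF _ diff_strip(1)[OF zs]] chi_DERIV field_differentiable_def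
    field_differentiable_imp_differentiable by blast
  then show ?thesis using dd_mult[OF _ dF] dd_real_compose[OF diff_strip(1)[OF zs] chi_DERIV] by simp
 next
  case False
  have "dd h (%z. chi ep (bd z) * F z) z = dd h F z"
   by (rule dd_cong_open[OF open_superlevel[of "2 * ep"]]) (use z False e chi_large in auto)
  then show ?thesis using False e chi_large[of ep "bd z"] chi1_zero[of ep "bd z"] by simp
 qed
 finally show ?thesis .
qed

lemma cut_outside: "z \<notin> D ==> cut ep F z = 0" by (simp add: cut_def)

lemma dd_cut_outside:
 assumes "z : slab" "z \<notin> D" "0 < ep"
 shows "dd h (cut ep F) z = 0"
proof -
 obtain t x where zz: "z = (t, x)" by (cases z)
 obtain U where U: "open U" "(t, x) : U" "!!z. z : U ==> z : D ==> bd z < ep"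
  using bd_small_near_boundary[of t x ep] assms by (auto simp: zz)
 have "dd h (cut ep F) z = dd h (%z. 0::real) z"
  by (rule dd_cong_open[OF U(1)]) (use U chi_small assms zz in \<open>auto simp: cut_def\<close>)
 then show ?thesis by simp
qed

lemma slice_norm_bound: obtains R where "R > 0" "!!z. z : closure D ==> norm (snd z) <= R"
proof -
 have "bounded (snd ` closure D)" using bounded_snd[OF bounded_closure[OF bounded_D]] .
 then show ?thesis using that bounded_pos by (metis image_eqI)
qed

lemma slice_G: "0 < t ==> t < T ==> x : slice D t \<longleftrightarrow> (t, x) : G"
 by (simp add: G_def)

lemma continuous_slice:
 assumes "continuous_on G F" "t : {0<..<T}"
 shows "continuous_on (slice D t) (%x. F (t, x))"
 by (rule continuous_on_compose2[OF assms(1)]) (use assms(2) slice_G in \<open>auto intro!: continuous_intros\<close>)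

lemma integrable_slice:
 fixes F :: "real \<times> (real^'n) => real"
 assumes "continuous_on G F" "!!z. z : G ==> \<bar>F z\<bar> <= C" "t : {0<..<T}"
 shows "(%x. F (t, x)) absolutely_integrable_on slice D t"
 by (rule absolutely_integrable_on_open[OF open_slice bounded_slice continuous_slice[OF assms(1,3)], of C])
  (use assms slice_G in auto)

lemma integral_px_cut:
 assumes t: "t : {0<..<T}" and F: "Ck_on 1 G F" and e: "0 < ep" "2 * ep < d0"
 shows "((%x. px k (cut ep F) (t, x)) has_integral 0) (slice D t)"
proof -
 have C: "Ck_on 1 slab (cut ep F)" by (rule Ck_cut[OF F _ e]) simp
 obtain R where R: "R > 0" "!!z. z : closure D ==> norm (snd z) <= R" using slice_norm_bound by blast
 define h where "h x = cut ep F (t, x)" for x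
 have "{y. (t, y) : slab} = UNIV" using t by auto
 then have "Ck_on 1 UNIV h" using Ck_on_slice[OF open_slab C, of t] unfolding h_def by simp
 moreover have "norm x <= R" if "h x ~= 0" for x
  using that cut_outside[of "(t, x)" ep F] R(2)[of "(t, x)"] closure_subset[of D] by (auto simp: h_def)
 ultimately have "(dd (axis k 1) h has_integral 0) UNIV"
  using has_integral_dd_zero[of h R "axis k (1::real)"] by (simp add: norm_axis_1)
 moreover have "dd (axis k 1) h x = (if x : slice D t then px k (cut ep F) (t, x) else 0)" for x
 proof -
  have "cut ep F differentiable at (t, x)" using Ck1_differentiable[OF C] t by auto
  then have "dd (axis k 1) h x = px k (cut ep F) (t, x)" unfolding h_def by (rule dd_slice)
  then show ?thesis using dd_cut_outside[of "(t, x)" ep] e t by auto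
 qed
 ultimately have "((%x. if x : slice D t then px k (cut ep F) (t, x) else 0) has_integral 0) UNIV"
  by (simp cong: has_integral_cong)
 then show ?thesis by (simp only: has_integral_restrict_UNIV)
qed

text \<open>The offset 3 ensures \<open>2 * eps n < d0\<close> already for
  \<open>n = 0\<close>.\<close>

definition eps :: "nat => real" where "eps n = d0 / (real n + 3)"

lemma eps: "0 < eps n" "2 * eps n < d0" "eps \<longlonglongrightarrow> 0"
proof -
 show "0 < eps n" "2 * eps n < d0" using d0 by (auto simp: eps_def field_simps add_pos_nonneg)
 show "eps \<longlonglongrightarrow> 0" using LIMSEQ_ignore_initial_segment[OF lim_const_over_n[of d0], of 3] by (simp add: eps_def[abs_def])
qed

lemma eventually_eps:
 assumes "s > 0"
 shows "\<forall>\<^sub>F n in sequentially. 2 * eps n < s"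
proof -
 have "(%n. 2 * eps n) \<longlonglongrightarrow> 2 * 0" by (intro tendsto_intros eps)
 then show ?thesis using order_tendstoD(2)[of _ "2 * 0" sequentially s] assms by simp
qed

text \<open>The error produced by the cutoff is bounded because the flux vanishes to first order at the
 boundary, and it lives on a layer whose volume tends to zero.\<close>

lemma cut_error_bound:
 assumes C0: "ALL z:G. \<bar>g z\<bar> <= C" and tan0: "ALL z:G. bd z < dl --> \<bar>w z\<bar> <= C * bd z"
  and "dl > 0"
 shows "\<exists>C' N. (\<forall>n z. z : G & n \<ge> N --> \<bar>chi (eps n) (bd z) * g z + chi1 (eps n) (bd z) * w z\<bar> <= C') &
  (\<forall>z. z : G --> (%n. chi (eps n) (bd z) * g z + chi1 (eps n) (bd z) * w z) \<longlonglongrightarrow> g z)"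
proof -
 have C: "!!z. z : G ==> \<bar>g z\<bar> <= C" and tan: "!!z. z : G ==> bd z < dl ==> \<bar>w z\<bar> <= C * bd z"
  using C0 tan0 by auto
 obtain c where c: "c > 0" "!!ep s. ep > 0 ==> s > 0 ==> \<bar>chi1 ep s\<bar> * s <= c" using chi1_bound by blast
 obtain N where N: "!!n. n \<ge> N ==> 2 * eps n < dl"
  using eventually_eps[OF assms(3)] by (auto simp: eventually_sequentially)
 show ?thesis
 proof (rule exI[of _ "C + C * c"], rule exI[of _ N], intro conjI allI impI)
  fix n z assume "z : G & n \<ge> N"
  then have z: "z : G" and n: "n \<ge> N" by auto
  have bp: "bd z > 0" using bd_pos G_D z by blast
  have C0: "C \<ge> 0" using C[OF z] by linarith
  have "\<bar>chi (eps n) (bd z) * g z\<bar> <= 1 * C"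
   unfolding abs_mult using chi_range[of "eps n" "bd z"] C[OF z] by (intro mult_mono) auto
  moreover have "\<bar>chi1 (eps n) (bd z) * w z\<bar> <= C * c"
  proof (cases "bd z < dl")
   case True
   have "\<bar>chi1 (eps n) (bd z) * w z\<bar> <= \<bar>chi1 (eps n) (bd z)\<bar> * (C * bd z)"
    unfolding abs_mult using tan[OF z True] by (intro mult_left_mono) auto
   also have "... = C * (\<bar>chi1 (eps n) (bd z)\<bar> * bd z)" by simp
   also have "... <= C * c" using c(2)[OF eps(1) bp] C0 by (rule mult_left_mono)
   finally show ?thesis .
  next
   case False
   then have "chi1 (eps n) (bd z) = 0" using chi1_zero[OF eps(1)] N[OF n] by simp
   then show ?thesis using C0 c(1) by simp
  qed
  ultimately show "\<bar>chi (eps n) (bd z) * g z + chi1 (eps n) (bd z) * w z\<bar> <= C + C * c" by linarith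
 next
  fix z assume z: "z : G"
  have "\<forall>\<^sub>F n in sequentially. chi (eps n) (bd z) * g z + chi1 (eps n) (bd z) * w z = g z"
   using eventually_eps[OF bd_pos[OF G_D[OF z]]]
   by eventually_elim (simp add: chi_large[OF eps(1)] chi1_zero[OF eps(1)])
  then show "(%n. chi (eps n) (bd z) * g z + chi1 (eps n) (bd z) * w z) \<longlonglongrightarrow> g z"
   by (rule tendsto_eventually)
 qed
qed

lemma integral_slice_limit:
 fixes F :: "nat => real \<times> (real^'n) => real"
 assumes t: "t : {0<..<T}"
  and F: "!!n. continuous_on G (F n)" and C: "!!n z. z : G ==> n \<ge> N ==> \<bar>F n z\<bar> <= C"
  and lim: "!!z. z : G ==> (%n. F n z) \<longlonglongrightarrow> g z"
 shows "(%n. integral (slice D t) (%x. F n (t, x))) \<longlonglongrightarrow> integral (slice D t) (%x. g (t, x))"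
proof -
 have "(%n. integral (slice D t) (%x. F (n + N) (t, x))) \<longlonglongrightarrow> integral (slice D t) (%x. g (t, x))"
 proof (rule dominated_convergence(2))
  show "(%x. F (n + N) (t, x)) integrable_on slice D t" for n
   using integrable_slice[OF F _ t, of "n + N" C] C set_lebesgue_integral_eq_integral(1) by fastforce
  show "(%x. C) integrable_on slice D t"
   using lmeasurable_open[OF bounded_slice open_slice] by (simp add: integrable_on_const)
  show "norm (F (n + N) (t, x)) <= C" if "x : slice D t" for n x using C that t slice_G by auto
  show "(%n. F (n + N) (t, x)) \<longlonglongrightarrow> g (t, x)" if "x : slice D t" for x
   using LIMSEQ_ignore_initial_segment[OF lim] that t slice_G by auto
 qed
 then show ?thesis by (rule LIMSEQ_offset)
qed

lemma continuous_dd_cut: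
 assumes "Ck_on 1 G F" "0 < ep" "2 * ep < d0"
 shows "continuous_on G (dd h (cut ep F))"
proof -
 have "continuous_on slab (dd h (cut ep F))"
  by (rule Ck1_continuous_dd[OF Ck_cut]) (use assms in auto)
 moreover have "G \<subseteq> slab" by (force simp: G_def)
 ultimately show ?thesis using continuous_on_subset by blast
qed

text \<open>The bound \<open>C * bd z\<close> on the normal component plays the role of a vanishing
  boundary integral. With the fields cut off the integral is exactly zero, and dominated convergence
  removes the cutoff.\<close>

theorem divergence_slice:
 assumes t: "t : {0<..<T}" and X: "!!k. Ck_on 1 G (X k)"
  and C: "!!z. z : G ==> \<bar>SUMU k. px k (X k) z\<bar> <= C"
  and tan: "!!z. z : G ==> bd z < dl ==> \<bar>SUMU k. px k bd z * X k z\<bar> <= C * bd z" and "dl > 0"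
 shows "integral (slice D t) (%x. SUMU k. px k (X k) (t, x)) = 0"
proof -
 define g where "g z = (SUMU k. px k (X k) z)" for z
 define w where "w z = (SUMU k. px k bd z * X k z)" for z
 have Cg: "ALL z:G. \<bar>g z\<bar> <= C" and tw: "ALL z:G. bd z < dl --> \<bar>w z\<bar> <= C * bd z"
  using C tan by (simp_all add: g_def w_def)
 define F where "F n z = (SUMU k. px k (cut (eps n) (X k)) z)" for n z
 have Fe: "F n z = chi (eps n) (bd z) * g z + chi1 (eps n) (bd z) * w z" if "z : G" for n z
  using dd_cut[OF that X eps(1,2)] by (simp add: F_def g_def w_def sum.distrib sum_distrib_left)
 obtain C' N where C'0: "\<forall>n z. z : G & n \<ge> N --> \<bar>chi (eps n) (bd z) * g z + chi1 (eps n) (bd z) * w z\<bar> <= C'"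
  "\<forall>z. z : G --> (%n. chi (eps n) (bd z) * g z + chi1 (eps n) (bd z) * w z) \<longlonglongrightarrow> g z"
  using cut_error_bound[of g C dl w, OF Cg tw assms(5)] by (elim exE conjE) (rule that)
 note C' = C'0(1)[rule_format, OF conjI] C'0(2)[rule_format]
 have "(%n. integral (slice D t) (%x. F n (t, x))) \<longlonglongrightarrow> integral (slice D t) (%x. g (t, x))"
 proof (rule integral_slice_limit[OF t])
  show "continuous_on G (F n)" for n unfolding F_def
   by (intro continuous_on_sum continuous_dd_cut X eps)
 qed (use C' Fe in auto)
 moreover have "integral (slice D t) (%x. F n (t, x)) = 0" for n
 proof -
  have "((%x. SUMU k. px k (cut (eps n) (X k)) (t, x)) has_integral (\<Sum>k::'n\<in>UNIV. 0)) (slice D t)"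
   by (intro has_integral_sum integral_px_cut t X eps) auto
  then show ?thesis unfolding F_def by (simp add: integral_unique)
 qed
 ultimately show ?thesis by (simp add: LIMSEQ_const_iff g_def)
qed

text \<open>Reynolds' transport theorem for a space-time flux \<open>(f, X)\<close> that is
  tangential to the moving boundary to first order, which is why the time derivative of
  \<open>bd\<close> occurs in the hypothesis. The conclusion is integrated in time: the limit of the
  cutoff is taken inside the time integral, where pointwise convergence and a common bound
  suffice.\<close>

theorem transport_slice:
 assumes f: "continuous_on D f" "Ck_on 1 G f" "!!z. z : D ==> \<bar>f z\<bar> <= Cf" and X: "!!k. Ck_on 1 G (X k)"
  and C: "!!z. z : G ==> \<bar>dd (1, 0) f z + (SUMU k. px k (X k) z)\<bar> <= C"
  and tan: "!!z. z : G ==> bd z < dl ==> \<bar>dd (1, 0) bd z * f z + (SUMU k. px k bd z * X k z)\<bar> <= C * bd z"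
  and "dl > 0" and t12: "0 <= t1" "t1 <= t2" "t2 <= T"
 shows "((%t. integral (slice D t) (%x. dd (1, 0) f (t, x) + (SUMU k. px k (X k) (t, x)))) has_integral
  (integral (slice D t2) (%x. f (t2, x)) - integral (slice D t1) (%x. f (t1, x)))) {t1..t2}"
proof -
 define g where "g z = dd (1, 0) f z + (SUMU k. px k (X k) z)" for z
 define w where "w z = dd (1, 0) bd z * f z + (SUMU k. px k bd z * X k z)" for z
 have Cg: "ALL z:G. \<bar>g z\<bar> <= C" and tw: "ALL z:G. bd z < dl --> \<bar>w z\<bar> <= C * bd z"
  using C tan by (simp_all add: g_def w_def)
 obtain R where R: "R > 0" "!!z. z : closure D ==> norm (snd z) <= R" using slice_norm_bound by blast
 define c where "c = R *\<^sub>R (One::real^'n)"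
 have sub: "x : cbox (-c) c" if "(t, x) : D" for t x
 proof -
  have "norm x <= R" using R(2)[of "(t, x)"] closure_subset[of D] that by auto
  then have "\<bar>x \<bullet> i\<bar> <= R" if "i : Basis" for i using Basis_le_norm[OF that, of x] by simp
  then show ?thesis by (simp add: mem_box c_def abs_le_iff) force
 qed
 have restrict: "integral (cbox (-c) c) h = integral (slice D t) h" if "!!x. (t, x) \<notin> D ==> h x = 0" for h :: "real^'n => real" and t
 proof -
  have "integral (cbox (-c) c) h = integral (cbox (-c) c) (%x. if x : slice D t then h x else 0)"
   using that by (intro integral_cong) auto
  also have "... = integral (slice D t \<inter> cbox (-c) c) h" by (rule Henstock_Kurzweil_Integration.integral_restrict_Int)
  also have "slice D t \<inter> cbox (-c) c = slice D t" using sub by auto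
  finally show ?thesis .
 qed
 define F where "F n z = dd (1, 0) (cut (eps n) f) z + (SUMU k. px k (cut (eps n) (X k)) z)" for n z
 define I where "I n t = integral (cbox (-c) c) (%x. cut (eps n) f (t, x))" for n t
 define J where "J n t = integral (slice D t) (%x. F n (t, x))" for n t
 define J0 where "J0 t = integral (slice D t) (%x. g (t, x))" for t
 have Fe: "F n z = chi (eps n) (bd z) * g z + chi1 (eps n) (bd z) * w z" if "z : G" for n z
  using dd_cut[OF that f(2) eps(1,2)] dd_cut[OF that X eps(1,2)]
  by (simp add: F_def g_def w_def sum.distrib sum_distrib_left algebra_simps)
 obtain C' N where C'0: "\<forall>n z. z : G & n \<ge> N --> \<bar>chi (eps n) (bd z) * g z + chi1 (eps n) (bd z) * w z\<bar> <= C'"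
  "\<forall>z. z : G --> (%n. chi (eps n) (bd z) * g z + chi1 (eps n) (bd z) * w z) \<longlonglongrightarrow> g z"
  using cut_error_bound[of g C dl w, OF Cg tw assms(7)] by (elim exE conjE) (rule that)
 note C' = C'0(1)[rule_format, OF conjI] C'0(2)[rule_format]
 have contF: "continuous_on G (F n)" for n unfolding F_def
  by (intro continuous_on_add continuous_on_sum continuous_dd_cut X f eps)
 have J_lim: "(%n. J n t) \<longlonglongrightarrow> J0 t" if "t : {0<..<T}" for t
  unfolding J_def J0_def by (rule integral_slice_limit[OF that contF]) (use C' Fe in auto)
 have I_lim: "(%n. I n t) \<longlonglongrightarrow> integral (slice D t) (%x. f (t, x))" if t: "t : {0..T}" for t
 proof -
  have "(%n. integral (slice D t) (%x. cut (eps n) f (t, x))) \<longlonglongrightarrow> integral (slice D t) (%x. f (t, x))"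
  proof (rule dominated_convergence(2))
   show "(%x. cut (eps n) f (t, x)) integrable_on slice D t" for n
   proof -
    have "continuous_on (slice D t) (%x. cut (eps n) f (t, x))"
     by (rule continuous_on_compose2[OF continuous_on_cut[OF f(1) eps(1)]]) (use t in \<open>auto intro!: continuous_intros\<close>)
    moreover have "\<bar>cut (eps n) f (t, x)\<bar> <= 1 * Cf" if "x : slice D t" for x
    proof -
     have "\<bar>cut (eps n) f (t, x)\<bar> = \<bar>chi (eps n) (bd (t, x))\<bar> * \<bar>f (t, x)\<bar>" using that by (simp add: cut_def abs_mult)
     also have "... <= 1 * Cf" using chi_range[of "eps n" "bd (t, x)"] f(3)[of "(t, x)"] that by (intro mult_mono) auto
     finally show ?thesis .
    qed
    ultimately show ?thesis
     using absolutely_integrable_on_open[OF open_slice bounded_slice] set_lebesgue_integral_eq_integral(1) by blast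
   qed
   show "(%x. Cf) integrable_on slice D t"
    using lmeasurable_open[OF bounded_slice open_slice] by (simp add: integrable_on_const)
   show "norm (cut (eps n) f (t, x)) <= Cf" if "x : slice D t" for n x
   proof -
    have "\<bar>cut (eps n) f (t, x)\<bar> = \<bar>chi (eps n) (bd (t, x))\<bar> * \<bar>f (t, x)\<bar>" using that by (simp add: cut_def abs_mult)
    also have "... <= 1 * Cf" using chi_range[of "eps n" "bd (t, x)"] f(3)[of "(t, x)"] that by (intro mult_mono) auto
    finally show ?thesis by simp
   qed
   show "(%n. cut (eps n) f (t, x)) \<longlonglongrightarrow> f (t, x)" if x: "x : slice D t" for x
   proof (rule tendsto_eventually)
    have "bd (t, x) > 0" using x bd_pos by simp
    from eventually_eps[OF this] show "\<forall>\<^sub>F n in sequentially. cut (eps n) f (t, x) = f (t, x)"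
     by eventually_elim (use x in \<open>simp add: cut_def chi_large[OF eps(1)]\<close>)
   qed
  qed
  moreover have "I n t = integral (slice D t) (%x. cut (eps n) f (t, x))" for n
   unfolding I_def by (rule restrict) (simp add: cut_outside)
  ultimately show ?thesis by simp
 qed
 have I_cont: "continuous_on {0..T} (I n)" for n
  unfolding I_def
 proof (rule integral_continuous_on_param)
  show "continuous_on ({0..T} \<times> cbox (-c) c) (%(t, x). cut (eps n) f (t, x))"
   using continuous_on_subset[OF continuous_on_cut[OF f(1) eps(1)], of "{0..T} \<times> cbox (-c) c" n]
   by (auto simp: case_prod_beta')
 qed
 have I_der: "(I n has_vector_derivative J n t) (at t)" if t: "t : {0<..<T}" for n t
 proof -
  have Cc: "Ck_on 1 slab (cut (eps n) f)" by (rule Ck_cut[OF f(2) _ eps(1,2)]) simp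
  have "(I n has_vector_derivative integral (cbox (-c) c) (%x. dd (1, 0) (cut (eps n) f) (t, x))) (at t within {0<..<T})"
   unfolding I_def
  proof (rule leibniz_rule_vector_derivative)
   fix s x assume s: "s : {0<..<T}"
   have "cut (eps n) f differentiable at (s, x)" using Ck1_differentiable[OF Cc] s by auto
   from slice_differentiable(2)[OF this]
   show "((%s. cut (eps n) f (s, x)) has_vector_derivative dd (1, 0) (cut (eps n) f) (s, x)) (at s within {0<..<T})"
    by (rule has_vector_derivative_at_within)
  next
   fix s assume s: "s : {0<..<T}"
   have "continuous_on (cbox (-c) c) (%x. cut (eps n) f (s, x))"
    by (rule continuous_on_compose2[OF Ck_on_cont[OF Cc]]) (use s in \<open>auto intro!: continuous_intros\<close>)
   then show "(%x. cut (eps n) f (s, x)) integrable_on cbox (-c) c" by (rule integrable_continuous)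
  next
   have "continuous_on slab (dd (1, 0) (cut (eps n) f))" using Cc by (rule Ck1_continuous_dd)
   then show "continuous_on ({0<..<T} \<times> cbox (-c) c) (%(t, x). dd (1, 0) (cut (eps n) f) (t, x))"
    using continuous_on_subset[of slab "dd (1, 0) (cut (eps n) f)" "{0<..<T} \<times> cbox (-c) c"]
    by (auto simp: case_prod_beta')
  qed (use t in auto)
  then have 1: "(I n has_vector_derivative integral (cbox (-c) c) (%x. dd (1, 0) (cut (eps n) f) (t, x))) (at t)"
   by (subst (asm) at_within_open) (use t in auto)
  have 2: "integral (cbox (-c) c) (%x. dd (1, 0) (cut (eps n) f) (t, x)) =
    integral (slice D t) (%x. dd (1, 0) (cut (eps n) f) (t, x))"
   by (rule restrict) (use t eps(1) dd_cut_outside in auto)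
  have 3: "((%x. SUMU k. px k (cut (eps n) (X k)) (t, x)) has_integral (\<Sum>k::'n\<in>UNIV. 0)) (slice D t)"
   by (intro has_integral_sum integral_px_cut t X eps) auto
  have "(%x. dd (1, 0) (cut (eps n) f) (t, x)) integrable_on cbox (-c) c"
  proof (rule integrable_continuous)
   have "continuous_on slab (dd (1, 0) (cut (eps n) f))" using Cc by (rule Ck1_continuous_dd)
   then show "continuous_on (cbox (-c) c) (%x. dd (1, 0) (cut (eps n) f) (t, x))"
    by (rule continuous_on_compose2) (use t in \<open>auto intro!: continuous_intros\<close>)
  qed
  then have "(%x. if x : slice D t then dd (1, 0) (cut (eps n) f) (t, x) else 0) integrable_on cbox (-c) c"
   by (rule integrable_eq) (use t eps(1) dd_cut_outside in auto)
  then have "(%x. dd (1, 0) (cut (eps n) f) (t, x)) integrable_on (slice D t \<inter> cbox (-c) c)"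
   by (simp only: Henstock_Kurzweil_Integration.integrable_restrict_Int)
  moreover have "slice D t \<inter> cbox (-c) c = slice D t" using sub by auto
  ultimately have "(%x. dd (1, 0) (cut (eps n) f) (t, x)) integrable_on slice D t" by simp
  from has_integral_add[OF integrable_integral[OF this] 3]
  have "J n t = integral (slice D t) (%x. dd (1, 0) (cut (eps n) f) (t, x))"
   unfolding J_def F_def by (simp add: integral_unique)
  then show ?thesis using 1 2 by simp
 qed
 \<comment> \<open>The derivative of \<open>I n\<close> is known at interior times only; continuity
   covers the end points.\<close>
 have FTC: "(J n has_integral (I n t2 - I n t1)) {t1..t2}" for n
  by (rule fundamental_theorem_of_calculus_interior[OF t12(2) continuous_on_subset[OF I_cont]])
   (use t12 I_der in auto)
 then have FTCo: "(J n has_integral (I n t2 - I n t1)) {t1<..<t2}" for n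
  using has_integral_open_interval[of "J n" _ t1 t2] by simp
 define Vb where "Vb = \<bar>C'\<bar> * measure lebesgue (cbox (-c) c)"
 have J_bound: "\<bar>J n t\<bar> <= Vb" if "t : {0<..<T}" "n \<ge> N" for n t
 proof -
  have m: "slice D t : lmeasurable" using lmeasurable_open[OF bounded_slice open_slice] .
  have "norm (J n t) <= integral (slice D t) (%x. \<bar>C'\<bar>)"
   unfolding J_def
  proof (rule integral_norm_bound_integral)
   show "(%x. F n (t, x)) integrable_on slice D t"
    using integrable_slice[OF contF _ that(1), of n C'] C' Fe that(2) set_lebesgue_integral_eq_integral(1) by fastforce
   show "(%x. \<bar>C'\<bar>) integrable_on slice D t" using m by (simp add: integrable_on_const)
   show "norm (F n (t, x)) <= \<bar>C'\<bar>" if x: "x : slice D t" for x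
   proof -
    have "(t, x) : G" using x \<open>t : {0<..<T}\<close> by (simp add: G_def)
    then show ?thesis using C'(1)[of "(t, x)" n] Fe[of "(t, x)" n] \<open>n \<ge> N\<close> by simp
   qed
  qed
  also have "... = \<bar>C'\<bar> * measure lebesgue (slice D t)" using m by (simp add: lmeasure_integral integral_mult_right[symmetric, of "\<bar>C'\<bar>" _ "%x. 1", simplified])
  also have "... <= Vb" unfolding Vb_def using sub m by (intro mult_left_mono measure_mono_fmeasurable) auto
  finally show ?thesis by simp
 qed
 have i01: "{t1<..<t2} \<subseteq> {0<..<T}" using t12 by auto
 have conv: "J0 integrable_on {t1<..<t2}" "(%n. integral {t1<..<t2} (J (n + N))) \<longlonglongrightarrow> integral {t1<..<t2} J0"
 proof -
  have A: "J (n + N) integrable_on {t1<..<t2}" for n using FTCo by (rule has_integral_integrable)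
  have "{t1<..<t2} : lmeasurable" by (intro lmeasurable_open) (auto intro: bounded_subset[OF bounded_closed_interval[of t1 t2]])
  then have V: "(%t. Vb) integrable_on {t1<..<t2}" by (rule integrable_on_const)
  have N: "norm (J (n + N) t) <= Vb" if "t : {t1<..<t2}" for n t
   using J_bound[of t "n + N"] that i01 by auto
  have L: "(%n. J (n + N) t) \<longlonglongrightarrow> J0 t" if "t : {t1<..<t2}" for t
   by (rule LIMSEQ_ignore_initial_segment[OF J_lim]) (use that i01 in auto)
  show "J0 integrable_on {t1<..<t2}" by (rule dominated_convergence(1)[OF A V N L])
  show "(%n. integral {t1<..<t2} (J (n + N))) \<longlonglongrightarrow> integral {t1<..<t2} J0"
   by (rule dominated_convergence(2)[OF A V N L])
 qed
 have "(%n. I (n + N) t2 - I (n + N) t1) \<longlonglongrightarrow>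
   integral (slice D t2) (%x. f (t2, x)) - integral (slice D t1) (%x. f (t1, x))"
  using t12 by (intro tendsto_diff LIMSEQ_ignore_initial_segment[OF I_lim]) auto
 moreover have "integral {t1<..<t2} (J (n + N)) = I (n + N) t2 - I (n + N) t1" for n
  using FTCo by (rule integral_unique)
 ultimately have "integral {t1<..<t2} J0 =
   integral (slice D t2) (%x. f (t2, x)) - integral (slice D t1) (%x. f (t1, x))"
  using conv(2) LIMSEQ_unique by simp
 then have "(J0 has_integral (integral (slice D t2) (%x. f (t2, x)) - integral (slice D t1) (%x. f (t1, x)))) {t1<..<t2}"
  using conv(1) integrable_integral by metis
 then show ?thesis using has_integral_open_interval[of J0 _ t1 t2] unfolding J0_def g_def by simp
qed

end

section \<open>The equations and the propagation of the constraints\<close>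

text \<open>Truncated powers serve as weights in the distance that vanish beyond a given value. The
  exponent is at least 2, so the one-sided derivatives at the corner are both zero.\<close>

lemma DERIV_max_power:
 fixes c :: real
 shows "((%s. (max 0 (c - s)) ^ Suc (Suc k)) has_field_derivative - real (Suc (Suc k)) * (max 0 (c - s)) ^ Suc k) (at s)"
proof -
 have p: "((%u::real. (max 0 u) ^ Suc (Suc k)) has_field_derivative real (Suc (Suc k)) * (max 0 u) ^ Suc k) (at u)" for u
 proof (cases u "0::real" rule: linorder_cases)
  case less
  have "((%u::real. 0) has_field_derivative real (Suc (Suc k)) * (max 0 u) ^ Suc k) (at u)" using less by simp
  then show ?thesis
   by (rule has_field_derivative_transform_within_open[where S = "{..<0}"]) (use less in auto)
 next
  case greater
  have "((%u::real. u ^ Suc (Suc k)) has_field_derivative real (Suc (Suc k)) * u ^ Suc k) (at u)"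
   by (rule DERIV_cong[OF DERIV_power[OF DERIV_ident]]) simp
  then have "((%u::real. u ^ Suc (Suc k)) has_field_derivative real (Suc (Suc k)) * (max 0 u) ^ Suc k) (at u)"
   using greater by simp
  then show ?thesis
   by (rule has_field_derivative_transform_within_open[where S = "{0<..}"]) (use greater in auto)
 next
  case equal
  have "((%h::real. (max 0 (0 + h)) ^ Suc (Suc k) / h) \<longlongrightarrow> 0) (at 0)"
  proof (rule Lim_null_comparison)
   show "\<forall>\<^sub>F h in at 0. norm ((max 0 (0 + h)) ^ Suc (Suc k) / h) <= \<bar>h\<bar> ^ Suc k"
   proof (rule always_eventually, rule allI)
    fix h :: real
    show "norm ((max 0 (0 + h)) ^ Suc (Suc k) / h) <= \<bar>h\<bar> ^ Suc k"
    proof (cases "h <= 0")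
     case True
     then have "norm ((max 0 (0 + h)) ^ Suc (Suc k) / h) = 0" by simp
     then show ?thesis using zero_le_power_abs[of h "Suc k"] by linarith
    next
     case False
     then show ?thesis by simp
    qed
   qed
   have "((%h::real. \<bar>h\<bar> ^ Suc k) \<longlongrightarrow> \<bar>0\<bar> ^ Suc k) (at 0)" by (intro tendsto_intros)
   then show "((%h::real. \<bar>h\<bar> ^ Suc k) \<longlongrightarrow> 0) (at 0)" by simp
  qed
  then show ?thesis using equal by (simp add: DERIV_def)
 qed
 have 1: "((%s. c - s) has_field_derivative -1) (at s)" by (auto intro!: derivative_eq_intros)
 have "((%s. (max 0 (c - s)) ^ Suc (Suc k)) has_field_derivative
   (real (Suc (Suc k)) * (max 0 (c - s)) ^ Suc k) * -1) (at s)"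
  by (rule DERIV_chain2[OF p 1])
 moreover have "(real (Suc (Suc k)) * (max 0 (c - s)) ^ Suc k) * -1 = - real (Suc (Suc k)) * (max 0 (c - s)) ^ Suc k"
  by (simp only: mult_minus_right mult_minus_left mult_1_right)
 ultimately show ?thesis by (simp only:)
qed

lemma dd_material:
 fixes f :: "real \<times> (real^'n::finite) => 'b::real_normed_vector"
 assumes "f differentiable at z"
 shows "dd (1, w) f z = dd (1, 0) f z + (SUMU k. w $ k *\<^sub>R px k f z)"
proof -
 have "dd ((1, 0) + (0, w)) f z = dd (1, 0) f z + dd (0, w) f z" by (rule dd_add_dir[OF assms])
 then show ?thesis using dd_space_expand[OF assms, of w] by simp
qed

context mhd_flow
begin

text \<open>The weights of the proof. \<open>bb\<close> exceeds \<open>9/16 * d0\<close>, the end of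
  the cutoff layer fattened by an averaging radius \<open>d0 / 16\<close>, and is below
  \<open>d0\<close>, where the distance is smooth. The exponent makes half of \<open>- th1\<close>
  dominate \<open>th\<close> times the Laplacian of \<open>bd\<close>: that product costs
  \<open>bb * 16 / (3 * d0) = 10/3\<close> per dimension, less than \<open>7/2\<close>.
  \<open>psi\<close> is the primitive of \<open>th\<close> vanishing at 0: comparable to
  \<open>bd\<close> near the boundary and constant beyond \<open>bb\<close>.\<close>

definition bb :: real where "bb = 5/8 * d0"
definition mm :: nat where "mm = 7 * CARD('n)"
definition th :: "real => real" where "th s = (max 0 (bb - s)) ^ mm"
definition th1 :: "real => real" where "th1 s = - real mm * (max 0 (bb - s)) ^ (mm - 1)"
definition psi :: "real => real" where "psi s = (bb ^ (mm + 1) - (max 0 (bb - s)) ^ (mm + 1)) / real (mm + 1)"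

lemma bb: "0 < bb" "bb < d0" using d0 by (auto simp: bb_def)

lemma mm: "mm \<ge> 7" using zero_less_card_finite[where 'a='n] by (simp add: mm_def)

lemma mm_Suc: "mm = Suc (Suc (mm - 2))" "mm - 1 = Suc (mm - 2)" using mm by auto

lemma th_DERIV: "(th has_field_derivative th1 s) (at s)"
 using DERIV_max_power[of bb "mm - 2" s] mm_Suc unfolding th_def[abs_def] th1_def by metis

lemma psi_DERIV: "(psi has_field_derivative th s) (at s)"
proof -
 have "((%s. (max 0 (bb - s)) ^ (mm + 1)) has_field_derivative - real (mm + 1) * (max 0 (bb - s)) ^ mm) (at s)"
  using DERIV_max_power[of bb "mm - 1" s] mm by simp
 then have "((%s. (bb ^ (mm + 1) - (max 0 (bb - s)) ^ (mm + 1)) / real (mm + 1)) has_field_derivative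
   (0 - (- real (mm + 1) * (max 0 (bb - s)) ^ mm)) / real (mm + 1)) (at s)"
  by (intro DERIV_cdivide DERIV_diff DERIV_const)
 moreover have "(0 - (- a * x)) / a = x" if "a ~= 0" for a x :: real using that by simp
 then have "(0 - (- real (mm + 1) * x)) / real (mm + 1) = x" for x
  by (metis add_is_0 of_nat_eq_0_iff one_neq_zero)
 ultimately show ?thesis unfolding psi_def[abs_def] th_def by (simp only:)
qed

lemma Ck_th: "Ck_on 1 UNIV th" and Ck_psi: "Ck_on 2 UNIV psi"
proof -
 have "Ck_on 0 UNIV th1" unfolding th1_def[abs_def] by (auto intro!: continuous_intros)
 then have "Ck_on (Suc 0) UNIV th" by (rule Ck_on_deriv[OF open_UNIV th_DERIV])
 then show "Ck_on 1 UNIV th" by simp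
 then have "Ck_on (Suc 1) UNIV psi" by (rule Ck_on_deriv[OF open_UNIV psi_DERIV])
 then show "Ck_on 2 UNIV psi" by (simp add: numeral_2_eq_2)
qed

lemma th_nonneg: "0 <= th s" by (simp add: th_def)

lemma th_le: "0 <= s ==> th s <= bb ^ mm"
 unfolding th_def using bb by (intro power_mono) auto

lemma th_beyond: "bb <= s ==> th s = 0" and th1_beyond: "bb <= s ==> th1 s = 0"
 using mm by (auto simp: th_def th1_def max_def)

lemma psi_bounds:
 assumes "0 <= s"
 shows "s * th s <= psi s" "psi s <= bb ^ mm * s" "0 < s ==> 0 < psi s" "psi s <= bb ^ (mm + 1)"
  "s <= bb ==> s * (bb ^ mm / real (mm + 1)) <= psi s"
proof -
 have p0: "psi 0 = 0" using bb by (simp add: psi_def)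
 have m1: "s * th s <= psi s & psi s <= bb ^ mm * s"
 proof (cases "s = 0")
  case False
  then have "\<exists>z. 0 < z & z < s & psi s - psi 0 = (s - 0) * th z"
   using assms psi_DERIV by (intro MVT2) auto
  then obtain z where z: "0 < z" "z < s" "psi s = s * th z" using p0 by auto
  have "th s <= th z" unfolding th_def using z by (intro power_mono) auto
  then show ?thesis using z th_le[of z] assms by (auto intro: mult_left_mono simp: mult.commute)
 qed (simp add: p0)
 then show "s * th s <= psi s" "psi s <= bb ^ mm * s" by auto
 have m0: "max 0 (bb - s) ^ (mm + 1) <= bb ^ mm * max 0 (bb - s)"
  using mult_right_mono[OF power_mono[of "max 0 (bb - s)" bb mm], of "max 0 (bb - s)"] bb assms
  by (simp add: mult.commute)
 show "0 < psi s" if "0 < s"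
 proof -
  have "max 0 (bb - s) < bb" using that bb by auto
  then have "max 0 (bb - s) ^ (mm + 1) < bb ^ (mm + 1)" by (intro power_strict_mono) auto
  then show ?thesis unfolding psi_def by (intro divide_pos_pos) auto
 qed
 have "psi s <= (bb ^ (mm + 1)) / real (mm + 1)" unfolding psi_def by (intro divide_right_mono) auto
 also have "... <= (bb ^ (mm + 1)) / 1" using bb by (intro divide_left_mono) auto
 finally show "psi s <= bb ^ (mm + 1)" by simp
 show "s * (bb ^ mm / real (mm + 1)) <= psi s" if "s <= bb"
 proof -
  have "s * bb ^ mm <= bb ^ (mm + 1) - max 0 (bb - s) ^ (mm + 1)"
   using m0 that by (simp add: algebra_simps)
  then show ?thesis unfolding psi_def by (simp add: divide_right_mono)
 qed
qed

definition Vc :: "'n => real \<times> (real^'n) => real" where "Vc j z = V z $ j"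
definition Bc :: "'n => real \<times> (real^'n) => real" where "Bc j z = Bm z $ j"

lemma Ck_Vc: "Ck_on k dom (Vc j)" and Ck_Bc: "Ck_on k dom (Bc j)"
 unfolding Vc_def[abs_def] Bc_def[abs_def] by (intro Ck_on_vec_nth dom Ck_V Ck_B)+

lemma Ck_dd_dom: "(!!k. Ck_on k dom f) ==> Ck_on k dom (dd h f)"
 by (rule Ck_on_dd)

lemmas Ck_dVc = Ck_dd_dom[OF Ck_Vc] and Ck_dBc = Ck_dd_dom[OF Ck_Bc] and Ck_dP = Ck_dd_dom[OF Ck_P]
lemmas diff_Vc = diff_dom[OF Ck_Vc] and diff_Bc = diff_dom[OF Ck_Bc]
 and diff_dVc = diff_dom[OF Ck_dVc] and diff_dBc = diff_dom[OF Ck_dBc] and diff_dP = diff_dom[OF Ck_dP]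

lemma dd_Vc: "z : dom ==> dd h (Vc j) z = dd h V z $ j" and dd_Bc: "z : dom ==> dd h (Bc j) z = dd h Bm z $ j"
 using dd_bounded_linear_compose[OF bounded_linear_vec_nth diff_V] dd_bounded_linear_compose[OF bounded_linear_vec_nth diff_B]
 by (auto simp: Vc_def[abs_def] Bc_def[abs_def])

lemma material_deriv_eq:
 assumes "(t, x) : dom"
 shows "material_deriv v v t x = dd (1, V (t, x)) V (t, x)" "material_deriv v B t x = dd (1, V (t, x)) Bm (t, x)"
proof -
 note dV = diff_V[OF assms] and dB = diff_B[OF assms]
 have pdV: "pd k (v t) x = px k V (t, x)" and pdB: "pd k (B t) x = px k Bm (t, x)" for k
  using dd_slice[OF dV, of "axis k 1"] dd_slice[OF dB, of "axis k 1"]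
  by (simp_all add: pd_def dd_def[symmetric] V_def Bm_def)
 have "vector_derivative (%s. v s x) (at t) = dd (1, 0) V (t, x)" "vector_derivative (%s. B s x) (at t) = dd (1, 0) Bm (t, x)"
  using vector_derivative_at[OF slice_differentiable(2)[OF dV]] vector_derivative_at[OF slice_differentiable(2)[OF dB]]
  by (simp_all add: V_def Bm_def)
 then show "material_deriv v v t x = dd (1, V (t, x)) V (t, x)" "material_deriv v B t x = dd (1, V (t, x)) Bm (t, x)"
  using dd_material[OF dV, of "V (t, x)"] dd_material[OF dB, of "V (t, x)"]
  by (simp_all add: material_deriv_def pdV pdB V_def)
qed

lemma eq_V: "z : D ==> dd (1, V z) (Vc j) z = - px j P z + (SUMU k. Bc k z * px k (Bc j) z) / (4 * pi)"
 and eq_B: "z : D ==> dd (1, V z) (Bc j) z = (SUMU k. Bc k z * px k (Vc j) z)"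
 and div_V: "z : D ==> (SUMU k. px k (Vc k) z) = 0"
proof -
 assume z: "z : D"
 obtain t x where ze: "z = (t, x)" by (cases z)
 have zd: "(t, x) : dom" using D_dom z ze by simp
 have pdV: "pd k (v t) x $ j = px k (Vc j) z" and pdB: "pd k (B t) x $ j = px k (Bc j) z"
  and pdP: "pd k (total_pressure p B t) x = px k P z" for k j
  using dd_slice[OF diff_V[OF zd], of "axis k 1"] dd_slice[OF diff_B[OF zd], of "axis k 1"] dd_slice[OF diff_P[OF zd], of "axis k 1"]
  by (simp_all add: pd_def dd_def[symmetric] V_def Bm_def P_def dd_Vc[OF zd] dd_Bc[OF zd] ze)
 have e: "material_deriv v v t x $ j + pd j (total_pressure p B t) x =
     (SUMU k. B t x $ k * pd k (B t) x $ j) / (4 * pi)"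
    "material_deriv v B t x $ j = (SUMU k. B t x $ k * pd k (v t) x $ j)"
    "divergence (v t) x = 0"
  using sol z unfolding mhd_solution_def ze by blast+
 show "dd (1, V z) (Vc j) z = - px j P z + (SUMU k. Bc k z * px k (Bc j) z) / (4 * pi)"
  using e(1) material_deriv_eq(1)[OF zd] dd_Vc[OF zd, of "(1, V z)" j] pdP pdB by (simp add: ze Bc_def Bm_def)
 show "dd (1, V z) (Bc j) z = (SUMU k. Bc k z * px k (Vc j) z)"
  using e(2) material_deriv_eq(2)[OF zd] dd_Bc[OF zd, of "(1, V z)" j] pdV by (simp add: ze Bc_def Bm_def)
 show "(SUMU k. px k (Vc k) z) = 0" using e(3) pdV by (simp add: divergence_def)
qed

lemma dd_material_Vc:
 fixes f :: "real \<times> (real^'n) => real"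
 shows "f differentiable at z ==> dd (1, V z) f z = dd (1, 0) f z + (SUMU l. Vc l z * px l f z)"
 using dd_material[of f z "V z"] by (simp add: Vc_def)

lemma dd_commute_dom:
 fixes f :: "real \<times> (real^'n) => real"
 assumes "!!k. Ck_on k dom f" "z : dom"
 shows "dd h (dd k f) z = dd k (dd h f) z"
 by (rule dd_commute[OF dom(1) assms(2,1)])

lemma dd_sum_mult:
 assumes "!!i. i : I ==> f i differentiable at z" "!!i. i : I ==> g i differentiable at z"
 shows "dd h (%z. \<Sum>i\<in>I. f i z * (g i z :: real)) z = (\<Sum>i\<in>I. f i z * dd h (g i) z + dd h (f i) z * g i z)"
 using assms by (subst dd_sum) (auto simp: dd_mult intro!: sum.cong differentiable_mult)

text \<open>The commutator of material and spatial derivatives. On the left the direction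
  \<open>(1, V z)\<close> is frozen at the base point; inside \<open>px i\<close> on the right it
  varies with the point.\<close>

lemma material_px:
 fixes f :: "real \<times> (real^'n) => real"
 assumes f: "!!k. Ck_on k dom f" and z: "z : dom"
 shows "dd (1, V z) (px i f) z = px i (%z. dd (1, V z) f z) z - (SUMU l. px i (Vc l) z * px l f z)"
proof -
 note df = diff_dom[OF f] and ddf = diff_dom[OF Ck_dd_dom[OF f]]
 have "px i (%z. dd (1, V z) f z) z = px i (%z. dd (1, 0) f z + (SUMU l. Vc l z * px l f z)) z"
  by (rule dd_cong_open[OF dom(1) z]) (rule dd_material_Vc[OF df])
 also have "... = px i (dd (1, 0) f) z + px i (%z. SUMU l. Vc l z * px l f z) z"
  using z by (intro dd_add ddf differentiable_sum ballI differentiable_mult diff_Vc) auto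
 also have "px i (%z. SUMU l. Vc l z * px l f z) z = (SUMU l. Vc l z * px i (px l f) z + px i (Vc l) z * px l f z)"
  by (rule dd_sum_mult) (use z in \<open>auto intro: diff_Vc ddf\<close>)
 also have "... = (SUMU l. Vc l z * px l (px i f) z) + (SUMU l. px i (Vc l) z * px l f z)"
  using dd_commute_dom[OF f z] by (simp add: sum.distrib)
 also have "px i (dd (1, 0) f) z = dd (1, 0) (px i f) z" by (rule dd_commute_dom[OF f z])
 finally show ?thesis using dd_material_Vc[OF ddf[OF z]] by simp
qed

lemma Dt_dV:
 assumes z: "z : G"
 shows "dd (1, V z) (px i (Vc k)) z = - px i (px k P) z
  + (SUMU l. Bc l z * px l (px i (Bc k)) z + px i (Bc l) z * px l (Bc k) z) / (4 * pi)
  - (SUMU l. px i (Vc l) z * px l (Vc k) z)"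
proof -
 note zd = G_dom[OF z]
 have dS: "(%z. SUMU l. Bc l z * px l (Bc k) z) differentiable at z"
  using zd by (intro differentiable_sum ballI differentiable_mult diff_Bc diff_dBc) auto
 have "px i (%z. dd (1, V z) (Vc k) z) z = px i (%z. - px k P z + (1 / (4 * pi)) * (SUMU l. Bc l z * px l (Bc k) z)) z"
  by (rule dd_cong_open[OF open_G z]) (simp add: eq_V G_D)
 also have "... = px i (%z. - px k P z) z + px i (%z. (1 / (4 * pi)) * (SUMU l. Bc l z * px l (Bc k) z)) z"
  by (intro dd_add differentiable_minus diff_dP zd differentiable_mult dS differentiable_const)
 also have "... = - px i (px k P) z + (1 / (4 * pi)) * (SUMU l. Bc l z * px i (px l (Bc k)) z + px i (Bc l) z * px l (Bc k) z)"
  by (subst dd_minus[OF diff_dP[OF zd]], subst dd_cmult[OF dS], subst dd_sum_mult)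
   (simp_all add: diff_Bc[OF zd] diff_dBc[OF zd])
 finally show ?thesis
  using material_px[OF Ck_Vc zd] dd_commute_dom[OF Ck_Bc zd, of "(0, axis i 1)"] by simp
qed

lemma Dt_dB:
 assumes z: "z : G"
 shows "dd (1, V z) (px i (Bc k)) z =
  (SUMU l. Bc l z * px l (px i (Vc k)) z + px i (Bc l) z * px l (Vc k) z)
  - (SUMU l. px i (Vc l) z * px l (Bc k) z)"
proof -
 note zd = G_dom[OF z]
 have "px i (%z. dd (1, V z) (Bc k) z) z = px i (%z. SUMU l. Bc l z * px l (Vc k) z) z"
  by (rule dd_cong_open[OF open_G z]) (simp add: eq_B G_D)
 also have "... = (SUMU l. Bc l z * px i (px l (Vc k)) z + px i (Bc l) z * px l (Vc k) z)"
  by (rule dd_sum_mult) (use zd in \<open>auto intro: diff_Bc diff_dVc\<close>)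
 finally show ?thesis
  using material_px[OF Ck_Bc zd] dd_commute_dom[OF Ck_Vc zd, of "(0, axis i 1)"] by simp
qed

text \<open>The inequality \<open>s * th s <= psi s\<close> turns the bound \<open>M * bd\<close>
  for the distance into one relative to \<open>psi\<close> itself, that is, into a bound for the
  logarithm of \<open>psi\<close>.\<close>

lemma abs_material_psi:
 assumes "z : G"
 shows "(%z. psi (bd z)) differentiable at z" "\<bar>dd (1, V z) (%z. psi (bd z)) z\<bar> <= M * psi (bd z)"
proof -
 have b: "bd z > 0" using bd_pos G_D assms by blast
 have "(%z. psi (bd z)) differentiable at z & \<bar>dd (1, V z) (%z. psi (bd z)) z\<bar> <= M * psi (bd z)"
 proof (cases "bd z < d0")
  case True
  then have zs: "z : strip" using assms by (simp add: strip_def)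
  have "\<bar>dd (1, V z) (%z. psi (bd z)) z\<bar> = th (bd z) * \<bar>dd (1, V z) bd z\<bar>"
   using dd_real_compose[OF diff_strip(1)[OF zs] psi_DERIV] th_nonneg by (simp add: abs_mult)
  also have "... <= th (bd z) * (M * bd z)" by (intro mult_left_mono abs_material_bd zs th_nonneg)
  also have "... <= M * psi (bd z)" using psi_bounds(1)[of "bd z"] b M_pos by (simp add: mult.commute mult.left_commute)
  finally show ?thesis using differentiable_compose[OF _ diff_strip(1)[OF zs]] psi_DERIV
   field_differentiable_imp_differentiable field_differentiable_def by blast
 next
  case False
  have e: "psi (bd y) = psi bb" if "y : {z\<in>G. bb < bd z}" for y using that mm by (simp add: psi_def max_def)
  have zz: "z : {z\<in>G. bb < bd z}" using False assms bb by auto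
  have "dd (1, V z) (%z. psi (bd z)) z = dd (1, V z) (%z. psi bb) z"
   by (rule dd_cong_open[OF open_superlevel zz e])
  moreover have "(%z. psi (bd z)) differentiable at z"
   by (rule differentiable_cong_open[OF open_superlevel zz, of "%z. psi bb"]) (use e in auto)
  ultimately show ?thesis using psi_bounds(3)[OF _ b] b M_pos by simp
 qed
 then show "(%z. psi (bd z)) differentiable at z" "\<bar>dd (1, V z) (%z. psi (bd z)) z\<bar> <= M * psi (bd z)" by auto
qed

text \<open>The barrier \<open>ln psi(bd)\<close> tends to minus infinity at the boundary and is transported with
 bounded speed, so that the maximum of the penalised function is attained in the interior.\<close>

lemma maximum_principle:
 fixes b :: "real \<times> (real^'n) => real"
 assumes b: "continuous_on D b" "!!z. z : D ==> \<bar>b z\<bar> <= Cb" "Ck_on 1 G b"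
  and le: "!!z. z : G ==> dd (1, V z) b z <= c * b z"
  and init: "!!x. (0, x) : D ==> b (0, x) <= 0"
  and z1: "z1 : D" "fst z1 < T"
 shows "b z1 <= 0"
proof -
 define \<Phi> where "\<Phi> dl z = exp (- c * fst z) * b z + dl * (ln (psi (bd z)) - (M + 1) * fst z)" for dl and z :: "real \<times> (real^'n)"
 define L where "L = \<bar>ln (bb ^ (mm + 1))\<bar>"
 have psip: "psi (bd z) > 0" if "z : D" for z using psi_bounds(3)[of "bd z"] bd_pos[OF that] by auto
 have ln_le: "ln (psi (bd z)) <= L" if "z : D" for z
 proof -
  have "ln (psi (bd z)) <= ln (bb ^ (mm + 1))"
   using psip[OF that] psi_bounds(4)[of "bd z"] bd_pos[OF that] bb by (intro ln_mono) auto
  then show ?thesis by (simp add: L_def)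
 qed
 have key: "\<Phi> dl z1 <= dl * L" if dl: "dl > 0" for dl
 proof -
  define E where "E = exp (\<bar>c\<bar> * T) * \<bar>Cb\<bar>"
  have bE: "\<bar>exp (- c * fst z) * b z\<bar> <= E" if "z : D" for z
  proof -
   have "0 <= fst z" "fst z <= T" using D_subset[OF that] by auto
   then have "- c * fst z <= \<bar>c\<bar> * fst z" "\<bar>c\<bar> * fst z <= \<bar>c\<bar> * T"
    by (intro mult_right_mono mult_left_mono; simp)+
   then have "- c * fst z <= \<bar>c\<bar> * T" by linarith
   then have "exp (- c * fst z) * \<bar>b z\<bar> <= exp (\<bar>c\<bar> * T) * \<bar>Cb\<bar>" using b(2)[OF that] by (intro mult_mono) auto
   then show ?thesis by (simp add: E_def abs_mult)
  qed
  \<comment> \<open>Closer to the boundary than \<open>ep\<close>, the logarithm alone pushes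
    \<open>\<Phi>\<close> below its value at \<open>z1\<close>. The maximum over the compact set
    \<open>K2\<close> of the remaining points is therefore a maximum over all of
    \<open>K1\<close>.\<close>
  define \<kappa> where "\<kappa> = exp ((\<Phi> dl z1 - E) / dl)"
  define ep where "ep = min (bd z1) (\<kappa> / bb ^ mm)"
  have ep: "ep > 0" using bd_pos[OF z1(1)] bb by (simp add: ep_def \<kappa>_def)
  define K1 where "K1 = {z\<in>D. fst z <= fst z1}"
  define K2 where "K2 = {z\<in>K1. ep <= bd z}"
  have small: "\<Phi> dl z < \<Phi> dl z1" if z: "z : D" "bd z < ep" for z
  proof -
   have "psi (bd z) <= bb ^ mm * bd z" using psi_bounds(2)[of "bd z"] bd_pos[OF z(1)] by simp
   also have "... < \<kappa>" using z(2) bb by (simp add: ep_def field_simps)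
   finally have "ln (psi (bd z)) < (\<Phi> dl z1 - E) / dl"
    using psip[OF z(1)] ln_less_cancel_iff[of "psi (bd z)" \<kappa>] by (simp add: \<kappa>_def)
   then have "dl * ln (psi (bd z)) < \<Phi> dl z1 - E" using dl by (simp add: field_simps)
   moreover have "exp (- c * fst z) * b z <= E" using bE[OF z(1)] by linarith
   moreover have "0 <= dl * ((M + 1) * fst z)" using dl M_pos D_subset[OF z(1)] by simp
   ultimately show ?thesis unfolding \<Phi>_def[of dl z] by (simp add: right_diff_distrib)
  qed
  have "closed K2"
   unfolding closed_sequential_limits
  proof (intro allI impI)
   fix X l assume "(\<forall>n. X n : K2) & X \<longlonglongrightarrow> l"
   then have X: "!!n. X n : K2" "X \<longlonglongrightarrow> l" by auto
   have fl: "(%n. fst (X n)) \<longlonglongrightarrow> fst l" using X(2) by (rule tendsto_fst)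
   have Xn: "0 <= fst (X n)" "fst (X n) <= fst z1" for n
    using X(1)[of n] D_subset[of "X n"] by (auto simp: K2_def K1_def)
   have ft: "0 <= fst l" "fst l <= fst z1"
    using LIMSEQ_le_const[OF fl, of 0] LIMSEQ_le_const2[OF fl, of "fst z1"] Xn by blast+
   have lD: "l : D"
   proof (rule ccontr)
    assume "l \<notin> D"
    then obtain U where U: "open U" "l : U" "!!z. z : U ==> z : D ==> bd z < ep"
     using bd_small_near_boundary[of "fst l" "snd l" ep] ft z1 ep by auto
    then have "\<forall>\<^sub>F n in sequentially. X n : U" using X(2) topological_tendstoD by blast
    then obtain n where "X n : U" by (auto simp: eventually_sequentially)
    then show False using U(3)[of "X n"] X(1)[of n] by (auto simp: K2_def K1_def)
   qed
   have "(%n. bd (X n)) \<longlonglongrightarrow> bd l"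
    using continuous_on_bd lD X unfolding continuous_on_sequentially comp_def by (auto simp: K2_def K1_def)
   then have "ep <= bd l" using X(1) by (intro LIMSEQ_le_const) (auto simp: K2_def)
   then show "l : K2" using lD ft by (simp add: K2_def K1_def)
  qed
  moreover have "bounded K2" using bounded_D by (rule bounded_subset) (auto simp: K2_def K1_def)
  ultimately have "compact K2" by (simp add: compact_eq_bounded_closed)
  moreover have "z1 : K2" using z1 by (simp add: K2_def K1_def ep_def)
  moreover have "continuous_on K2 (\<Phi> dl)"
  proof -
   have "continuous_on D (%z. psi (bd z))"
    by (rule continuous_on_compose2[OF Ck_on_cont[OF Ck_psi] continuous_on_bd]) auto
   then have "continuous_on D (\<Phi> dl)"
    unfolding \<Phi>_def[abs_def] by (intro continuous_intros b(1)) (use psip in fastforce)+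
   then show ?thesis by (rule continuous_on_subset) (auto simp: K2_def K1_def)
  qed
  ultimately obtain zm where zm: "zm : K2" "!!z. z : K2 ==> \<Phi> dl z <= \<Phi> dl zm"
   using continuous_attains_sup[of K2 "\<Phi> dl"] by blast
  have zm1: "\<Phi> dl z <= \<Phi> dl zm" if "z : K1" for z
   using zm(2)[of z] zm(2)[OF \<open>z1 : K2\<close>] small[of z] that by (cases "ep <= bd z") (auto simp: K2_def K1_def)
  have zmD: "zm : D" "fst zm <= fst z1" using zm by (auto simp: K2_def K1_def)
  show ?thesis
  proof (cases "fst zm = 0")
   case True
   have "b zm <= 0" using init[of "snd zm"] zmD True by (metis prod.collapse)
   moreover have "dl * ln (psi (bd zm)) <= dl * L" using ln_le[OF zmD(1)] dl by simp
   ultimately have "\<Phi> dl zm <= dl * L" using True by (simp add: \<Phi>_def)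
   then show ?thesis using zm(2)[OF \<open>z1 : K2\<close>] by simp
  next
   case False
   then have zG: "zm : G" using zmD z1 D_subset[OF zmD(1)] by (auto simp: G_def)
   let ?w = "(1, V zm)"
   have db: "b differentiable at zm" using b(3) zG by (rule Ck1_differentiable)
   note dp = abs_material_psi[OF zG]
   have line: "((%s. f (zm + s *\<^sub>R ?w)) has_field_derivative dd ?w f zm) (at 0)" if "f differentiable at zm" for f :: "real \<times> (real^'n) => real"
    using has_field_derivative_line[of f zm 0 ?w, unfolded scaleR_zero_left add_0_right] that by blast
   define p0 where "p0 = psi (bd zm)"
   have p0: "p0 > 0" unfolding p0_def by (rule psip[OF zmD(1)])
   define e where "e = exp (- c * fst zm) * (dd ?w b zm - c * b zm)
     + dl * (dd ?w (%z. psi (bd z)) zm / p0 - (M + 1))"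
   have D: "((%s. \<Phi> dl (zm + s *\<^sub>R ?w)) has_field_derivative e) (at 0)"
   proof -
    have e1: "((%s. exp (- c * (fst zm + s))) has_field_derivative - c * exp (- c * fst zm)) (at 0)"
     by (auto intro!: derivative_eq_intros)
    have p0': "0 < psi (bd (zm + 0 *\<^sub>R ?w))" using p0 unfolding p0_def scaleR_zero_left add_0_right .
    have D3: "((%s. (M + 1) * (fst zm + s)) has_field_derivative M + 1) (at 0)"
     by (auto intro!: derivative_eq_intros)
    note D1 = DERIV_mult[OF e1 line[OF db]]
    note D2 = DERIV_cmult[OF DERIV_diff[OF DERIV_chain2[OF DERIV_ln[OF p0'] line[OF dp(1)]] D3], of dl]
    have f: "\<Phi> dl (zm + s *\<^sub>R ?w) = exp (- c * (fst zm + s)) * b (zm + s *\<^sub>R ?w) +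
      dl * (ln (psi (bd (zm + s *\<^sub>R ?w))) - (M + 1) * (fst zm + s))" for s
     by (simp add: \<Phi>_def)
    have e: "e = (- c * exp (- c * fst zm)) * b (zm + 0 *\<^sub>R ?w) + dd ?w b zm * exp (- c * (fst zm + 0)) +
      dl * (inverse (psi (bd (zm + 0 *\<^sub>R ?w))) * dd ?w (%z. psi (bd z)) zm - (M + 1))"
     unfolding e_def p0_def scaleR_zero_left add_0_right by (simp add: algebra_simps divide_inverse)
    show ?thesis unfolding f e by (rule DERIV_add[OF D1 D2])
   qed
   \<comment> \<open>The penalty decreases at rate \<open>M + 1\<close>, while the logarithm of
     \<open>psi\<close> grows at rate at most \<open>M\<close>; the term with \<open>b\<close> is
     nonpositive by the differential inequality.\<close>
   have "e < 0"
   proof -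
    have "exp (- c * fst zm) * (dd ?w b zm - c * b zm) <= 0" using le[OF zG] by (simp add: mult_le_0_iff)
    moreover have "dd ?w (%z. psi (bd z)) zm / p0 <= M" using dp(2) p0 by (simp add: p0_def field_simps)
    then have "dl * (dd ?w (%z. psi (bd z)) zm / p0 - (M + 1)) < 0" using dl by (intro mult_pos_neg) auto
    ultimately show ?thesis unfolding e_def by linarith
   qed
   \<comment> \<open>A strict decrease along \<open>(1, V zm)\<close> means larger values slightly
     earlier on this line. Earlier points of \<open>G\<close> still belong to \<open>K1\<close>,
     contradicting maximality.\<close>
   from has_real_derivative_neg_dec_left[OF D this] obtain s0 where s0: "s0 > 0"
    "!!h. 0 < h ==> h < s0 ==> \<Phi> dl (zm + 0 *\<^sub>R ?w) < \<Phi> dl (zm + (0 - h) *\<^sub>R ?w)" by blast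
   have "\<forall>\<^sub>F s in at_right (0::real). zm + s *\<^sub>R (- ?w) : G" by (rule eventually_in_open_direction[OF open_G zG])
   moreover have "\<forall>\<^sub>F s in at_right (0::real). 0 < s & s < s0" using s0(1) by (auto simp: eventually_at_right_field)
   ultimately have "\<forall>\<^sub>F s in at_right (0::real). False"
   proof eventually_elim
    case (elim s)
    have inK: "zm + (0 - s) *\<^sub>R ?w : K1" using elim zmD G_D[of "zm + s *\<^sub>R (- ?w)"] by (simp add: K1_def)
    then show ?case using zm1[OF inK] s0(2)[of s] elim unfolding scaleR_zero_left add_0_right by linarith
   qed
   then show ?thesis by simp
  qed
 qed
 define a where "a = exp (- c * fst z1) * b z1"
 define r where "r = L - (ln (psi (bd z1)) - (M + 1) * fst z1)"
 have "a <= dl * r" if "dl > 0" for dl using key[OF that] by (simp add: \<Phi>_def a_def r_def algebra_simps)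
 then have "a <= 0"
 proof -
  have "((%dl. dl * r) \<longlongrightarrow> 0 * r) (at_right 0)" by (intro tendsto_intros)
  moreover have "\<forall>\<^sub>F dl in at_right 0. a <= dl * r"
   using \<open>!!dl. dl > 0 ==> a <= dl * r\<close> by (intro eventually_at_rightI[of 0 1]) auto
  ultimately show ?thesis using tendsto_lowerbound[of _ "0 * r"] trivial_limit_at_right_real by fastforce
 qed
 then show ?thesis by (simp add: a_def mult_le_0_iff)
qed

lemma Ck_glue:
 assumes "Ck_on k strip f" "Ck_on k G g" "!!z. z : G ==> c < bd z ==> f z = g z" "c < d0"
 shows "Ck_on k G f"
proof (rule Ck_on_UN[of "UNIV :: bool set" "%b. if b then strip else {z\<in>G. c < bd z}"])
 have "Ck_on k {z\<in>G. c < bd z} f"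
  by (rule Ck_on_cong[OF open_superlevel _ Ck_on_subset[OF assms(2)]]) (use assms(3) in auto)
 then show "open (if b then strip else {z\<in>G. c < bd z}) & Ck_on k (if b then strip else {z\<in>G. c < bd z}) f" for b
  using open_strip open_superlevel assms(1) by auto
 show "G \<subseteq> (\<Union>b\<in>UNIV. if b then strip else {z\<in>G. c < bd z})" using assms(4) by (auto simp: strip_def)
qed

lemma continuous_on_glue:
 assumes "continuous_on {z\<in>D. bd z < d0} f" "continuous_on D g" "!!z. z : D ==> c < bd z ==> f z = g z" "c < d0"
 shows "continuous_on D f"
proof -
 let ?S = "{z\<in>D. bd z < d0}" and ?T = "{z\<in>D. c < bd z}"
 have e: "?S = D \<inter> bd -` {..<d0}" "?T = D \<inter> bd -` {c<..}" by auto
 have U: "?S \<union> ?T = D" using assms(4) by auto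
 have "continuous_on ?T g" using assms(2) by (rule continuous_on_subset) auto
 then have "continuous_on ?T f" by (rule continuous_on_eq) (use assms(3) in auto)
 moreover have "openin (top_of_set D) ?S" "openin (top_of_set D) ?T"
  unfolding e by (rule continuous_openin_preimage_gen[OF continuous_on_bd]; simp)+
 ultimately show ?thesis using continuous_on_Un_local_open[of ?S ?T f] assms(1) unfolding U by blast
qed

text \<open>\<open>Ck1_strip\<close> covers interior times; the local tube coordinates give
  continuity at the end times too, which the energies at time 0 and \<open>T\<close>
  require.\<close>

lemma continuous_on_nn: "continuous_on {z\<in>D. bd z < d0} nn"
 unfolding continuous_on_def
proof
 fix z0 assume z0: "z0 : {z\<in>D. bd z < d0}"
 then have z0': "z0 : D" "bd z0 < d0" by auto
 obtain W S Y N where W: "open W" "z0 : W" "Ck_on 1 W N" "!!z. z : W ==> z : D ==> bd z = S z & ft z = Y z & nn z = N z"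
  by (rule local_tube_coordinates[OF z0']) blast
 have "isCont N z0" using Ck_on_cont[OF W(3)] W(1,2) continuous_on_eq_continuous_at by blast
 then have "(N \<longlongrightarrow> nn z0) (at z0 within {z\<in>D. bd z < d0})"
  using W(4)[OF W(2) z0'(1)] 
   continuous_at_imp_continuous_at_within[of z0 N "{z\<in>D. bd z < d0}"] by (simp add: continuous_within)
 moreover have "\<forall>\<^sub>F z in at z0 within {z\<in>D. bd z < d0}. N z = nn z"
  unfolding eventually_at_topological using W by (intro exI[of _ W]) auto
 ultimately show "(nn \<longlongrightarrow> nn z0) (at z0 within {z\<in>D. bd z < d0})"
  by (rule Lim_transform_eventually)
qed

lemma pd_bdist:
 assumes z: "(t, x) : D" "bd (t, x) < d0"
 shows "pd i (bdist (slice D t)) x = - nn (t, x) $ i"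
proof -
 obtain W S Y N where W: "open W" "(t, x) : W" "Ck_on 1 W S" "!!z. z : W ==> z : D ==> bd z = S z & ft z = Y z & nn z = N z"
  "!!z. z : W ==> z : D ==> \<exists>k. (\<forall>\<tau> \<xi>. dd (\<tau>, \<xi>) S z = \<tau> * k - nn z \<bullet> \<xi>) &
    (fst z < T --> k = normal_velocity T D (fst z) (ft z))"
  by (rule local_tube_coordinates[OF z]) blast
 have dS: "S differentiable at (t, x)" using Ck1_differentiable[OF W(3,2)] .
 have o: "open (slice D t \<inter> {y. (t, y) : W})"
  using open_vimage[OF W(1), of "Pair t"] open_slice by (auto simp: vimage_def continuous_on_Pair)
 have "pd i (bdist (slice D t)) x = dd (axis i 1) (%y. bd (t, y)) x" by (simp add: pd_def dd_def bd_def)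
 also have "... = dd (axis i 1) (%y. S (t, y)) x"
  by (rule dd_cong_open[OF o]) (use z W in auto)
 also have "... = px i S (t, x)" by (rule dd_slice[OF dS])
 also have "... = - nn (t, x) $ i"
 proof -
  obtain k where "!!\<tau> \<xi>. dd (\<tau>, \<xi>) S (t, x) = \<tau> * k - nn (t, x) \<bullet> \<xi>" using W(5)[OF W(2) z(1)] by blast
  then show ?thesis by (simp add: inner_axis)
 qed
 finally show ?thesis .
qed

lemma px_bd: "z : strip ==> px k bd z = - nn z $ k"
 using dd_bd[of z 0 "axis k 1"] by (simp add: inner_axis)

lemma D_G_initial: "z : D ==> fst z < T ==> z : G \<or> fst z = 0"
 using D_subset[of z] by (auto simp: G_def)

lemma slice_0: "slice D 0 = D0" using sol unfolding mhd_solution_def by blast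

lemma bounded_on_D:
 fixes f :: "real \<times> (real^'n) => real"
 assumes "continuous_on dom f"
 obtains C where "C > 0" "!!z. z : D ==> \<bar>f z\<bar> <= C"
 using bounded_on_closure[OF assms] closure_subset[of D] by (metis real_norm_def subsetD)

text \<open>The divergence is constant along the flow: its material derivative contains
  \<open>B\<close> paired with the gradient of \<open>div v\<close>, which vanishes, and two
  quadratic sums that cancel after exchanging indices. Its square then satisfies the maximum
  principle with \<open>c = 0\<close>.\<close>

lemma div_B:
 assumes "z : G"
 shows "(SUMU k. px k (Bc k) z) = 0"
proof -
 define dB where "dB z = (SUMU k. px k (Bc k) z)" for z
 have C: "Ck_on k dom dB" for k unfolding dB_def[abs_def] by (intro Ck_on_sum dom Ck_dBc)
 have C2: "Ck_on k dom (%z. dB z * dB z)" for k by (intro Ck_on_mult dom C)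
 have cD: "continuous_on D (%z. dB z * dB z)"
  using Ck_on_cont[OF C2] by (rule continuous_on_subset) (use D_dom in auto)
 have cG: "Ck_on 1 G (%z. dB z * dB z)" using C2 by (rule Ck_on_subset) (use G_dom in auto)
 obtain Cb where Cb: "!!z. z : D ==> \<bar>dB z * dB z\<bar> <= Cb" using bounded_on_D[OF Ck_on_cont[OF C2]] by blast
 have mat: "dd (1, V z) dB z = 0" if z: "z : G" for z
 proof -
  note zd = G_dom[OF z]
  have lap: "(SUMU k. px l (px k (Vc k)) z) = 0" for l
  proof -
   have "(SUMU k. px l (px k (Vc k)) z) = px l (%z. SUMU k. px k (Vc k) z) z"
    by (rule dd_sum[symmetric]) (rule diff_dVc[OF zd])
   also have "... = px l (%z. 0::real) z"
    by (rule dd_cong_open[OF open_G z]) (simp add: div_V G_D)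
   finally show ?thesis by simp
  qed
  have "dd (1, V z) dB z = (SUMU k. dd (1, V z) (px k (Bc k)) z)"
   unfolding dB_def by (rule dd_sum) (rule diff_dBc[OF zd])
  also have "... = (SUMU k. SUMU l. Bc l z * px l (px k (Vc k)) z)
    + (SUMU k. SUMU l. px k (Bc l) z * px l (Vc k) z)
    - (SUMU k. SUMU l. px k (Vc l) z * px l (Bc k) z)"
   using Dt_dB[OF z] by (simp add: sum.distrib sum_subtractf)
  also have "(SUMU k. SUMU l. Bc l z * px l (px k (Vc k)) z) = (SUMU l. Bc l z * (SUMU k. px l (px k (Vc k)) z))"
   by (subst sum.swap) (simp add: sum_distrib_left)
  also have "... = 0" using lap by simp
  also have "(SUMU k. SUMU l. px k (Vc l) z * px l (Bc k) z) = (SUMU k. SUMU l. px k (Bc l) z * px l (Vc k) z)"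
   by (subst sum.swap) (simp add: mult.commute)
  finally show ?thesis by simp
 qed
 have "dB z * dB z <= 0"
 proof (rule maximum_principle[OF cD Cb cG, where c = 0])
  fix z assume z: "z : G"
  show "dd (1, V z) (%z. dB z * dB z) z <= 0 * (dB z * dB z)"
   using dd_mult[OF diff_dom[OF C G_dom[OF z]] diff_dom[OF C G_dom[OF z]], of "(1, V z)"] mat[OF z] by simp
 next
  fix x assume x: "(0, x) : D"
  then have xd: "(0, x) : dom" by (rule D_dom)
  have "divergence (B 0) x = 0" using sol x slice_0 unfolding mhd_solution_def by (metis mem_slice)
  moreover have "pd k (B 0) x $ k = px k (Bc k) (0, x)" for k
   using dd_slice[OF diff_B[OF xd], of "axis k 1"] by (simp add: pd_def dd_def[symmetric] Bm_def dd_Bc[OF xd])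
  ultimately show "dB (0, x) * dB (0, x) <= 0" by (simp add: divergence_def dB_def)
 qed (use assms in \<open>auto simp: G_def\<close>)
 then have "dB z = 0" using zero_le_square[of "dB z"] by (metis antisym mult_eq_0_iff)
 then show ?thesis by (simp add: dB_def)
qed

section \<open>Propagation of the tangency of the magnetic field\<close>

definition bn :: "real \<times> (real^'n) => real" where "bn z = Bm z \<bullet> nn z"

lemma Ck_bn: "Ck_on 1 strip bn"
 unfolding bn_def by (intro Ck_on_inner open_strip Ck1_strip Ck_strip_dom Ck_B)

lemma material_B: "z : D ==> dd (1, V z) Bm z = dd (0, Bm z) V z"
proof -
 assume z: "z : D"
 have zd: "z : dom" using D_dom z .
 have "dd (1, V z) Bm z $ j = dd (0, Bm z) V z $ j" for j
  using eq_B[OF z, of j] dd_Bc[OF zd, of "(1, V z)" j] dd_space_expand[OF diff_Vc[OF zd], where h = "Bm z", of j]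
   dd_Vc[OF zd, of "(0, Bm z)" j]
  by (simp add: Bc_def)
 then show ?thesis by (simp add: vec_eq_iff)
qed

text \<open>The stretching of \<open>B\<close> contributes the normal component of
  \<open>dd (0, Bm z) V\<close> at the point, and the rotation of the normal contributes the same
  quantity at the foot with the opposite sign. Their difference is \<open>O(bd)\<close>, and every
  other term carries \<open>bd\<close>, \<open>bn\<close> or \<open>V (fz z) - V z\<close>.\<close>

lemma material_bn:
 assumes z: "z : strip"
 defines "A \<equiv> dd (0, Bm z) nn z"
 shows "dd (1, V z) bn z = nn z \<bullet> (dd (0, Bm z) V z - dd (0, Bm z) V (fz z)) - bd z * (nn z \<bullet> dd (0, A) V (fz z))
  + bn z * (nn z \<bullet> dd (0, nn z) V (fz z)) - A \<bullet> (V (fz z) - V z)"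
proof -
 note zD = strip_D[OF z]
 note dV = diff_V[OF fz_dom[OF zD]]
 have "dd (1, V z) bn z = Bm z \<bullet> dd (1, V z) nn z + dd (1, V z) Bm z \<bullet> nn z"
  unfolding bn_def by (rule dd_inner[OF diff_B[OF D_dom[OF zD]] diff_strip(3)[OF z]])
 also have "Bm z \<bullet> dd (1, V z) nn z = - (A \<bullet> (V (fz z) - V z) + nn z \<bullet> dd (0, dd (0, Bm z) ft z) V (fz z))"
  using material_nn[OF z, of "Bm z"] by (simp add: inner_commute A_def)
 also have "dd (0, dd (0, Bm z) ft z) V (fz z) = dd (0, Bm z) V (fz z) + bd z *\<^sub>R dd (0, A) V (fz z) - bn z *\<^sub>R dd (0, nn z) V (fz z)"
 proof -
  have "(0::real, dd (0, Bm z) ft z) = (0, Bm z) + bd z *\<^sub>R (0, A) + (- bn z) *\<^sub>R (0, nn z)"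
   by (simp add: dd_ft[OF z] A_def bn_def inner_commute)
  then have "dd (0, dd (0, Bm z) ft z) V (fz z) = dd (0, Bm z) V (fz z) + bd z *\<^sub>R dd (0, A) V (fz z) + (- bn z) *\<^sub>R dd (0, nn z) V (fz z)"
   by (simp only: dd_add_dir[OF dV] dd_scale_dir[OF dV])
  then show ?thesis by simp
 qed
 also have "dd (1, V z) Bm z = dd (0, Bm z) V z" by (rule material_B[OF zD])
 finally show ?thesis by (simp add: inner_add_right inner_diff_right inner_commute algebra_simps)
qed

lemma material_bn_bound:
 obtains C where "C > 0" "!!z. z : strip ==> bd z <= bb ==> \<bar>dd (1, V z) bn z\<bar> <= C * (\<bar>bn z\<bar> + bd z)"
  "!!z. z : D ==> \<bar>bn z\<bar> <= C"
proof -
 obtain CB where CB: "CB > 0" "!!z. z : closure D ==> norm (Bm z) <= CB" using bounded_on_closure[OF Ck_on_cont[OF Ck_B]] by blast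
 have "\<forall>k. \<exists>L>0. ALL z:D. norm (px k V z - px k V (fz z)) <= L * bd z"
 proof
  fix k :: 'n
  obtain L where "L > 0" "!!z. z : D ==> norm (px k V z - px k V (fz z)) <= L * bd z"
   by (rule foot_lipschitz[OF Ck_on_dd[OF Ck_V[of "Suc 1"], where h = "(0, axis k 1)"]]) blast
  then show "\<exists>L>0. ALL z:D. norm (px k V z - px k V (fz z)) <= L * bd z" by blast
 qed
 then obtain L where L: "!!k. L k > 0" "!!k z. z : D ==> norm (px k V z - px k V (fz z)) <= L k * bd z" by metis
 define SL where "SL = (SUMU k. L k)"
 have SL: "SL \<ge> 0" unfolding SL_def using L(1) by (intro sum_nonneg) (auto intro: less_imp_le)
 define c0 where "c0 = 16 / (3 * d0)"
 have c0: "c0 > 0" using d0 by (simp add: c0_def)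
 define C where "C = CB * SL + M + 2 * (M * (c0 * CB)) + CB"
 have pos: "0 <= CB * SL" "0 <= M * (c0 * CB)" using CB SL M_pos c0 by simp_all
 have C: "C > 0" unfolding C_def using CB M_pos pos by linarith
 have bnC: "\<bar>bn z\<bar> <= CB" if "z : D" for z
 proof -
  have "\<bar>bn z\<bar> <= norm (Bm z) * norm (nn z)" unfolding bn_def by (rule Cauchy_Schwarz_ineq2)
  then show ?thesis using CB(2)[of z] closure_subset[of D] norm_nn[OF that] that by auto
 qed
 have main: "\<bar>dd (1, V z) bn z\<bar> <= C * (\<bar>bn z\<bar> + bd z)" if z: "z : strip" "bd z <= bb" for z
 proof -
  note zD = strip_D[OF z(1)]
  have zc: "z : closure D" "fz z : closure D" using closure_subset[of D] zD fz_closure by auto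
  have b: "bd z > 0" using bd_pos zD by blast
  have n1: "norm (nn z) = 1" using norm_nn zD by blast
  define A where "A = dd (0, Bm z) nn z"
  have A: "norm A <= c0 * CB"
  proof -
   have "norm A <= c0 * norm (Bm z)" unfolding A_def c0_def using norm_dd_nn'(1)[OF z(1)] z(2) by (simp add: bb_def)
   also have "... <= c0 * CB" using CB(2)[OF zc(1)] c0 by (intro mult_left_mono) auto
   finally show ?thesis .
  qed
  have 1: "norm (dd (0, Bm z) V z - dd (0, Bm z) V (fz z)) <= CB * SL * bd z"
  proof -
   have "dd (0, Bm z) V z - dd (0, Bm z) V (fz z) = (SUMU k. Bm z $ k *\<^sub>R (px k V z - px k V (fz z)))"
    by (subst dd_space_expand[OF diff_V[OF closure_dom[OF zc(1)]]], subst dd_space_expand[OF diff_V[OF closure_dom[OF zc(2)]]])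
     (simp add: sum_subtractf scaleR_diff_right)
   also have "norm ... <= (SUMU k. norm (Bm z $ k *\<^sub>R (px k V z - px k V (fz z))))" by (rule norm_sum)
   also have "... <= (SUMU k. CB * (L k * bd z))"
   proof (rule sum_mono)
    fix k
    have "\<bar>Bm z $ k\<bar> <= CB" using component_le_norm_cart[of "Bm z" k] CB(2)[OF zc(1)] by linarith
    then show "norm (Bm z $ k *\<^sub>R (px k V z - px k V (fz z))) <= CB * (L k * bd z)"
     unfolding norm_scaleR real_norm_def using L(2)[OF zD] CB by (intro mult_mono) auto
   qed
   also have "... = CB * SL * bd z" by (simp add: SL_def sum_distrib_left sum_distrib_right mult.assoc)
   finally show ?thesis .
  qed
  have cs: "\<bar>nn z \<bullet> u\<bar> <= norm u" for u using Cauchy_Schwarz_ineq2[of "nn z" u] n1 by simp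
  have t1: "\<bar>nn z \<bullet> (dd (0, Bm z) V z - dd (0, Bm z) V (fz z))\<bar> <= CB * SL * bd z" using cs 1 order.trans by blast
  have MA: "M * norm A <= M * (c0 * CB)" using A M_pos by simp
  have "\<bar>nn z \<bullet> dd (0, A) V (fz z)\<bar> <= M * (c0 * CB)" using cs[of "dd (0, A) V (fz z)"] norm_dd_V[OF zc(2), of A] MA by linarith
  then have t2: "\<bar>bd z * (nn z \<bullet> dd (0, A) V (fz z))\<bar> <= M * (c0 * CB) * bd z" using b by (simp add: abs_mult mult.commute)
  have "\<bar>nn z \<bullet> dd (0, nn z) V (fz z)\<bar> <= M" using cs[of "dd (0, nn z) V (fz z)"] norm_dd_V[OF zc(2), of "nn z"] n1 by simp
  then have t3: "\<bar>bn z * (nn z \<bullet> dd (0, nn z) V (fz z))\<bar> <= M * \<bar>bn z\<bar>" unfolding abs_mult by (metis abs_ge_zero mult.commute mult_right_mono)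
  have "\<bar>A \<bullet> (V (fz z) - V z)\<bar> <= norm A * norm (V z - V (fz z))" using Cauchy_Schwarz_ineq2[of A "V (fz z) - V z"] by (simp add: norm_minus_commute)
  also have "... <= (c0 * CB) * (M * bd z)" using A V_foot[OF zD] CB c0 by (intro mult_mono) auto
  finally have t4: "\<bar>A \<bullet> (V (fz z) - V z)\<bar> <= M * (c0 * CB) * bd z" by (simp add: mult_ac)
  have "\<bar>dd (1, V z) bn z\<bar> <= CB * SL * bd z + M * (c0 * CB) * bd z + M * \<bar>bn z\<bar> + M * (c0 * CB) * bd z"
   using t1 t2 t3 t4 unfolding material_bn[OF z(1)] A_def[symmetric] by linarith
  also have "... = (CB * SL + 2 * (M * (c0 * CB))) * bd z + M * \<bar>bn z\<bar>" by (simp add: algebra_simps)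
  also have "... <= C * bd z + C * \<bar>bn z\<bar>"
   using pos CB M_pos b by (intro add_mono mult_right_mono) (auto simp: C_def)
  finally show ?thesis by (simp add: algebra_simps)
 qed
 show ?thesis
 proof (rule that[OF C main])
  show "\<bar>bn z\<bar> <= C" if "z : D" for z using bnC[OF that] pos CB M_pos by (simp add: C_def)
 qed
qed

lemma bn_initial:
 obtains L where "L > 0" "!!x. (0, x) : D ==> \<bar>bn (0, x)\<bar> <= L * bd (0, x)"
proof -
 obtain L where L: "L > 0" "!!z. z : D ==> norm (Bm z - Bm (fz z)) <= L * bd z" using foot_lipschitz[OF Ck_B] by blast
 have "\<bar>bn (0, x)\<bar> <= L * bd (0, x)" if x: "(0, x) : D" for x
 proof -
  have "ft (0, x) : frontier D0" using ft_frontier[OF x] slice_0 by simp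
  then have "B 0 (ft (0, x)) \<bullet> ext_normal D0 (ft (0, x)) = 0" using sol unfolding mhd_solution_def by blast
  then have "Bm (fz (0, x)) \<bullet> nn (0, x) = 0" by (simp add: Bm_def fz_def nn_def slice_0)
  then have "\<bar>bn (0, x)\<bar> = \<bar>(Bm (0, x) - Bm (fz (0, x))) \<bullet> nn (0, x)\<bar>" by (simp add: bn_def inner_diff_left)
  also have "... <= norm (Bm (0, x) - Bm (fz (0, x))) * norm (nn (0, x))" by (rule Cauchy_Schwarz_ineq2)
  finally show ?thesis using L(2)[OF x] norm_nn[OF x] by simp
 qed
 then show ?thesis using L(1) that by blast
qed

text \<open>The maximum principle is applied to \<open>h\<close> squared minus an exponentially
  growing multiple of \<open>psi\<close> squared. The factor \<open>th\<close> in \<open>h\<close>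
  makes \<open>bn\<close> globally defined, and \<open>psi\<close> stands in for the distance. The
  resulting constant depends on the solution; it serves to show that fluxes along \<open>B\<close>
  are tangential.\<close>

lemma normal_B_bound:
 obtains C where "C > 0" "!!z. z : G ==> bd z < d0 / 4 ==> \<bar>bn z\<bar> <= C * bd z"
proof -
 obtain C where C: "C > 0" "!!z. z : strip ==> bd z <= bb ==> \<bar>dd (1, V z) bn z\<bar> <= C * (\<bar>bn z\<bar> + bd z)"
  "!!z. z : D ==> \<bar>bn z\<bar> <= C" using material_bn_bound by blast
 obtain L where L: "L > 0" "!!x. (0, x) : D ==> \<bar>bn (0, x)\<bar> <= L * bd (0, x)" using bn_initial by blast
 define h where "h z = th (bd z) * bn z" for z
 define k where "k = bb ^ mm / real (mm + 1)"
 have k: "k > 0" using bb by (simp add: k_def)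
 have bdpsi: "bd z <= psi (bd z) / k" if "z : D" "bd z <= bb" for z
 proof -
  have "bd z * k <= psi (bd z)" unfolding k_def using psi_bounds(5)[of "bd z"] bd_pos[OF that(1)] that(2) by simp
  then show ?thesis using k by (simp add: pos_le_divide_eq)
 qed
 define c1 where "c1 = (real mm * bb ^ (mm - 1) * M * C + C * bb ^ mm) / k"
 have c1: "c1 \<ge> 0" using bb C M_pos k by (simp add: c1_def)
 \<comment> \<open>In the differential inequality, \<open>2 * M\<close> in \<open>\<kappa>\<close>
   pays for the decay of \<open>psi\<close> squared, \<open>c1\<close> for the square of
   \<open>psi\<close> produced by the mixed term, and \<open>c\<close> for the right-hand side. The
   first entry of the maximum in \<open>\<Lambda>\<close> makes the factor of \<open>psi\<close>
   squared at least 1, the second makes the initial value nonpositive.\<close>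
 define c where "c = 2 * C + c1"
 define \<Lambda> where "\<Lambda> = max 1 ((bb ^ mm * L / k)\<^sup>2)"
 define \<kappa> where "\<kappa> = 2 * M + c + c1"
 define b where "b z = (h z)\<^sup>2 - \<Lambda> * exp (\<kappa> * fst z) * (psi (bd z))\<^sup>2" for z :: "real \<times> (real^'n)"
 have h0: "h z = 0" if "bb < bd z" for z using that th_beyond[of "bd z"] by (simp add: h_def)
 have contD: "continuous_on {z\<in>D. bd z < d0} h"
  unfolding h_def bn_def
  by (intro continuous_on_mult continuous_on_inner continuous_on_nn continuous_on_subset[OF Ck_on_cont[OF Ck_B]]
    continuous_on_compose2[OF Ck_on_cont[OF Ck_th] continuous_on_subset[OF continuous_on_bd]]) (auto simp: D_dom)
 have hD: "continuous_on D h" by (rule continuous_on_glue[OF contD continuous_on_const _ bb(2)]) (rule h0)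
 have Chs: "Ck_on 1 strip h"
  unfolding h_def by (intro Ck_on_mult open_strip Ck_bn Ck_on_compose[OF open_strip Ck1_strip(1) Ck_th]) auto
 have hG: "Ck_on 1 G h" by (rule Ck_glue[OF Chs Ck_on_const _ bb(2)]) (rule h0)
 have pG: "Ck_on 1 G (%z. psi (bd z))"
  by (rule Ck_bd_compose[of 1 psi bb "psi bb"]) (use Ck_on_le[OF Ck_psi, of 1] mm bb in \<open>auto simp: psi_def max_def\<close>)
 have pD: "continuous_on D (%z. psi (bd z))"
  by (rule continuous_on_compose2[OF Ck_on_cont[OF Ck_psi] continuous_on_bd]) auto
 have Cexp: "Ck_on 1 G (%z. exp (\<kappa> * fst z))"
 proof -
  have "Ck_on (Suc 0) UNIV (%s. exp (\<kappa> * s))"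
   by (rule Ck_on_deriv[OF open_UNIV, of _ "%s. \<kappa> * exp (\<kappa> * s)"]) (auto intro!: derivative_eq_intros continuous_intros)
  then have "Ck_on 1 UNIV (%s. exp (\<kappa> * s))" by simp
  from Ck_on_compose[OF open_G Ck_on_bounded_linear[OF bounded_linear_fst] this] show ?thesis by auto
 qed
 have bG: "Ck_on 1 G b" unfolding b_def by (intro Ck_on_diff_fun Ck_on_mult Ck_on_power open_G hG pG Ck_on_const Cexp)
 have bD: "continuous_on D b" unfolding b_def by (intro continuous_intros hD pD)
 have hle: "\<bar>h z\<bar> <= bb ^ mm * \<bar>bn z\<bar>" if "z : D" for z
  unfolding h_def abs_mult using th_le[of "bd z"] th_nonneg[of "bd z"] bd_pos[OF that] by (intro mult_right_mono) auto
 have matpsi: "dd (1, V z) (%z. psi (bd z)) z \<ge> - M * psi (bd z)" if "z : G" for z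
  using abs_material_psi(2)[OF that] by linarith
 have math: "\<bar>dd (1, V z) h z\<bar> <= C * \<bar>h z\<bar> + c1 * psi (bd z)" if z: "z : G" for z
 proof (cases "bd z <= bb")
  case True
  then have zs: "z : strip" using z bb by (simp add: strip_def)
  have zD: "z : D" using G_D[OF z] .
  have b0: "bd z > 0" using bd_pos zD by blast
  have dth: "(%z. th (bd z)) differentiable at z"
   using Ck1_differentiable[OF Ck_on_compose[OF open_strip Ck1_strip(1) Ck_th] zs] by auto
  have "dd (1, V z) h z = th (bd z) * dd (1, V z) bn z + th1 (bd z) * dd (1, V z) bd z * bn z"
   unfolding h_def using dd_mult[OF dth Ck1_differentiable[OF Ck_bn zs]] dd_real_compose[OF diff_strip(1)[OF zs] th_DERIV] by simp
  moreover have "\<bar>th (bd z) * dd (1, V z) bn z\<bar> <= C * \<bar>h z\<bar> + C * bb ^ mm * bd z"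
  proof -
   have "\<bar>th (bd z) * dd (1, V z) bn z\<bar> <= th (bd z) * (C * (\<bar>bn z\<bar> + bd z))"
    unfolding abs_mult using C(2)[OF zs True] th_nonneg[of "bd z"] by (simp add: mult_left_mono)
   also have "... = C * \<bar>h z\<bar> + C * th (bd z) * bd z" using th_nonneg[of "bd z"] by (simp add: h_def abs_mult algebra_simps)
   also have "C * th (bd z) * bd z <= C * bb ^ mm * bd z" using th_le[of "bd z"] b0 C(1) by (intro mult_right_mono mult_left_mono) auto
   finally show ?thesis by simp
  qed
  moreover have "\<bar>th1 (bd z) * dd (1, V z) bd z * bn z\<bar> <= (real mm * bb ^ (mm - 1)) * (M * bd z) * C"
  proof -
   have "\<bar>th1 (bd z)\<bar> <= real mm * bb ^ (mm - 1)"
    unfolding th1_def using b0 bb by (auto simp: abs_mult intro!: mult_left_mono power_mono)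
   then show ?thesis unfolding abs_mult using abs_material_bd[OF zs] C(3)[OF zD] bb M_pos b0 by (intro mult_mono) auto
  qed
  ultimately have "\<bar>dd (1, V z) h z\<bar> <= C * \<bar>h z\<bar> + (real mm * bb ^ (mm - 1) * M * C + C * bb ^ mm) * bd z"
   by (simp add: algebra_simps)
  also have "(real mm * bb ^ (mm - 1) * M * C + C * bb ^ mm) * bd z <= (real mm * bb ^ (mm - 1) * M * C + C * bb ^ mm) * (psi (bd z) / k)"
   using bdpsi[OF zD True] bb M_pos C(1) by (intro mult_left_mono) auto
  finally show ?thesis by (simp add: c1_def)
 next
  case False
  have "dd (1, V z) h z = dd (1, V z) (%z. 0::real) z"
   by (rule dd_cong_open[OF open_superlevel[of bb]]) (use z False h0 in auto)
  then show ?thesis using C(1) c1 psi_bounds(3)[of "bd z"] bd_pos[OF G_D[OF z]] by simp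
 qed
 have bdC: "\<bar>b z\<bar> <= (bb ^ mm * C)\<^sup>2 + \<Lambda> * exp (\<bar>\<kappa>\<bar> * T) * (bb ^ (mm + 1))\<^sup>2" if "z : D" for z
 proof -
  have "\<bar>h z\<bar> <= bb ^ mm * C" using hle[OF that] C(3)[OF that] bb by (meson mult_left_mono order.trans zero_le_power less_imp_le)
  then have 1: "(h z)\<^sup>2 <= (bb ^ mm * C)\<^sup>2" by (simp add: abs_le_square_iff[symmetric] C bb less_imp_le)
  have "\<kappa> * fst z <= \<bar>\<kappa>\<bar> * T" using D_subset[OF that] by (intro mult_mono) auto
  then have 2: "exp (\<kappa> * fst z) * (psi (bd z))\<^sup>2 <= exp (\<bar>\<kappa>\<bar> * T) * (bb ^ (mm + 1))\<^sup>2"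
   using psi_bounds(3,4)[of "bd z"] bd_pos[OF that] by (intro mult_mono power_mono) auto
  have L0: "\<Lambda> \<ge> 0" by (simp add: \<Lambda>_def)
  have "0 <= exp (\<kappa> * fst z) * (psi (bd z))\<^sup>2" by simp
  with 2 L0 have "0 <= \<Lambda> * (exp (\<kappa> * fst z) * (psi (bd z))\<^sup>2)" "\<Lambda> * (exp (\<kappa> * fst z) * (psi (bd z))\<^sup>2) <= \<Lambda> * (exp (\<bar>\<kappa>\<bar> * T) * (bb ^ (mm + 1))\<^sup>2)"
   by (auto intro: mult_left_mono)
  then show ?thesis using 1 zero_le_power2[of "h z"] unfolding b_def mult.assoc by linarith
 qed
 have matb: "dd (1, V z) b z <= c * b z" if z: "z : G" for z
 proof -
  define p where "p = psi (bd z)"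
  define e where "e = \<Lambda> * exp (\<kappa> * fst z)"
  have "fst z \<ge> 0" using z by (simp add: G_def)
  moreover have "\<kappa> \<ge> 0" using M_pos C c1 by (simp add: \<kappa>_def c_def)
  ultimately have "exp (\<kappa> * fst z) \<ge> 1" by simp
  then have "1 * 1 <= e" unfolding e_def \<Lambda>_def by (intro mult_mono) auto
  then have e1: "e \<ge> 1" by simp
  have p0: "p > 0" using psi_bounds(3)[of "bd z"] bd_pos[OF G_D[OF z]] by (simp add: p_def)
  have dh: "h differentiable at z" and dp: "(%z. psi (bd z)) differentiable at z" and de: "(%z. exp (\<kappa> * fst z)) differentiable at z"
   using Ck1_differentiable[OF hG z] Ck1_differentiable[OF pG z] Ck1_differentiable[OF Cexp z] by auto
  have "dd (1, V z) (%z. exp (\<kappa> * fst z)) z = (\<kappa> * exp (\<kappa> * fst z)) * dd (1, V z) fst z"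
   by (rule dd_real_compose) (auto intro!: derivative_eq_intros bounded_linear_imp_differentiable bounded_linear_fst)
  then have dde: "dd (1, V z) (%z. exp (\<kappa> * fst z)) z = \<kappa> * exp (\<kappa> * fst z)"
   by (simp add: dd_bounded_linear[OF bounded_linear_fst])
  have "dd (1, V z) b z = 2 * h z * dd (1, V z) h z - (\<kappa> * e * p\<^sup>2 + e * (2 * p * dd (1, V z) (%z. psi (bd z)) z))"
  proof -
   have "dd (1, V z) b z = dd (1, V z) (%z. h z * h z - (\<Lambda> * exp (\<kappa> * fst z)) * (psi (bd z) * psi (bd z))) z"
    by (simp add: b_def[abs_def] power2_eq_square)
   also have "... = (h z * dd (1, V z) h z + dd (1, V z) h z * h z) -
     ((\<Lambda> * exp (\<kappa> * fst z)) * (psi (bd z) * dd (1, V z) (%z. psi (bd z)) z + dd (1, V z) (%z. psi (bd z)) z * psi (bd z))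
      + (\<Lambda> * (\<kappa> * exp (\<kappa> * fst z))) * (psi (bd z) * psi (bd z)))"
    using dd_diff[of "%z. h z * h z" z "%z. (\<Lambda> * exp (\<kappa> * fst z)) * (psi (bd z) * psi (bd z))" "(1, V z)"]
     dd_mult[OF dh dh, of "(1, V z)"] dd_mult[OF dp dp, of "(1, V z)"] dd_cmult[OF de, of "(1, V z)" \<Lambda>]
     dd_mult[of "%z. \<Lambda> * exp (\<kappa> * fst z)" z "%z. psi (bd z) * psi (bd z)" "(1, V z)"] dh dp de dde
    by (simp add: differentiable_mult)
   finally show ?thesis by (simp add: p_def e_def power2_eq_square algebra_simps)
  qed
  also have "... <= (2 * C * (h z)\<^sup>2 + c1 * ((h z)\<^sup>2 + p\<^sup>2)) - (\<kappa> * e * p\<^sup>2 - 2 * M * e * p\<^sup>2)"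
  proof -
   have "2 * h z * dd (1, V z) h z <= \<bar>2 * h z * dd (1, V z) h z\<bar>" by (rule abs_ge_self)
   also have "... = 2 * \<bar>h z\<bar> * \<bar>dd (1, V z) h z\<bar>" by (simp add: abs_mult)
   also have "... <= 2 * \<bar>h z\<bar> * (C * \<bar>h z\<bar> + c1 * p)" using math[OF z] by (intro mult_left_mono) (auto simp: p_def)
   also have "... = 2 * C * (h z)\<^sup>2 + c1 * (2 * \<bar>h z\<bar> * p)" by (simp add: power2_eq_square algebra_simps)
   also have "... <= 2 * C * (h z)\<^sup>2 + c1 * ((h z)\<^sup>2 + p\<^sup>2)"
    using sum_squares_bound[of "\<bar>h z\<bar>" p] c1 by (intro add_left_mono mult_left_mono) auto
   finally have 1: "2 * h z * dd (1, V z) h z <= 2 * C * (h z)\<^sup>2 + c1 * ((h z)\<^sup>2 + p\<^sup>2)" .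
   have "e * (2 * p) * (- M * p) <= e * (2 * p) * dd (1, V z) (%z. psi (bd z)) z"
    using matpsi[OF z] e1 p0 by (intro mult_left_mono) (auto simp: p_def)
   then show ?thesis using 1 by (simp add: power2_eq_square algebra_simps)
  qed
  also have "... = c * (h z)\<^sup>2 + c1 * p\<^sup>2 - (c + c1) * e * p\<^sup>2" by (simp add: c_def \<kappa>_def algebra_simps)
  also have "... <= c * (h z)\<^sup>2 - c * e * p\<^sup>2"
  proof -
   have "c1 * p\<^sup>2 * 1 <= c1 * p\<^sup>2 * e" using e1 c1 by (intro mult_left_mono) auto
   then show ?thesis by (simp add: algebra_simps)
  qed
  also have "... = c * b z" by (simp add: b_def p_def e_def algebra_simps)
  finally show ?thesis .
 qed
 have init: "b (0, x) <= 0" if x: "(0, x) : D" for x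
 proof -
  have "\<bar>h (0, x)\<bar> <= (bb ^ mm * L / k) * psi (bd (0, x))"
  proof (cases "bd (0, x) <= bb")
   case True
   have "\<bar>h (0, x)\<bar> <= bb ^ mm * (L * bd (0, x))" using hle[OF x] L(2)[OF x] bb by (meson mult_left_mono order.trans zero_le_power less_imp_le)
   also have "... <= bb ^ mm * (L * (psi (bd (0, x)) / k))" using bdpsi[OF x True] bb L(1) by (intro mult_left_mono) auto
   finally show ?thesis by simp
  next
   case False
   then show ?thesis using h0 psi_bounds(3)[of "bd (0, x)"] bd_pos[OF x] bb L k by simp
  qed
  then have "\<bar>h (0, x)\<bar>\<^sup>2 <= ((bb ^ mm * L / k) * psi (bd (0, x)))\<^sup>2" by (intro power_mono) auto
  also have "... <= \<Lambda> * (psi (bd (0, x)))\<^sup>2" unfolding power_mult_distrib by (intro mult_right_mono) (auto simp: \<Lambda>_def)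
  finally show ?thesis by (simp add: b_def)
 qed
 have bneg: "b z <= 0" if "z : G" for z
  by (rule maximum_principle[OF bD bdC bG matb init]) (use that in \<open>auto simp: G_def\<close>)
 define Q where "Q = \<Lambda> * exp (\<bar>\<kappa>\<bar> * T)"
 have Q: "Q > 0" by (simp add: Q_def \<Lambda>_def)
 define C2 where "C2 = sqrt Q * bb ^ mm / (3/8 * d0) ^ mm"
 show ?thesis
 proof (rule that[of C2])
  show "C2 > 0" using Q bb d0 by (simp add: C2_def)
  fix z assume z: "z : G" "bd z < d0 / 4"
  have b0: "bd z > 0" using bd_pos G_D z by blast
  have "\<kappa> * fst z <= \<bar>\<kappa>\<bar> * T" using z(1) by (intro mult_mono) (auto simp: G_def)
  then have "\<Lambda> * exp (\<kappa> * fst z) * (psi (bd z))\<^sup>2 <= Q * (psi (bd z))\<^sup>2"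
   unfolding Q_def by (intro mult_right_mono mult_left_mono) (auto simp: \<Lambda>_def)
  then have "(h z)\<^sup>2 <= Q * (psi (bd z))\<^sup>2" using bneg[OF z(1)] by (simp add: b_def)
  then have "\<bar>h z\<bar> <= sqrt Q * psi (bd z)"
  proof -
   have "\<bar>h z\<bar> <= sqrt (Q * (psi (bd z))\<^sup>2)" using \<open>(h z)\<^sup>2 <= Q * (psi (bd z))\<^sup>2\<close> by (intro real_le_rsqrt) simp
   also have "... = sqrt Q * psi (bd z)" using psi_bounds(3)[of "bd z"] b0 by (simp add: real_sqrt_mult)
   finally show ?thesis .
  qed
  also have "... <= sqrt Q * (bb ^ mm * bd z)" using psi_bounds(2)[of "bd z"] b0 Q by (intro mult_left_mono) auto
  finally have 1: "\<bar>h z\<bar> <= sqrt Q * bb ^ mm * bd z" by simp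
  have "(3/8 * d0) ^ mm <= th (bd z)" unfolding th_def using z d0 by (intro power_mono) (auto simp: bb_def)
  then have "(3/8 * d0) ^ mm * \<bar>bn z\<bar> <= \<bar>h z\<bar>" unfolding h_def abs_mult by (intro mult_right_mono) auto
  then have "(3/8 * d0) ^ mm * \<bar>bn z\<bar> <= sqrt Q * bb ^ mm * bd z" using 1 by simp
  then show "\<bar>bn z\<bar> <= C2 * bd z" using d0 by (simp add: C2_def field_simps)
 qed
qed

end

section \<open>An interior gradient estimate in L1\<close>

text \<open>Let \<open>m z = (1 - |z|\<^sup>2)\<^sub>+\<^sup>3\<close>, so that \<open>\<nabla>m z = - \<omega> z z\<close> with \<open>\<omega> z = 6 (1 - |z|\<^sup>2)\<^sub>+\<^sup>2\<close>. The
 average of \<open>\<partial>\<^sub>i u (x - r z)\<close> against \<open>\<omega>\<close> has \<open>r\<close>-derivative equal to the average of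
 \<open>\<Delta>u (x - r z)\<close> against \<open>\<partial>\<^sub>i m\<close>, which avoids the singular kernel of the Laplacian.\<close>

definition bump :: "nat => 'a::real_inner => real" where
 "bump k z = (max 0 (1 - z \<bullet> z)) ^ k"

lemma Ck_max_power:
 "Ck_on 1 UNIV (%s::real. (max 0 (1 - s)) ^ 2)" "Ck_on 2 UNIV (%s::real. (max 0 (1 - s)) ^ 3)"
proof -
 have "Ck_on (Suc 0) UNIV (%s::real. (max 0 (1 - s)) ^ Suc (Suc 0))"
  by (rule Ck_on_deriv[OF open_UNIV DERIV_max_power]) (auto intro!: continuous_intros)
 then show 1: "Ck_on 1 UNIV (%s::real. (max 0 (1 - s)) ^ 2)" by (simp add: numeral_2_eq_2)
 have "Ck_on (Suc 1) UNIV (%s::real. (max 0 (1 - s)) ^ Suc (Suc 1))"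
 proof (rule Ck_on_deriv[OF open_UNIV DERIV_max_power])
  have "Ck_on 1 UNIV (%s. - 3 * (max 0 (1 - s)) ^ 2 :: real)" by (intro Ck_on_mult open_UNIV Ck_on_const 1)
  then show "Ck_on 1 UNIV (%s. - real (Suc (Suc 1)) * max 0 (1 - s) ^ Suc 1)" by (simp add: numeral_2_eq_2)
 qed
 then show "Ck_on 2 UNIV (%s::real. (max 0 (1 - s)) ^ 3)" by (simp add: numeral_2_eq_2 numeral_3_eq_3)
qed

lemma Ck_bump:
 "Ck_on 1 UNIV (bump 2 :: 'a::euclidean_space => real)" "Ck_on 2 UNIV (bump 3 :: 'a => real)"
proof -
 have i: "Ck_on k UNIV (%z::'a. z \<bullet> z)" for k by (intro Ck_on_inner open_UNIV Ck_on_ident)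
 show "Ck_on 1 UNIV (bump 2 :: 'a => real)" "Ck_on 2 UNIV (bump 3 :: 'a => real)"
  unfolding bump_def[abs_def]
  using Ck_on_compose[OF open_UNIV i Ck_max_power(1)] Ck_on_compose[OF open_UNIV i Ck_max_power(2)] by auto
qed

lemma bump_zero: "(1::real) <= norm z ==> 0 < k ==> bump k z = 0"
proof -
 assume z: "1 <= norm z" and k: "0 < k"
 have "1 <= z \<bullet> z" using power_mono[OF z, of 2] by (simp add: dot_square_norm)
 then have "max 0 (1 - z \<bullet> z) = 0" by simp
 then show ?thesis using k unfolding bump_def by simp
qed

lemma bump_range: "0 <= bump k z & bump k z <= 1"
 by (auto simp: bump_def intro!: power_le_one)

lemma dd_bump:
 fixes z :: "'a::euclidean_space"
 shows "dd h (bump (Suc (Suc k))) z = - 2 * real (Suc (Suc k)) * bump (Suc k) z * (z \<bullet> h)"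
proof -
 have d: "(%z::'a. z \<bullet> z) differentiable at z" by (simp add: differentiable_inner)
 have "dd h (%z::'a. z \<bullet> z) z = 2 * (z \<bullet> h)"
  using dd_inner[of "%z. z" z "%z. z" h] dd_bounded_linear[OF bounded_linear_ident, of h z] by (simp add: inner_commute)
 then show ?thesis
  using dd_real_compose[OF d DERIV_max_power[of 1 k "z \<bullet> z"], of h] unfolding bump_def[abs_def] by simp
qed

lemma has_integral_translate:
 fixes h :: "'a::euclidean_space => real"
 assumes cont: "continuous_on UNIV h" and R: "!!x. h x ~= 0 ==> norm x <= R" and y: "norm y <= s"
 shows "((%x. h (x + y)) has_integral integral UNIV h) (cbox (- ((R + s) *\<^sub>R One)) ((R + s) *\<^sub>R One))"
  and "h integrable_on UNIV"
proof -
 define c where "c = (R + s) *\<^sub>R (One::'a)"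
 have sub: "x + w : cbox (-c) c" if "norm x <= R" "norm w <= s" for x w
 proof -
  have "\<bar>(x + w) \<bullet> i\<bar> <= R + s" if i: "i : Basis" for i
   using Basis_le_norm[OF i, of "x + w"] norm_triangle_ineq[of x w] \<open>norm x <= R\<close> \<open>norm w <= s\<close> by linarith
  then show ?thesis by (simp add: mem_box c_def abs_le_iff) force
 qed
 have box: "(h has_integral integral (cbox a b) h) (cbox a b)" for a b
  using cont by (intro integrable_integral integrable_continuous) (auto intro: continuous_on_subset)
 have s0: "0 <= s" using y norm_ge_zero order.trans by blast
 have U: "(h has_integral integral (cbox (-c) c) h) UNIV"
  by (rule has_integral_on_superset[OF box]) (use R sub[of _ 0] s0 in force)+
 then show "h integrable_on UNIV" by (rule has_integral_integrable)
 have "(h has_integral integral (cbox (-c + y) (c + y)) h) UNIV"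
 proof (rule has_integral_on_superset[OF box])
  fix x assume x: "x \<notin> cbox (-c + y) (c + y)"
  show "h x = 0"
  proof (rule ccontr)
   assume "h x ~= 0"
   then have "x - y : cbox (-c) c" using sub[of x "-y"] R y by simp
   then show False using x by (auto simp: mem_box inner_diff_left inner_add_left algebra_simps)
  qed
 qed simp
 then have "(h has_integral integral UNIV h) (cbox (-c + y) (c + y))"
  using box integral_unique by metis
 then have "((h \<circ> ((+) y)) has_integral integral UNIV h) (cbox (-c) c)" by (simp only: has_integral_shift_cbox_iff)
 then show "((%x. h (x + y)) has_integral integral UNIV h) (cbox (- ((R + s) *\<^sub>R One)) ((R + s) *\<^sub>R One))"
  by (simp add: o_def add.commute c_def)
qed

definition bump_mass :: "'n::finite itself => real" where
 "bump_mass _ = integral (cbox (-One) One) (%z::real^'n. 6 * bump 2 z)"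

lemma bump_mass_pos: "bump_mass TYPE('n::finite) > 0"
proof -
 have c: "continuous_on UNIV (%z::real^'n. 6 * bump 2 z)"
  using Ck_on_cont[OF Ck_bump(1)] by (intro continuous_intros)
 have nn: "0 <= bump_mass TYPE('n)" unfolding bump_mass_def using bump_range by (intro integral_nonneg integrable_continuous) (auto intro: continuous_on_subset[OF c])
 moreover have "bump_mass TYPE('n) ~= 0"
 proof
  assume z: "bump_mass TYPE('n) = 0"
  have "((%z::real^'n. 6 * bump 2 z) has_integral 0) (cbox (-One) One)"
   using integrable_integral[OF integrable_continuous[OF continuous_on_subset[OF c, of "cbox (-One) One"]]] z
   by (simp add: bump_mass_def)
  moreover have "0 : box (-One) (One::real^'n)" by (auto simp: mem_box)
  then have "box (-One) (One::real^'n) ~= {}" "0 : cbox (-One) (One::real^'n)" using box_subset_cbox by blast+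
  ultimately have "6 * bump 2 (0::real^'n) = 0"
   using has_integral_0_cbox_imp_0[OF continuous_on_subset[OF c subset_UNIV], of "-One" One 0]
    bump_range[THEN conjunct1] by auto
  then show False by (simp add: bump_def)
 qed
 ultimately show ?thesis by simp
qed

abbreviation ei :: "'n::finite => real^'n" where "ei i \<equiv> axis i 1"

lemma one_box: "norm (z::real^'n::finite) <= 1 ==> z : cbox (-One) One"
 using Basis_le_norm[of _ z] by (force simp: mem_box abs_le_iff)

text \<open>The average is evaluated at both ends: at \<open>r = 0\<close> it is
  \<open>bump_mass\<close> times the derivative at \<open>x\<close>; at \<open>r = rh\<close> one
  integration by parts moves the derivative onto the kernel and gains \<open>1 / rh\<close>. The
  fundamental theorem in \<open>r\<close> accounts for the difference.\<close>

lemma mean_gradient_identity: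
 fixes u :: "real^'n::finite => real"
 assumes u: "Ck_on 2 UNIV u" and rh: "rh > 0"
 defines "Q \<equiv> cbox (-One) (One::real^'n)"
 shows "bump_mass TYPE('n) * \<bar>dd (ei i) u x\<bar> <=
  (1 / rh) * integral Q (%z. \<bar>u (x - rh *\<^sub>R z)\<bar> * \<bar>dd (ei i) (%z. 6 * bump 2 z) z\<bar>) +
  integral {0..rh} (%r. integral Q (%z. \<bar>SUMU j. dd (ei j) (dd (ei j) u) (x - r *\<^sub>R z)\<bar> * \<bar>dd (ei i) (bump 3) z\<bar>))"
proof -
 define \<omega> where "\<omega> z = 6 * bump 2 z" for z :: "real^'n"
 define m where "m = (bump 3 :: real^'n => real)"
 define L where "L y = (SUMU j. dd (ei j) (dd (ei j) u) y)" for y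
 have C\<omega>: "Ck_on 1 UNIV \<omega>" unfolding \<omega>_def by (intro Ck_on_mult open_UNIV Ck_on_const Ck_bump)
 have Cm: "Ck_on 2 UNIV m" unfolding m_def by (rule Ck_bump)
 have Cdm: "Ck_on 1 UNIV (dd h m)" for h using Ck_on_dd[of 1 UNIV m h] Cm by (simp add: numeral_2_eq_2)
 have Cu1: "Ck_on 1 UNIV u" using Ck_on_le[OF u, of 1] by simp
 have Cdu: "Ck_on 1 UNIV (dd h u)" for h using Ck_on_dd[of 1 UNIV u h] u by (simp add: numeral_2_eq_2)
 have cddu: "continuous_on UNIV (dd k (dd h u))" for h k by (rule Ck1_continuous_dd[OF Cdu])
 have dm: "dd (ei j) m z = - (z $ j) * \<omega> z" for j z
  using dd_bump[of "ei j" 1 z] by (simp add: m_def \<omega>_def inner_axis numeral_3_eq_3 numeral_2_eq_2)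
 have supp: "norm z <= 1" if "f z ~= 0" "f = \<omega> \<or> (\<exists>h. f = dd h m)" for f z
 proof (rule ccontr)
  assume n: "\<not> norm z <= 1"
  have "dd h m z = - 6 * bump 2 z * (z \<bullet> h)" for h
   using dd_bump[of h 1 z] by (simp add: m_def numeral_3_eq_3 numeral_2_eq_2)
  then show False using that n bump_zero[of z 2] by (auto simp: \<omega>_def)
 qed
 have aff: "Ck_on k UNIV (%z. x - r *\<^sub>R z)" for k r
  by (intro Ck_on_diff_fun Ck_on_scaleR open_UNIV Ck_on_const Ck_on_ident)
 have shift: "dd h (%z. f (x - r *\<^sub>R z)) z = - r * dd h f (x - r *\<^sub>R z)" "(%z. f (x - r *\<^sub>R z)) differentiable at z"
  if "Ck_on 1 UNIV f" for f :: "real^'n => real" and h r z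
 proof -
  have df: "f differentiable at y" for y using Ck1_differentiable[OF that] by simp
  have da: "(%z. x - r *\<^sub>R z) differentiable at z" using Ck1_differentiable[OF aff] by simp
  have "((%z. x - r *\<^sub>R z) has_derivative (%h. - r *\<^sub>R h)) (at z)" by (auto intro!: derivative_eq_intros)
  then have "dd h (%z. x - r *\<^sub>R z) z = - r *\<^sub>R h" by (rule dd_eq)
  then show "dd h (%z. f (x - r *\<^sub>R z)) z = - r * dd h f (x - r *\<^sub>R z)"
   using dd_compose[OF da df, of h] dd_scale_dir[OF df, of "-r" h] by simp
  show "(%z. f (x - r *\<^sub>R z)) differentiable at z" using differentiable_compose[OF df da] by simp
 qed
 have Csh: "Ck_on 1 UNIV (%z. f (x - r *\<^sub>R z))" if "Ck_on 1 UNIV f" for f :: "real^'n => real" and r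
  by (rule Ck_on_compose[OF open_UNIV aff that]) simp
 have intQ: "f integrable_on Q" if "continuous_on UNIV f" for f :: "real^'n => real"
  unfolding Q_def by (intro integrable_continuous continuous_on_subset[OF that]) simp
 have UQ: "(f has_integral I) Q" if "(f has_integral I) UNIV" "!!z. f z ~= 0 ==> norm z <= 1" for f :: "real^'n => real" and I
 proof -
  have "((%z. if z : Q then f z else 0) has_integral I) UNIV"
   by (rule has_integral_eq[OF _ that(1)]) (use that(2) one_box in \<open>auto simp: Q_def\<close>)
  then show ?thesis by (simp only: has_integral_restrict_UNIV)
 qed
 have csh: "continuous_on UNIV (%z. f (x - r *\<^sub>R z))" if "continuous_on UNIV f" for f :: "real^'n => real" and r
  by (rule continuous_on_compose2[OF that]) (auto intro!: continuous_intros)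
 define A where "A r = integral Q (%z. dd (ei i) u (x - r *\<^sub>R z) * \<omega> z)" for r
 define A' where "A' r = integral Q (%z. L (x - r *\<^sub>R z) * dd (ei i) m z)" for r
 have c\<omega>: "continuous_on UNIV \<omega>" by (rule Ck_on_cont[OF C\<omega>])
 have cdm: "continuous_on UNIV (dd h m)" for h by (rule Ck_on_cont[OF Cdm])
 have cL: "continuous_on UNIV L" unfolding L_def by (intro continuous_on_sum cddu)
 have contA: "continuous_on {0..rh} A"
  unfolding A_def Q_def
 proof (rule integral_continuous_on_param)
  have "continuous_on ({0..rh} \<times> cbox (-One) One) (%p. dd (ei i) u (x - fst p *\<^sub>R snd p) * \<omega> (snd p))"
   by (intro continuous_on_mult continuous_on_compose2[OF Ck_on_cont[OF Cdu]] continuous_on_compose2[OF c\<omega>])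
    (auto intro!: continuous_intros)
  then show "continuous_on ({0..rh} \<times> cbox (-One) One) (%(r, z). dd (ei i) u (x - r *\<^sub>R z) * \<omega> z)"
   by (simp add: case_prod_beta')
 qed
 have derA: "(A has_vector_derivative A' r) (at r)" if r: "r : {0<..<rh}" for r
 proof -
  define D1 where "D1 r z = (SUMU j. dd (ei i) (dd (ei j) u) (x - r *\<^sub>R z) * dd (ei j) m z)" for r z
  have "(A has_vector_derivative integral (cbox (-One) One) (D1 r)) (at r within {0<..<rh})"
   unfolding A_def Q_def
  proof (rule leibniz_rule_vector_derivative)
   fix s :: real and z :: "real^'n"
   have da: "((%s. x - s *\<^sub>R z) has_derivative (%t. t *\<^sub>R (- z))) (at s)" by (auto intro!: derivative_eq_intros)
   have df: "dd (ei i) u differentiable at (x - s *\<^sub>R z)" using Ck1_differentiable[OF Cdu] by simp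
   have "((%s. dd (ei i) u (x + s *\<^sub>R (- z))) has_field_derivative dd (- z) (dd (ei i) u) (x + s *\<^sub>R (- z))) (at s)"
    by (rule has_field_derivative_line) (use df in simp)
   then have "((%s. dd (ei i) u (x - s *\<^sub>R z) * \<omega> z) has_field_derivative dd (- z) (dd (ei i) u) (x - s *\<^sub>R z) * \<omega> z) (at s)"
    using DERIV_cmult_right by fastforce
   moreover have "dd (- z) (dd (ei i) u) (x - s *\<^sub>R z) * \<omega> z = D1 s z"
   proof -
    have "dd (- z) (dd (ei i) u) (x - s *\<^sub>R z) = (SUMU j. - (z $ j) * dd (ei j) (dd (ei i) u) (x - s *\<^sub>R z))"
    proof -
     have "- z = (SUMU j. (- (z $ j)) *\<^sub>R ei j)"
      using basis_expansion[of "- z"] by (simp add: scalar_mult_eq_scaleR)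
     then show ?thesis using linear_sum[OF linear_dd[OF df], of "%j. (- (z $ j)) *\<^sub>R ei j" UNIV]
      by (simp only: linear_scale[OF linear_dd[OF df]] real_scaleR_def)
    qed
    also have "... * \<omega> z = (SUMU j. dd (ei j) (dd (ei i) u) (x - s *\<^sub>R z) * (- (z $ j) * \<omega> z))"
     by (simp add: sum_distrib_right sum_distrib_left mult_ac)
    finally show ?thesis using dd_commute[OF open_UNIV UNIV_I u] by (simp add: D1_def dm)
   qed
   ultimately show "((%s. dd (ei i) u (x - s *\<^sub>R z) * \<omega> z) has_vector_derivative D1 s z) (at s within {0<..<rh})"
    using has_real_derivative_iff_has_vector_derivative has_field_derivative_at_within by metis
  next
   fix s show "(%z. dd (ei i) u (x - s *\<^sub>R z) * \<omega> z) integrable_on cbox (-One) One"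
    using intQ[OF continuous_on_mult[OF csh[OF Ck_on_cont[OF Cdu]] c\<omega>]] by (simp add: Q_def)
  next
   have "continuous_on ({0<..<rh} \<times> cbox (-One) One) (%p. D1 (fst p) (snd p))"
    unfolding D1_def
    by (intro continuous_on_sum continuous_on_mult continuous_on_compose2[OF cddu] continuous_on_compose2[OF cdm])
     (auto intro!: continuous_intros)
   then show "continuous_on ({0<..<rh} \<times> cbox (-One) One) (%(r, z). D1 r z)" by (simp add: case_prod_beta')
  qed (use r in auto)
  then have 1: "(A has_vector_derivative integral Q (D1 r)) (at r)"
   unfolding Q_def by (subst (asm) at_within_open) (use r in auto)
  have "integral Q (D1 r) = A' r"
  proof -
   \<comment> \<open>The divergence that exchanges the index \<open>i\<close> of a second derivative
     of \<open>u\<close> for a Laplacian. Its integral vanishes, the second derivatives of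
     \<open>m\<close> cancel by symmetry, and \<open>- r\<close> times the difference of
     \<open>D1\<close> and the Laplacian term remains.\<close>
   define Y where "Y j k z = dd (ei j) u (x - r *\<^sub>R z) * dd (ei k) m z" for j k z
   have CY: "Ck_on 1 UNIV (Y j k)" for j k unfolding Y_def by (intro Ck_on_mult open_UNIV Csh Cdu Cdm)
   have Ysupp: "Y j k z ~= 0 ==> norm z <= 1" for j k z using supp[of "dd (ei k) m" z] by (auto simp: Y_def)
   have ddY: "dd (ei l) (Y j k) z = dd (ei j) u (x - r *\<^sub>R z) * dd (ei l) (dd (ei k) m) z - r * dd (ei l) (dd (ei j) u) (x - r *\<^sub>R z) * dd (ei k) m z" for j k l z
    unfolding Y_def using dd_mult[OF shift(2)[OF Cdu], of "dd (ei k) m" z "ei l"] Ck1_differentiable[OF Cdm] shift(1)[OF Cdu] by simp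
   have H1: "((%z. (SUMU j. dd (ei i) (Y j j) z - dd (ei j) (Y j i) z)) has_integral (\<Sum>j::'n\<in>UNIV. 0 - 0)) UNIV"
    by (intro has_integral_sum has_integral_diff has_integral_dd_zero[OF CY Ysupp]) auto
   have e: "(SUMU j. dd (ei i) (Y j j) z - dd (ei j) (Y j i) z) = (- r) * (D1 r z - L (x - r *\<^sub>R z) * dd (ei i) m z)" for z
    using dd_commute[OF open_UNIV UNIV_I Cm, of "ei i" _ z]
    by (simp add: ddY D1_def L_def sum_subtractf sum_negf sum_distrib_left sum_distrib_right right_diff_distrib mult_ac)
   have "((%z. (- r) * (D1 r z - L (x - r *\<^sub>R z) * dd (ei i) m z)) has_integral 0) UNIV"
    using H1 unfolding e by (simp only: diff_self sum.neutral_const)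
   from has_integral_mult_right[OF this, of "- (1 / r)"] r
   have "((%z. D1 r z - L (x - r *\<^sub>R z) * dd (ei i) m z) has_integral 0) UNIV"
    by (simp only: mult_zero_right mult.assoc[symmetric] minus_mult_minus divide_self_if times_divide_eq_left mult_1 if_False)
     (simp add: less_imp_neq[THEN not_sym] field_simps)
   then have I0: "((%z. D1 r z - L (x - r *\<^sub>R z) * dd (ei i) m z) has_integral 0) Q"
   proof (rule UQ)
    fix z assume nz: "D1 r z - L (x - r *\<^sub>R z) * dd (ei i) m z ~= 0"
    show "norm z <= 1"
    proof (rule ccontr)
     assume "\<not> norm z <= 1"
     then have "dd (ei k) m z = 0" for k using supp[of "dd (ei k) m" z] by auto
     then show False using nz by (simp add: D1_def)
    qed
   qed
   have iL: "(%z. L (x - r *\<^sub>R z) * dd (ei i) m z) integrable_on Q"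
    by (rule intQ[OF continuous_on_mult[OF csh[OF cL] cdm]])
   from has_integral_add[OF I0 integrable_integral[OF iL]]
   show ?thesis unfolding A'_def by (simp add: integral_unique)
  qed
  then show ?thesis using 1 by simp
 qed
 have FTC: "(A' has_integral (A rh - A 0)) {0..rh}"
  by (rule fundamental_theorem_of_calculus_interior[OF _ contA derA]) (use rh in auto)
 have A0: "A 0 = bump_mass TYPE('n) * dd (ei i) u x"
  by (simp add: A_def bump_mass_def \<omega>_def Q_def mult.commute)
 have Arh: "A rh = (1 / rh) * integral Q (%z. u (x - rh *\<^sub>R z) * dd (ei i) \<omega> z)"
 proof -
  have C: "Ck_on 1 UNIV (%z. u (x - rh *\<^sub>R z) * \<omega> z)" by (intro Ck_on_mult open_UNIV Csh Cu1 C\<omega>)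
  have "(dd (ei i) (%z. u (x - rh *\<^sub>R z) * \<omega> z) has_integral 0) UNIV"
   by (rule has_integral_dd_zero[OF C, of 1]) (use supp[of \<omega>] in auto)
  then have H: "(dd (ei i) (%z. u (x - rh *\<^sub>R z) * \<omega> z) has_integral 0) Q"
  proof (rule UQ)
   fix z assume nz: "dd (ei i) (%z. u (x - rh *\<^sub>R z) * \<omega> z) z ~= 0"
   show "norm z <= 1"
   proof (rule ccontr)
    assume n: "\<not> norm z <= 1"
    have "dd (ei i) (%z. u (x - rh *\<^sub>R z) * \<omega> z) z = dd (ei i) (%z. 0::real) z"
     by (rule dd_cong_open[of "- cball 0 1"]) (use n supp[of \<omega>] in \<open>auto simp: open_Compl\<close>)
    then show False using nz by simp
   qed
  qed
  have e: "dd (ei i) (%z. u (x - rh *\<^sub>R z) * \<omega> z) z =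
    u (x - rh *\<^sub>R z) * dd (ei i) \<omega> z - rh * (dd (ei i) u (x - rh *\<^sub>R z) * \<omega> z)" for z
   using dd_mult[OF shift(2)[OF Cu1], of \<omega> z "ei i"] Ck1_differentiable[OF C\<omega>] shift(1)[OF Cu1] by simp
  have I: "((%z. u (x - rh *\<^sub>R z) * dd (ei i) \<omega> z - rh * (dd (ei i) u (x - rh *\<^sub>R z) * \<omega> z)) has_integral 0) Q"
   by (rule has_integral_eq[OF _ H]) (rule e)
  have i1: "(%z. dd (ei i) u (x - rh *\<^sub>R z) * \<omega> z) integrable_on Q"
   by (rule intQ[OF continuous_on_mult[OF csh[OF Ck_on_cont[OF Cdu]] c\<omega>]])
  from has_integral_add[OF I has_integral_mult_right[OF integrable_integral[OF i1], of rh]]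
  have "integral Q (%z. u (x - rh *\<^sub>R z) * dd (ei i) \<omega> z) = rh * A rh"
   unfolding A_def by (simp add: integral_unique)
  then show ?thesis using rh by simp
 qed
 have cd\<omega>: "continuous_on UNIV (dd (ei i) \<omega>)" by (rule Ck1_continuous_dd[OF C\<omega>])
 have b1: "\<bar>integral Q (%z. u (x - rh *\<^sub>R z) * dd (ei i) \<omega> z)\<bar> <= integral Q (%z. \<bar>u (x - rh *\<^sub>R z)\<bar> * \<bar>dd (ei i) \<omega> z\<bar>)"
  using integral_norm_bound_integral[of "%z. u (x - rh *\<^sub>R z) * dd (ei i) \<omega> z" Q "%z. \<bar>u (x - rh *\<^sub>R z)\<bar> * \<bar>dd (ei i) \<omega> z\<bar>"]
   intQ[OF continuous_on_mult[OF csh[OF Ck_on_cont[OF Cu1]] cd\<omega>]]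
   intQ[OF continuous_on_mult[OF continuous_on_rabs[OF csh[OF Ck_on_cont[OF Cu1]]] continuous_on_rabs[OF cd\<omega>]]]
  by (simp add: abs_mult)
 have b2: "\<bar>A' r\<bar> <= integral Q (%z. \<bar>L (x - r *\<^sub>R z)\<bar> * \<bar>dd (ei i) m z\<bar>)" for r
  using integral_norm_bound_integral[of "%z. L (x - r *\<^sub>R z) * dd (ei i) m z" Q "%z. \<bar>L (x - r *\<^sub>R z)\<bar> * \<bar>dd (ei i) m z\<bar>"]
   intQ[OF continuous_on_mult[OF csh[OF cL] cdm]]
   intQ[OF continuous_on_mult[OF continuous_on_rabs[OF csh[OF cL]] continuous_on_rabs[OF cdm]]]
  by (simp add: A'_def abs_mult)
 have "continuous_on {0..rh} (%r. integral Q (%z. \<bar>L (x - r *\<^sub>R z)\<bar> * \<bar>dd (ei i) m z\<bar>))"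
  unfolding Q_def
 proof (rule integral_continuous_on_param)
  have "continuous_on ({0..rh} \<times> cbox (-One) One) (%p. \<bar>L (x - fst p *\<^sub>R snd p)\<bar> * \<bar>dd (ei i) m (snd p)\<bar>)"
   by (intro continuous_on_mult continuous_on_rabs continuous_on_compose2[OF cL] continuous_on_compose2[OF cdm])
    (auto intro!: continuous_intros)
  then show "continuous_on ({0..rh} \<times> cbox (-One) One) (%(r, z). \<bar>L (x - r *\<^sub>R z)\<bar> * \<bar>dd (ei i) m z\<bar>)"
   by (simp add: case_prod_beta')
 qed
 then have i2: "(%r. integral Q (%z. \<bar>L (x - r *\<^sub>R z)\<bar> * \<bar>dd (ei i) m z\<bar>)) integrable_on {0..rh}"
  using integrable_continuous_interval by blast
 have b3: "\<bar>A rh - A 0\<bar> <= integral {0..rh} (%r. integral Q (%z. \<bar>L (x - r *\<^sub>R z)\<bar> * \<bar>dd (ei i) m z\<bar>))"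
  using integral_norm_bound_integral[OF has_integral_integrable[OF FTC] i2] b2 integral_unique[OF FTC] by simp
 have "bump_mass TYPE('n) * \<bar>dd (ei i) u x\<bar> = \<bar>A 0\<bar>" using A0 bump_mass_pos[where 'n='n] by (simp add: abs_mult)
 also have "... <= \<bar>A rh\<bar> + \<bar>A rh - A 0\<bar>" by linarith
 also have "\<bar>A rh\<bar> <= (1 / rh) * integral Q (%z. \<bar>u (x - rh *\<^sub>R z)\<bar> * \<bar>dd (ei i) \<omega> z\<bar>)"
  using b1 rh by (simp add: Arh abs_mult divide_right_mono)
 finally show ?thesis using b3 unfolding \<omega>_def[abs_def] m_def L_def Q_def by simp
qed

lemma integrable_abs_mult_swap:
 fixes f :: "'a::euclidean_space => 'b::euclidean_space => real"
 assumes "continuous_on UNIV (%p. f (fst p) (snd p))"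
 shows "integral (cbox a b) (%x. integral (cbox c d) (f x)) = integral (cbox c d) (%y. integral (cbox a b) (%x. f x y))"
  "(%x. integral (cbox c d) (f x)) integrable_on cbox a b"
  "(%y. integral (cbox a b) (%x. f x y)) integrable_on cbox c d"
  "f x integrable_on cbox c d" "(%x. f x y) integrable_on cbox a b"
proof -
 have c: "continuous_on S (%(x, y). f x y)" for S
  using continuous_on_subset[OF assms subset_UNIV] by (simp add: case_prod_beta')
 show "integral (cbox a b) (%x. integral (cbox c d) (f x)) = integral (cbox c d) (%y. integral (cbox a b) (%x. f x y))"
  by (rule integral_swap_continuous[OF c])
 show "(%x. integral (cbox c d) (f x)) integrable_on cbox a b"
  by (rule integrable_continuous[OF integral_continuous_on_param[OF c]])
 have "continuous_on UNIV (%p. f (snd p) (fst p))"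
  using continuous_on_compose2[OF assms, of UNIV "%p. (snd p, fst p)"] by (simp add: continuous_on_Pair continuous_on_fst continuous_on_snd continuous_on_id)
 then have c': "continuous_on S (%(y, x). f x y)" for S
  using continuous_on_subset[OF _ subset_UNIV] by (simp add: case_prod_beta')
 show "(%y. integral (cbox a b) (%x. f x y)) integrable_on cbox c d"
  by (rule integrable_continuous[OF integral_continuous_on_param[OF c']])
 have "continuous_on UNIV (f x)"
  using continuous_on_compose2[OF assms, of UNIV "%y. (x, y)"] by (simp add: continuous_on_Pair continuous_on_id)
 then show "f x integrable_on cbox c d" using integrable_continuous continuous_on_subset subset_UNIV by blast
 have "continuous_on UNIV (%x. f x y)"
  using continuous_on_compose2[OF assms, of UNIV "%x. (x, y)"] by (simp add: continuous_on_Pair continuous_on_id)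
 then show "(%x. f x y) integrable_on cbox a b" using integrable_continuous continuous_on_subset subset_UNIV by blast
qed

text \<open>After exchanging the integrals, a translation by \<open>r z\<close> moves the shift from
  \<open>w\<close> to the weight, where the majorant \<open>U\<close> takes care of it. The power of
  2 is the volume of the box of integration in \<open>z\<close>.\<close>

lemma average_integral_le:
 fixes w k :: "real^'n::finite => real" and \<alpha> :: "real^'n => real"
 assumes w: "continuous_on UNIV w" and R: "!!x. w x ~= 0 ==> norm x <= R"
  and \<alpha>: "continuous_on UNIV \<alpha>" "!!x. 0 <= \<alpha> x"
  and k: "continuous_on UNIV k" "!!z. \<bar>k z\<bar> <= Ck" "!!z. k z ~= 0 ==> norm z <= 1"
  and U: "U integrable_on UNIV" "!!x y. norm y <= rh ==> \<alpha> (x + y) * \<bar>w x\<bar> <= U x" and r: "0 <= r" "r <= rh"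
 shows "integral (cbox (- ((R + rh) *\<^sub>R One)) ((R + rh) *\<^sub>R One)) (%x. integral (cbox (-One) (One::real^'n)) (%z. \<alpha> x * (\<bar>w (x - r *\<^sub>R z)\<bar> * \<bar>k z\<bar>)))
  <= 2 ^ CARD('n) * Ck * integral UNIV U"
proof -
 define f where "f x z = \<alpha> x * (\<bar>w (x - r *\<^sub>R z)\<bar> * \<bar>k z\<bar>)" for x z
 let ?B = "cbox (- ((R + rh) *\<^sub>R One)) ((R + rh) *\<^sub>R (One::real^'n))" and ?Q = "cbox (-One) (One::real^'n)"
 have cf: "continuous_on UNIV (%p. f (fst p) (snd p))"
  unfolding f_def
  by (intro continuous_on_mult continuous_on_rabs continuous_on_compose2[OF \<alpha>(1)] continuous_on_compose2[OF w] continuous_on_compose2[OF k(1)])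
   (auto intro!: continuous_intros)
 note sw = integrable_abs_mult_swap[OF cf]
 have U0: "0 <= U x" for x using U(2)[of 0 x] \<alpha>(2)[of x] r by (auto intro: order.trans[rotated])
 have Ck0: "0 <= Ck" using k(2)[of 0] by linarith
 have IU: "0 <= integral UNIV U" using U0 U(1) by (intro integral_nonneg) auto
 have inner: "integral ?B (%x. f x z) <= Ck * integral UNIV U" for z
 proof (cases "norm z <= 1")
  case False
  then have "k z = 0" using k(3) by blast
  then show ?thesis using IU Ck0 by (simp add: f_def)
 next
  case True
  define h where "h y = \<alpha> (y + r *\<^sub>R z) * \<bar>w y\<bar>" for y
  have rz: "norm (- (r *\<^sub>R z)) <= rh"
   using mult_mono[OF r(2) True] r by simp
  have ch: "continuous_on UNIV h" unfolding h_def
   by (intro continuous_on_mult continuous_on_rabs w continuous_on_compose2[OF \<alpha>(1)]) (auto intro!: continuous_intros)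
  have hR: "norm y <= R" if "h y ~= 0" for y using that R[of y] by (auto simp: h_def)
  note tr = has_integral_translate[OF ch hR rz]
  have "integral ?B (%x. f x z) = integral ?B (%x. \<bar>k z\<bar> * h (x + - (r *\<^sub>R z)))"
   by (rule integral_cong) (simp add: f_def h_def)
  also have "... = \<bar>k z\<bar> * integral UNIV h"
   using has_integral_mult_right[OF tr(1), of "\<bar>k z\<bar>"] by (rule integral_unique)
  also have "... <= Ck * integral UNIV U"
  proof (rule mult_mono)
   show "integral UNIV h <= integral UNIV U"
   proof (rule integral_le[OF tr(2) U(1)])
    fix x show "h x <= U x" using U(2)[of "r *\<^sub>R z" x] rz unfolding h_def norm_minus_cancel by blast
   qed
   show "0 <= integral UNIV h" using tr(2) \<alpha>(2) by (intro integral_nonneg) (auto simp: h_def)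
  qed (use k(2) Ck0 in auto)
  finally show ?thesis .
 qed
 have "integral ?B (%x. integral ?Q (f x)) = integral ?Q (%z. integral ?B (%x. f x z))" by (rule sw(1))
 also have "... <= integral ?Q (%z. Ck * integral UNIV U)"
  by (rule integral_le[OF sw(3)]) (use inner in auto)
 also have "... = measure lborel ?Q * (Ck * integral UNIV U)" by simp
 also have "measure lborel ?Q = 2 ^ CARD('n)"
  by (subst content_cbox) (auto simp: inner_diff_left)
 finally show ?thesis unfolding f_def by (simp add: mult.assoc)
qed

text \<open>The identity for the gradient at a point, integrated against the weight
  \<open>\<alpha>\<close>. The integrable majorants \<open>U\<close> and \<open>W\<close> replace
  suprema of the weight over balls; 24 and 6 bound the derivatives of the two kernels, and the
  integration over \<open>r\<close> supplies the factor \<open>rh\<close>.\<close>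

lemma L1_gradient_estimate:
 fixes u :: "real^'n::finite => real"
 assumes u: "Ck_on 2 UNIV u" and R: "!!x. u x ~= 0 ==> norm x <= R" and rh: "rh > 0"
  and \<alpha>: "continuous_on UNIV \<alpha>" "!!x. 0 <= \<alpha> x"
  and U: "U integrable_on UNIV" "!!x y. norm y <= rh ==> \<alpha> (x + y) * \<bar>u x\<bar> <= U x"
  and W: "W integrable_on UNIV" "!!x y. norm y <= rh ==> \<alpha> (x + y) * \<bar>SUMU j. dd (ei j) (dd (ei j) u) x\<bar> <= W x"
 shows "bump_mass TYPE('n) * integral UNIV (%x. \<alpha> x * \<bar>dd (ei i) u x\<bar>) <=
  2 ^ CARD('n) * (24 / rh * integral UNIV U + 6 * rh * integral UNIV W)"
proof -
 define L where "L y = (SUMU j. dd (ei j) (dd (ei j) u) y)" for y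
 let ?B = "cbox (- ((R + rh) *\<^sub>R One)) ((R + rh) *\<^sub>R (One::real^'n))" and ?Q = "cbox (-One) (One::real^'n)"
 define k1 where "k1 = dd (ei i) (%z::real^'n. 6 * bump 2 z)"
 define k2 where "k2 = dd (ei i) (bump 3 :: real^'n => real)"
 have Cdu: "Ck_on 1 UNIV (dd h u)" for h using Ck_on_dd[of 1 UNIV u h] u by (simp add: numeral_2_eq_2)
 have cL: "continuous_on UNIV L" unfolding L_def by (intro continuous_on_sum Ck1_continuous_dd Cdu)
 have dd0: "dd h f x = 0" if "norm x > R" "!!y. f y ~= 0 ==> norm y <= R" for h x and f :: "real^'n => real"
 proof -
  have "dd h f x = dd h (%y. 0::real) x"
   by (rule dd_cong_open[of "- cball 0 R"]) (use that in \<open>auto simp: open_Compl\<close>)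
  then show ?thesis by simp
 qed
 have duR: "norm x <= R" if "dd h u x ~= 0" for h x using dd0[of x u h] R that by fastforce
 have LR: "norm x <= R" if "L x ~= 0" for x
 proof (rule ccontr)
  assume "\<not> norm x <= R"
  then have "dd (ei j) (dd (ei j) u) x = 0" for j using dd0[of x "dd (ei j) u" "ei j"] duR by auto
  then show False using that by (simp add: L_def)
 qed
 have C6: "Ck_on 1 UNIV (%z::real^'n. 6 * bump 2 z)" by (intro Ck_on_mult open_UNIV Ck_on_const Ck_bump)
 have Cb: "Ck_on 1 UNIV (bump 3 :: real^'n => real)" using Ck_on_le[OF Ck_bump(2), of 1] by simp
 have ck: "continuous_on UNIV k1" "continuous_on UNIV k2" unfolding k1_def k2_def
  by (intro Ck1_continuous_dd C6 Cb)+
 have k1e: "k1 z = - 24 * bump 1 z * z $ i" and k2e: "k2 z = - 6 * bump 2 z * z $ i" for z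
  using dd_bump[of "ei i" 0 z] dd_bump[of "ei i" 1 z] dd_cmult[OF Ck1_differentiable[OF Ck_bump(1)], of z "ei i" 6]
  by (simp_all add: k1_def k2_def inner_axis numeral_3_eq_3 numeral_2_eq_2)
 have ks: "norm z <= 1" if "k1 z ~= 0 \<or> k2 z ~= 0" for z
  using that bump_zero[of z 1] bump_zero[of z 2] by (cases "norm z <= 1") (auto simp: k1e k2e)
 have kb: "\<bar>k1 z\<bar> <= 24" "\<bar>k2 z\<bar> <= 6" for z
 proof -
  have b: "\<bar>bump k z * z $ i\<bar> <= 1" if "0 < k" for k
  proof (cases "norm z <= 1")
   case True
   then have "\<bar>z $ i\<bar> <= 1" using component_le_norm_cart[of z i] by linarith
   then show ?thesis unfolding abs_mult using bump_range[of k z] by (intro mult_le_one) auto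
  next
   case False
   then show ?thesis using bump_zero[of z k] that by simp
  qed
  show "\<bar>k1 z\<bar> <= 24" "\<bar>k2 z\<bar> <= 6" using b[of 1] b[of 2] by (simp_all add: k1e k2e abs_mult)
 qed
 define F1 where "F1 x = integral ?Q (%z. \<alpha> x * (\<bar>u (x - rh *\<^sub>R z)\<bar> * \<bar>k1 z\<bar>))" for x
 define F2 where "F2 x r = integral ?Q (%z. \<alpha> x * (\<bar>L (x - r *\<^sub>R z)\<bar> * \<bar>k2 z\<bar>))" for x r
 have cu: "continuous_on UNIV u" by (rule Ck_on_cont[OF u])
 have iF1: "F1 integrable_on ?B" unfolding F1_def
  by (rule integrable_abs_mult_swap(2), intro continuous_on_mult continuous_on_rabs continuous_on_compose2[OF \<alpha>(1)] continuous_on_compose2[OF cu] continuous_on_compose2[OF ck(1)])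
   (auto intro!: continuous_intros)
 have iF1': "(%x. (1 / rh) * F1 x) integrable_on ?B"
  by (rule has_integral_integrable[OF has_integral_mult_right[OF integrable_integral[OF iF1]]])
 have cF2: "continuous_on UNIV (%p. F2 (fst p) (snd p))"
  unfolding F2_def
 proof (rule integral_continuous_on_param)
  have "continuous_on (UNIV \<times> ?Q) (%q. \<alpha> (fst (fst q)) * (\<bar>L (fst (fst q) - snd (fst q) *\<^sub>R snd q)\<bar> * \<bar>k2 (snd q)\<bar>))"
   by (intro continuous_on_mult continuous_on_rabs continuous_on_compose2[OF \<alpha>(1)] continuous_on_compose2[OF cL] continuous_on_compose2[OF ck(2)])
    (auto intro!: continuous_intros)
  then show "continuous_on (UNIV \<times> ?Q) (%(p, z). \<alpha> (fst p) * (\<bar>L (fst p - snd p *\<^sub>R z)\<bar> * \<bar>k2 z\<bar>))"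
   by (simp add: case_prod_beta')
 qed
 note sw = integrable_abs_mult_swap[OF cF2]
 have pt: "bump_mass TYPE('n) * (\<alpha> x * \<bar>dd (ei i) u x\<bar>) <= (1 / rh) * F1 x + integral (cbox 0 rh) (F2 x)" for x
 proof -
  have "\<alpha> x * (bump_mass TYPE('n) * \<bar>dd (ei i) u x\<bar>) <= \<alpha> x * ((1 / rh) * integral ?Q (%z. \<bar>u (x - rh *\<^sub>R z)\<bar> * \<bar>k1 z\<bar>) +
    integral {0..rh} (%r. integral ?Q (%z. \<bar>L (x - r *\<^sub>R z)\<bar> * \<bar>k2 z\<bar>)))"
   using mean_gradient_identity[OF u rh, of i x] \<alpha>(2)[of x] unfolding k1_def k2_def L_def by (rule mult_left_mono)
  also have "... = (1 / rh) * F1 x + integral (cbox 0 rh) (F2 x)"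
   unfolding F1_def F2_def by (simp add: algebra_simps)
  finally show ?thesis by (simp add: mult_ac)
 qed
 define g where "g x = \<alpha> x * \<bar>dd (ei i) u x\<bar>" for x
 have cg: "continuous_on UNIV g" unfolding g_def
  by (intro continuous_on_mult continuous_on_rabs \<alpha>(1) Ck_on_cont[OF Cdu])
 have gR: "norm x <= R" if "g x ~= 0" for x using that duR[of "ei i" x] by (auto simp: g_def)
 have gB: "(g has_integral integral UNIV g) ?B"
  using has_integral_translate(1)[OF cg gR, of 0 rh] rh by simp
 have "bump_mass TYPE('n) * integral UNIV g = integral ?B (%x. bump_mass TYPE('n) * g x)"
  by (rule integral_unique[OF has_integral_mult_right[OF gB], symmetric])
 also have "... <= integral ?B (%x. (1 / rh) * F1 x + integral (cbox 0 rh) (F2 x))"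
 proof (rule integral_le)
  show "(%x. bump_mass TYPE('n) * g x) integrable_on ?B" by (rule has_integral_integrable[OF has_integral_mult_right[OF gB]])
  show "(%x. (1 / rh) * F1 x + integral (cbox 0 rh) (F2 x)) integrable_on ?B"
   by (rule integrable_add[OF iF1' sw(2)])
 qed (use pt in \<open>simp add: g_def\<close>)
 also have "... = (1 / rh) * integral ?B F1 + integral ?B (%x. integral (cbox 0 rh) (F2 x))"
  by (subst integral_add[OF iF1' sw(2)]) simp
 also have "integral ?B (%x. integral (cbox 0 rh) (F2 x)) = integral (cbox 0 rh) (%r. integral ?B (%x. F2 x r))" by (rule sw(1))
 also have "... <= integral (cbox 0 rh) (%r. 2 ^ CARD('n) * 6 * integral UNIV W)"
 proof (rule integral_le[OF sw(3)])
  fix r assume "r : cbox 0 rh"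
  then show "integral ?B (%x. F2 x r) <= 2 ^ CARD('n) * 6 * integral UNIV W"
   unfolding F2_def using average_integral_le[OF cL LR \<alpha> ck(2) kb(2) _ W(1)] W(2) ks by (simp add: L_def)
 qed auto
 also have "... = rh * (2 ^ CARD('n) * 6 * integral UNIV W)" using rh by simp
 also have "integral ?B F1 <= 2 ^ CARD('n) * 24 * integral UNIV U"
  unfolding F1_def by (rule average_integral_le[OF cu R \<alpha> ck(1) kb(1) _ U]) (use ks rh in auto)
 finally show ?thesis using rh unfolding g_def by (simp add: algebra_simps divide_right_mono)
qed

section \<open>Estimates near the boundary at a fixed time\<close>

definition cut_deriv_bound :: "(real => real) => real" where
 "cut_deriv_bound \<eta> = (SOME c. c > 0 & (\<forall>s. \<bar>dd 1 \<eta> s\<bar> <= c))"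

lemma cut_deriv_bound:
 assumes "cutoff d0 \<eta>"
 shows "cut_deriv_bound \<eta> > 0" "\<bar>dd 1 \<eta> s\<bar> <= cut_deriv_bound \<eta>"
proof -
 have "\<exists>c. c > 0 & (\<forall>s. \<bar>dd 1 \<eta> s\<bar> <= c)" using cutoff_deriv_bound[OF assms] by metis
 from someI_ex[OF this] show "cut_deriv_bound \<eta> > 0" "\<bar>dd 1 \<eta> s\<bar> <= cut_deriv_bound \<eta>"
  unfolding cut_deriv_bound_def by auto
qed

text \<open>Defined outside the locale so that it visibly depends on the dimension,
  \<open>d0\<close> and \<open>\<eta>\<close> only; \<open>m\<close> and \<open>b\<close> repeat
  \<open>mm\<close> and \<open>bb\<close>. The first summand is the mean value part, fed by Kato's
  inequality with \<open>k\<close> a lower bound of its weight, the second comes from the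
  Laplacian.\<close>

definition strip_const :: "'n::finite itself => real => (real => real) => real" where
 "strip_const _ d0 \<eta> = (let m = 7 * CARD('n); b = 5/8 * d0; k = real m / 2 * (d0 / 16) ^ (m - 1); c = cut_deriv_bound \<eta> in
   2 ^ CARD('n) * (24 / (d0 / 16) * (c / k * b ^ (m + 1)) + 6 * (d0 / 16) * c) / bump_mass TYPE('n))"

context mhd_flow
begin

definition gV :: "real \<times> (real^'n) => real" where "gV z = (SUMU i. SUMU k. (px i (Vc k) z)\<^sup>2)"
definition gB :: "real \<times> (real^'n) => real" where "gB z = (SUMU i. SUMU k. (px i (Bc k) z)\<^sup>2)"
definition LapP :: "real \<times> (real^'n) => real" where "LapP z = (SUMU k. px k (px k P) z)"

lemma gV_nonneg: "0 <= gV z" and gB_nonneg: "0 <= gB z"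
 by (simp_all add: gV_def gB_def sum_nonneg)

text \<open>The trace of the differentiated momentum equation: the material derivative of
  \<open>div v\<close> vanishes, and so does the derivative of \<open>div B\<close> along
  \<open>B\<close>.\<close>

lemma LapP_eq:
 assumes z: "z : G"
 shows "LapP z = - (SUMU k. SUMU l. px k (Vc l) z * px l (Vc k) z) + (SUMU k. SUMU l. px k (Bc l) z * px l (Bc k) z) / (4 * pi)"
proof -
 note zd = G_dom[OF z]
 have "(SUMU k. dd (1, V z) (px k (Vc k)) z) = dd (1, V z) (%z. SUMU k. px k (Vc k) z) z"
  by (rule dd_sum[symmetric]) (rule diff_dVc[OF zd])
 also have "... = dd (1, V z) (%z. 0::real) z"
  by (rule dd_cong_open[OF open_G z]) (simp add: div_V G_D)
 finally have 1: "(SUMU k. dd (1, V z) (px k (Vc k)) z) = 0" by simp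
 have 2: "(SUMU k. px l (px k (Bc k)) z) = 0" for l
 proof -
  have "(SUMU k. px l (px k (Bc k)) z) = px l (%z. SUMU k. px k (Bc k) z) z"
   by (rule dd_sum[symmetric]) (rule diff_dBc[OF zd])
  also have "... = px l (%z. 0::real) z" by (rule dd_cong_open[OF open_G z]) (simp add: div_B)
  finally show ?thesis by simp
 qed
 have "(SUMU k. SUMU l. Bc l z * px l (px k (Bc k)) z) = (SUMU l. Bc l z * (SUMU k. px l (px k (Bc k)) z))"
  by (subst sum.swap) (simp add: sum_distrib_left)
 then have 3: "(SUMU k. SUMU l. Bc l z * px l (px k (Bc k)) z) = 0" using 2 by simp
 have "(SUMU k. dd (1, V z) (px k (Vc k)) z) = - LapP z
  + ((SUMU k. SUMU l. Bc l z * px l (px k (Bc k)) z) + (SUMU k. SUMU l. px k (Bc l) z * px l (Bc k) z)) / (4 * pi)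
  - (SUMU k. SUMU l. px k (Vc l) z * px l (Vc k) z)"
  using Dt_dV[OF z] by (simp add: LapP_def sum.distrib sum_subtractf sum_negf sum_divide_distrib[symmetric])
 then show ?thesis using 1 3 by simp
qed

lemma abs_sum_transpose_le:
 fixes a :: "'n => 'n => real"
 shows "\<bar>SUMU i. SUMU k. a i k * a k i\<bar> <= (SUMU i. SUMU k. (a i k)\<^sup>2)"
proof -
 have "\<bar>SUMU i. SUMU k. a i k * a k i\<bar> <= (SUMU i. SUMU k. \<bar>a i k * a k i\<bar>)"
  by (rule order.trans[OF sum_abs]) (intro sum_mono sum_abs)
 also have "... <= (SUMU i. SUMU k. ((a i k)\<^sup>2 + (a k i)\<^sup>2) / 2)"
 proof (intro sum_mono)
  fix i k
  show "\<bar>a i k * a k i\<bar> <= ((a i k)\<^sup>2 + (a k i)\<^sup>2) / 2"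
   using sum_squares_bound[of "\<bar>a i k\<bar>" "\<bar>a k i\<bar>"] by (simp add: abs_mult)
 qed
 also have "... = ((SUMU i. SUMU k. (a i k)\<^sup>2) + (SUMU i. SUMU k. (a k i)\<^sup>2)) / 2"
  by (simp add: sum.distrib sum_divide_distrib[symmetric])
 also have "(SUMU i. SUMU k. (a k i)\<^sup>2) = (SUMU i. SUMU k. (a i k)\<^sup>2)" by (rule sum.swap)
 finally show ?thesis by simp
qed

lemma abs_LapP_le: "z : G ==> \<bar>LapP z\<bar> <= gV z + gB z"
proof -
 assume z: "z : G"
 define a b where "a = (SUMU k. SUMU l. px k (Vc l) z * px l (Vc k) z)" and "b = (SUMU k. SUMU l. px k (Bc l) z * px l (Bc k) z)"
 have "\<bar>a\<bar> <= gV z" "\<bar>b\<bar> <= gB z"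
  using abs_sum_transpose_le[of "%i k. px i (Vc k) z"] abs_sum_transpose_le[of "%i k. px i (Bc k) z"]
  by (auto simp: a_def b_def gV_def gB_def)
 moreover have "\<bar>b / (4 * pi)\<bar> <= \<bar>b\<bar>" using pi_gt3 by (simp add: divide_simps mult_le_cancel_left1)
 ultimately show ?thesis unfolding LapP_eq[OF z] a_def[symmetric] b_def[symmetric] by linarith
qed

section \<open>The weighted flux along the normal\<close>

definition kap :: "real => real" where "kap s = real mm / 2 * (max 0 (bb - s)) ^ (mm - 1)"

lemma kap_nonneg: "0 <= kap s" by (simp add: kap_def)

text \<open>The exterior normal weighted by \<open>th (bd z) * g z\<close>. Its divergence contains
  \<open>- th1 * g\<close>, which is positive for positive \<open>g\<close> and yields the weighted
  estimates below.\<close>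

definition flux :: "(real \<times> (real^'n) => real) => 'n => real \<times> (real^'n) => real" where
 "flux g k z = - (th (bd z) * g z) * px k bd z"

lemma Ck_dbd: "Ck_on 1 strip (dd h bd)"
 using Ck_on_dd[of 1 strip bd h] Ck2_bd by (simp add: numeral_2_eq_2)

lemma flux_beyond: "bb < bd z ==> flux g k z = 0" by (simp add: flux_def th_beyond)

lemma Ck_th_bd: "Ck_on 1 strip (%z. th (bd z))"
 using Ck_on_compose[OF open_strip Ck1_strip(1) Ck_th] by auto

lemma Ck_flux:
 assumes "Ck_on 1 strip g"
 shows "Ck_on 1 strip (flux g k)" "Ck_on 1 G (flux g k)"
proof -
 show 1: "Ck_on 1 strip (flux g k)"
  unfolding flux_def by (intro Ck_on_mult Ck_on_minus open_strip Ck_th_bd assms Ck_dbd)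
 show "Ck_on 1 G (flux g k)" by (rule Ck_glue[OF 1 Ck_on_const _ bb(2)]) (rule flux_beyond)
qed

lemma dd_nn_component: "z : strip ==> dd h (%z. nn z $ k) z = dd h nn z $ k"
 using dd_bounded_linear_compose[OF bounded_linear_vec_nth diff_strip(3)] .

lemma px_px_bd:
 assumes zs: "z : strip"
 shows "px l (px k bd) z = - px l nn z $ k"
proof -
 have "px l (px k bd) z = px l (%z. - (nn z $ k)) z"
  by (rule dd_cong_open[OF open_strip zs]) (rule px_bd)
 also have "... = - px l (%z. nn z $ k) z"
  by (rule dd_minus) (rule Ck1_differentiable[OF Ck_on_vec_nth[OF open_strip Ck1_strip(3)] zs])
 finally show ?thesis by (simp add: dd_nn_component[OF zs])
qed

lemma div_flux:
 assumes g: "Ck_on 1 strip g" and zs: "z : strip" and le: "bd z <= bb"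
 obtains L where "\<bar>L\<bar> <= real CARD('n) * (16 / (3 * d0))"
  "(SUMU k. px k (flux g k) z) = (- th1 (bd z) - th (bd z) * L) * g z + th (bd z) * dd (0, nn z) g z"
proof -
 note db = diff_strip(1)[OF zs]
 have dg: "g differentiable at z" using Ck1_differentiable[OF g zs] .
 have dth: "(%z. th (bd z)) differentiable at z" using Ck1_differentiable[OF Ck_th_bd zs] .
 have ddb: "px k bd differentiable at z" for k using Ck1_differentiable[OF Ck_dbd zs] .
 have 1: "px k (flux g k) z = - (th1 (bd z) * px k bd z * g z + th (bd z) * px k g z) * px k bd z - th (bd z) * g z * px k (px k bd) z" for k
 proof -
  have "px k (flux g k) z = - (th (bd z) * g z) * px k (px k bd) z + px k (%z. - (th (bd z) * g z)) z * px k bd z"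
   unfolding flux_def using dth dg by (intro dd_mult differentiable_minus differentiable_mult ddb) auto
  also have "px k (%z. - (th (bd z) * g z)) z = - (th (bd z) * px k g z + th1 (bd z) * px k bd z * g z)"
   using dd_minus[of "%z. th (bd z) * g z" z] dd_mult[OF dth dg] dd_real_compose[OF db th_DERIV] dth dg by simp
  finally show ?thesis by (simp add: algebra_simps)
 qed
 have nn1: "(SUMU k. (nn z $ k)\<^sup>2) = 1"
  using norm_nn[OF strip_D[OF zs]] by (simp add: norm_vec_def L2_set_def)
 define Lb where "Lb = (SUMU k. px k (px k bd) z)"
 have Lbe: "\<bar>Lb\<bar> <= real CARD('n) * (16 / (3 * d0))"
 proof -
  have "\<bar>px k (px k bd) z\<bar> <= 16 / (3 * d0)" for k
  proof -
   have "\<bar>px k (px k bd) z\<bar> <= norm (px k nn z)" using component_le_norm_cart[of "px k nn z" k] px_px_bd[OF zs] by simp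
   then show ?thesis using norm_dd_nn'(1)[OF zs, of "axis k 1"] le by (simp add: bb_def norm_axis_1)
  qed
  then have "(SUMU k. \<bar>px k (px k bd) z\<bar>) <= (\<Sum>k::'n\<in>UNIV. 16 / (3 * d0))" by (intro sum_mono)
  then show ?thesis unfolding Lb_def by (intro order.trans[OF sum_abs]) simp
 qed
 have ng: "(SUMU k. nn z $ k * px k g z) = dd (0, nn z) g z"
  using dd_space_expand[OF dg, of "nn z"] by simp
 have "(SUMU k. px k (flux g k) z) = (SUMU k. - th1 (bd z) * g z * (nn z $ k)\<^sup>2 + th (bd z) * (nn z $ k * px k g z) - th (bd z) * g z * px k (px k bd) z)"
  unfolding 1 px_bd[OF zs] by (intro sum.cong) (auto simp: power2_eq_square algebra_simps)
 also have "... = - th1 (bd z) * g z * (SUMU k. (nn z $ k)\<^sup>2) + th (bd z) * (SUMU k. nn z $ k * px k g z) - th (bd z) * g z * Lb"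
  by (simp only: sum.distrib sum_subtractf sum_distrib_left[symmetric] Lb_def)
 also have "... = (- th1 (bd z) - th (bd z) * Lb) * g z + th (bd z) * dd (0, nn z) g z" by (simp add: nn1 ng algebra_simps)
 finally have e: "(SUMU k. px k (flux g k) z) = (- th1 (bd z) - th (bd z) * Lb) * g z + th (bd z) * dd (0, nn z) g z" .
 show ?thesis by (rule that[OF Lbe e])
qed

lemma div_flux_beyond:
 assumes "z : G" "bb < bd z"
 shows "(SUMU k. px k (flux g k) z) = 0"
proof -
 have "px k (flux g k) z = px k (%z. 0::real) z" for k
  by (rule dd_cong_open[OF open_superlevel[of bb]]) (use assms flux_beyond in auto)
 then show ?thesis by simp
qed

text \<open>\<open>kap\<close> is half of \<open>- th1\<close>; the other half absorbs the Laplacian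
  of the distance. This is the comparison of \<open>10/3\<close> with \<open>7/2\<close> that fixes
  the exponent \<open>mm\<close>.\<close>

lemma div_flux_ge:
 assumes g: "Ck_on 1 strip g" and z: "z : G" "0 <= g z"
 shows "kap (bd z) * g z + th (bd z) * dd (0, nn z) g z <= (SUMU k. px k (flux g k) z)"
proof (cases "bd z <= bb")
 case True
 then have zs: "z : strip" using z bb by (simp add: strip_def)
 have b0: "bd z > 0" using bd_pos strip_D zs by blast
 obtain Lb where Lbe: "\<bar>Lb\<bar> <= real CARD('n) * (16 / (3 * d0))"
  and e: "(SUMU k. px k (flux g k) z) = (- th1 (bd z) - th (bd z) * Lb) * g z + th (bd z) * dd (0, nn z) g z"
  by (rule div_flux[OF g zs True])
 define q where "q = max 0 (bb - bd z)"
 have q: "0 <= q" "q <= bb" using b0 bb by (auto simp: q_def)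
 have "th (bd z) * Lb <= q ^ (mm - 1) * (q * \<bar>Lb\<bar>)"
 proof -
  have "th (bd z) = q ^ (mm - 1) * q" unfolding th_def q_def[symmetric] using mm by (simp add: power_eq_if)
  then show ?thesis using q by (simp add: mult_left_mono mult.assoc)
 qed
 also have "... <= q ^ (mm - 1) * (bb * (real CARD('n) * (16 / (3 * d0))))"
  using q Lbe by (intro mult_left_mono mult_mono) auto
 also have "bb * (real CARD('n) * (16 / (3 * d0))) = 10/3 * real CARD('n)" using d0 by (simp add: bb_def field_simps)
 also have "q ^ (mm - 1) * (10/3 * real CARD('n)) <= q ^ (mm - 1) * (real mm / 2)" using q by (intro mult_left_mono) (auto simp: mm_def)
 finally have "th (bd z) * Lb <= real mm / 2 * q ^ (mm - 1)" by (simp add: mult.commute)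
 then have "kap (bd z) <= - th1 (bd z) - th (bd z) * Lb" by (simp add: kap_def th1_def q_def[symmetric])
 then show ?thesis unfolding e using z(2) by (simp add: mult_right_mono)
next
 case False
 then show ?thesis using mm div_flux_beyond[OF z(1)] by (auto simp: th_beyond kap_def max_def power_0_left)
qed

lemma div_flux_bound:
 assumes g: "Ck_on 1 strip g" and C: "!!z. z : strip ==> \<bar>g z\<bar> <= C1 & \<bar>dd (0, nn z) g z\<bar> <= C2" "0 <= C1" "0 <= C2"
 shows "\<exists>C. ALL z:G. \<bar>SUMU k. px k (flux g k) z\<bar> <= C"
proof -
 define c where "c = real CARD('n) * (16 / (3 * d0))"
 have c0: "0 <= c" using d0 by (simp add: c_def)
 define C where "C = (real mm * bb ^ (mm - 1) + bb ^ mm * c) * C1 + bb ^ mm * C2"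
 have C0: "0 <= C" unfolding C_def using bb c0 assms(3,4) by auto
 have "\<bar>SUMU k. px k (flux g k) z\<bar> <= C" if z: "z : G" for z
 proof (cases "bd z <= bb")
  case True
  then have zs: "z : strip" using z bb by (simp add: strip_def)
  have b0: "bd z > 0" using bd_pos G_D z by blast
  obtain L where L: "\<bar>L\<bar> <= c"
   and e: "(SUMU k. px k (flux g k) z) = (- th1 (bd z) - th (bd z) * L) * g z + th (bd z) * dd (0, nn z) g z"
   unfolding c_def by (rule div_flux[OF g zs True])
  have t: "\<bar>th (bd z)\<bar> <= bb ^ mm" using th_le th_nonneg[of "bd z"] b0 by simp
  have t1: "\<bar>th1 (bd z)\<bar> <= real mm * bb ^ (mm - 1)"
   unfolding th1_def abs_mult using b0 bb by (auto intro!: mult_left_mono power_mono)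
  have "\<bar>th (bd z) * L\<bar> <= bb ^ mm * c" unfolding abs_mult using t L bb by (intro mult_mono) auto
  then have "\<bar>- th1 (bd z) - th (bd z) * L\<bar> <= real mm * bb ^ (mm - 1) + bb ^ mm * c" using t1 by linarith
  then have "\<bar>(- th1 (bd z) - th (bd z) * L) * g z\<bar> <= (real mm * bb ^ (mm - 1) + bb ^ mm * c) * C1"
   unfolding abs_mult using C(1)[OF zs] bb c0 by (intro mult_mono) auto
  moreover have "\<bar>th (bd z) * dd (0, nn z) g z\<bar> <= bb ^ mm * C2"
   unfolding abs_mult using C(1)[OF zs] bb t by (intro mult_mono) auto
  ultimately show ?thesis unfolding e C_def by linarith
 next
  case False
  then show ?thesis using div_flux_beyond[OF z] C0 by simp
 qed
 then show ?thesis by blast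
qed

lemma tangency_flux:
 assumes "z : strip"
 shows "(SUMU k. px k bd z * flux g k z) = - th (bd z) * g z"
proof -
 have "(SUMU k. px k bd z * flux g k z) = - th (bd z) * g z * (SUMU k. (nn z $ k)\<^sup>2)"
  unfolding flux_def px_bd[OF assms] sum_distrib_left by (intro sum.cong) (auto simp: power2_eq_square)
 then show ?thesis using norm_nn[OF strip_D[OF assms]] by (simp add: norm_vec_def L2_set_def)
qed

section \<open>Kato's inequality for the pressure\<close>

definition cP :: real where "cP = \<sigma>\<^sup>2 / (8 * pi)"

lemma P_boundary: "z : D ==> P (fz z) = cP"
proof -
 assume z: "z : D"
 have "norm (B (fst z) (ft z)) = \<sigma> & p (fst z) (ft z) = 0"
  using sol ft_frontier[OF z] D_subset[OF z] unfolding mhd_solution_def by blast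
 then show ?thesis by (simp add: P_def fz_def total_pressure_def cP_def)
qed

lemma pressure_linear: obtains L where "L > 0" "!!z. z : D ==> \<bar>P z - cP\<bar> <= L * bd z"
proof -
 obtain L where "L > 0" "!!z. z : D ==> norm (P z - P (fz z)) <= L * bd z" using foot_lipschitz[OF Ck_P] by blast
 then show ?thesis using that P_boundary by auto
qed

lemma abs_px_P_le: "z : closure D ==> \<bar>px k P z\<bar> <= M"
 using component_le_norm_cart[of "\<chi> k. px k P z" k] grad_P_le[of z] by simp

lemma integrable_on_slice:
 fixes F :: "real \<times> (real^'n) => real"
 assumes "continuous_on G F" "!!z. z : G ==> \<bar>F z\<bar> <= C" "t : {0<..<T}"
 shows "(%x. F (t, x)) integrable_on slice D t"
 using integrable_slice[OF assms] set_lebesgue_integral_eq_integral(1) by blast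

lemma divergence_slice_zero:
 assumes t: "t : {0<..<T}" and X: "!!k. Ck_on 1 G (X k)"
  and C1: "!!z. z : G ==> \<bar>SUMU k. px k (X k) z\<bar> <= C1"
  and C2: "!!z. z : G ==> bd z < dl ==> \<bar>SUMU k. px k bd z * X k z\<bar> <= C2 * bd z" and "dl > 0"
 shows "integral (slice D t) (%x. SUMU k. px k (X k) (t, x)) = 0"
proof (rule divergence_slice[OF t X, where C = "max C1 C2" and dl = dl])
 fix z assume z: "z : G" "bd z < dl"
 have "C2 * bd z <= max C1 C2 * bd z" using bd_pos[OF G_D[OF z(1)]] by (intro mult_right_mono) auto
 then show "\<bar>SUMU k. px k bd z * X k z\<bar> <= max C1 C2 * bd z" using C2[OF z] by linarith
qed (use C1 \<open>dl > 0\<close> in \<open>auto simp: le_max_iff_disj\<close>)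

lemma continuous_on_dom_G: "(!!k. Ck_on k dom f) ==> continuous_on G f"
 using continuous_on_subset[OF Ck_on_cont, of 0 dom f G] G_dom by blast

lemma Ck_dom_G: "(!!k. Ck_on k dom f) ==> Ck_on k G f"
 using Ck_on_subset[of k dom f G] G_dom by blast

lemma bounded_on_G:
 fixes f :: "real \<times> (real^'n) => real"
 assumes "!!k. Ck_on k dom f"
 obtains C where "C > 0" "!!z. z : G ==> \<bar>f z\<bar> <= C"
 using bounded_on_D[OF Ck_on_cont[OF assms[of 0]]] G_D by metis

lemma bounded_on_D_cont:
 fixes f :: "real \<times> (real^'n) => real"
 assumes "!!k. Ck_on k dom f"
 shows "\<exists>C\<ge>0. ALL z:D. \<bar>f z\<bar> <= C & (\<forall>h. \<bar>dd (0, h) f z\<bar> <= C * norm h)"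
proof -
 obtain C1 where C1: "C1 > 0" "!!z. z : D ==> \<bar>f z\<bar> <= C1" using bounded_on_D[OF Ck_on_cont[OF assms[of 0]]] by metis
 have "continuous_on dom (%z. SUMU k. norm (px k f z))"
  by (intro continuous_intros Ck1_continuous_dd[OF assms])
 then obtain C2 where C2: "C2 > 0" "!!z. z : D ==> \<bar>SUMU k. norm (px k f z)\<bar> <= C2" by (rule bounded_on_D) blast
 have "\<bar>dd (0, h) f z\<bar> <= (C1 + C2) * norm h" if "z : D" for z h
 proof -
  have "\<bar>dd (0, h) f z\<bar> <= (SUMU k. norm (px k f z)) * norm h"
   using norm_dd_space_le[OF diff_dom[OF assms D_dom[OF that]]] by simp
  also have "... <= (C1 + C2) * norm h" using C1(1) C2(2)[OF that] by (intro mult_right_mono) auto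
  finally show ?thesis .
 qed
 moreover have "\<bar>f z\<bar> <= C1 + C2" if "z : D" for z using C1(2)[OF that] C2(1) by simp
 ultimately show ?thesis using C1(1) C2(1) by (intro exI[of _ "C1 + C2"]) auto
qed

lemma Ck_LapP: "Ck_on k dom LapP" and Ck_gV: "Ck_on k dom gV" and Ck_gB: "Ck_on k dom gB"
 unfolding LapP_def[abs_def] gV_def[abs_def] gB_def[abs_def]
 by (intro Ck_on_sum Ck_on_power dom Ck_dd_dom[OF Ck_dP] Ck_dVc Ck_dBc)+

lemma continuous_bd_G: "continuous_on UNIV f ==> continuous_on G (%z. f (bd z))"
 by (rule continuous_on_compose2[OF _ continuous_on_subset[OF continuous_on_bd]]) (auto simp: G_D)

lemma kap_continuous: "continuous_on UNIV kap" and psi_continuous: "continuous_on UNIV psi"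
 unfolding kap_def[abs_def] using Ck_on_cont[OF Ck_psi] by (auto intro!: continuous_intros)

lemma kap_le: "0 <= s ==> \<bar>kap s\<bar> <= real mm / 2 * bb ^ (mm - 1)"
 using bb unfolding kap_def by (auto intro!: mult_left_mono power_mono simp: abs_mult)

lemma psi_bd_range: "z : G ==> 0 <= psi (bd z) & psi (bd z) <= bb ^ (mm + 1)"
 using psi_bounds(3,4)[of "bd z"] bd_pos[of z] G_D[of z] by (simp add: less_imp_le)

lemma Ck_psi_bd: "Ck_on 1 G (%z. psi (bd z))"
 by (rule Ck_bd_compose[of 1 psi bb "psi bb"]) (use Ck_on_le[OF Ck_psi, of 1] mm bb in \<open>auto simp: psi_def max_def\<close>)

lemma px_psi_bd: "z : G ==> px k (%z. psi (bd z)) z = th (bd z) * px k bd z"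
proof (cases "bd z < d0")
 case True
 assume "z : G"
 then have "z : strip" using True by (simp add: strip_def)
 from dd_real_compose[OF diff_strip(1)[OF this] psi_DERIV] show ?thesis by simp
next
 case False
 assume z: "z : G"
 have "px k (%z. psi (bd z)) z = px k (%z. psi bb) z"
  by (rule dd_cong_open[OF open_superlevel[of bb]]) (use False z bb mm in \<open>auto simp: psi_def max_def\<close>)
 then show ?thesis using False bb by (simp add: th_beyond)
qed

text \<open>Kato's inequality tested with \<open>psi(bd)\<close>, with the smooth approximation
 \<open>sqrt (u\<^sup>2 + e\<^sup>2) - e\<close> of the absolute value of \<open>u = P - cP\<close>.\<close>

lemma kato_approx:
 assumes t: "t : {0<..<T}" and e: "e > 0"
 shows "integral (slice D t) (%x. kap (bd (t, x)) * (sqrt ((P (t, x) - cP)\<^sup>2 + e\<^sup>2) - e)) <=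
  bb ^ (mm + 1) * integral (slice D t) (%x. \<bar>LapP (t, x)\<bar>)"
proof -
 define u where "u z = P z - cP" for z
 define R where "R z = sqrt ((u z)\<^sup>2 + e\<^sup>2)" for z
 define S where "S z = R z - e" for z
 define s where "s z = u z * inverse (R z)" for z
 have Cu: "Ck_on k dom u" for k unfolding u_def by (intro Ck_on_diff_fun dom Ck_P Ck_on_const)
 have pos: "(u z)\<^sup>2 + e\<^sup>2 > 0" for z using e by (simp add: add_nonneg_pos)
 have R0: "R z > 0" for z using pos by (simp add: R_def)
 have CR: "Ck_on k dom R" for k unfolding R_def
  by (rule Ck_on_compose[OF dom(1) Ck_on_add[OF dom(1) Ck_on_power[OF dom(1) Cu] Ck_on_const] Ck_on_sqrt]) (use pos in auto)
 have CS: "Ck_on k dom S" for k unfolding S_def by (intro Ck_on_diff_fun dom CR Ck_on_const)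
 have Ciz: "Ck_on k dom (%z. inverse (R z))" for k
  by (rule Ck_on_compose[OF dom(1) CR Ck_on_inverse]) (use R0 in \<open>auto simp: less_imp_neq[THEN not_sym]\<close>)
 have Cs: "Ck_on k dom s" for k unfolding s_def by (intro Ck_on_mult dom Cu Ciz)
 have R2: "R z * R z = u z * u z + e\<^sup>2" for z using pos[of z] by (simp add: R_def power2_eq_square)
 have Rabs: "\<bar>u z\<bar> <= R z" "e <= R z" for z
  unfolding R_def using e by (auto intro!: real_le_rsqrt)
 have Rup: "R z <= \<bar>u z\<bar> + e" for z
 proof -
  have "(u z)\<^sup>2 + e\<^sup>2 <= (\<bar>u z\<bar> + e)\<^sup>2" using e by (simp add: power2_sum)
  then show ?thesis unfolding R_def using e by (intro real_le_lsqrt) auto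
 qed
 have S0: "0 <= S z" "S z <= \<bar>u z\<bar>" for z using Rabs[of z] Rup[of z] by (simp_all add: S_def)
 have s1: "\<bar>s z\<bar> <= 1" for z using Rabs[of z] R0[of z] by (simp add: s_def abs_mult field_simps)
 note du = diff_dom[OF Cu] and dR = diff_dom[OF CR] and ds = diff_dom[OF Cs] and dS = diff_dom[OF CS]
 have ddu: "dd h u z = dd h P z" if "z : dom" for h z
  unfolding u_def using dd_diff[OF diff_P[OF that] differentiable_const] by simp
 have ddR: "dd h R z = s z * dd h P z" if z: "z : dom" for h z
 proof -
  have "dd h (%z. R z * R z) z = dd h (%z. u z * u z + e\<^sup>2) z" by (simp add: R2)
  also have "... = 2 * u z * dd h P z"
   using dd_add[OF differentiable_mult[OF du[OF z] du[OF z]] differentiable_const] dd_mult[OF du[OF z] du[OF z]] ddu[OF z] by simp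
  finally have "2 * R z * dd h R z = 2 * u z * dd h P z" using dd_mult[OF dR[OF z] dR[OF z], of h] by simp
  then show ?thesis using R0[of z] by (simp add: s_def field_simps)
 qed
 have ddS: "dd h S z = s z * dd h P z" if "z : dom" for h z
  unfolding S_def using dd_diff[OF dR[OF that] differentiable_const] ddR[OF that] by simp
 have dds: "dd h s z * dd h P z \<ge> 0" if z: "z : dom" for h z
 proof -
  have "s z * R z = u z" for z using R0[of z] by (simp add: s_def)
  then have "dd h (%z. s z * R z) z = dd h u z" by simp
  then have "s z * dd h R z + dd h s z * R z = dd h P z" using dd_mult[OF ds[OF z] dR[OF z], of h] ddu[OF z] by simp
  then have "dd h s z * R z = (1 - s z * s z) * dd h P z" using ddR[OF z] by (simp add: algebra_simps)
  then have "(dd h s z * dd h P z) * R z = (1 - s z * s z) * (dd h P z)\<^sup>2" by (simp add: power2_eq_square mult_ac)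
  moreover have "s z * s z <= 1" using s1[of z] by (metis abs_le_square_iff abs_one one_power2 power2_eq_square)
  ultimately have "(dd h s z * dd h P z) * R z \<ge> 0" by simp
  then show ?thesis using R0[of z] by (simp add: zero_le_mult_iff)
 qed
 \<comment> \<open>The second summand removes the cross term: the gradient of
   \<open>psi (bd z)\<close> in the first one gives \<open>th\<close> times a normal derivative of
   \<open>S\<close>, and the divergence of the flux contains the same expression with the opposite
   sign. Both summands are \<open>O(bd)\<close> at the boundary.\<close>
 define X where "X k z = psi (bd z) * (s z * px k P z) + flux S k z" for k z
 have CSs: "Ck_on 1 strip S" by (rule Ck_strip_dom[OF CS])
 have sPk: "Ck_on k dom (%z. s z * px j P z)" for k j by (intro Ck_on_mult dom Cs Ck_dP)
 have CX: "Ck_on 1 G (X k)" for k unfolding X_def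
  by (intro Ck_on_add Ck_on_mult open_G Ck_psi_bd Ck_dom_G[OF sPk] Ck_flux(2)[OF CSs])
 have eX: "(SUMU k. px k (X k) z) = psi (bd z) * (s z * LapP z) + psi (bd z) * (SUMU k. px k s z * px k P z)
    - th (bd z) * dd (0, nn z) S z + (SUMU k. px k (flux S k) z)" if z: "z : G" for z
 proof -
  note zd = G_dom[OF z]
  have dpsi: "(%z. psi (bd z)) differentiable at z" using Ck1_differentiable[OF Ck_psi_bd z] .
  have dsP: "(%z. s z * px k P z) differentiable at z" for k by (intro differentiable_mult ds diff_dP zd)
  have 1: "px k (X k) z = psi (bd z) * (s z * px k (px k P) z + px k s z * px k P z) + th (bd z) * px k bd z * (s z * px k P z) + px k (flux S k) z" for k
   unfolding X_def
   using dd_add[OF differentiable_mult[OF dpsi dsP[of k]] Ck1_differentiable[OF Ck_flux(2)[OF CSs] z], of "(0, axis k 1)" k]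
    dd_mult[OF dpsi dsP[of k], of "(0, axis k 1)"] dd_mult[OF ds[OF zd] diff_dP[OF zd], of "(0, axis k 1)"] px_psi_bd[OF z] by simp
  have cancel: "th (bd z) * dd (0, nn z) S z = - (SUMU k. th (bd z) * px k bd z * (s z * px k P z))"
  proof (cases "bd z < d0")
   case True
   then have zs: "z : strip" using z by (simp add: strip_def)
   have "dd (0, nn z) S z = s z * (SUMU k. nn z $ k * px k P z)"
    using ddS[OF zd, of "(0, nn z)"] dd_space_expand[OF diff_P[OF zd], of "nn z"] by simp
   then show ?thesis by (simp add: px_bd[OF zs] sum_distrib_left sum_negf[symmetric] mult_ac)
  next
   case False
   then show ?thesis using bb by (simp add: th_beyond)
  qed
  show ?thesis unfolding 1 LapP_def cancel by (simp add: sum.distrib sum_distrib_left distrib_left)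
 qed
 have divX: "kap (bd z) * S z - bb ^ (mm + 1) * \<bar>LapP z\<bar> <= (SUMU k. px k (X k) z)" if z: "z : G" for z
 proof -
  note zd = G_dom[OF z]
  have a: "- (bb ^ (mm + 1) * \<bar>LapP z\<bar>) <= psi (bd z) * (s z * LapP z)"
  proof -
   have "\<bar>psi (bd z) * (s z * LapP z)\<bar> <= bb ^ (mm + 1) * (1 * \<bar>LapP z\<bar>)"
    unfolding abs_mult using psi_bd_range[OF z] s1[of z] by (intro mult_mono) auto
   then show ?thesis by linarith
  qed
  have b: "0 <= psi (bd z) * (SUMU k. px k s z * px k P z)"
   using psi_bd_range[OF z] dds[OF zd] by (intro mult_nonneg_nonneg[OF _ sum_nonneg]) auto
  show ?thesis using a b div_flux_ge[OF CSs z S0(1)] unfolding eX[OF z] by linarith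
 qed
 have tan: "\<exists>C. ALL z:G. (bd z < d0 --> \<bar>SUMU k. px k bd z * X k z\<bar> <= C * bd z)"
 proof -
  obtain L where L: "L > 0" "!!z. z : D ==> \<bar>P z - cP\<bar> <= L * bd z" by (rule pressure_linear) blast
  have "\<bar>SUMU k. px k bd z * X k z\<bar> <= (bb ^ mm * (real CARD('n) * M) + bb ^ mm * L) * bd z" if z: "z : G" "bd z < d0" for z
  proof -
   have zs: "z : strip" using z by (simp add: strip_def)
   have zD: "z : D" and zc: "z : closure D" using G_D[OF z(1)] closure_subset[of D] by auto
   have b0: "bd z > 0" using bd_pos zD by blast
   have "(SUMU k. px k bd z * X k z) = psi (bd z) * (SUMU k. px k bd z * (s z * px k P z)) + (SUMU k. px k bd z * flux S k z)"
    unfolding X_def by (simp add: sum.distrib sum_distrib_left algebra_simps)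
   also have "... = psi (bd z) * (SUMU k. px k bd z * (s z * px k P z)) - th (bd z) * S z"
    using tangency_flux[OF zs] by simp
   finally have e: "(SUMU k. px k bd z * X k z) = psi (bd z) * (SUMU k. px k bd z * (s z * px k P z)) - th (bd z) * S z" .
   have "\<bar>SUMU k. px k bd z * (s z * px k P z)\<bar> <= (SUMU k. \<bar>px k bd z * (s z * px k P z)\<bar>)" by (rule sum_abs)
   also have "... <= (\<Sum>k::'n\<in>UNIV. 1 * (1 * M))"
   proof (rule sum_mono)
    fix k
    have "\<bar>px k bd z\<bar> <= 1" using component_le_norm_cart[of "nn z" k] norm_nn[OF zD] by (simp add: px_bd[OF zs])
    then show "\<bar>px k bd z * (s z * px k P z)\<bar> <= 1 * (1 * M)"
     unfolding abs_mult using s1[of z] abs_px_P_le[OF zc, of k] by (intro mult_mono) auto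
   qed
   finally have "\<bar>psi (bd z) * (SUMU k. px k bd z * (s z * px k P z))\<bar> <= (bb ^ mm * bd z) * (real CARD('n) * M)"
    unfolding abs_mult using psi_bounds(2)[of "bd z"] psi_bd_range[OF z(1)] b0 bb by (intro mult_mono) auto
   moreover have "\<bar>th (bd z) * S z\<bar> <= bb ^ mm * (L * bd z)"
    unfolding abs_mult using th_le[of "bd z"] th_nonneg[of "bd z"] b0 S0[of z] L(2)[OF zD] by (intro mult_mono) (auto simp: u_def)
   ultimately show ?thesis unfolding e by (simp add: algebra_simps)
  qed
  then show ?thesis by blast
 qed
 have Xb: "\<exists>C. ALL z:G. \<bar>SUMU k. px k (X k) z\<bar> <= C"
 proof -
  have Cy: "Ck_on k dom (%z. s z * LapP z + (SUMU k. px k s z * px k P z))" for k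
   by (intro Ck_on_add Ck_on_sum Ck_on_mult dom Cs Ck_LapP Ck_dP Ck_dd_dom[OF Cs])
  obtain c1 where c1: "c1 > 0" "!!z. z : G ==> \<bar>s z * LapP z + (SUMU k. px k s z * px k P z)\<bar> <= c1" by (rule bounded_on_G[OF Cy]) blast
  obtain c2 where c2: "c2 \<ge> 0" "!!z. z : D ==> \<bar>S z\<bar> <= c2 & (\<forall>h. \<bar>dd (0, h) S z\<bar> <= c2 * norm h)" using bounded_on_D_cont[OF CS] by metis
  have c2': "\<bar>S z\<bar> <= c2 & \<bar>dd (0, nn z) S z\<bar> <= c2" if "z : D" for z using c2(2)[OF that] norm_nn[OF that] by (metis mult.right_neutral)
  obtain c3 where c3: "ALL z:G. \<bar>SUMU k. px k (flux S k) z\<bar> <= c3"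
   using div_flux_bound[OF CSs c2'[OF strip_D] c2(1) c2(1)] by blast
  have "\<bar>SUMU k. px k (X k) z\<bar> <= bb ^ (mm + 1) * c1 + bb ^ mm * c2 + c3" if z: "z : G" for z
  proof -
   have b0: "bd z > 0" using bd_pos G_D z by blast
   have "\<bar>psi (bd z) * (s z * LapP z + (SUMU k. px k s z * px k P z))\<bar> <= bb ^ (mm + 1) * c1"
    unfolding abs_mult using psi_bd_range[OF z] c1 z by (intro mult_mono) auto
   moreover have "\<bar>th (bd z) * dd (0, nn z) S z\<bar> <= bb ^ mm * c2"
    unfolding abs_mult using th_le[of "bd z"] th_nonneg[of "bd z"] b0 bb c2'[OF G_D[OF z]] by (intro mult_mono) auto
   moreover have "\<bar>SUMU k. px k (flux S k) z\<bar> <= c3" using c3 z by blast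
   ultimately show ?thesis unfolding eX[OF z] distrib_left by linarith
  qed
  then show ?thesis by blast
 qed
 obtain C1 where C1: "!!z. z : G ==> \<bar>SUMU k. px k (X k) z\<bar> <= C1" using Xb by blast
 obtain C2 where C2: "!!z. z : G ==> bd z < d0 ==> \<bar>SUMU k. px k bd z * X k z\<bar> <= C2 * bd z" using tan by blast
 note div0 = divergence_slice_zero[OF t CX C1 C2 d0]
 obtain CL where CL: "CL > 0" "!!z. z : G ==> \<bar>LapP z\<bar> <= CL" by (rule bounded_on_G[OF Ck_LapP]) blast
 obtain c2 where c2: "c2 > 0" "!!z. z : G ==> \<bar>S z\<bar> <= c2" by (rule bounded_on_G[OF CS]) blast
 have cS: "continuous_on G (%z. kap (bd z) * S z)"
  by (intro continuous_on_mult continuous_bd_G kap_continuous continuous_on_dom_G[OF CS])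
 have bS: "\<bar>kap (bd z) * S z\<bar> <= real mm / 2 * bb ^ (mm - 1) * c2" if "z : G" for z
  unfolding abs_mult using kap_le[of "bd z"] bd_pos[OF G_D[OF that]] c2(2)[OF that] by (intro mult_mono) auto
 have cL: "continuous_on G (%z. \<bar>LapP z\<bar>)" by (intro continuous_on_rabs continuous_on_dom_G[OF Ck_LapP])
 have bL: "\<bar>\<bar>LapP z\<bar>\<bar> <= CL" if "z : G" for z using CL that by simp
 note iS = integrable_on_slice[OF cS bS t] and iL = integrable_on_slice[OF cL bL t]
 have "integral (slice D t) (%x. kap (bd (t, x)) * S (t, x) - bb ^ (mm + 1) * \<bar>LapP (t, x)\<bar>)
   <= integral (slice D t) (%x. SUMU k. px k (X k) (t, x))"
 proof (rule integral_le)
  show "(%x. SUMU k. px k (X k) (t, x)) integrable_on slice D t"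
   by (rule integrable_on_slice[OF _ C1 t]) (auto intro!: continuous_intros Ck1_continuous_dd[OF CX])
 qed (use divX t slice_G iS iL in \<open>auto intro!: integrable_diff integrable_on_mult_right\<close>)
 then show ?thesis
  using div0 integral_diff[OF iS integrable_on_mult_right[OF iL, of "bb ^ (mm + 1)"]] by (simp add: S_def R_def u_def)
qed

lemma le_of_le_add_mult:
 fixes a b c :: real
 assumes "!!e. e > 0 ==> a <= b + e * c"
 shows "a <= b"
proof (rule field_le_epsilon)
 fix e :: real assume "e > 0"
 then have "a <= b + (e / (\<bar>c\<bar> + 1)) * c" by (intro assms) auto
 moreover have "(e / (\<bar>c\<bar> + 1)) * c <= e"
 proof -
  have "e * c <= e * (\<bar>c\<bar> + 1)" using \<open>e > 0\<close> by (intro mult_left_mono) auto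
  then have "e * c / (\<bar>c\<bar> + 1) <= e" by (subst pos_divide_le_eq) auto
  then show ?thesis by simp
 qed
 ultimately show "a <= b + e" by linarith
qed

text \<open>The smoothing differs from the absolute value by at most \<open>e\<close>, and the
  weight \<open>kap\<close> is integrable, so \<open>kato_approx\<close> passes to the
  limit.\<close>

lemma kato:
 assumes t: "t : {0<..<T}"
 shows "(%x. kap (bd (t, x)) * \<bar>P (t, x) - cP\<bar>) integrable_on slice D t"
  and "(%x. \<bar>LapP (t, x)\<bar>) integrable_on slice D t"
  and "integral (slice D t) (%x. kap (bd (t, x)) * \<bar>P (t, x) - cP\<bar>) <=
   bb ^ (mm + 1) * integral (slice D t) (%x. \<bar>LapP (t, x)\<bar>)"
proof -
 have Cu: "Ck_on k dom (%z. P z - cP)" for k by (intro Ck_on_diff_fun dom Ck_P Ck_on_const)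
 obtain c where c: "c > 0" "!!z. z : G ==> \<bar>P z - cP\<bar> <= c" by (rule bounded_on_G[OF Cu]) blast
 obtain CL where CL: "CL > 0" "!!z. z : G ==> \<bar>LapP z\<bar> <= CL" by (rule bounded_on_G[OF Ck_LapP]) blast
 show "(%x. \<bar>LapP (t, x)\<bar>) integrable_on slice D t"
  by (rule integrable_on_slice[of "%z. \<bar>LapP z\<bar>", OF _ _ t]) (use CL in \<open>auto intro!: continuous_on_rabs continuous_on_dom_G[OF Ck_LapP]\<close>)
 define kb where "kb = real mm / 2 * bb ^ (mm - 1)"
 have kb: "\<bar>kap (bd z)\<bar> <= kb" if "z : G" for z using kap_le[of "bd z"] bd_pos[OF G_D[OF that]] by (simp add: kb_def)
 have kb0: "0 <= kb" using bb by (simp add: kb_def)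
 have ck: "continuous_on G (%z. kap (bd z))" by (rule continuous_bd_G[OF kap_continuous])
 note cu = continuous_on_dom_G[OF Cu]
 show i1: "(%x. kap (bd (t, x)) * \<bar>P (t, x) - cP\<bar>) integrable_on slice D t"
  by (rule integrable_on_slice[of "%z. kap (bd z) * \<bar>P z - cP\<bar>" "kb * c", OF _ _ t])
   (auto intro!: continuous_on_mult ck continuous_on_rabs cu mult_mono simp: abs_mult kb c kb0)
 have i2: "(%x. kap (bd (t, x))) integrable_on slice D t" by (rule integrable_on_slice[OF ck kb t])
 show "integral (slice D t) (%x. kap (bd (t, x)) * \<bar>P (t, x) - cP\<bar>) <=
   bb ^ (mm + 1) * integral (slice D t) (%x. \<bar>LapP (t, x)\<bar>)"
 proof (rule le_of_le_add_mult)
  fix e :: real assume e: "e > 0"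
  define S where "S z = sqrt ((P z - cP)\<^sup>2 + e\<^sup>2) - e" for z
  have S: "\<bar>P z - cP\<bar> <= S z + e" "0 <= S z" "S z <= \<bar>P z - cP\<bar>" for z
  proof -
   have "(P z - cP)\<^sup>2 + e\<^sup>2 <= (\<bar>P z - cP\<bar> + e)\<^sup>2" using e by (simp add: power2_sum)
   then have "sqrt ((P z - cP)\<^sup>2 + e\<^sup>2) <= \<bar>P z - cP\<bar> + e" using e by (intro real_le_lsqrt) auto
   then show "\<bar>P z - cP\<bar> <= S z + e" "0 <= S z" "S z <= \<bar>P z - cP\<bar>"
    unfolding S_def using e by (auto intro!: real_le_rsqrt)
  qed
  have cS: "continuous_on G S" unfolding S_def
   by (intro continuous_on_diff continuous_on_real_sqrt continuous_on_add continuous_on_power cu continuous_on_const)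
  have bS: "\<bar>kap (bd z) * S z\<bar> <= kb * c" if "z : G" for z
   unfolding abs_mult using kb[OF that] S(2,3)[of z] c(2)[OF that] kb0 by (intro mult_mono) auto
  have i3: "(%x. kap (bd (t, x)) * S (t, x)) integrable_on slice D t"
   by (rule integrable_on_slice[OF continuous_on_mult[OF ck cS] bS t])
  have "integral (slice D t) (%x. kap (bd (t, x)) * \<bar>P (t, x) - cP\<bar>) <=
    integral (slice D t) (%x. kap (bd (t, x)) * S (t, x) + e * kap (bd (t, x)))"
  proof (rule integral_le[OF i1 integrable_add[OF i3 integrable_on_mult_right[OF i2]]])
   fix x show "kap (bd (t, x)) * \<bar>P (t, x) - cP\<bar> <= kap (bd (t, x)) * S (t, x) + e * kap (bd (t, x))"
    using mult_left_mono[OF S(1)[of "(t, x)"] kap_nonneg[of "bd (t, x)"]] by (simp add: algebra_simps)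
  qed
  also have "... = integral (slice D t) (%x. kap (bd (t, x)) * S (t, x)) + e * integral (slice D t) (%x. kap (bd (t, x)))"
   using integral_add[OF i3 integrable_on_mult_right[OF i2, of e]] by simp
  also have "integral (slice D t) (%x. kap (bd (t, x)) * S (t, x)) <= bb ^ (mm + 1) * integral (slice D t) (%x. \<bar>LapP (t, x)\<bar>)"
   using kato_approx[OF t e] by (simp add: S_def)
  finally show "integral (slice D t) (%x. kap (bd (t, x)) * \<bar>P (t, x) - cP\<bar>) <=
   bb ^ (mm + 1) * integral (slice D t) (%x. \<bar>LapP (t, x)\<bar>) + e * integral (slice D t) (%x. kap (bd (t, x)))" by simp
 qed
qed

text \<open>The second derivative of the distance is symmetric, so differentiating the normal along
  itself amounts to differentiating its constant length.\<close>

lemma dd_nn_nn: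
 assumes z: "z : strip"
 shows "dd (0, nn z) nn z = 0"
proof -
 have sym: "px l nn z $ k = px k nn z $ l" for k l
  using dd_commute[OF open_strip z Ck2_bd, of "(0, axis l 1)" "(0, axis k 1)"] px_px_bd[OF z] by simp
 have "dd (0, nn z) nn z $ k = nn z \<bullet> px k nn z" for k
  using dd_space_expand[OF diff_strip(3)[OF z], of "nn z"] sym[of _ k] by (simp add: inner_vec_def)
 then show ?thesis using nn_dd_nn[OF z] by (simp add: vec_eq_iff)
qed

lemma norm_dd_space_sq:
 fixes f :: "real \<times> (real^'n) => 'b::real_normed_vector"
 assumes "f differentiable at z"
 shows "(norm (dd (0, h) f z))\<^sup>2 <= (SUMU k. (norm (px k f z))\<^sup>2) * (norm h)\<^sup>2"
proof -
 have "norm (dd (0, h) f z) <= (SUMU k. \<bar>h $ k\<bar> * norm (px k f z))"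
  unfolding dd_space_expand[OF assms, of h] by (rule order.trans[OF norm_sum]) simp
 then have "(norm (dd (0, h) f z))\<^sup>2 <= (SUMU k. \<bar>h $ k\<bar> * norm (px k f z))\<^sup>2" by (intro power_mono) auto
 also have "... <= (SUMU k. \<bar>h $ k\<bar>\<^sup>2) * (SUMU k. (norm (px k f z))\<^sup>2)" by (rule Cauchy_Schwarz_ineq_sum)
 also have "(SUMU k. \<bar>h $ k\<bar>\<^sup>2) = (norm h)\<^sup>2" by (simp add: norm_vec_def L2_set_def sum_nonneg)
 finally show ?thesis by (simp add: mult.commute)
qed

lemma norm_vec_sq: "(norm (x::real^'n))\<^sup>2 = (SUMU k. (x $ k)\<^sup>2)"
 by (simp add: norm_vec_def L2_set_def sum_nonneg)

lemma gB_eq: "z : dom ==> gB z = (SUMU k. (norm (px k Bm z))\<^sup>2)"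
 and gV_eq: "z : dom ==> gV z = (SUMU k. (norm (px k V z))\<^sup>2)"
 by (simp_all add: gB_def gV_def norm_vec_sq dd_Bc dd_Vc)

text \<open>The flux of \<open>bn\<close> squared integrates to zero divergence, because
  \<open>bn\<close> is \<open>O(bd)\<close>. By \<open>dd_nn_nn\<close> the normal derivative of
  \<open>bn\<close> involves only derivatives of \<open>B\<close>; Young's inequality splits the
  mixed term, and half of \<open>kap\<close> absorbs the part without derivatives.\<close>

lemma poincare:
 assumes t: "t : {0<..<T}"
 shows "(%x. kap (bd (t, x)) * (bn (t, x))\<^sup>2) integrable_on slice D t"
  and "integral (slice D t) (%x. kap (bd (t, x)) * (bn (t, x))\<^sup>2) <= 2 * bb ^ (mm + 1) * integral (slice D t) (%x. gB (t, x))"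
proof -
 define g where "g z = bn z ^ 2" for z
 have Cg: "Ck_on 1 strip g" unfolding g_def by (rule Ck_on_power[OF open_strip Ck_bn])
 obtain CB where CB: "CB > 0" "!!z. z : closure D ==> norm (Bm z) <= CB"
  by (rule bounded_on_closure[OF Ck_on_cont[OF Ck_B]]) blast
 have cgB: "continuous_on G gB" by (rule continuous_on_dom_G[OF Ck_gB])
 obtain CG where CG: "CG > 0" "!!z. z : G ==> \<bar>gB z\<bar> <= CG" by (rule bounded_on_G[OF Ck_gB]) blast
 have bnB: "\<bar>bn z\<bar> <= CB" if "z : D" for z
  using Cauchy_Schwarz_ineq2[of "Bm z" "nn z"] norm_nn[OF that] CB(2)[of z] that closure_subset[of D] by (auto simp: bn_def)
 define \<beta> where "\<beta> z = dd (0, nn z) Bm z \<bullet> nn z" for z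
 have db: "dd (0, nn z) bn z = \<beta> z" if z: "z : strip" for z
  unfolding bn_def[abs_def] \<beta>_def using dd_inner[OF diff_B[OF strip_dom[OF z]] diff_strip(3)[OF z], of "(0, nn z)"] dd_nn_nn[OF z] by simp
 have \<beta>: "(\<beta> z)\<^sup>2 <= gB z" if z: "z : strip" for z
 proof -
  have n1: "norm (nn z) = 1" by (rule norm_nn[OF strip_D[OF z]])
  have "\<bar>\<beta> z\<bar> <= norm (dd (0, nn z) Bm z)"
   using Cauchy_Schwarz_ineq2[of "dd (0, nn z) Bm z" "nn z"] n1 by (simp add: \<beta>_def)
  then have "(\<beta> z)\<^sup>2 <= (norm (dd (0, nn z) Bm z))\<^sup>2" by (metis abs_ge_zero power2_abs power_mono)
  then show ?thesis using norm_dd_space_sq[OF diff_B[OF strip_dom[OF z]], of "nn z"] n1 gB_eq[OF strip_dom[OF z]] by simp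
 qed
 have dg: "dd (0, nn z) g z = 2 * bn z * \<beta> z" if z: "z : strip" for z
  unfolding g_def power2_eq_square
  using dd_mult[OF Ck1_differentiable[OF Ck_bn z] Ck1_differentiable[OF Ck_bn z], of "(0, nn z)"] db[OF z] by simp
 have "\<bar>g z\<bar> <= CB\<^sup>2 & \<bar>dd (0, nn z) g z\<bar> <= CB\<^sup>2 + CG" if z: "z : strip" for z
 proof -
  have b2: "(bn z)\<^sup>2 <= CB\<^sup>2" using bnB[OF strip_D[OF z]] CB by (metis abs_ge_zero power2_abs power_mono)
  have "\<bar>2 * bn z * \<beta> z\<bar> <= (bn z)\<^sup>2 + (\<beta> z)\<^sup>2"
   using sum_squares_bound[of "\<bar>bn z\<bar>" "\<bar>\<beta> z\<bar>"] by (simp add: abs_mult)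
  then show ?thesis using b2 dg[OF z] \<beta>[OF z] CG(2)[OF strip_G[OF z]] by (simp add: g_def)
 qed
 then obtain C1 where C1: "!!z. z : G ==> \<bar>SUMU k. px k (flux g k) z\<bar> <= C1"
  using div_flux_bound[OF Cg, of "CB\<^sup>2" "CB\<^sup>2 + CG"] CG(1) by auto
 obtain Cn where Cn: "Cn > 0" "!!z. z : G ==> bd z < d0 / 4 ==> \<bar>bn z\<bar> <= Cn * bd z" by (rule normal_B_bound) blast
 have C2: "\<bar>SUMU k. px k bd z * flux g k z\<bar> <= (bb ^ mm * (CB * Cn)) * bd z" if z: "z : G" "bd z < d0 / 4" for z
 proof -
  have zs: "z : strip" using z d0 by (simp add: strip_def)
  have b0: "bd z > 0" by (rule bd_pos[OF G_D[OF z(1)]])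
  have "\<bar>g z\<bar> <= CB * (Cn * bd z)"
   unfolding g_def power2_eq_square abs_mult using bnB[OF G_D[OF z(1)]] Cn(2)[OF z] CB(1) by (intro mult_mono) auto
  then have "\<bar>th (bd z) * g z\<bar> <= bb ^ mm * (CB * (Cn * bd z))"
   unfolding abs_mult using th_le[of "bd z"] th_nonneg[of "bd z"] b0 bb by (intro mult_mono) auto
  then show ?thesis unfolding tangency_flux[OF zs] by (simp add: mult_ac)
 qed
 have d4: "d0 / 4 > 0" using d0 by simp
 have div0: "integral (slice D t) (%x. SUMU k. px k (flux g k) (t, x)) = 0"
  by (rule divergence_slice_zero[OF t Ck_flux(2)[OF Cg] C1 C2 d4])
 have le: "1/2 * (kap (bd z) * g z) - bb ^ (mm + 1) * gB z <= (SUMU k. px k (flux g k) z)" if z: "z : G" for z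
 proof (cases "bd z <= bb")
  case True
  then have zs: "z : strip" using z bb by (simp add: strip_def)
  define q where "q = max 0 (bb - bd z)"
  have q: "0 <= q" "q <= bb" using bd_pos[OF G_D[OF z]] bb by (auto simp: q_def)
  have thq: "th (bd z) = q ^ (mm - 1) * q" unfolding th_def q_def[symmetric] using mm by (simp add: power_eq_if)
  have "\<bar>2 * bn z * (q * \<beta> z)\<bar> <= (bn z)\<^sup>2 + (q * \<beta> z)\<^sup>2"
   using sum_squares_bound[of "\<bar>bn z\<bar>" "\<bar>q * \<beta> z\<bar>"] by (simp add: abs_mult power_mult_distrib)
  \<comment> \<open>Half of \<open>kap\<close> provides \<open>mm / 4\<close> copies of
    \<open>bn\<close> squared, at least one since \<open>mm >= 7\<close>.\<close>
  moreover have "1 * (bn z)\<^sup>2 <= real mm / 4 * (bn z)\<^sup>2" using mm by (intro mult_right_mono) auto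
  moreover have "(q * \<beta> z)\<^sup>2 <= q * q * gB z" using \<beta>[OF zs] q by (simp add: power2_eq_square mult_ac mult_left_mono)
  ultimately have "- (real mm / 4 * g z) - q * q * gB z <= 2 * bn z * (q * \<beta> z)" by (simp add: g_def)
  then have "q ^ (mm - 1) * (- (real mm / 4 * g z) - q * q * gB z) <= q ^ (mm - 1) * (2 * bn z * (q * \<beta> z))"
   using q by (intro mult_left_mono) auto
  also have "... = th (bd z) * dd (0, nn z) g z" by (simp add: thq dg[OF zs])
  finally have 1: "- (1/2 * (kap (bd z) * g z)) - q ^ (mm - 1) * (q * q) * gB z <= th (bd z) * dd (0, nn z) g z"
   by (simp add: kap_def q_def[symmetric] algebra_simps)
  have "q ^ (mm - 1) * (q * q) <= bb ^ (mm - 1) * (bb * bb)" using q bb by (intro mult_mono power_mono) auto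
  also have "... = bb ^ (mm + 1)" using mm by (simp add: power_eq_if mult_ac)
  finally have "q ^ (mm - 1) * (q * q) * gB z <= bb ^ (mm + 1) * gB z" using gB_nonneg by (intro mult_right_mono)
  then show ?thesis using 1 div_flux_ge[OF Cg z] by (simp add: g_def)
 next
  case False
  then have "kap (bd z) = 0" using mm by (auto simp: kap_def max_def power_0_left)
  then show ?thesis using False div_flux_beyond[OF z] gB_nonneg[of z] bb by simp
 qed
 have ck0: "kap s = 0" if "s > bb" for s using that mm by (auto simp: kap_def max_def power_0_left)
 have "Ck_on 0 G (%z. kap (bd z) * g z)"
 proof (rule Ck_glue[OF _ Ck_on_const _ bb(2)])
  show "Ck_on 0 strip (%z. kap (bd z) * g z)"
   using continuous_on_mult[OF continuous_on_subset[OF continuous_bd_G[OF kap_continuous] subsetI[OF strip_G]] Ck_on_cont[OF Cg]] by simp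
 qed (use ck0 in auto)
 then have cK: "continuous_on G (%z. kap (bd z) * g z)" by simp
 have bK: "\<bar>kap (bd z) * g z\<bar> <= real mm / 2 * bb ^ (mm - 1) * CB\<^sup>2" if "z : G" for z
  unfolding abs_mult using kap_le[of "bd z"] bd_pos[OF G_D[OF that]] bb power_mono[OF bnB[OF G_D[OF that]], of 2]
  by (intro mult_mono) (auto simp: g_def)
 note iK = integrable_on_slice[OF cK bK t] and iG = integrable_on_slice[OF cgB CG(2) t]
 show "(%x. kap (bd (t, x)) * (bn (t, x))\<^sup>2) integrable_on slice D t" using iK by (simp add: g_def)
 have "integral (slice D t) (%x. 1/2 * (kap (bd (t, x)) * g (t, x)) - bb ^ (mm + 1) * gB (t, x))
   <= integral (slice D t) (%x. SUMU k. px k (flux g k) (t, x))"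
 proof (rule integral_le[OF integrable_diff[OF integrable_on_mult_right[OF iK] integrable_on_mult_right[OF iG]]])
  show "(%x. SUMU k. px k (flux g k) (t, x)) integrable_on slice D t"
   by (rule integrable_on_slice[OF _ C1 t]) (auto intro!: continuous_intros Ck1_continuous_dd[OF Ck_flux(2)[OF Cg]])
 qed (use le t slice_G in auto)
 then show "integral (slice D t) (%x. kap (bd (t, x)) * (bn (t, x))\<^sup>2) <= 2 * bb ^ (mm + 1) * integral (slice D t) (%x. gB (t, x))"
  using div0 integral_diff[OF integrable_on_mult_right[OF iK, of "1/2"] integrable_on_mult_right[OF iG, of "bb ^ (mm + 1)"]]
  by (simp add: g_def)
qed

lemma kap_ge: "s <= 9/16 * d0 ==> real mm / 2 * (d0 / 16) ^ (mm - 1) <= kap s"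
 unfolding kap_def using d0 by (intro mult_left_mono power_mono) (auto simp: bb_def)

lemma bd_lipschitz:
 assumes "(t, x) : D" "(t, y) : D"
 shows "\<bar>bd (t, x) - bd (t, y)\<bar> <= dist x y"
 using infdist_triangle_abs[of x "frontier (slice D t)" y] by (simp add: bd_def)

text \<open>The averaging radius \<open>rh = d0 / 16\<close> keeps all averages over points of the
  cutoff layer in the range of distances from \<open>3 * rh\<close> to \<open>9 * rh\<close>. There
  the pressure is not affected by \<open>cut rh\<close>, whose transition ends at
  \<open>2 * rh\<close>, and \<open>kap\<close> is bounded below, so Kato's inequality controls the
  mean value part.\<close>

lemma strip_gradient_P:
 assumes t: "t : {0<..<T}"
 shows "(%x. \<bar>\<eta> (bd (t, x)) * dd 1 \<eta> (bd (t, x))\<bar> * \<bar>px i P (t, x)\<bar>) integrable_on slice D t"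
  and "integral (slice D t) (%x. \<bar>\<eta> (bd (t, x)) * dd 1 \<eta> (bd (t, x))\<bar> * \<bar>px i P (t, x)\<bar>) <=
   strip_const TYPE('n) d0 \<eta> * integral (slice D t) (%x. \<bar>LapP (t, x)\<bar>)"
proof -
 define rh where "rh = d0 / 16"
 have rh: "rh > 0" "2 * rh < d0" using d0 by (auto simp: rh_def)
 define c where "c = cut_deriv_bound \<eta>"
 have c: "c > 0" "\<bar>dd 1 \<eta> s\<bar> <= c" for s using cut_deriv_bound[OF cutoff_\<eta>] by (auto simp: c_def)
 have er: "0 <= \<eta> s" "\<eta> s <= 1" for s using cutoff_\<eta> by (auto simp: cutoff_def)
 define h where "h s = \<bar>\<eta> s * dd 1 \<eta> s\<bar>" for s
 have h: "0 <= h s" "h s <= c" for s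
  using mult_mono[of "\<bar>\<eta> s\<bar>" 1 "\<bar>dd 1 \<eta> s\<bar>" c] er[of s] c by (auto simp: h_def abs_mult)
 have h0: "h s = 0" if "s < d0 / 4 \<or> s > d0 / 2" for s using cutoff_deriv_zero[OF cutoff_\<eta> that] by (simp add: h_def)
 have ch: "continuous_on UNIV h" unfolding h_def
  using Ck_on_cont[OF cutoff_Ck[OF cutoff_\<eta>, of 0]] Ck1_continuous_dd[OF cutoff_Ck[OF cutoff_\<eta>]] by (intro continuous_intros)
 define k where "k = real mm / 2 * (d0 / 16) ^ (mm - 1)"
 have k: "k > 0" using mm d0 by (simp add: k_def)
 define w where "w z = P z - cP" for z
 have Cw: "Ck_on k dom w" for k unfolding w_def by (intro Ck_on_diff_fun dom Ck_P Ck_on_const)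
 define u where "u x = cut rh w (t, x)" for x
 define \<alpha> where "\<alpha> x = cut rh (%z. h (bd z)) (t, x)" for x
 have "Ck_on 2 {y. (t, y) : slab} u" unfolding u_def
  by (rule Ck_on_slice[OF open_slab Ck_cut[OF Ck_dom_G[OF Cw] _ rh]]) simp
 then have u2: "Ck_on 2 UNIV u" using t by simp
 obtain R where R: "R > 0" "!!z. z : closure D ==> norm (snd z) <= R" by (rule slice_norm_bound) blast
 have uR: "norm x <= R" if "u x ~= 0" for x
 proof -
  have "(t, x) : D" using that cut_outside unfolding u_def by blast
  then show ?thesis using R(2)[of "(t, x)"] closure_subset[of D] by auto
 qed
 have cD: "continuous_on D (%z. h (bd z))"
  by (rule continuous_on_compose2[OF ch continuous_on_bd]) auto
 have \<alpha>c: "continuous_on UNIV \<alpha>" unfolding \<alpha>_def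
  by (rule continuous_on_compose2[OF continuous_on_cut[OF cD rh(1)]]) (use t in \<open>auto intro!: continuous_intros\<close>)
 have \<alpha>eq: "\<alpha> x = h (bd (t, x))" if "(t, x) : D" for x
 proof (cases "bd (t, x) > 2 * rh")
  case True
  then show ?thesis using that chi_large[OF rh(1)] by (simp add: \<alpha>_def cut_def)
 next
  case False
  then show ?thesis using that h0[of "bd (t, x)"] rh(1) by (simp add: \<alpha>_def cut_def rh_def)
 qed
 have \<alpha>0: "0 <= \<alpha> x" "\<alpha> x <= c" for x
  using \<alpha>eq[of x] h c(1) by (cases "(t, x) : D"; auto simp: \<alpha>_def cut_outside)+
 \<comment> \<open>A nonzero weight at \<open>x + y\<close> places that point between distances
   \<open>d0 / 4\<close> and \<open>d0 / 2\<close>; the distance changes by at most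
   \<open>rh\<close> on the way to \<open>x\<close>.\<close>
 have near: "(t, x) : G & 3 * rh <= bd (t, x) & bd (t, x) <= 9/16 * d0" if "\<alpha> (x + y) ~= 0" "norm y <= rh" for x y
 proof -
  have xy: "(t, x + y) : D" using that(1) cut_outside unfolding \<alpha>_def by blast
  have b: "d0 / 4 <= bd (t, x + y)" "bd (t, x + y) <= d0 / 2"
   using h0[of "bd (t, x + y)"] that(1) \<alpha>eq[OF xy] by (auto simp: not_less[symmetric])
  have xD: "(t, x) : D"
  proof (rule ccontr)
   assume "(t, x) \<notin> D"
   then have "bd (t, x + y) <= norm y" using bd_le[OF xy, of x] by (simp add: dist_norm)
   then show False using b that(2) d0 by (simp add: rh_def)
  qed
  have "\<bar>bd (t, x + y) - bd (t, x)\<bar> <= rh" using bd_lipschitz[OF xy xD] that(2) by (simp add: dist_norm)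
  then have "bd (t, x + y) - bd (t, x) <= d0 / 16" "bd (t, x) - bd (t, x + y) <= d0 / 16" unfolding rh_def by linarith+
  then have "3 * (d0 / 16) <= bd (t, x)" "bd (t, x) <= 9/16 * d0" using b by linarith+
  then show ?thesis using xD slice_G[of t x] t by (simp add: rh_def)
 qed
 define O' where "O' = {z\<in>G. 2 * rh < bd z}"
 have oO: "open O'" unfolding O'_def by (rule open_superlevel)
 have cutw: "cut rh w z = w z" if "z : O'" for z
  using that chi_large[OF rh(1)] G_D by (simp add: O'_def cut_def)
 have "open ((%x. (t, x)) -` O')" by (intro open_vimage oO continuous_intros)
 then have oS: "open {x. (t, x) : O'}" by (simp add: vimage_def)
 have ddu: "dd (ei j) u x = px j P (t, x)" if "(t, x) : O'" for j x
 proof -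
  have zd: "(t, x) : dom" using that G_dom by (auto simp: O'_def)
  have "dd (ei j) u x = dd (ei j) (%x. w (t, x)) x"
   by (rule dd_cong_open[OF oS]) (use that cutw in \<open>auto simp: u_def\<close>)
  also have "... = px j w (t, x)" by (rule dd_slice[OF diff_dom[OF Cw zd]])
  also have "... = px j P (t, x)" unfolding w_def using dd_diff[OF diff_P[OF zd] differentiable_const] by simp
  finally show ?thesis .
 qed
 have lapu: "(SUMU j. dd (ei j) (dd (ei j) u) x) = LapP (t, x)" if "(t, x) : O'" for x
 proof -
  have zd: "(t, x) : dom" using that G_dom by (auto simp: O'_def)
  have "dd (ei j) (dd (ei j) u) x = px j (px j P) (t, x)" for j
  proof -
   have "dd (ei j) (dd (ei j) u) x = dd (ei j) (%x. px j P (t, x)) x"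
    by (rule dd_cong_open[OF oS]) (use that ddu in auto)
   then show ?thesis using dd_slice[OF diff_dP[OF zd], of "ei j"] by simp
  qed
  then show ?thesis by (simp add: LapP_def)
 qed
 define U where "U x = (if x : slice D t then c / k * (kap (bd (t, x)) * \<bar>P (t, x) - cP\<bar>) else 0)" for x
 define W where "W x = (if x : slice D t then c * \<bar>LapP (t, x)\<bar> else 0)" for x
 have Ui: "U integrable_on UNIV" "integral UNIV U = c / k * integral (slice D t) (%x. kap (bd (t, x)) * \<bar>P (t, x) - cP\<bar>)"
  unfolding U_def integrable_restrict_UNIV integral_restrict_UNIV
  by (rule integrable_on_mult_right[OF kato(1)[OF t]], rule integral_mult_right)
 have Wi: "W integrable_on UNIV" "integral UNIV W = c * integral (slice D t) (%x. \<bar>LapP (t, x)\<bar>)"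
  unfolding W_def integrable_restrict_UNIV integral_restrict_UNIV
  by (rule integrable_on_mult_right[OF kato(2)[OF t]], rule integral_mult_right)
 have UW0: "0 <= U x" "0 <= W x" for x unfolding U_def W_def using c k kap_nonneg by auto
 have Ub: "\<alpha> (x + y) * \<bar>u x\<bar> <= U x" if "norm y <= rh" for x y
 proof (cases "\<alpha> (x + y) = 0")
  case False
  note n = near[OF False that]
  then have xO: "(t, x) : O'" using rh by (simp add: O'_def)
  have "k <= kap (bd (t, x))" unfolding k_def by (rule kap_ge) (use n in simp)
  then have "1 <= kap (bd (t, x)) / k" using k by simp
  then have "c * \<bar>P (t, x) - cP\<bar> * 1 <= c * \<bar>P (t, x) - cP\<bar> * (kap (bd (t, x)) / k)" using c by (intro mult_left_mono) auto
  moreover have "\<alpha> (x + y) * \<bar>u x\<bar> <= c * \<bar>P (t, x) - cP\<bar>"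
   using \<alpha>0[of "x + y"] c by (intro mult_mono) (auto simp: u_def cutw[OF xO] w_def)
  ultimately show ?thesis using n G_D by (simp add: U_def mult_ac)
 qed (use UW0 in simp)
 have Wb: "\<alpha> (x + y) * \<bar>SUMU j. dd (ei j) (dd (ei j) u) x\<bar> <= W x" if "norm y <= rh" for x y
 proof (cases "\<alpha> (x + y) = 0")
  case False
  note n = near[OF False that]
  then have xO: "(t, x) : O'" using rh by (simp add: O'_def)
  show ?thesis using n G_D \<alpha>0[of "x + y"] by (simp add: W_def lapu[OF xO] mult_right_mono)
 qed (use UW0 in simp)
 have eq: "\<alpha> x * \<bar>dd (ei i) u x\<bar> = (if x : slice D t then h (bd (t, x)) * \<bar>px i P (t, x)\<bar> else 0)" for x
 proof (cases "\<alpha> x = 0")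
  case True
  then show ?thesis using \<alpha>eq[of x] by auto
 next
  case False
  then have xO: "(t, x) : O'" using near[of x 0] rh by (simp add: O'_def)
  then show ?thesis using \<alpha>eq[of x] ddu[OF xO] G_D by (auto simp: O'_def)
 qed
 have cP': "continuous_on G (%z. h (bd z) * \<bar>px i P z\<bar>)"
  by (intro continuous_on_mult continuous_bd_G[OF ch] continuous_on_rabs continuous_on_dom_G[OF Ck_dP])
 have "\<bar>h (bd z) * \<bar>px i P z\<bar>\<bar> <= c * M" if "z : G" for z
  using h[of "bd z"] abs_px_P_le[of z i] closure_subset[of D] G_D[OF that] M_pos c by (auto simp: abs_mult intro!: mult_mono)
 from integrable_on_slice[OF cP' this t]
 show "(%x. \<bar>\<eta> (bd (t, x)) * dd 1 \<eta> (bd (t, x))\<bar> * \<bar>px i P (t, x)\<bar>) integrable_on slice D t" by (simp add: h_def)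
 let ?I = "integral (slice D t) (%x. h (bd (t, x)) * \<bar>px i P (t, x)\<bar>)" and ?L = "integral (slice D t) (%x. \<bar>LapP (t, x)\<bar>)"
 have "bump_mass TYPE('n) * ?I <= 2 ^ CARD('n) * (24 / rh * integral UNIV U + 6 * rh * integral UNIV W)"
  using L1_gradient_estimate[OF u2 uR rh(1) \<alpha>c \<alpha>0(1) Ui(1) Ub Wi(1) Wb, of i] unfolding eq integral_restrict_UNIV .
 also have "... <= 2 ^ CARD('n) * (24 / rh * (c / k * (bb ^ (mm + 1) * ?L)) + 6 * rh * (c * ?L))"
  unfolding Ui Wi using rh c k kato(3)[OF t] by (intro mult_left_mono add_mono) auto
 finally have fin: "bump_mass TYPE('n) * ?I <= (2 ^ CARD('n) * (24 / rh * (c / k * bb ^ (mm + 1)) + 6 * rh * c)) * ?L"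
  by (simp add: algebra_simps)
 have sc: "strip_const TYPE('n) d0 \<eta> = (2 ^ CARD('n) * (24 / rh * (c / k * bb ^ (mm + 1)) + 6 * rh * c)) / bump_mass TYPE('n)"
  by (simp only: strip_const_def Let_def rh_def c_def k_def bb_def mm_def)
 from fin have "?I <= (2 ^ CARD('n) * (24 / rh * (c / k * bb ^ (mm + 1)) + 6 * rh * c)) * ?L / bump_mass TYPE('n)"
  using bump_mass_pos[where 'n='n] by (subst pos_le_divide_eq) (auto simp: mult.commute)
 then show "integral (slice D t) (%x. \<bar>\<eta> (bd (t, x)) * dd 1 \<eta> (bd (t, x))\<bar> * \<bar>px i P (t, x)\<bar>) <=
   strip_const TYPE('n) d0 \<eta> * ?L"
  unfolding sc h_def by (simp only: times_divide_eq_left)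
qed

end

section \<open>The energy identity\<close>

text \<open>The polarised first part of the energy density. Matrices stand for gradients with the
  index of differentiation first.\<close>

definition tri :: "('n::finite => 'n => real) => ('n => 'n => real) => ('n => 'n => real) => real" where
 "tri q a b = (SUMU i. SUMU k. SUMU j. q i j * a j k * b i k)"

text \<open>Since \<open>|curl v|\<^sup>2 = 2 |\<partial>v|\<^sup>2 - 2 \<partial>\<^sub>iv\<^sub>k \<partial>\<^sub>kv\<^sub>i\<close>, the density of \<open>E\<^sub>1\<close> is
 \<open>bil q \<partial>v \<partial>v + bil q \<partial>B \<partial>B / (4\<pi>)\<close>.\<close>

definition bil :: "('n::finite => 'n => real) => ('n => 'n => real) => ('n => 'n => real) => real" where
 "bil q a b = tri q a b + 2 * (SUMU i. SUMU k. (a i k - a k i) * b i k)"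

lemma tri_sym:
 fixes q a b :: "'n::finite => 'n => real"
 assumes "!!i j. q i j = q j i"
 shows "tri q a b = tri q b a"
proof -
 have "tri q a b = (SUMU i. SUMU j. SUMU k. q i j * a j k * b i k)"
  unfolding tri_def by (intro sum.cong refl sum.swap)
 also have "... = (SUMU j. SUMU i. SUMU k. q j i * b i k * a j k)"
  by (subst sum.swap) (use assms in \<open>simp add: mult_ac\<close>)
 also have "... = tri q b a"
  unfolding tri_def by (intro sum.cong refl sum.swap)
 finally show ?thesis .
qed

lemma bil_sym:
 fixes q a b :: "'n::finite => 'n => real"
 assumes "!!i j. q i j = q j i"
 shows "bil q a b = bil q b a"
proof -
 have "(SUMU i. SUMU k. a k i * b i k) = (SUMU i. SUMU k. b k i * a i k)"
  by (subst sum.swap) (simp add: mult.commute)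
 moreover have "(SUMU i. SUMU k. (x i k - x k i) * y i k) = (SUMU i. SUMU k. x i k * y i k) - (SUMU i. SUMU k. x k i * y i k)" for x y :: "'n => 'n => real"
  by (simp add: left_diff_distrib sum_subtractf)
 moreover have "(SUMU i. SUMU k. a i k * b i k) = (SUMU i. SUMU k. b i k * a i k)" by (simp only: mult.commute)
 ultimately show ?thesis using tri_sym[of q a b] assms unfolding bil_def by simp
qed

lemma bil_linear:
 "bil q (%i k. a i k + a' i k) b = bil q a b + bil q a' b"
 "bil q (%i k. a i k - a' i k) b = bil q a b - bil q a' b"
 "bil q (%i k. - a i k) b = - bil q a b"
 "bil q (%i k. c * a i k) b = c * bil q a b"
 by (simp_all add: bil_def tri_def algebra_simps sum.distrib sum_subtractf sum_negf sum_distrib_left)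

lemma abs_sum_le_card:
 fixes f :: "'n::finite => real"
 assumes "!!i. \<bar>f i\<bar> <= c"
 shows "\<bar>SUMU i. f i\<bar> <= real CARD('n) * c"
 using order.trans[OF sum_abs sum_bounded_above[of UNIV "%i. \<bar>f i\<bar>" c]] assms by simp

lemma abs_tri_le:
 fixes q :: "'n::finite => 'n => real"
 assumes q: "!!i j. \<bar>q i j\<bar> <= \<kappa>" and a: "!!i j. \<bar>a i j\<bar> <= \<alpha>" and b: "!!i j. \<bar>b i j\<bar> <= \<beta>"
 shows "\<bar>tri q a b\<bar> <= real CARD('n) ^ 3 * (\<kappa> * \<alpha> * \<beta>)"
proof -
 have "\<kappa> \<ge> 0" "\<alpha> \<ge> 0" using q a by (meson abs_ge_zero order.trans)+
 then have "\<bar>q i j * a j k * b i k\<bar> <= \<kappa> * \<alpha> * \<beta>" for i j k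
  unfolding abs_mult using q a b by (intro mult_mono mult_nonneg_nonneg) auto
 then have "\<bar>tri q a b\<bar> <= real CARD('n) * (real CARD('n) * (real CARD('n) * (\<kappa> * \<alpha> * \<beta>)))"
  unfolding tri_def by (intro abs_sum_le_card)
 then show ?thesis by (simp add: power3_eq_cube mult_ac)
qed

lemma abs_bil_le:
 fixes q :: "'n::finite => 'n => real"
 assumes q: "!!i j. \<bar>q i j\<bar> <= 2" and a: "!!i j. \<bar>a i j\<bar> <= \<alpha>" and b: "!!i j. \<bar>b i j\<bar> <= \<beta>"
 shows "\<bar>bil q a b\<bar> <= 6 * real CARD('n) ^ 3 * (\<alpha> * \<beta>)"
proof -
 have ab: "\<alpha> \<ge> 0" "\<beta> \<ge> 0" using a b by (meson abs_ge_zero order.trans)+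
 have "\<bar>(a i k - a k i) * b i k\<bar> <= (2 * \<alpha>) * \<beta>" for i k
  unfolding abs_mult using a[of i k] a[of k i] b[of i k] ab by (intro mult_mono) auto
 then have "\<bar>SUMU i. SUMU k. (a i k - a k i) * b i k\<bar> <= real CARD('n) * (real CARD('n) * ((2 * \<alpha>) * \<beta>))"
  by (intro abs_sum_le_card)
 then have 1: "\<bar>SUMU i. SUMU k. (a i k - a k i) * b i k\<bar> <= 2 * ((real CARD('n) * real CARD('n)) * (\<alpha> * \<beta>))" by (simp add: mult_ac)
 have 2: "\<bar>tri q a b\<bar> <= 2 * (real CARD('n) ^ 3 * (\<alpha> * \<beta>))"
  using abs_tri_le[of q 2 a \<alpha> b \<beta>] assms by (simp add: mult_ac)
 have "1 <= real CARD('n)" using zero_less_card_finite[where 'a='n] by linarith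
 then have "(real CARD('n) * real CARD('n)) * 1 <= (real CARD('n) * real CARD('n)) * real CARD('n)" by (intro mult_left_mono) auto
 then have "(real CARD('n) * real CARD('n)) * (\<alpha> * \<beta>) <= real CARD('n) ^ 3 * (\<alpha> * \<beta>)"
  using ab by (intro mult_right_mono) (auto simp: power3_eq_cube)
 then show ?thesis using 1 2 unfolding bil_def by linarith
qed

lemma antisymmetric_sq:
 fixes a :: "'n::finite => 'n => real"
 shows "(SUMU i. SUMU k. (a i k - a k i)\<^sup>2) = 2 * (SUMU i. SUMU k. (a i k - a k i) * a i k)"
proof -
 have 1: "(SUMU i. SUMU k. (a i k - a k i) * a i k) = (SUMU i. SUMU k. - ((a i k - a k i) * a k i))"
  by (subst sum.swap) (simp add: algebra_simps)
 have "(SUMU i. SUMU k. (a i k - a k i)\<^sup>2) = (SUMU i. SUMU k. (a i k - a k i) * a i k - (a i k - a k i) * a k i)"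
  by (simp add: power2_eq_square algebra_simps)
 also have "... = 2 * (SUMU i. SUMU k. (a i k - a k i) * a i k)"
  using 1 by (simp only: sum_subtractf sum_negf)
 finally show ?thesis .
qed

text \<open>The form bounds the tangential part \<open>b\<close> and the antisymmetric part
  \<open>c\<close> of the gradient; the missing normal derivative \<open>w\<close> is recovered from
  these and from the zero trace. Since \<open>e <= 1\<close>, a partly switched off projection only
  adds to the form.\<close>

lemma coercivity:
 fixes a :: "'n::finite => 'n => real" and N :: "'n => real"
 assumes tr: "(SUMU k. a k k) = 0" and N: "(SUMU k. (N k)\<^sup>2) = 1" and e: "0 <= e" "e <= 1"
 shows "(SUMU i. SUMU k. (a i k)\<^sup>2) <= (3 * real CARD('n) + 4) *
  bil (%i j. (if i = j then 1 else 0) - e\<^sup>2 * N i * N j) a a"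
proof -
 define w where "w k = (SUMU i. N i * a i k)" for k
 define b where "b i k = a i k - N i * w k" for i k
 define c where "c i k = a i k - a k i" for i k
 define A W Bs Cs where "A = (SUMU i. SUMU k. (a i k)\<^sup>2)" and "W = (SUMU k. (w k)\<^sup>2)"
  and "Bs = (SUMU k. SUMU i. (b i k)\<^sup>2)" and "Cs = (SUMU k. SUMU i. (c i k)\<^sup>2)"
 have A': "A = (SUMU k. SUMU i. (a i k)\<^sup>2)" unfolding A_def by (rule sum.swap)
 have nonneg: "0 <= W" "0 <= Bs" "0 <= Cs" by (simp_all add: W_def Bs_def Cs_def sum_nonneg)
 have "(SUMU i. (b i k)\<^sup>2) = (SUMU i. (a i k)\<^sup>2) - (w k)\<^sup>2" for k
 proof -
  have "(SUMU i. (b i k)\<^sup>2) = (SUMU i. (a i k)\<^sup>2 - 2 * w k * (N i * a i k) + (w k)\<^sup>2 * (N i)\<^sup>2)"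
   by (intro sum.cong) (auto simp: b_def power2_eq_square algebra_simps)
  also have "... = (SUMU i. (a i k)\<^sup>2) - 2 * w k * w k + (w k)\<^sup>2 * 1"
   by (simp only: sum.distrib sum_subtractf sum_distrib_left[symmetric] w_def[symmetric] N)
  finally show ?thesis by (simp add: power2_eq_square)
 qed
 then have AB: "A = Bs + W" by (simp add: A' Bs_def W_def sum_subtractf)
 \<comment> \<open>Antisymmetry exchanges the normal derivative of component \<open>k\<close> for
   the derivative of the normal component in direction \<open>k\<close>. The only part of the latter
   not visible in \<open>b\<close> is purely normal, and the trace condition expresses it by the
   trace of \<open>b\<close>.\<close>
 have wk: "w k = (SUMU i. N i * b k i) - N k * (SUMU i. b i i) + (SUMU i. N i * c i k)" for k
 proof -
  have "(SUMU i. N i * b k i) = (SUMU i. N i * a k i) - N k * (SUMU i. N i * w i)"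
   by (simp add: b_def right_diff_distrib sum_subtractf sum_distrib_left mult_ac)
  moreover have "(SUMU i. b i i) = - (SUMU i. N i * w i)" using tr by (simp add: b_def sum_subtractf)
  moreover have "(SUMU i. N i * c i k) = w k - (SUMU i. N i * a k i)"
   by (simp add: c_def right_diff_distrib sum_subtractf w_def)
  ultimately show ?thesis by simp
 qed
 have cs: "(SUMU i. N i * x i)\<^sup>2 <= (SUMU i. (x i)\<^sup>2)" for x
  using Cauchy_Schwarz_ineq_sum[of N x UNIV] N by simp
 have tb: "(SUMU i. b i i)\<^sup>2 <= real CARD('n) * Bs"
 proof -
  have "(SUMU i. 1 * b i i)\<^sup>2 <= (\<Sum>i::'n\<in>UNIV. 1\<^sup>2) * (SUMU i. (b i i)\<^sup>2)" by (rule Cauchy_Schwarz_ineq_sum)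
  also have "... <= real CARD('n) * Bs" unfolding Bs_def
   by (auto intro!: mult_left_mono sum_mono member_le_sum)
  finally show ?thesis by simp
 qed
 have sq3: "(x - y + z)\<^sup>2 <= 3 * (x\<^sup>2 + y\<^sup>2 + z\<^sup>2)" for x y z :: real
  using zero_le_power2[of "x + y"] zero_le_power2[of "x - z"] zero_le_power2[of "y + z"] by (simp add: power2_eq_square algebra_simps)
 have "W <= (SUMU k. 3 * ((SUMU i. (b k i)\<^sup>2) + (N k)\<^sup>2 * (SUMU i. b i i)\<^sup>2 + (SUMU i. (c i k)\<^sup>2)))"
  unfolding W_def
 proof (rule sum_mono)
  fix k
  show "(w k)\<^sup>2 <= 3 * ((SUMU i. (b k i)\<^sup>2) + (N k)\<^sup>2 * (SUMU i. b i i)\<^sup>2 + (SUMU i. (c i k)\<^sup>2))"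
   unfolding wk[of k] power_mult_distrib[symmetric] by (intro order.trans[OF sq3] mult_left_mono add_mono cs order_refl) simp
 qed
 also have "... = 3 * (Bs + (SUMU i. b i i)\<^sup>2 + Cs)"
 proof -
  have "(SUMU k. SUMU i. (b k i)\<^sup>2) = Bs" unfolding Bs_def by (rule sum.swap)
  then show ?thesis by (simp only: sum.distrib sum_distrib_left[symmetric] sum_distrib_right[symmetric] N Cs_def[symmetric]) simp
 qed
 also have "... <= 3 * (Bs + real CARD('n) * Bs + Cs)" using tb by simp
 finally have W: "W <= 3 * (Bs + real CARD('n) * Bs + Cs)" .
 have e2: "e\<^sup>2 <= 1" using e by (simp add: power_le_one)
 have "tri (%i j. (if i = j then 1 else 0) - e\<^sup>2 * N i * N j) a a = A - e\<^sup>2 * W"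
 proof -
  have "tri (%i j. (if i = j then 1 else 0) - e\<^sup>2 * N i * N j) a a
    = (SUMU i. SUMU k. (SUMU j. (if i = j then a j k * a i k else 0)) - e\<^sup>2 * (N i * a i k) * (SUMU j. N j * a j k))"
   unfolding tri_def sum_distrib_left sum_subtractf[symmetric] by (intro sum.cong) (auto simp: algebra_simps)
  also have "... = A - (SUMU i. SUMU k. e\<^sup>2 * (N i * a i k) * w k)"
   by (simp add: sum_subtractf A_def power2_eq_square w_def)
  also have "(SUMU i. SUMU k. e\<^sup>2 * (N i * a i k) * w k) = (SUMU k. e\<^sup>2 * (w k * w k))"
   by (subst sum.swap) (simp add: w_def sum_distrib_left sum_distrib_right mult_ac)
  finally show ?thesis by (simp add: W_def sum_distrib_left power2_eq_square)
 qed
 moreover have "2 * (SUMU i. SUMU k. (a i k - a k i) * a i k) = Cs"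
  unfolding antisymmetric_sq[symmetric] Cs_def c_def by (rule sum.swap)
 ultimately have f: "bil (%i j. (if i = j then 1 else 0) - e\<^sup>2 * N i * N j) a a = A - e\<^sup>2 * W + Cs" by (simp add: bil_def)
 have "e\<^sup>2 * W <= W" using e2 nonneg by (simp add: mult_left_le_one_le)
 then have "Bs + Cs <= A - e\<^sup>2 * W + Cs" using AB by simp
 then have "(3 * real CARD('n) + 4) * (Bs + Cs) <= (3 * real CARD('n) + 4) * (A - e\<^sup>2 * W + Cs)" by (intro mult_left_mono) auto
 moreover have "A <= (3 * real CARD('n) + 4) * (Bs + Cs)"
 proof -
  have "0 <= (3 * real CARD('n) + 1) * Cs" using nonneg by simp
  then show ?thesis using AB W by (simp add: algebra_simps)
 qed
 ultimately show ?thesis unfolding f A_def[symmetric] by linarith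
qed

lemma dd_tri:
 assumes "!!i j. q i j differentiable at z" "!!i j. a i j differentiable at z" "!!i j. b i j differentiable at z"
 shows "dd h (%z. tri (%i j. q i j z) (%i j. a i j z) (%i j. b i j z)) z =
  tri (%i j. dd h (q i j) z) (%i j. a i j z) (%i j. b i j z) + tri (%i j. q i j z) (%i j. dd h (a i j) z) (%i j. b i j z)
  + tri (%i j. q i j z) (%i j. a i j z) (%i j. dd h (b i j) z)"
  and "(%z. tri (%i j. q i j z) (%i j. a i j z) (%i j. b i j z)) differentiable at z"
proof -
 note d = assms
 have d2: "(%z. q i j z * a j k z) differentiable at z" for i j k by (intro differentiable_mult d)
 have d3: "(%z. q i j z * a j k z * b i k z) differentiable at z" for i j k by (intro differentiable_mult d)
 have e: "dd h (%z. q i j z * a j k z * b i k z) z =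
  dd h (q i j) z * a j k z * b i k z + q i j z * dd h (a j k) z * b i k z + q i j z * a j k z * dd h (b i k) z" for i j k
  using dd_mult[OF d2 d(3), of h i j k i k] dd_mult[OF d(1,2), of h i j j k] by (simp add: algebra_simps)
 have s1: "(%z. SUMU j. q i j z * a j k z * b i k z) differentiable at z" for i k by (intro differentiable_sum ballI finite d3)
 have s2: "(%z. SUMU k. SUMU j. q i j z * a j k z * b i k z) differentiable at z" for i by (intro differentiable_sum ballI finite s1)
 show "(%z. tri (%i j. q i j z) (%i j. a i j z) (%i j. b i j z)) differentiable at z"
  unfolding tri_def by (intro differentiable_sum ballI finite s2)
 have t3: "dd h (%z. SUMU j.  q i j z * a j k z * b i k z) z = (SUMU j. dd h (%z.  q i j z * a j k z * b i k z) z)" for i k by (rule dd_sum) (rule d3)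
 have t2: "dd h (%z. SUMU k. SUMU j. q i j z * a j k z * b i k z) z = (SUMU k. dd h (%z. SUMU j. q i j z * a j k z * b i k z) z)" for i by (rule dd_sum) (rule s1)
 have t1: "dd h (%z. SUMU i. SUMU k. SUMU j. q i j z * a j k z * b i k z) z = (SUMU i. dd h (%z. SUMU k. SUMU j. q i j z * a j k z * b i k z) z)" by (rule dd_sum) (rule s2)
 show "dd h (%z. tri (%i j. q i j z) (%i j. a i j z) (%i j. b i j z)) z =
  tri (%i j. dd h (q i j) z) (%i j. a i j z) (%i j. b i j z) + tri (%i j. q i j z) (%i j. dd h (a i j) z) (%i j. b i j z)
  + tri (%i j. q i j z) (%i j. a i j z) (%i j. dd h (b i j) z)"
  unfolding tri_def t1 t2 t3 e by (simp add: sum.distrib)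
qed

lemma dd_bil:
 assumes q: "!!i j. q i j differentiable at z" and a: "!!i j. a i j differentiable at z" and b: "!!i j. b i j differentiable at z"
 shows "dd h (%z. bil (%i j. q i j z) (%i j. a i j z) (%i j. b i j z)) z =
  tri (%i j. dd h (q i j) z) (%i j. a i j z) (%i j. b i j z) + bil (%i j. q i j z) (%i j. dd h (a i j) z) (%i j. b i j z)
  + bil (%i j. q i j z) (%i j. a i j z) (%i j. dd h (b i j) z)"
  and "(%z. bil (%i j. q i j z) (%i j. a i j z) (%i j. b i j z)) differentiable at z"
proof -
 have c: "(%z. a i k z - a k i z) differentiable at z" for i k by (intro differentiable_diff a)
 have d3: "(%z. (a i k z - a k i z) * b i k z) differentiable at z" for i k by (intro differentiable_mult c b)
 have s1: "(%z. SUMU k. (a i k z - a k i z) * b i k z) differentiable at z" for i by (intro differentiable_sum ballI finite d3)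
 have s2: "(%z. SUMU i. SUMU k. (a i k z - a k i z) * b i k z) differentiable at z" by (intro differentiable_sum ballI finite s1)
 have s3: "(%z. 2 * (SUMU i. SUMU k. (a i k z - a k i z) * b i k z)) differentiable at z" by (intro differentiable_mult s2) auto
 note tq = dd_tri[OF q a b]
 have e: "dd h (%z. (a i k z - a k i z) * b i k z) z = (dd h (a i k) z - dd h (a k i) z) * b i k z + (a i k z - a k i z) * dd h (b i k) z" for i k
  using dd_mult[OF c b, of h i k i k] dd_diff[OF a a, of h i k k i] by simp
 show "(%z. bil (%i j. q i j z) (%i j. a i j z) (%i j. b i j z)) differentiable at z"
  unfolding bil_def by (intro differentiable_add tq s3)
 have t2: "dd h (%z. SUMU k.  (a i k z - a k i z) * b i k z) z = (SUMU k. dd h (%z.  (a i k z - a k i z) * b i k z) z)" for i by (rule dd_sum) (rule d3)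
 have t1: "dd h (%z. SUMU i. SUMU k. (a i k z - a k i z) * b i k z) z = (SUMU i. dd h (%z. SUMU k. (a i k z - a k i z) * b i k z) z)" by (rule dd_sum) (rule s1)
 show "dd h (%z. bil (%i j. q i j z) (%i j. a i j z) (%i j. b i j z)) z =
  tri (%i j. dd h (q i j) z) (%i j. a i j z) (%i j. b i j z) + bil (%i j. q i j z) (%i j. dd h (a i j) z) (%i j. b i j z)
  + bil (%i j. q i j z) (%i j. a i j z) (%i j. dd h (b i j) z)"
  unfolding bil_def dd_add[OF tq(2) s3] dd_cmult[OF s2] t1 t2 e tq(1) by (simp add: sum.distrib)
qed

lemma Ck_tri:
 assumes S: "open S" and q: "!!i j. Ck_on k S (q i j)" and a: "!!i j. Ck_on k S (a i j)" and b: "!!i j. Ck_on k S (b i j)"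
 shows "Ck_on k S (%z. tri (%i j. q i j z) (%i j. a i j z) (%i j. b i j z))"
  and "Ck_on k S (%z. bil (%i j. q i j z) (%i j. a i j z) (%i j. b i j z))"
 unfolding bil_def tri_def
 by (intro Ck_on_add Ck_on_sum Ck_on_mult Ck_on_diff_fun S q a b Ck_on_const)+

context mhd_flow
begin

text \<open>\<open>q_coeff\<close> with the gradient of the distance replaced by the normal at the
  foot. The two agree in the strip, and beyond it both are multiplied by zero.\<close>

definition qq :: "'n => 'n => real \<times> (real^'n) => real" where
 "qq i j z = (if i = j then 1 else 0) - (\<eta> (bd z))\<^sup>2 * nn z $ i * nn z $ j"

abbreviation dV :: "'n => 'n => real \<times> (real^'n) => real" where "dV i k \<equiv> px i (Vc k)"
abbreviation dB :: "'n => 'n => real \<times> (real^'n) => real" where "dB i k \<equiv> px i (Bc k)"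
abbreviation qz :: "real \<times> (real^'n) => 'n => 'n => real" where "qz z \<equiv> (%i j. qq i j z)"
abbreviation vz :: "real \<times> (real^'n) => 'n => 'n => real" where "vz z \<equiv> (%i j. dV i j z)"
abbreviation bz :: "real \<times> (real^'n) => 'n => 'n => real" where "bz z \<equiv> (%i j. dB i j z)"

definition en :: "real \<times> (real^'n) => real" where
 "en z = bil (qz z) (vz z) (vz z) + (1 / (4 * pi)) * bil (qz z) (bz z) (bz z)"

lemma qq_sym: "qq i j z = qq j i z" by (auto simp: qq_def)

lemma eta_range: "0 <= \<eta> s" "\<eta> s <= 1" and eta_zero: "s > d0 / 2 ==> \<eta> s = 0" and eta_one: "s < d0 / 4 ==> \<eta> s = 1"
 using cutoff_\<eta> by (auto simp: cutoff_def)

lemma abs_nn_le: "z : D ==> \<bar>nn z $ i\<bar> <= 1"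
 using component_le_norm_cart[of "nn z" i] norm_nn[of z] by simp

lemma abs_qq_le: "z : D ==> \<bar>qq i j z\<bar> <= 2"
proof -
 assume z: "z : D"
 have "\<bar>(\<eta> (bd z))\<^sup>2 * nn z $ i * nn z $ j\<bar> <= 1 * 1 * 1"
  unfolding abs_mult using abs_nn_le[OF z] eta_range[of "bd z"] by (intro mult_mono) (auto simp: power_le_one)
 then show ?thesis by (auto simp: qq_def)
qed

lemma Ck_eta_bd: "Ck_on 1 strip (%z. \<eta> (bd z))"
 using Ck_on_compose[OF open_strip Ck1_strip(1) cutoff_Ck[OF cutoff_\<eta>]] by auto

lemma Ck_qq: "Ck_on 1 G (qq i j)"
proof (rule Ck_glue[of _ _ "%z. if i = j then 1 else 0" "d0 / 2"])
 show "Ck_on 1 strip (qq i j)" unfolding qq_def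
  by (intro Ck_on_diff_fun Ck_on_mult Ck_on_power open_strip Ck_on_const Ck_eta_bd Ck_on_vec_nth Ck1_strip)
qed (use d0 eta_zero in \<open>auto simp: qq_def\<close>)

lemma continuous_qq: "continuous_on D (qq i j)"
proof (rule continuous_on_glue[of _ "%z. if i = j then 1 else 0" "d0 / 2"])
 have "continuous_on {z\<in>D. bd z < d0} (%z. \<eta> (bd z))"
  by (rule continuous_on_compose2[OF Ck_on_cont[OF cutoff_Ck[OF cutoff_\<eta>, of 0]] continuous_on_subset[OF continuous_on_bd]]) auto
 then show "continuous_on {z\<in>D. bd z < d0} (qq i j)" unfolding qq_def by (intro continuous_intros continuous_on_nn)
qed (use d0 eta_zero in \<open>auto simp: qq_def\<close>)

lemma dd_qq_beyond: "z : G ==> d0 / 2 < bd z ==> dd h (qq i j) z = 0"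
proof -
 assume z: "z : G" "d0 / 2 < bd z"
 have "dd h (qq i j) z = dd h (%z. if i = j then 1 else 0 :: real) z"
  by (rule dd_cong_open[OF open_superlevel[of "d0 / 2"]]) (use z eta_zero in \<open>auto simp: qq_def\<close>)
 then show ?thesis by simp
qed

text \<open>Differentiating the cutoff costs \<open>1/d0\<close>, which cannot be bounded by \<open>K\<close>; these terms are
 kept separate.\<close>

lemma dd_qq_bound:
 assumes z: "z : G" and nu: "bd z <= d0 / 2 ==> norm (dd h nn z) <= \<nu>" and b: "bd z <= d0 / 2 ==> \<bar>dd h bd z\<bar> <= \<beta>" "0 <= \<beta>" "0 <= \<nu>"
 shows "\<bar>dd h (qq i j) z\<bar> <= 2 * \<bar>\<eta> (bd z) * dd 1 \<eta> (bd z)\<bar> * \<beta> + 2 * \<nu>"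
proof (cases "bd z <= d0 / 2")
 case True
 then have zs: "z : strip" using z d0 by (simp add: strip_def)
 note zD = G_D[OF z]
 define e where "e = \<eta> (bd z)"
 have dn: "(%z. nn z $ i) differentiable at z" for i
  by (rule Ck1_differentiable[OF Ck_on_vec_nth[OF open_strip Ck1_strip(3)] zs])
 have de: "(%z. \<eta> (bd z)) differentiable at z" by (rule Ck1_differentiable[OF Ck_eta_bd zs])
 have dde: "dd h (%z. \<eta> (bd z)) z = dd 1 \<eta> (bd z) * dd h bd z"
  by (rule dd_real_compose[OF diff_strip(1)[OF zs] cutoff_DERIV[OF cutoff_\<eta>]])
 have de2: "(%z. (\<eta> (bd z))\<^sup>2) differentiable at z" unfolding power2_eq_square by (intro differentiable_mult de)
 have d3: "(%z. (\<eta> (bd z))\<^sup>2 * nn z $ i) differentiable at z" by (intro differentiable_mult de2 dn)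
 have d4: "(%z. (\<eta> (bd z))\<^sup>2 * nn z $ i * nn z $ j) differentiable at z" by (intro differentiable_mult d3 dn)
 have "dd h (%z. (\<eta> (bd z))\<^sup>2) z = 2 * (e * dd 1 \<eta> (bd z)) * dd h bd z"
  unfolding power2_eq_square using dd_mult[OF de de, of h] dde by (simp add: e_def)
 then have "dd h (%z. (\<eta> (bd z))\<^sup>2 * nn z $ i * nn z $ j) z =
   2 * (e * dd 1 \<eta> (bd z)) * dd h bd z * nn z $ i * nn z $ j + e\<^sup>2 * (dd h nn z $ i * nn z $ j + nn z $ i * dd h nn z $ j)"
  using dd_mult[OF d3 dn, of h j] dd_mult[OF de2 dn, of h i] dd_nn_component[OF zs] by (simp add: e_def algebra_simps)
 moreover have "dd h (qq i j) z = - dd h (%z. (\<eta> (bd z))\<^sup>2 * nn z $ i * nn z $ j) z"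
  unfolding qq_def[abs_def] using dd_diff[OF differentiable_const d4] by simp
 moreover have "\<bar>2 * (e * dd 1 \<eta> (bd z)) * dd h bd z * nn z $ i * nn z $ j\<bar> <= 2 * \<bar>e * dd 1 \<eta> (bd z)\<bar> * \<beta> * 1 * 1"
  unfolding abs_mult[of "_ * _ * _"] abs_mult[of "_ * _" "_ $ _"] abs_mult[of "2 * _"] using b True abs_nn_le[OF zD]
  by (intro mult_mono mult_nonneg_nonneg) (auto simp: abs_mult)
 moreover have "\<bar>e\<^sup>2 * (dd h nn z $ i * nn z $ j + nn z $ i * dd h nn z $ j)\<bar> <= 1 * (\<nu> + \<nu>)"
 proof -
  have c: "\<bar>dd h nn z $ i\<bar> <= \<nu>" for i using component_le_norm_cart[of "dd h nn z" i] nu[OF True] by simp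
  have "\<bar>dd h nn z $ i * nn z $ j\<bar> <= \<nu> * 1" "\<bar>nn z $ i * dd h nn z $ j\<bar> <= 1 * \<nu>"
   unfolding abs_mult using c abs_nn_le[OF zD] b(3) by (intro mult_mono; auto)+
  then have "\<bar>dd h nn z $ i * nn z $ j + nn z $ i * dd h nn z $ j\<bar> <= \<nu> + \<nu>" by linarith
  then show ?thesis unfolding abs_mult using eta_range[of "bd z"] by (intro mult_mono) (auto simp: e_def power_le_one)
 qed
 ultimately show ?thesis by (simp add: e_def)
next
 case False
 then show ?thesis using dd_qq_beyond[OF z, of h i j] b by simp
qed

end

definition mp :: "('n::finite => 'n => real) => ('n => 'n => real) => 'n => 'n => real" where
 "mp a b i k = (SUMU l. a i l * b l k)"

lemma abs_mp_le:
 fixes a b :: "'n::finite => 'n => real"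
 assumes "!!i j. \<bar>a i j\<bar> <= \<alpha>" "!!i j. \<bar>b i j\<bar> <= \<beta>"
 shows "\<bar>mp a b i k\<bar> <= real CARD('n) * (\<alpha> * \<beta>)"
proof -
 have "\<alpha> \<ge> 0" using assms(1) by (meson abs_ge_zero order.trans)
 then have "\<bar>a i l * b l k\<bar> <= \<alpha> * \<beta>" for l unfolding abs_mult using assms by (intro mult_mono) auto
 then show ?thesis unfolding mp_def by (rule abs_sum_le_card)
qed

context mhd_flow
begin

definition cc :: real where "cc = 1 / (4 * pi)"

lemma cc: "0 < cc" "cc <= 1" using pi_gt3 by (simp_all add: cc_def)

text \<open>\<open>HH\<close> is the mixed form through which velocity and magnetic field exchange
  energy: the derivative of this form along \<open>B\<close> collects their second derivatives.
  \<open>YY\<close> does the same for the pressure: its divergence contains the second derivatives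
  of \<open>P\<close> paired with the velocity gradient. \<open>XE\<close> is the resulting flux,
  and the remainder \<open>RR\<close> contains no second derivatives of \<open>v\<close>,
  \<open>B\<close> or \<open>P\<close>.\<close>

definition HH :: "real \<times> (real^'n) => real" where "HH z = bil (qz z) (vz z) (bz z)"
definition YY :: "'n => real \<times> (real^'n) => real" where
 "YY l z = (SUMU i. SUMU j. qq i j z * dV j l z * px i P z)"
definition XE :: "'n => real \<times> (real^'n) => real" where
 "XE l z = en z * Vc l z + (2 * YY l z - 2 * cc * (Bc l z * HH z))"
definition YR :: "real \<times> (real^'n) => real" where
 "YR z = (SUMU l. SUMU i. SUMU j. px l (qq i j) z * dV j l z * px i P z)"
definition RR :: "real \<times> (real^'n) => real" where
 "RR z = tri (%i j. dd (1, V z) (qq i j) z) (vz z) (vz z) + cc * tri (%i j. dd (1, V z) (qq i j) z) (bz z) (bz z)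
  + 2 * cc * bil (qz z) (mp (bz z) (bz z)) (vz z) - 2 * bil (qz z) (mp (vz z) (vz z)) (vz z)
  + 2 * cc * bil (qz z) (%i k. mp (bz z) (vz z) i k - mp (vz z) (bz z) i k) (bz z)
  + 2 * YR z - 2 * cc * tri (%i j. dd (0, Bm z) (qq i j) z) (vz z) (bz z)"

lemma diff_qq: "z : G ==> qq i j differentiable at z" using Ck1_differentiable[OF Ck_qq] .

lemma Ck_en_HH_YY: "Ck_on 1 G en" "Ck_on 1 G HH" "Ck_on 1 G (YY l)" "Ck_on 1 G (XE l)"
proof -
 have v: "Ck_on 1 G (dV i j)" and b: "Ck_on 1 G (dB i j)" and p: "Ck_on 1 G (px i P)" and V: "Ck_on 1 G (Vc i)" and B: "Ck_on 1 G (Bc i)" for i j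
  using Ck_dom_G[OF Ck_dVc] Ck_dom_G[OF Ck_dBc] Ck_dom_G[OF Ck_dP] Ck_dom_G[OF Ck_Vc] Ck_dom_G[OF Ck_Bc] by auto
 show 1: "Ck_on 1 G en" unfolding en_def[abs_def]
  by (intro Ck_on_add Ck_on_mult Ck_on_const Ck_tri open_G Ck_qq v b)
 show 2: "Ck_on 1 G HH" unfolding HH_def[abs_def] by (intro Ck_tri open_G Ck_qq v b)
 show 3: "Ck_on 1 G (YY l)" for l unfolding YY_def[abs_def] by (intro Ck_on_sum Ck_on_mult open_G Ck_qq v p)
 show "Ck_on 1 G (XE l)" unfolding XE_def[abs_def]
  by (intro Ck_on_add Ck_on_diff_fun Ck_on_mult Ck_on_const open_G 1 2 3 V B)
qed

text \<open>The terms with second derivatives of \<open>v\<close> sum to a derivative of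
  \<open>div v\<close>. The second derivatives of \<open>P\<close> form a symmetric matrix, so the
  antisymmetric part of \<open>bil\<close> does not see them.\<close>

lemma div_YY:
 assumes z: "z : G"
 shows "(SUMU l. px l (YY l) z) = YR z + bil (qz z) (%i k. px i (px k P) z) (vz z)"
proof -
 note zd = G_dom[OF z]
 have d1: "(%z. qq i j z * dV j l z) differentiable at z" for i j l by (intro differentiable_mult diff_qq z diff_dVc zd)
 have d2: "(%z. qq i j z * dV j l z * px i P z) differentiable at z" for i j l by (intro differentiable_mult d1 diff_dP zd)
 have d3: "(%z. SUMU j. qq i j z * dV j l z * px i P z) differentiable at z" for i l by (intro differentiable_sum ballI finite d2)
 have "px l (YY l) z = (SUMU i. SUMU j. px l (qq i j) z * dV j l z * px i P z + qq i j z * px i P z * px l (dV j l) z + qq i j z * dV j l z * px l (px i P) z)" for l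
 proof -
  have "px l (%z. qq i j z * dV j l z * px i P z) z = px l (qq i j) z * dV j l z * px i P z + qq i j z * px i P z * px l (dV j l) z + qq i j z * dV j l z * px l (px i P) z" for i j
   using dd_mult[OF d1 diff_dP[OF zd], of "(0, axis l 1)" i j l "(0, axis i 1)"] dd_mult[OF diff_qq[OF z] diff_dVc[OF zd], of "(0, axis l 1)" i j "(0, axis j 1)" l]
   by (simp add: algebra_simps)
  moreover have "px l (%z. SUMU j. qq i j z * dV j l z * px i P z) z = (SUMU j. px l (%z. qq i j z * dV j l z * px i P z) z)" for i
   by (rule dd_sum) (rule d2)
  moreover have "px l (%z. SUMU i. SUMU j. qq i j z * dV j l z * px i P z) z = (SUMU i. px l (%z. SUMU j. qq i j z * dV j l z * px i P z) z)"
   by (rule dd_sum) (rule d3)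
  ultimately show ?thesis unfolding YY_def[abs_def] by simp
 qed
 then have "(SUMU l. px l (YY l) z) = YR z + (SUMU l. SUMU i. SUMU j. qq i j z * px i P z * px l (dV j l) z)
   + (SUMU l. SUMU i. SUMU j. qq i j z * dV j l z * px l (px i P) z)"
  by (simp add: sum.distrib YR_def)
 moreover have "(SUMU l. SUMU i. SUMU j. qq i j z * px i P z * px l (dV j l) z) = 0"
 proof -
  have "(SUMU l. px l (dV j l) z) = 0" for j
  proof -
   have "(SUMU l. px l (dV j l) z) = (SUMU l. px j (px l (Vc l)) z)"
    by (intro sum.cong refl dd_commute_dom[OF Ck_Vc zd])
   also have "... = px j (%z. SUMU l. px l (Vc l) z) z"
    by (rule dd_sum[symmetric]) (rule diff_dVc[OF zd])
   also have "... = px j (%z. 0::real) z" by (rule dd_cong_open[OF open_G z]) (simp add: div_V G_D)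
   finally show ?thesis by simp
  qed
  moreover have "(SUMU l. SUMU i. SUMU j. qq i j z * px i P z * px l (dV j l) z) =
    (SUMU i. SUMU j. qq i j z * px i P z * (SUMU l. px l (dV j l) z))"
  proof -
   have "(SUMU l. SUMU i. SUMU j. qq i j z * px i P z * px l (dV j l) z) =
     (SUMU i. SUMU l. SUMU j. qq i j z * px i P z * px l (dV j l) z)" by (rule sum.swap)
   also have "... = (SUMU i. SUMU j. SUMU l. qq i j z * px i P z * px l (dV j l) z)" by (intro sum.cong refl sum.swap)
   finally show ?thesis by (simp add: sum_distrib_left)
  qed
  ultimately show ?thesis by simp
 qed
 moreover have "(SUMU l. SUMU i. SUMU j. qq i j z * dV j l z * px l (px i P) z) = bil (qz z) (%i k. px i (px k P) z) (vz z)"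
 proof -
  have c: "px l (px i P) z = px i (px l P) z" for i l by (rule dd_commute_dom[OF Ck_P zd])
  have "(SUMU l. SUMU i. SUMU j. qq i j z * dV j l z * px l (px i P) z) = tri (qz z) (vz z) (%i k. px i (px k P) z)"
   unfolding tri_def by (subst sum.swap) (simp add: c[of _ _])
  also have "... = tri (qz z) (%i k. px i (px k P) z) (vz z)" by (rule tri_sym) (rule qq_sym)
  also have "... = bil (qz z) (%i k. px i (px k P) z) (vz z)"
  proof -
   have "px i (px k P) z - px k (px i P) z = 0" for i k using c[of i k] by simp
   then show ?thesis by (simp add: bil_def)
  qed
  finally show ?thesis .
 qed
 ultimately show ?thesis by simp
qed

text \<open>The second derivatives in the material derivative of \<open>en\<close> are matched one
  by one: those of \<open>P\<close> by \<open>YY\<close>, and those taken along \<open>B\<close> by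
  \<open>HH\<close>, where \<open>div B = 0\<close> turns the derivative along \<open>B\<close> into
  a divergence.\<close>

lemma energy_identity:
 assumes z: "z : G"
 shows "dd (1, 0) en z + (SUMU l. px l (XE l) z) = RR z"
proof -
 note zd = G_dom[OF z]
 note dq = diff_qq[OF z] and dv = diff_dVc[OF zd] and db = diff_dBc[OF zd]
 define \<beta> \<gamma> where "\<beta> i k = dd (0, Bm z) (dB i k) z" and "\<gamma> i k = dd (0, Bm z) (dV i k) z" for i k
 define h where "h i k = px i (px k P) z" for i k
 have ex: "dd (0, Bm z) f z = (SUMU l. Bc l z * px l f z)" if "f differentiable at z" for f :: "real \<times> (real^'n) => real"
  using dd_space_expand[OF that, of "Bm z"] by (simp add: Bc_def)
 have Dv: "dd (1, V z) (dV i k) z = - h i k + cc * (\<beta> i k + mp (bz z) (bz z) i k) - mp (vz z) (vz z) i k" for i k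
  using Dt_dV[OF z, of i k] ex[OF db[of "(0, axis i 1)" k]] by (simp add: \<beta>_def h_def mp_def cc_def sum.distrib)
 have Db: "dd (1, V z) (dB i k) z = \<gamma> i k + (mp (bz z) (vz z) i k - mp (vz z) (bz z) i k)" for i k
  using Dt_dB[OF z, of i k] ex[OF dv[of "(0, axis i 1)" k]] by (simp add: \<gamma>_def mp_def sum.distrib)
 have sym: "bil (qz z) a b = bil (qz z) b a" for a b by (rule bil_sym) (rule qq_sym)
 let ?Dq = "%i j. dd (1, V z) (qq i j) z"
 have De: "dd (1, V z) en z = tri ?Dq (vz z) (vz z) + 2 * bil (qz z) (%i k. dd (1, V z) (dV i k) z) (vz z)
   + cc * (tri ?Dq (bz z) (bz z) + 2 * bil (qz z) (%i k. dd (1, V z) (dB i k) z) (bz z))"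
  unfolding en_def[abs_def] cc_def[symmetric] dd_add[OF dd_bil(2)[of qq z dV dV, OF dq dv dv] differentiable_mult[OF differentiable_const dd_bil(2)[of qq z dB dB, OF dq db db]]]
   dd_cmult[OF dd_bil(2)[of qq z dB dB, OF dq db db]] dd_bil(1)[of qq z dV dV, OF dq dv dv] dd_bil(1)[of qq z dB dB, OF dq db db]
  using sym[of "vz z"] sym[of "bz z"] by (simp add: algebra_simps)
 have DH: "dd (0, Bm z) HH z = tri (%i j. dd (0, Bm z) (qq i j) z) (vz z) (bz z) + bil (qz z) \<gamma> (bz z) + bil (qz z) (vz z) \<beta>"
  unfolding HH_def[abs_def] dd_bil(1)[of qq z dV dB, OF dq dv db] by (simp add: \<beta>_def[abs_def] \<gamma>_def[abs_def])
 have dE: "en differentiable at z" and dH: "HH differentiable at z" and dY: "YY l differentiable at z" for l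
  using Ck1_differentiable[OF Ck_en_HH_YY(1) z] Ck1_differentiable[OF Ck_en_HH_YY(2) z] Ck1_differentiable[OF Ck_en_HH_YY(3) z] by auto
 have pX: "px l (XE l) z = Vc l z * px l en z + en z * px l (Vc l) z + 2 * px l (YY l) z - 2 * cc * (Bc l z * px l HH z + px l (Bc l) z * HH z)" for l
 proof -
  note dV = diff_Vc[OF zd, of l] and dB = diff_Bc[OF zd, of l]
  have a: "(%z. Bc l z * HH z) differentiable at z" by (intro differentiable_mult dB dH)
  have b: "(%z. 2 * cc * (Bc l z * HH z)) differentiable at z" "(%z. 2 * YY l z) differentiable at z"
   by (intro differentiable_mult a dY differentiable_const)+
  show ?thesis unfolding XE_def[abs_def]
   dd_add[OF differentiable_mult[OF dE dV] differentiable_diff[OF b(2,1)]] dd_diff[OF b(2,1)] dd_cmult[OF a] dd_cmult[OF dY] dd_mult[OF dE dV] dd_mult[OF dB dH]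
   by simp
 qed
 have "(SUMU l. px l (XE l) z) = (SUMU l. Vc l z * px l en z) + en z * (SUMU l. px l (Vc l) z) + 2 * (SUMU l. px l (YY l) z)
   - 2 * cc * ((SUMU l. Bc l z * px l HH z) + (SUMU l. px l (Bc l) z) * HH z)"
  by (simp only: pX sum.distrib sum_subtractf sum_distrib_left[symmetric] sum_distrib_right[symmetric])
 then have "dd (1, 0) en z + (SUMU l. px l (XE l) z) = dd (1, V z) en z + 2 * (SUMU l. px l (YY l) z) - 2 * cc * dd (0, Bm z) HH z"
  using dd_material_Vc[OF dE] ex[OF dH] div_V[OF G_D[OF z]] div_B[OF z] by simp
 then show ?thesis
  unfolding De DH Dv Db div_YY[OF z] RR_def bil_linear h_def[symmetric] using sym[of "vz z" \<beta>]
  by (simp add: algebra_simps)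
qed

text \<open>The pressure is constant on the boundary, so its tangential gradient is \<open>O(bd)\<close>.\<close>

lemma tangential_P:
 obtains C where "C > 0" "!!z j. z : G ==> bd z < d0 / 4 ==> \<bar>SUMU i. qq i j z * px i P z\<bar> <= C * bd z"
proof -
 have "\<exists>L. L > 0 & (ALL z:D. norm (px k P z - px k P (fz z)) <= L * bd z)" for k
  using foot_lipschitz[OF Ck_dP[of 1]] by metis
 then obtain L where L: "!!k. L k > 0" "!!k z. z : D ==> norm (px k P z - px k P (fz z)) <= L k * bd z" by metis
 define C where "C = M * (16 / (3 * d0)) + (SUMU k. 2 * L k)"
 have C: "C > 0" unfolding C_def using M_pos d0 L(1) by (auto intro!: add_pos_nonneg sum_nonneg simp: less_imp_le)
 have "\<bar>SUMU i. qq i j z * px i P z\<bar> <= C * bd z" if z: "z : G" "bd z < d0 / 4" for z j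
 proof -
  have zs: "z : strip" using z d0 by (simp add: strip_def)
  note zD = G_D[OF z(1)]
  have b0: "bd z > 0" by (rule bd_pos[OF zD])
  have fd: "fz z : dom" and fc: "fz z : closure D" by (rule fz_dom[OF zD], rule fz_closure[OF zD])
  define e where "e = (axis j 1 :: real^'n)"
  \<comment> \<open>Below \<open>d0 / 4\<close> the cutoff is 1, so \<open>qq\<close> is the
    tangential projection and \<open>w\<close> one of its columns. The foot moves along
    \<open>w\<close> up to \<open>O(bd)\<close> when the point moves along \<open>e\<close>, and
    \<open>P\<close> does not change at the foot.\<close>
  define w where "w = e - (nn z \<bullet> e) *\<^sub>R nn z"
  have wi: "w $ i = qq i j z" for i
  proof -
   have "e $ i = (if i = j then 1 else 0)" by (simp add: e_def axis_def)
   moreover have "nn z \<bullet> e = nn z $ j" by (simp add: e_def inner_axis)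
   ultimately show ?thesis using eta_one[OF z(2)] by (simp add: w_def qq_def mult.commute)
  qed
  have "dd (0, e) (%z. P (fz z)) z = dd (0, e) (%z. cP) z"
   by (rule dd_cong_open[OF open_strip zs]) (simp add: P_boundary strip_D)
  then have "dd (0, dd (0, e) ft z) P (fz z) = 0"
   using dd_compose[OF diff_fz[OF zs] diff_P[OF fd], of "(0, e)"] dd_fz[OF zs, of e] by simp
  moreover have "dd (0, e) ft z = w + bd z *\<^sub>R dd (0, e) nn z" by (simp add: dd_ft[OF zs] w_def)
  ultimately have "dd (0, w) P (fz z) + bd z * dd (0, dd (0, e) nn z) P (fz z) = 0"
   using dd_add_dir[OF diff_P[OF fd], of "(0, w)" "(0, bd z *\<^sub>R dd (0, e) nn z)"] dd_scale_dir[OF diff_P[OF fd], of "bd z" "(0, dd (0, e) nn z)"] by simp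
  moreover have "\<bar>bd z * dd (0, dd (0, e) nn z) P (fz z)\<bar> <= bd z * (M * (16 / (3 * d0)))"
  proof -
   have sq: "(SUMU k. (px k P (fz z))\<^sup>2) <= M\<^sup>2"
    using power_mono[OF grad_P_le[OF fc], of 2] by (simp add: norm_vec_sq)
   have "norm (dd (0, e) nn z) <= 16 / (3 * d0)" using norm_dd_nn'(1)[OF zs, of e] z(2) d0 by (simp add: e_def norm_axis_1)
   then have "(norm (dd (0, e) nn z))\<^sup>2 <= (16 / (3 * d0))\<^sup>2" by (intro power_mono) auto
   then have "(norm (dd (0, dd (0, e) nn z) P (fz z)))\<^sup>2 <= M\<^sup>2 * (16 / (3 * d0))\<^sup>2"
    using norm_dd_space_sq[OF diff_P[OF fd], of "dd (0, e) nn z"] sq by (intro order.trans[OF norm_dd_space_sq[OF diff_P[OF fd]]] mult_mono) auto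
   then have "norm (dd (0, dd (0, e) nn z) P (fz z)) <= M * (16 / (3 * d0))"
    using M_pos d0 by (simp add: power_mult_distrib[symmetric] power2_le_iff_abs_le)
   then show ?thesis unfolding abs_mult real_norm_def using b0 by (intro mult_mono) auto
  qed
  ultimately have 1: "\<bar>dd (0, w) P (fz z)\<bar> <= bd z * (M * (16 / (3 * d0)))" by linarith
  have ex: "dd (0, w) P y = (SUMU k. w $ k * px k P y)" if "y : dom" for y
   using dd_space_expand[OF diff_P[OF that], of w] by simp
  have "\<bar>dd (0, w) P z - dd (0, w) P (fz z)\<bar> = \<bar>SUMU k. w $ k * (px k P z - px k P (fz z))\<bar>"
   unfolding ex[OF strip_dom[OF zs]] ex[OF fd] by (simp add: sum_subtractf right_diff_distrib)
  also have "... <= (SUMU k. 2 * (L k * bd z))"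
  proof (rule order.trans[OF sum_abs sum_mono])
   fix k show "\<bar>w $ k * (px k P z - px k P (fz z))\<bar> <= 2 * (L k * bd z)"
    unfolding abs_mult wi using abs_qq_le[OF zD, of k j] L(2)[OF zD, of k] by (intro mult_mono) auto
  qed
  finally have 2: "\<bar>dd (0, w) P z - dd (0, w) P (fz z)\<bar> <= (SUMU k. 2 * L k) * bd z" by (simp add: sum_distrib_right mult.assoc)
  have "(SUMU i. qq i j z * px i P z) = dd (0, w) P z" by (simp add: ex[OF strip_dom[OF zs]] wi)
  then show ?thesis using 1 2 by (simp add: C_def algebra_simps abs_le_iff)
 qed
 then show ?thesis using that C by blast
qed

end

text \<open>\<open>J\<close> is merely integrable, so \<open>F\<close> need not be differentiable.
  Its primitive \<open>y\<close> is, and \<open>exp (- a * s) * (y s + F 0 / a)\<close> is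
  nonincreasing because \<open>F - F 0 <= a * y\<close>.\<close>

lemma gronwall_integral:
 fixes F J :: "real => real"
 assumes J: "!!t1 t2. 0 <= t1 ==> t1 <= t2 ==> t2 <= T ==> (J has_integral F t2 - F t1) {t1..t2}"
  and le: "!!t. 0 < t ==> t < T ==> J t <= a * F t" and a: "a > 0" and t: "0 <= t" "t <= T"
 shows "F t <= F 0 * exp (a * t)"
proof -
 have int: "J integrable_on {0..T}" using J[of 0 T] t by auto
 have Fe: "F s = F 0 + integral {0..s} J" if "s : {0..T}" for s using J[of 0 s] that by (simp add: integral_unique)
 have cF: "continuous_on {0..T} F"
 proof (rule continuous_on_eq)
  show "continuous_on {0..T} (%s. F 0 + integral {0..s} J)"
   by (intro continuous_on_add continuous_on_const indefinite_integral_continuous_1 int)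
 qed (rule Fe[symmetric])
 define y where "y s = integral {0..s} F" for s
 have y': "(y has_real_derivative F s) (at s within {0..T})" if "s : {0..T}" for s
  unfolding y_def by (rule integral_has_real_derivative[OF cF that])
 have FJ: "F s - F 0 <= a * y s" if s: "s : {0..T}" for s
 proof -
  have Fi: "(F has_integral y s) {0..s}" unfolding y_def
   by (rule integrable_integral, rule integrable_continuous_interval, rule continuous_on_subset[OF cF]) (use s in auto)
  \<comment> \<open>The inequality between \<open>J\<close> and \<open>a * F\<close> is assumed at
    interior times; redefining \<open>J\<close> at the two end points does not change its
    integral.\<close>
  have "((%r. if r : {0, T} then a * F r else J r) has_integral F s - F 0) {0..s}"
   by (rule has_integral_spike_finite[of "{0, T}", OF _ _ J[of 0 s]]) (use s in auto)
  then show ?thesis by (rule has_integral_le[OF _ has_integral_mult_right[OF Fi]]) (use le s in auto)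
 qed
 define ph where "ph s = exp (- a * s) * (y s + F 0 / a)" for s
 have dph: "(ph has_real_derivative exp (- a * s) * (F s - F 0 - a * y s)) (at s)" if s: "0 < s" "s < t" for s
 proof -
  have "(y has_real_derivative F s) (at s)" using y'[of s] t s at_within_Icc_at[of 0 s T] by simp
  then have 1: "((%s. y s + F 0 / a) has_real_derivative F s) (at s)" using DERIV_add[OF _ DERIV_const] by fastforce
  have 2: "((%s. exp (- a * s)) has_real_derivative exp (- a * s) * (- a)) (at s)" by (auto intro!: derivative_eq_intros)
  show ?thesis unfolding ph_def by (rule DERIV_cong[OF DERIV_mult[OF 2 1]]) (use a in \<open>simp add: field_simps\<close>)
 qed
 have "ph t <= ph 0"
 proof (cases "t = 0")
  case False
  have "continuous_on {0..T} y" using y' by (rule DERIV_continuous_on)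
  then have cy: "continuous_on {0..t} y" by (rule continuous_on_subset) (use t in auto)
  have cph: "continuous_on {0..t} ph" unfolding ph_def by (intro continuous_intros cy)
  have "ph differentiable (at s)" if "0 < s" "s < t" for s
   unfolding real_differentiable_def by (rule exI, rule dph[OF that])
  with MVT[OF _ cph] False t(1) obtain l s where s: "0 < s" "s < t" and l: "DERIV ph s :> l" "ph t - ph 0 = (t - 0) * l"
   by (metis less_eq_real_def)
  have "exp (- a * s) * (F s - F 0 - a * y s) <= 0" using FJ[of s] s t by (simp add: mult_le_0_iff)
  then have "l <= 0" using DERIV_unique[OF l(1) dph[OF s]] by simp
  then show ?thesis using l(2) t mult_nonneg_nonpos[of t l] by simp
 qed simp
 then have "exp (- a * t) * (y t + F 0 / a) <= F 0 / a" by (simp add: ph_def y_def)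
 then have "exp (a * t) * (exp (- a * t) * (y t + F 0 / a)) <= exp (a * t) * (F 0 / a)" by (intro mult_left_mono) auto
 then have "y t + F 0 / a <= exp (a * t) * (F 0 / a)" by (simp add: mult.assoc[symmetric] exp_add[symmetric])
 then have "a * (y t + F 0 / a) <= a * (exp (a * t) * (F 0 / a))" using a by (intro mult_left_mono) auto
 then show ?thesis using FJ[of t] t a by (simp add: distrib_left mult.commute)
qed

text \<open>The fourth power of the dimension comes from a triple sum together with a matrix
  product. The contributions \<open>2 * cut_deriv_bound \<eta> * d0\<close> and
  \<open>2 * cut_deriv_bound \<eta>\<close> are due to derivatives of the cutoff along the flow and
  along \<open>B\<close>; 72 covers the numerical coefficients, of which the largest is 64.\<close>

definition en_const :: "'n::finite itself => real => (real => real) => real" where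
 "en_const _ d0 \<eta> = real CARD('n) ^ 4 * (2 * cut_deriv_bound \<eta> * d0 + 2 * cut_deriv_bound \<eta> + 72)"

lemma le_sqrt_sum_sq:
 fixes a :: "'n::finite => 'n => real"
 shows "\<bar>a i k\<bar> <= sqrt (SUMU i. SUMU k. (a i k)\<^sup>2)"
proof -
 have "(a i k)\<^sup>2 <= (SUMU k. (a i k)\<^sup>2)" by (rule member_le_sum) auto
 also have "... <= (SUMU i. SUMU k. (a i k)\<^sup>2)" by (rule member_le_sum[of i UNIV "%i. SUMU k. (a i k)\<^sup>2"]) (auto intro: sum_nonneg)
 finally show ?thesis by (simp add: real_le_rsqrt)
qed

context mhd_flow
begin

definition ee :: "real \<times> (real^'n) => real" where "ee z = \<bar>\<eta> (bd z) * dd 1 \<eta> (bd z)\<bar>"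

lemma ee: "0 <= ee z" "ee z <= cut_deriv_bound \<eta>"
 using mult_mono[of "\<bar>\<eta> (bd z)\<bar>" 1 "\<bar>dd 1 \<eta> (bd z)\<bar>" "cut_deriv_bound \<eta>"] eta_range[of "bd z"] cut_deriv_bound(2)[OF cutoff_\<eta>, of "bd z"]
 by (auto simp: ee_def abs_mult)

lemma gV_le: "z : D ==> gV z <= M\<^sup>2"
 using power_mono[OF grad_V_le[of z], of 2] closure_subset[of D] D_dom[of z] by (auto simp: gV_eq norm_vec_def L2_set_def sum_nonneg)

lemma abs_dV_le: "\<bar>dV i k z\<bar> <= sqrt (gV z)" and abs_dB_le: "\<bar>dB i k z\<bar> <= sqrt (gB z)"
 unfolding gV_def gB_def using le_sqrt_sum_sq[of "%i k. dV i k z"] le_sqrt_sum_sq[of "%i k. dB i k z"] by auto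

text \<open>A factor \<open>M\<close> is split off every term, from the velocity gradient, the
  pressure gradient or the material derivatives of the geometry. Where the cutoff is differentiated
  in the pressure term, the velocity gradient is estimated by \<open>M\<close>, so that the pressure
  gradient occurs to the first power, as an L1 bound requires. Along \<open>B\<close> the cutoff
  changes only through \<open>bn\<close>. Curvature terms of size \<open>K\<close> are split by
  Young's inequality.\<close>

lemma RR_bound:
 assumes z: "z : G"
 shows "\<bar>RR z\<bar> <= en_const TYPE('n) d0 \<eta> * (M * gV z + M * gB z + M * K\<^sup>2 + M * (K\<^sup>2 * (norm (Bm z))\<^sup>2)
  + M * (ee z * (SUMU i. \<bar>px i P z\<bar>)) + M * (ee z * (bn z)\<^sup>2))"
proof -
 define N where "N = real CARD('n)"
 have N1: "1 <= N" using zero_less_card_finite[where 'a='n] unfolding N_def by linarith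
 have N34: "N ^ 3 <= N ^ 4" "N ^ 2 <= N ^ 4" using N1 by (auto intro: power_increasing)
 define X Y where "X = sqrt (gV z)" and "Y = sqrt (gB z)"
 have zD: "z : D" by (rule G_D[OF z])
 have X0: "0 <= X" "0 <= Y" by (simp_all add: X_def Y_def gV_nonneg gB_nonneg)
 have XX: "X * X = gV z" "Y * Y = gB z" by (simp_all add: X_def Y_def gV_nonneg gB_nonneg)
 have XM: "X <= M" unfolding X_def using gV_le[OF zD] M_pos by (intro real_le_lsqrt) auto
 have v: "!!i j. \<bar>vz z i j\<bar> <= X" and b: "!!i j. \<bar>bz z i j\<bar> <= Y" by (simp_all add: X_def Y_def abs_dV_le abs_dB_le)
 have q: "!!i j. \<bar>qz z i j\<bar> <= 2" by (rule abs_qq_le[OF zD])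
 define c0 where "c0 = cut_deriv_bound \<eta>"
 have c0: "c0 > 0" "ee z <= c0" "0 <= ee z" using cut_deriv_bound[OF cutoff_\<eta>] ee by (auto simp: c0_def)
 define \<beta> where "\<beta> = norm (Bm z)"
 have st: "z : strip" if "bd z <= d0 / 2" using that z d0 by (simp add: strip_def)
 have b0: "bd z > 0" by (rule bd_pos[OF zD])
 define kq where "kq = 2 * c0 * d0 + 12"
 have kq0: "0 <= kq" using c0 d0 by (simp add: kq_def)
 have Dq: "\<bar>dd (1, V z) (qq i j) z\<bar> <= M * kq" for i j
 proof -
  have "\<bar>dd (1, V z) bd z\<bar> <= M * d0" if "bd z <= d0 / 2"
  proof -
   have "M * bd z <= M * d0" using that M_pos d0 by (intro mult_left_mono) auto
   then show ?thesis using abs_material_bd[OF st[OF that]] by linarith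
  qed
  then have "\<bar>dd (1, V z) (qq i j) z\<bar> <= 2 * ee z * (M * d0) + 2 * (6 * M)"
   unfolding ee_def using norm_material_nn[OF st] M_pos d0 by (intro dd_qq_bound[OF z]) auto
  also have "... <= 2 * c0 * (M * d0) + 2 * (6 * M)" using c0 M_pos d0 by (intro add_mono mult_right_mono mult_left_mono) auto
  finally show ?thesis by (simp add: kq_def algebra_simps)
 qed
 have Lq: "\<bar>px l (qq i j) z\<bar> <= 2 * ee z + 16 * K" for l i j
 proof -
  have "\<bar>px l (qq i j) z\<bar> <= 2 * ee z * 1 + 2 * (8 * K)"
   unfolding ee_def using norm_dd_nn'(3)[OF st, of "axis l 1"] px_bd[OF st] abs_nn_le[OF zD] K_pos
   by (intro dd_qq_bound[OF z]) (auto simp: norm_axis_1)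
  then show ?thesis by simp
 qed
 have Bq: "\<bar>dd (0, Bm z) (qq i j) z\<bar> <= 2 * ee z * \<bar>bn z\<bar> + 16 * K * \<beta>" for i j
 proof -
  have "\<bar>dd (0, Bm z) (qq i j) z\<bar> <= 2 * ee z * \<bar>bn z\<bar> + 2 * (8 * K * \<beta>)"
   unfolding ee_def using norm_dd_nn'(3)[OF st, of "Bm z"] dd_bd[OF st, of 0 "Bm z"] K_pos
   by (intro dd_qq_bound[OF z]) (auto simp: \<beta>_def bn_def inner_commute)
  then show ?thesis by simp
 qed
 define a b' k kb S s t where "a = M * gV z" and "b' = M * gB z" and "k = M * K\<^sup>2" and "kb = M * (K\<^sup>2 * \<beta>\<^sup>2)"
  and "S = (SUMU i. \<bar>px i P z\<bar>)" and "s = M * (ee z * S)" and "t = M * (ee z * (bn z)\<^sup>2)"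
 have S0: "0 <= S" by (simp add: S_def sum_nonneg)
 have pos: "0 <= a" "0 <= b'" "0 <= k" "0 <= kb" "0 <= s" "0 <= t"
  using M_pos c0 S0 gV_nonneg[of z] gB_nonneg[of z] by (auto simp: a_def b'_def k_def kb_def s_def t_def)
 have Xa: "X * X * X <= a" "X * (Y * Y) <= b'" using XM X0 unfolding a_def b'_def XX[symmetric] mult.assoc by (auto intro: mult_right_mono)
 have c1: "0 < cc" "cc <= 1" by (rule cc)+
 have cct: "\<bar>cc * r\<bar> <= \<bar>r\<bar>" for r using c1 by (simp add: abs_mult mult_left_le_one_le)
 have cc2: "\<bar>2 * cc * r\<bar> <= 2 * c" if "\<bar>r\<bar> <= c" for r c
 proof -
  have "\<bar>2 * cc * r\<bar> = 2 * \<bar>cc * r\<bar>" by (simp add: abs_mult)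
  then show ?thesis using cct[of r] that by linarith
 qed
 have T1: "\<bar>tri (%i j. dd (1, V z) (qq i j) z) (vz z) (vz z)\<bar> <= N ^ 4 * (kq * a)"
 proof -
  have "\<bar>tri (%i j. dd (1, V z) (qq i j) z) (vz z) (vz z)\<bar> <= N ^ 3 * (M * kq * X * X)"
   unfolding N_def by (rule abs_tri_le[OF Dq v v])
  also have "... = N ^ 3 * (kq * a)" by (simp add: a_def XX[symmetric])
  also have "... <= N ^ 4 * (kq * a)" using N34 kq0 pos by (intro mult_right_mono) auto
  finally show ?thesis .
 qed
 have T2: "\<bar>cc * tri (%i j. dd (1, V z) (qq i j) z) (bz z) (bz z)\<bar> <= N ^ 4 * (kq * b')"
 proof -
  have "\<bar>tri (%i j. dd (1, V z) (qq i j) z) (bz z) (bz z)\<bar> <= N ^ 3 * (M * kq * Y * Y)"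
   unfolding N_def by (rule abs_tri_le[OF Dq b b])
  also have "... = N ^ 3 * (kq * b')" by (simp add: b'_def XX[symmetric])
  also have "... <= N ^ 4 * (kq * b')" using N34 kq0 pos by (intro mult_right_mono) auto
  finally show ?thesis using cct order.trans by blast
 qed
 have T3: "\<bar>2 * cc * bil (qz z) (mp (bz z) (bz z)) (vz z)\<bar> <= N ^ 4 * (12 * b')"
 proof -
  have "\<bar>bil (qz z) (mp (bz z) (bz z)) (vz z)\<bar> <= 6 * N ^ 3 * (N * (Y * Y) * X)"
   unfolding N_def by (rule abs_bil_le[OF q abs_mp_le[OF b b] v])
  also have "... = N ^ 4 * (6 * (X * (Y * Y)))" by (simp add: power4_eq_xxxx power3_eq_cube)
  also have "... <= N ^ 4 * (6 * b')" using Xa N1 by (intro mult_left_mono) auto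
  finally have "\<bar>bil (qz z) (mp (bz z) (bz z)) (vz z)\<bar> <= N ^ 4 * (6 * b')" .
  from cc2[OF this] show ?thesis by simp
 qed
 have T4: "\<bar>2 * bil (qz z) (mp (vz z) (vz z)) (vz z)\<bar> <= N ^ 4 * (12 * a)"
 proof -
  have "\<bar>bil (qz z) (mp (vz z) (vz z)) (vz z)\<bar> <= 6 * N ^ 3 * (N * (X * X) * X)"
   unfolding N_def by (rule abs_bil_le[OF q abs_mp_le[OF v v] v])
  also have "... = N ^ 4 * (6 * (X * X * X))" by (simp add: power4_eq_xxxx power3_eq_cube)
  also have "... <= N ^ 4 * (6 * a)" using Xa N1 by (intro mult_left_mono) auto
  finally show ?thesis by linarith
 qed
 have T5: "\<bar>2 * cc * bil (qz z) (%i k. mp (bz z) (vz z) i k - mp (vz z) (bz z) i k) (bz z)\<bar> <= N ^ 4 * (24 * b')"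
 proof -
  have "\<bar>mp (bz z) (vz z) i k - mp (vz z) (bz z) i k\<bar> <= N * (Y * X) + N * (X * Y)" for i k
  proof -
   have "\<bar>mp (bz z) (vz z) i k\<bar> <= N * (Y * X)" "\<bar>mp (vz z) (bz z) i k\<bar> <= N * (X * Y)"
    unfolding N_def by (rule abs_mp_le[OF b v], rule abs_mp_le[OF v b])
   then show ?thesis by linarith
  qed
  then have "\<bar>bil (qz z) (%i k. mp (bz z) (vz z) i k - mp (vz z) (bz z) i k) (bz z)\<bar> <= 6 * N ^ 3 * ((N * (Y * X) + N * (X * Y)) * Y)"
   unfolding N_def by (intro abs_bil_le q b)
  also have "... = N ^ 4 * (12 * (X * (Y * Y)))" by (simp add: power4_eq_xxxx power3_eq_cube)
  also have "... <= N ^ 4 * (12 * b')" using Xa N1 by (intro mult_left_mono) auto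
  finally have "\<bar>bil (qz z) (%i k. mp (bz z) (vz z) i k - mp (vz z) (bz z) i k) (bz z)\<bar> <= N ^ 4 * (12 * b')" .
  from cc2[OF this] show ?thesis by simp
 qed
 have T6: "\<bar>2 * YR z\<bar> <= N ^ 4 * (4 * s + 16 * k + 16 * a)"
 proof -
  define w where "w = (2 * ee z + 16 * K) * X"
  have w0: "0 <= w" using c0 K_pos X0 by (simp add: w_def)
  have iN: "\<bar>SUMU j. px l (qq i j) z * dV j l z * px i P z\<bar> <= N * (w * \<bar>px i P z\<bar>)" for l i
   unfolding N_def
  proof (rule abs_sum_le_card)
   fix j show "\<bar>px l (qq i j) z * dV j l z * px i P z\<bar> <= w * \<bar>px i P z\<bar>"
    unfolding abs_mult w_def using Lq[of l i j] v[of j l] c0 K_pos by (intro mult_right_mono mult_mono) auto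
  qed
  have "\<bar>SUMU i. SUMU j. px l (qq i j) z * dV j l z * px i P z\<bar> <= (SUMU i. N * (w * \<bar>px i P z\<bar>))" for l
   by (rule order.trans[OF sum_abs sum_mono[OF iN]])
  then have h: "\<bar>SUMU i. SUMU j. px l (qq i j) z * dV j l z * px i P z\<bar> <= N * (w * S)" for l
   by (simp add: S_def sum_distrib_left)
  have y: "\<bar>YR z\<bar> <= N * (N * (w * S))" unfolding YR_def N_def by (rule abs_sum_le_card[OF h[unfolded N_def]])
  have 1: "2 * ee z * X * S <= 2 * s"
  proof -
   have "(ee z * S) * X <= (ee z * S) * M" using XM c0 S0 by (intro mult_left_mono) auto
   then show ?thesis by (simp add: s_def mult_ac)
  qed
  have "S <= N * M" unfolding S_def N_def using sum_bounded_above[of UNIV "%i. \<bar>px i P z\<bar>" M] abs_px_P_le[of z] zD closure_subset[of D] by auto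
  \<comment> \<open>For the curvature part the pressure gradient is estimated by \<open>M\<close>,
    which leaves \<open>K * X\<close> for Young's inequality.\<close>
  then have "(K * X) * S <= (K * X) * (N * M)" using K_pos X0 by (intro mult_left_mono) auto
  also have "... <= N * M * ((K\<^sup>2 + X * X) / 2)"
  proof -
   have "K * X <= (K\<^sup>2 + X * X) / 2" using sum_squares_bound[of K X] by (simp add: power2_eq_square)
   then have "(N * M) * (K * X) <= N * M * ((K\<^sup>2 + X * X) / 2)" using N1 M_pos by (intro mult_left_mono) auto
   then show ?thesis by (simp add: mult_ac)
  qed
  finally have 2: "16 * K * X * S <= N * (8 * k + 8 * a)" by (simp add: k_def a_def XX algebra_simps)
  have "w * S <= 2 * s + N * (8 * k + 8 * a)" using 1 2 by (simp add: w_def algebra_simps)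
  also have "... <= N * (2 * s) + N * (8 * k + 8 * a)" using mult_right_mono[OF N1 pos(5)] by simp
  finally have "N * (N * (w * S)) <= N * (N * (N * (2 * s) + N * (8 * k + 8 * a)))" using N1 by (intro mult_left_mono) auto
  then have "\<bar>2 * YR z\<bar> <= N ^ 3 * (4 * s + 16 * k + 16 * a)" using y by (simp add: power3_eq_cube algebra_simps)
  also have "... <= N ^ 4 * (4 * s + 16 * k + 16 * a)" using N34 pos by (intro mult_right_mono) auto
  finally show ?thesis .
 qed
 have T7: "\<bar>2 * cc * tri (%i j. dd (0, Bm z) (qq i j) z) (vz z) (bz z)\<bar> <= N ^ 4 * (2 * t + 2 * c0 * b' + 16 * kb + 16 * b')"
 proof -
  define w where "w = 2 * ee z * \<bar>bn z\<bar> + 16 * K * \<beta>"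
  have w0: "0 <= w" using c0 K_pos by (simp add: w_def \<beta>_def)
  have 0: "\<bar>tri (%i j. dd (0, Bm z) (qq i j) z) (vz z) (bz z)\<bar> <= N ^ 3 * (w * X * Y)"
   unfolding N_def w_def by (rule abs_tri_le[OF Bq v b])
  have "w * X * Y <= w * M * Y" using w0 XM X0 by (intro mult_mono) auto
  also have "... = M * (2 * ee z * (\<bar>bn z\<bar> * Y) + 16 * (K * \<beta> * Y))" by (simp add: w_def algebra_simps)
  also have "... <= M * (2 * ee z * (((bn z)\<^sup>2 + Y * Y) / 2) + 16 * ((K\<^sup>2 * \<beta>\<^sup>2 + Y * Y) / 2))"
   using sum_squares_bound[of "\<bar>bn z\<bar>" Y] sum_squares_bound[of "K * \<beta>" Y] c0 M_pos
   by (intro mult_left_mono add_mono) (auto simp: power2_eq_square power_mult_distrib mult_ac)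
  also have "... = t + ee z * b' + 8 * kb + 8 * b'" by (simp add: t_def b'_def kb_def XX field_simps)
  also have "... <= t + c0 * b' + 8 * kb + 8 * b'" using c0 pos by (intro add_mono mult_right_mono) auto
  finally have "N ^ 3 * (w * X * Y) <= N ^ 4 * (t + c0 * b' + 8 * kb + 8 * b')"
   using N34 N1 w0 X0 by (intro mult_mono) auto
  from cc2[OF order.trans[OF 0 this]] show ?thesis by (simp add: algebra_simps)
 qed
 define \<Lambda> where "\<Lambda> = 2 * c0 * d0 + 2 * c0 + 72"
 have cd: "0 <= c0 * d0" using c0 d0 by simp
 have "kq * a + kq * b' + 12 * b' + 12 * a + 24 * b' + (4 * s + 16 * k + 16 * a) + (2 * t + 2 * c0 * b' + 16 * kb + 16 * b')
   = (kq + 28) * a + (kq + 2 * c0 + 52) * b' + 16 * k + 16 * kb + 4 * s + 2 * t" by (simp add: algebra_simps)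
 also have "... <= \<Lambda> * a + \<Lambda> * b' + \<Lambda> * k + \<Lambda> * kb + \<Lambda> * s + \<Lambda> * t"
  using pos c0(1) cd by (intro add_mono mult_right_mono) (auto simp: \<Lambda>_def kq_def)
 finally have sum: "kq * a + kq * b' + 12 * b' + 12 * a + 24 * b' + (4 * s + 16 * k + 16 * a) + (2 * t + 2 * c0 * b' + 16 * kb + 16 * b')
   <= \<Lambda> * (a + b' + k + kb + s + t)" by (simp add: algebra_simps)
 have ad: "\<bar>x + y\<bar> <= c + d" and sb: "\<bar>x - y\<bar> <= c + d" if "\<bar>x\<bar> <= c" "\<bar>y\<bar> <= d" for x y c d :: real
  using that by linarith+
 have "\<bar>RR z\<bar> <= N ^ 4 * (kq * a) + N ^ 4 * (kq * b') + N ^ 4 * (12 * b') + N ^ 4 * (12 * a) + N ^ 4 * (24 * b')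
   + N ^ 4 * (4 * s + 16 * k + 16 * a) + N ^ 4 * (2 * t + 2 * c0 * b' + 16 * kb + 16 * b')"
  unfolding RR_def by (intro ad sb T1 T2 T3 T4 T5 T6 T7)
 also have "... = N ^ 4 * (kq * a + kq * b' + 12 * b' + 12 * a + 24 * b' + (4 * s + 16 * k + 16 * a) + (2 * t + 2 * c0 * b' + 16 * kb + 16 * b'))"
  by (simp only: distrib_left)
 also have "... <= N ^ 4 * (\<Lambda> * (a + b' + k + kb + s + t))"
  by (rule mult_left_mono[OF sum]) (use N1 in simp)
 finally show ?thesis
  by (simp only: en_const_def N_def[symmetric] c0_def[symmetric] \<Lambda>_def a_def b'_def k_def kb_def s_def t_def S_def \<beta>_def mult.assoc)
qed

end

text \<open>Again independent of the solution: \<open>4 * pi * (3 * real CARD('n) + 4)\<close> is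
  the price of coercivity, \<open>8 * pi\<close> converts the square of \<open>B\<close> into the
  density of \<open>E_0\<close>, and the other summands stem from the pressure gradient and from
  \<open>bn\<close> in the cutoff layer.\<close>

definition growth_const :: "'n::finite itself => real => (real => real) => real" where
 "growth_const _ d0 \<eta> = (let m = 7 * CARD('n); b = 5/8 * d0; k = real m / 2 * (d0 / 16) ^ (m - 1) in
   en_const TYPE('n) d0 \<eta> * ((1 + real CARD('n) * strip_const TYPE('n) d0 \<eta> + cut_deriv_bound \<eta> / k * (2 * b ^ (m + 1)))
    * (4 * pi * (3 * real CARD('n) + 4)) + 8 * pi))"

lemma strip_const_nonneg: "d0 > 0 ==> cutoff d0 \<eta> ==> 0 <= strip_const TYPE('n::finite) d0 \<eta>"
 using bump_mass_pos[where 'n='n] cut_deriv_bound(1)[of d0 \<eta>] unfolding strip_const_def Let_def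
 by (intro divide_nonneg_nonneg mult_nonneg_nonneg add_nonneg_nonneg) auto

lemma en_const_pos: "d0 > 0 ==> cutoff d0 \<eta> ==> 0 < en_const TYPE('n::finite) d0 \<eta>"
 using cut_deriv_bound(1)[of d0 \<eta>] unfolding en_const_def
 by (intro mult_pos_pos add_nonneg_pos add_nonneg_nonneg) auto

lemma growth_const_pos: "d0 > 0 ==> cutoff d0 \<eta> ==> 0 < growth_const TYPE('n::finite) d0 \<eta>"
 using strip_const_nonneg[of d0 \<eta>, where 'n='n] en_const_pos[of d0 \<eta>, where 'n='n] cut_deriv_bound(1)[of d0 \<eta>]
 unfolding growth_const_def Let_def
 by (intro mult_pos_pos add_nonneg_pos mult_nonneg_nonneg add_nonneg_nonneg divide_nonneg_nonneg) auto

lemma has_integral_zero_interior: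
 fixes J :: "real => real"
 assumes "(J has_integral c) {0..t}" "!!s. 0 < s ==> s < T ==> J s = 0" "t <= T"
 shows "c = 0"
proof -
 have "((%s. 0) has_integral c) {0..t}"
  by (rule has_integral_spike_finite[of "{0, T}", OF _ _ assms(1)]) (use assms in auto)
 then show ?thesis by simp
qed

context mhd_flow
begin

section \<open>Conservation laws for volume and energy\<close>

lemma transport:
 assumes f: "continuous_on D f" "Ck_on 1 G f" "!!z. z : D ==> \<bar>f z\<bar> <= Cf" and X: "!!k. Ck_on 1 G (X k)"
  and Ca: "!!z. z : G ==> \<bar>dd (1, 0) f z + (SUMU k. px k (X k) z)\<bar> <= Ca"
  and Cb: "!!z. z : G ==> bd z < dl ==> \<bar>dd (1, 0) bd z * f z + (SUMU k. px k bd z * X k z)\<bar> <= Cb * bd z"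
  and "dl > 0" "0 <= t1" "t1 <= t2" "t2 <= T"
 shows "((%t. integral (slice D t) (%x. dd (1, 0) f (t, x) + (SUMU k. px k (X k) (t, x)))) has_integral
  (integral (slice D t2) (%x. f (t2, x)) - integral (slice D t1) (%x. f (t1, x)))) {t1..t2}"
proof (rule transport_slice[OF f X, where C = "max Ca Cb" and dl = dl])
 fix z assume z: "z : G" "bd z < dl"
 have "Cb * bd z <= max Ca Cb * bd z" using bd_pos[OF G_D[OF z(1)]] by (intro mult_right_mono) auto
 then show "\<bar>dd (1, 0) bd z * f z + (SUMU k. px k bd z * X k z)\<bar> <= max Ca Cb * bd z" using Cb[OF z] by linarith
qed (use Ca assms(7-) in \<open>auto simp: le_max_iff_disj\<close>)

lemma conserved:
 assumes f: "continuous_on D f" "Ck_on 1 G f" "!!z. z : D ==> \<bar>f z\<bar> <= Cf" and X: "!!k. Ck_on 1 G (X k)"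
  and zero: "!!z. z : G ==> dd (1, 0) f z + (SUMU k. px k (X k) z) = 0"
  and Cb: "!!z. z : G ==> bd z < dl ==> \<bar>dd (1, 0) bd z * f z + (SUMU k. px k bd z * X k z)\<bar> <= Cb * bd z"
  and "dl > 0" and t: "t : {0..T}"
 shows "integral (slice D t) (%x. f (t, x)) = integral (slice D 0) (%x. f (0, x))"
proof -
 have z': "\<bar>dd (1, 0) f z + (SUMU k. px k (X k) z)\<bar> <= 0" if "z : G" for z using zero[OF that] by simp
 have "integral (slice D s) (%x. dd (1, 0) f (s, x) + (SUMU k. px k (X k) (s, x))) = 0" if "0 < s" "s < T" for s
 proof -
  have "integral (slice D s) (%x. dd (1, 0) f (s, x) + (SUMU k. px k (X k) (s, x))) = integral (slice D s) (%x. 0)"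
   by (rule integral_cong) (use zero slice_G that in auto)
  then show ?thesis by simp
 qed
 from has_integral_zero_interior[OF transport[OF f X z' Cb \<open>dl > 0\<close>, of 0 t] this] t show ?thesis by simp
qed

lemma flux_bd:
 assumes "z : strip"
 shows "(SUMU k. px k bd z * Vc k z) = - (nn z \<bullet> V z)" "(SUMU k. px k bd z * Bc k z) = - bn z"
  "dd (1, 0) bd z + (SUMU k. px k bd z * Vc k z) = dd (1, V z) bd z"
proof -
 show "(SUMU k. px k bd z * Vc k z) = - (nn z \<bullet> V z)" "(SUMU k. px k bd z * Bc k z) = - bn z"
  by (simp_all add: px_bd[OF assms] inner_vec_def Vc_def Bc_def bn_def sum_negf mult.commute)
 show "dd (1, 0) bd z + (SUMU k. px k bd z * Vc k z) = dd (1, V z) bd z"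
  using dd_material_Vc[OF diff_strip(1)[OF assms]] by (simp add: mult.commute)
qed

lemma div_transported:
 fixes g :: "real \<times> (real^'n) => real"
 assumes z: "z : G" and g: "g differentiable at z"
 shows "(SUMU l. px l (%z. g z * Vc l z) z) = (SUMU l. Vc l z * px l g z)"
  "(SUMU l. px l (%z. g z * Bc l z) z) = dd (0, Bm z) g z"
proof -
 note zd = G_dom[OF z]
 have "(SUMU l. px l (%z. g z * Vc l z) z) = g z * (SUMU l. px l (Vc l) z) + (SUMU l. Vc l z * px l g z)"
  by (simp add: dd_mult[OF g diff_Vc[OF zd]] sum.distrib sum_distrib_left mult.commute)
 then show "(SUMU l. px l (%z. g z * Vc l z) z) = (SUMU l. Vc l z * px l g z)" using div_V[OF G_D[OF z]] by simp
 have "(SUMU l. px l (%z. g z * Bc l z) z) = g z * (SUMU l. px l (Bc l) z) + (SUMU l. Bc l z * px l g z)"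
  by (simp add: dd_mult[OF g diff_Bc[OF zd]] sum.distrib sum_distrib_left mult.commute)
 then show "(SUMU l. px l (%z. g z * Bc l z) z) = dd (0, Bm z) g z"
  using div_B[OF z] dd_space_expand[OF g, of "Bm z"] by (simp add: Bc_def)
qed

lemma continuous_D: "(!!k. Ck_on k dom f) ==> continuous_on D f"
 using continuous_on_subset[OF Ck_on_cont, of 0 dom f D] D_dom by blast

lemma strip_near: "z : G ==> bd z < d0 / 4 ==> z : strip" using d0 by (simp add: strip_def)

lemma volume_conserved:
 assumes t: "t : {0..T}"
 shows "measure lebesgue (slice D t) = measure lebesgue (slice D 0)"
proof -
 have "integral (slice D t) (%x. 1) = integral (slice D 0) (%x. 1 :: real)"
 proof (rule conserved[of "%z. 1" 1 Vc "d0 / 4" M, OF _ _ _ Ck_dom_G[OF Ck_Vc] _ _ _ t])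
  fix z assume z: "z : G" "bd z < d0 / 4"
  show "\<bar>dd (1, 0) bd z * 1 + (SUMU k. px k bd z * Vc k z)\<bar> <= M * bd z"
   using flux_bd(3)[OF strip_near[OF z]] abs_material_bd[OF strip_near[OF z]] by simp
 qed (use div_V G_D d0 in auto)
 moreover have "slice D t : lmeasurable" for t by (rule lmeasurable_open[OF bounded_slice open_slice])
 ultimately show ?thesis by (simp add: lmeasure_integral)
qed

definition f0 :: "real \<times> (real^'n) => real" where
 "f0 z = (norm (V z))\<^sup>2 / 2 + (norm (Bm z))\<^sup>2 / (8 * pi)"

lemma f0_eq: "f0 z = 1/2 * (V z \<bullet> V z) + cc / 2 * (Bm z \<bullet> Bm z)"
 by (simp add: f0_def cc_def power2_norm_eq_inner)

lemma Ck_f0: "Ck_on k dom f0"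
 unfolding f0_eq[abs_def] by (intro Ck_on_add Ck_on_mult Ck_on_inner Ck_on_const dom Ck_V Ck_B)

lemma energy0_eq: "energy0 (slice D t) (v t) (B t) = integral (slice D t) (%x. f0 (t, x))"
 by (simp add: energy0_def f0_def V_def Bm_def)

text \<open>Subtracting the boundary value \<open>cP\<close> from the pressure does not affect the
  divergence, because \<open>div v = 0\<close>, but it makes the pressure flux vanish at the
  boundary. Hence the energy is conserved also when the field strength on the boundary is not
  zero.\<close>

lemma f0_identity:
 assumes z: "z : G"
 shows "dd (1, 0) f0 z + (SUMU l. px l (%z. f0 z * Vc l z + ((P z - cP) * Vc l z - cc * ((V z \<bullet> Bm z) * Bc l z))) z) = 0"
proof -
 note zd = G_dom[OF z]
 note dV = diff_V[OF zd] and dB = diff_B[OF zd] and df = diff_dom[OF Ck_f0 zd]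
 have CW: "Ck_on k dom (%z. V z \<bullet> Bm z)" for k by (intro Ck_on_inner dom Ck_V Ck_B)
 have CP: "Ck_on k dom (%z. P z - cP)" for k by (intro Ck_on_diff_fun dom Ck_P Ck_on_const)
 note dW = diff_dom[OF CW zd] and dP = diff_dom[OF CP zd]
 have C2: "Ck_on k dom (%z. V z \<bullet> V z)" "Ck_on k dom (%z. Bm z \<bullet> Bm z)" for k by (intro Ck_on_inner dom Ck_V Ck_B)+
 note d2 = diff_dom[OF C2(1) zd] diff_dom[OF C2(2) zd]
 have Df: "dd h f0 z = V z \<bullet> dd h V z + cc * (Bm z \<bullet> dd h Bm z)" for h
  unfolding f0_eq[abs_def] dd_add[OF differentiable_mult[OF differentiable_const d2(1)] differentiable_mult[OF differentiable_const d2(2)]]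
   dd_cmult[OF d2(1)] dd_cmult[OF d2(2)] dd_inner[OF dV dV] dd_inner[OF dB dB] by (simp add: inner_commute)
 have DVt: "V z \<bullet> dd (1, V z) V z = - (SUMU j. Vc j z * px j P z) + cc * (V z \<bullet> dd (0, Bm z) Bm z)"
 proof -
  have e: "(SUMU k. Bc k z * px k (Bc j) z) = dd (0, Bm z) Bm z $ j" for j
   using dd_space_expand[OF diff_Bc[OF zd], of "Bm z" j] dd_Bc[OF zd, of "(0, Bm z)" j] by (simp add: Bc_def)
  have eVj: "dd (1, V z) V z $ j = - px j P z + cc * (dd (0, Bm z) Bm z $ j)" for j
   using eq_V[OF G_D[OF z], of j] dd_Vc[OF zd, of "(1, V z)" j] e[of j] by (simp add: cc_def)
  show ?thesis unfolding inner_vec_def inner_real_def eVj by (simp add: Vc_def algebra_simps sum.distrib sum_subtractf sum_distrib_left)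
 qed
 have 1: "px l (%z. f0 z * Vc l z + ((P z - cP) * Vc l z - cc * ((V z \<bullet> Bm z) * Bc l z))) z =
   px l (%z. f0 z * Vc l z) z + (px l (%z. (P z - cP) * Vc l z) z - cc * px l (%z. (V z \<bullet> Bm z) * Bc l z) z)" for l
 proof -
  have a: "(%z. f0 z * Vc l z) differentiable at z" "(%z. (P z - cP) * Vc l z) differentiable at z" "(%z. (V z \<bullet> Bm z) * Bc l z) differentiable at z"
   by (intro differentiable_mult df dP dW diff_Vc[OF zd] diff_Bc[OF zd])+
  have b: "(%z. cc * ((V z \<bullet> Bm z) * Bc l z)) differentiable at z" by (intro differentiable_mult a differentiable_const)
  show ?thesis unfolding dd_add[OF a(1) differentiable_diff[OF a(2) b]] dd_diff[OF a(2) b] dd_cmult[OF a(3)] ..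
 qed
 have "px l (%z. P z - cP) z = px l P z" for l using dd_diff[OF diff_P[OF zd] differentiable_const] by simp
 then have "(SUMU l. px l (%z. f0 z * Vc l z + ((P z - cP) * Vc l z - cc * ((V z \<bullet> Bm z) * Bc l z))) z)
   = (SUMU l. Vc l z * px l f0 z) + (SUMU l. Vc l z * px l P z) - cc * dd (0, Bm z) (%z. V z \<bullet> Bm z) z"
  unfolding 1 sum.distrib sum_subtractf sum_distrib_left[symmetric] div_transported(1)[OF z df] div_transported(1)[OF z dP] div_transported(2)[OF z dW]
  by simp
 moreover have "dd (1, 0) f0 z + (SUMU l. Vc l z * px l f0 z) = dd (1, V z) f0 z" using dd_material_Vc[OF df] by simp
 ultimately show ?thesis
  using Df[of "(1, V z)"] DVt material_B[OF G_D[OF z]] dd_inner[OF dV dB, of "(0, Bm z)"] by (simp add: inner_commute algebra_simps)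
qed

lemma energy0_conserved:
 assumes t: "t : {0..T}"
 shows "energy0 (slice D t) (v t) (B t) = energy0 (slice D 0) (v 0) (B 0)"
proof -
 have CW: "Ck_on k dom (%z. V z \<bullet> Bm z)" for k by (intro Ck_on_inner dom Ck_V Ck_B)
 obtain Cf where Cf: "Cf > 0" "!!z. z : D ==> \<bar>f0 z\<bar> <= Cf" by (rule bounded_on_D[OF Ck_on_cont[OF Ck_f0[of 0]]]) blast
 obtain Cw where Cw: "Cw > 0" "!!z. z : D ==> \<bar>V z \<bullet> Bm z\<bar> <= Cw" by (rule bounded_on_D[OF Ck_on_cont[OF CW[of 0]]]) blast
 obtain CV where CV: "CV > 0" "!!z. z : closure D ==> norm (V z) <= CV" by (rule bounded_on_closure[OF Ck_on_cont[OF Ck_V]]) blast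
 obtain Cn where Cn: "Cn > 0" "!!z. z : G ==> bd z < d0 / 4 ==> \<bar>bn z\<bar> <= Cn * bd z" by (rule normal_B_bound) blast
 obtain L where L: "L > 0" "!!z. z : D ==> \<bar>P z - cP\<bar> <= L * bd z" by (rule pressure_linear) blast
 have CX: "Ck_on 1 dom (%z. f0 z * Vc l z + ((P z - cP) * Vc l z - cc * ((V z \<bullet> Bm z) * Bc l z)))" for l
  by (intro Ck_on_add Ck_on_diff_fun Ck_on_mult dom Ck_f0 Ck_Vc Ck_Bc Ck_P Ck_on_const CW)
 show ?thesis unfolding energy0_eq
 proof (rule conserved[OF continuous_D[OF Ck_f0] Ck_dom_G[OF Ck_f0] Cf(2) Ck_on_subset[OF CX] f0_identity, where dl = "d0 / 4" and Cb = "Cf * M + (L * CV + Cw * Cn)", OF _ _ _ _ _ t])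
  fix z assume z: "z : G" "bd z < d0 / 4"
  note zs = strip_near[OF z] and zD = G_D[OF z(1)]
  have b0: "bd z > 0" by (rule bd_pos[OF zD])
  have "(SUMU k. px k bd z * (f0 z * Vc k z + ((P z - cP) * Vc k z - cc * ((V z \<bullet> Bm z) * Bc k z)))) =
    f0 z * (SUMU k. px k bd z * Vc k z) + ((P z - cP) * (SUMU k. px k bd z * Vc k z) - cc * ((V z \<bullet> Bm z) * (SUMU k. px k bd z * Bc k z)))"
   by (simp only: sum_distrib_left sum.distrib[symmetric] sum_subtractf[symmetric]) (intro sum.cong refl, simp add: algebra_simps)
  then have e: "dd (1, 0) bd z * f0 z + (SUMU k. px k bd z * (f0 z * Vc k z + ((P z - cP) * Vc k z - cc * ((V z \<bullet> Bm z) * Bc k z)))) =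
    f0 z * dd (1, V z) bd z + (- ((P z - cP) * (nn z \<bullet> V z)) + cc * ((V z \<bullet> Bm z) * bn z))"
   using flux_bd[OF zs] by (simp add: algebra_simps)
  have "\<bar>f0 z * dd (1, V z) bd z\<bar> <= Cf * (M * bd z)"
   unfolding abs_mult using Cf zD abs_material_bd[OF zs] by (intro mult_mono) auto
  moreover have "\<bar>(P z - cP) * (nn z \<bullet> V z)\<bar> <= (L * bd z) * CV"
  proof -
   have "\<bar>nn z \<bullet> V z\<bar> <= CV" using Cauchy_Schwarz_ineq2[of "nn z" "V z"] norm_nn[OF zD] CV(2)[of z] zD closure_subset[of D] by auto
   then show ?thesis unfolding abs_mult using L zD b0 by (intro mult_mono) auto
  qed
  moreover have "\<bar>cc * ((V z \<bullet> Bm z) * bn z)\<bar> <= 1 * (Cw * (Cn * bd z))"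
   unfolding abs_mult using cc Cw zD Cn z b0 by (intro mult_mono mult_nonneg_nonneg) auto
  ultimately show "\<bar>dd (1, 0) bd z * f0 z + (SUMU k. px k bd z * (f0 z * Vc k z + ((P z - cP) * Vc k z - cc * ((V z \<bullet> Bm z) * Bc k z))))\<bar> <= (Cf * M + (L * CV + Cw * Cn)) * bd z"
   unfolding e by (simp add: algebra_simps)
 qed (use d0 G_dom in auto)
qed

lemma continuous_en: "continuous_on D (%z. tri (qz z) (vz z) (vz z) + cc * tri (qz z) (bz z) (bz z))" "continuous_on D en"
 unfolding en_def[abs_def] bil_def tri_def
 by (intro continuous_intros continuous_qq continuous_D[OF Ck_dVc] continuous_D[OF Ck_dBc])+

lemma bounded_en:
 obtains C where "C > 0" "!!z. z : D ==> \<bar>en z\<bar> <= C" "!!z. z : D ==> \<bar>tri (qz z) (vz z) (vz z) + cc * tri (qz z) (bz z) (bz z)\<bar> <= C"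
  "!!z. z : D ==> \<bar>HH z\<bar> <= C"
proof -
 obtain Cb where Cb: "Cb > 0" "!!z. z : D ==> \<bar>gV z + gB z\<bar> <= Cb"
  by (rule bounded_on_D[OF Ck_on_cont[OF Ck_on_add[OF dom(1) Ck_gV[of 0] Ck_gB]]]) blast
 define s where "s = sqrt Cb"
 have v: "\<bar>vz z i j\<bar> <= s" and b: "\<bar>bz z i j\<bar> <= s" if "z : D" for z i j
 proof -
  have "gV z <= Cb" "gB z <= Cb" using Cb(2)[OF that] gV_nonneg[of z] gB_nonneg[of z] by auto
  then show "\<bar>vz z i j\<bar> <= s" "\<bar>bz z i j\<bar> <= s" unfolding s_def
   by (meson abs_dV_le abs_dB_le order.trans real_sqrt_le_mono)+
 qed
 have s: "0 <= s * s" by simp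
 define c where "c = 6 * real CARD('n) ^ 3 * (s * s)"
 have c: "0 <= c" unfolding c_def by simp
 have ct: "\<bar>cc * r\<bar> <= c" if "\<bar>r\<bar> <= c" for r
  using mult_mono[of "\<bar>cc\<bar>" 1 "\<bar>r\<bar>" c] cc that c by (simp add: abs_mult)
 have bl: "\<bar>bil (qz z) (vz z) (vz z)\<bar> <= c" "\<bar>bil (qz z) (bz z) (bz z)\<bar> <= c" "\<bar>HH z\<bar> <= c"
  "\<bar>tri (qz z) (vz z) (vz z)\<bar> <= c" "\<bar>tri (qz z) (bz z) (bz z)\<bar> <= c" if "z : D" for z
 proof -
  show "\<bar>bil (qz z) (vz z) (vz z)\<bar> <= c" "\<bar>bil (qz z) (bz z) (bz z)\<bar> <= c" "\<bar>HH z\<bar> <= c"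
   unfolding c_def HH_def using that by (auto intro!: abs_bil_le abs_qq_le v b)
  have "\<bar>tri (qz z) (vz z) (vz z)\<bar> <= real CARD('n) ^ 3 * (2 * s * s)" "\<bar>tri (qz z) (bz z) (bz z)\<bar> <= real CARD('n) ^ 3 * (2 * s * s)"
   using that by (auto intro!: abs_tri_le abs_qq_le v b)
  moreover have "real CARD('n) ^ 3 * (2 * s * s) <= c"
  proof -
   have "0 <= real CARD('n) ^ 3 * (s * s)" by simp
   then show ?thesis by (simp add: c_def)
  qed
  ultimately show "\<bar>tri (qz z) (vz z) (vz z)\<bar> <= c" "\<bar>tri (qz z) (bz z) (bz z)\<bar> <= c" by linarith+
 qed
 show ?thesis
 proof (rule that[of "2 * c + 1"])
  fix z assume z: "z : D"
  show "\<bar>en z\<bar> <= 2 * c + 1" unfolding en_def cc_def[symmetric] using bl(1)[OF z] ct[OF bl(2)[OF z]] by linarith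
  show "\<bar>tri (qz z) (vz z) (vz z) + cc * tri (qz z) (bz z) (bz z)\<bar> <= 2 * c + 1" using bl(4)[OF z] ct[OF bl(5)[OF z]] by linarith
  show "\<bar>HH z\<bar> <= 2 * c + 1" using bl(3)[OF z] c by linarith
 qed (use c in auto)
qed

text \<open>The factor \<open>4 * pi\<close> compensates the weight of the magnetic part. At time 0,
  which lies outside \<open>G\<close>, the divergence of \<open>B\<close> vanishes by the initial
  condition instead of \<open>div_B\<close>.\<close>

lemma en_coercive:
 assumes z: "z : D" "fst z < T"
 shows "gV z + gB z <= 4 * pi * (3 * real CARD('n) + 4) * en z"
proof -
 define c where "c = 3 * real CARD('n) + 4"
 have q: "qz z = (%i j. (if i = j then 1 else 0) - (\<eta> (bd z))\<^sup>2 * nn z $ i * nn z $ j)" by (intro ext) (simp add: qq_def)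
 have N: "(SUMU k. (nn z $ k)\<^sup>2) = 1" using norm_nn[OF z(1)] norm_vec_sq[of "nn z"] by simp
 have dB: "(SUMU k. dB k k z) = 0"
 proof (cases "z : G")
  case False
  then obtain x where x: "z = (0, x)" using D_G_initial[OF z] by (cases z) auto
  then have "x : D0" using z(1) slice_0 by auto
  then have "divergence (B 0) x = 0" using sol unfolding mhd_solution_def by blast
  moreover have "pd k (B 0) x $ k = dB k k z" for k
  proof -
   have "pd k (B 0) x = px k Bm (0, x)"
    using dd_slice[OF diff_B[OF D_dom[OF z(1)[unfolded x]]], of "axis k 1"] by (simp add: pd_def dd_def Bm_def)
   then show ?thesis using dd_Bc[OF D_dom[OF z(1)]] x by simp
  qed
  ultimately show ?thesis by (simp add: divergence_def)
 qed (rule div_B)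
 have 1: "gV z <= c * bil (qz z) (vz z) (vz z)" unfolding q gV_def c_def
  by (rule coercivity[where a = "vz z" and N = "%k. nn z $ k" and e = "\<eta> (bd z)"]) (use div_V[OF z(1)] N eta_range in auto)
 have 2: "gB z <= c * bil (qz z) (bz z) (bz z)" unfolding q gB_def c_def
  by (rule coercivity[where a = "bz z" and N = "%k. nn z $ k" and e = "\<eta> (bd z)"]) (use dB N eta_range in auto)
 have c0: "c > 0" by (simp add: c_def add_nonneg_pos)
 have "0 <= c * bil (qz z) (vz z) (vz z)" using 1 gV_nonneg[of z] by linarith
 then have "1 * (c * bil (qz z) (vz z) (vz z)) <= (4 * pi) * (c * bil (qz z) (vz z) (vz z))" using pi_gt3 by (intro mult_right_mono) auto
 then show ?thesis using 1 2 unfolding en_def c_def[symmetric] by (simp add: algebra_simps)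
qed

lemma energy1_eq:
 assumes t: "t : {0..T}"
 shows "energy1 \<eta> (slice D t) (v t) (B t) = integral (slice D t) (%x. en (t, x))"
proof -
 define e1 where "e1 z = tri (qz z) (vz z) (vz z) + cc * tri (qz z) (bz z) (bz z)" for z
 define e2 where "e2 z = en z - e1 z" for z
 obtain C where C: "C > 0" "!!z. z : D ==> \<bar>en z\<bar> <= C" "!!z. z : D ==> \<bar>e1 z\<bar> <= C"
  unfolding e1_def by (rule bounded_en) blast
 have int: "(%x. f (t, x)) integrable_on slice D t" if "continuous_on D f" "!!z. z : D ==> \<bar>f z\<bar> <= C" for f :: "real \<times> (real^'n) => real"
 proof -
  have "continuous_on (slice D t) (%x. f (t, x))"
   by (rule continuous_on_compose2[OF that(1)]) (auto intro!: continuous_intros)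
  then have "(%x. f (t, x)) absolutely_integrable_on slice D t"
   using that(2) by (intro absolutely_integrable_on_open[OF open_slice bounded_slice, of _ _ C]) auto
  then show ?thesis using set_lebesgue_integral_eq_integral(1) by blast
 qed
 have i1: "(%x. e1 (t, x)) integrable_on slice D t" by (rule int) (use continuous_en C in \<open>auto simp: e1_def[abs_def]\<close>)
 have ie: "(%x. en (t, x)) integrable_on slice D t" by (rule int) (use continuous_en C in auto)
 have i2: "(%x. e2 (t, x)) integrable_on slice D t" unfolding e2_def by (rule integrable_diff[OF ie i1])
 have d: "grad (%y. v t y $ i) x $ k = vz (t, x) k i" "grad (%y. B t y $ i) x $ k = bz (t, x) k i"
  "pd k (v t) x $ i = vz (t, x) k i" "pd k (B t) x $ i = bz (t, x) k i" if "(t, x) : D" for x i k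
 proof -
  note zd = D_dom[OF that]
  show "grad (%y. v t y $ i) x $ k = vz (t, x) k i" "grad (%y. B t y $ i) x $ k = bz (t, x) k i"
   using dd_slice[OF diff_Vc[OF zd], of "axis k 1" i] dd_slice[OF diff_Bc[OF zd], of "axis k 1" i]
   by (simp_all add: grad_def pd_def dd_def Vc_def Bc_def V_def Bm_def)
  have "pd k (v t) x = px k V (t, x)" "pd k (B t) x = px k Bm (t, x)"
   using dd_slice[OF diff_V[OF zd], of "axis k 1"] dd_slice[OF diff_B[OF zd], of "axis k 1"]
   by (simp_all add: pd_def dd_def V_def Bm_def)
  then show "pd k (v t) x $ i = vz (t, x) k i" "pd k (B t) x $ i = bz (t, x) k i" using dd_Vc[OF zd] dd_Bc[OF zd] by auto
 qed
 have qc: "q_coeff \<eta> (slice D t) x $ i $ j = qq i j (t, x)" if x: "(t, x) : D" for x i j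
 proof (cases "bd (t, x) < d0")
  case True
  then show ?thesis by (simp add: q_coeff_def qq_def pd_bdist[OF x True] bd_def)
 next
  case False
  \<comment> \<open>Here the distance may have no derivative and the choice of the foot may be
    arbitrary; both are multiplied by the vanishing cutoff.\<close>
  then have "\<eta> (bd (t, x)) = 0" using d0 by (intro eta_zero) auto
  then show ?thesis by (simp add: q_coeff_def qq_def bd_def)
 qed
 have 1: "(SUMU i. Q_form \<eta> (slice D t) x (grad (%y. v t y $ i) x) (grad (%y. v t y $ i) x)
   + Q_form \<eta> (slice D t) x (grad (%y. B t y $ i) x) (grad (%y. B t y $ i) x) / (4 * pi)) = e1 (t, x)" if x: "(t, x) : D" for x
 proof -
  have s: "(SUMU k. SUMU i. SUMU j. qq i j (t, x) * a i k * a j k) = tri (qz (t, x)) a a" for a :: "'n => 'n => real"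
   unfolding tri_def by (subst sum.swap) (simp add: mult_ac)
  show ?thesis unfolding Q_form_def d[OF x] qc[OF x] sum.distrib sum_divide_distrib[symmetric] s[of "vz (t, x)"] s[of "bz (t, x)"]
   by (simp add: e1_def cc_def)
 qed
 have 2: "(norm (curl (v t) x))\<^sup>2 + (norm (curl (B t) x))\<^sup>2 / (4 * pi) = e2 (t, x)" if x: "(t, x) : D" for x
 proof -
  have n: "(norm (\<chi> i j. a i j - a j i))\<^sup>2 = 2 * (SUMU i. SUMU k. (a i k - a k i) * a i k)" for a :: "'n => 'n => real"
   unfolding antisymmetric_sq[symmetric] by (simp add: norm_vec_def L2_set_def sum_nonneg)
  show ?thesis unfolding curl_def d[OF x] n[of "vz (t, x)"] n[of "bz (t, x)"]
   by (simp add: e2_def e1_def en_def bil_def cc_def algebra_simps)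
 qed
 have "energy1 \<eta> (slice D t) (v t) (B t) = integral (slice D t) (%x. e1 (t, x)) + integral (slice D t) (%x. e2 (t, x))"
  unfolding energy1_def by (intro arg_cong2[of _ _ _ _ "(+)"] integral_cong) (use 1 2 in auto)
 then show ?thesis using integral_add[OF i1 i2] by (simp add: e2_def)
qed

definition JJ :: "real => real" where
 "JJ t = integral (slice D t) (%x. dd (1, 0) en (t, x) + (SUMU k. px k (XE k) (t, x)))"

lemma RR_bounded: "\<exists>C. ALL z:G. \<bar>dd (1, 0) en z + (SUMU k. px k (XE k) z)\<bar> <= C"
proof -
 obtain C1 where C1: "C1 > 0" "!!z. z : G ==> \<bar>gV z\<bar> <= C1" by (rule bounded_on_G[OF Ck_gV]) blast
 obtain C2 where C2: "C2 > 0" "!!z. z : G ==> \<bar>gB z\<bar> <= C2" by (rule bounded_on_G[OF Ck_gB]) blast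
 obtain CB where CB: "CB > 0" "!!z. z : closure D ==> norm (Bm z) <= CB"
  by (rule bounded_on_closure[OF Ck_on_cont[OF Ck_B]]) blast
 define c0 where "c0 = cut_deriv_bound \<eta>"
 have c0: "c0 > 0" using cut_deriv_bound[OF cutoff_\<eta>] by (simp add: c0_def)
 have A: "0 <= en_const TYPE('n) d0 \<eta>" using en_const_pos[OF d0 cutoff_\<eta>, where 'n='n] by simp
 have "\<bar>dd (1, 0) en z + (SUMU k. px k (XE k) z)\<bar> <= en_const TYPE('n) d0 \<eta> * (M * C1 + M * C2 + M * K\<^sup>2 + M * (K\<^sup>2 * CB\<^sup>2)
  + M * (c0 * (real CARD('n) * M)) + M * (c0 * CB\<^sup>2))" if z: "z : G" for z
 proof -
  have zc: "z : closure D" using G_D[OF z] closure_subset by blast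
  have "\<bar>bn z\<bar> <= CB" using Cauchy_Schwarz_ineq2[of "Bm z" "nn z"] norm_nn[OF G_D[OF z]] CB(2)[OF zc] by (simp add: bn_def)
  then have b: "(bn z)\<^sup>2 <= CB\<^sup>2" by (metis abs_ge_zero power2_abs power_mono)
  have B: "(norm (Bm z))\<^sup>2 <= CB\<^sup>2" using CB(2)[OF zc] by (intro power_mono) auto
  have S: "(SUMU i. \<bar>px i P z\<bar>) <= real CARD('n) * M"
   using sum_bounded_above[of UNIV "%i. \<bar>px i P z\<bar>" M] abs_px_P_le[OF zc] by simp
  have "\<bar>dd (1, 0) en z + (SUMU k. px k (XE k) z)\<bar> <= en_const TYPE('n) d0 \<eta> * (M * gV z + M * gB z + M * K\<^sup>2 + M * (K\<^sup>2 * (norm (Bm z))\<^sup>2)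
   + M * (ee z * (SUMU i. \<bar>px i P z\<bar>)) + M * (ee z * (bn z)\<^sup>2))"
   unfolding energy_identity[OF z] by (rule RR_bound[OF z])
  also have "... <= en_const TYPE('n) d0 \<eta> * (M * C1 + M * C2 + M * K\<^sup>2 + M * (K\<^sup>2 * CB\<^sup>2)
   + M * (c0 * (real CARD('n) * M)) + M * (c0 * CB\<^sup>2))"
   using C1(2)[OF z] C2(2)[OF z] b B S ee[of z] c0 M_pos A
   by (intro mult_left_mono add_mono mult_mono[of "ee z" c0]) (auto simp: c0_def[symmetric] intro: sum_nonneg)
  finally show ?thesis .
 qed
 then show ?thesis by blast
qed

text \<open>The three parts of \<open>XE\<close> are tangential for different reasons: transport by
  \<open>V\<close> because the boundary moves with the fluid, \<open>YY\<close> because it contains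
  the tangential gradient of \<open>P\<close>, and the magnetic part because \<open>bn\<close> is
  \<open>O(bd)\<close>.\<close>

lemma energy_growth:
 assumes t: "0 <= t1" "t1 <= t2" "t2 <= T"
 shows "(JJ has_integral (integral (slice D t2) (%x. en (t2, x)) - integral (slice D t1) (%x. en (t1, x)))) {t1..t2}"
proof -
 obtain Ce where Ce: "Ce > 0" "!!z. z : D ==> \<bar>en z\<bar> <= Ce" "!!z. z : D ==> \<bar>HH z\<bar> <= Ce" by (rule bounded_en) blast
 obtain C1 where C1: "!!z. z : G ==> \<bar>dd (1, 0) en z + (SUMU k. px k (XE k) z)\<bar> <= C1" using RR_bounded by blast
 obtain Cn where Cn: "Cn > 0" "!!z. z : G ==> bd z < d0 / 4 ==> \<bar>bn z\<bar> <= Cn * bd z" by (rule normal_B_bound) blast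
 obtain CP where CP: "CP > 0" "!!z j. z : G ==> bd z < d0 / 4 ==> \<bar>SUMU i. qq i j z * px i P z\<bar> <= CP * bd z" by (rule tangential_P) blast
 define N where "N = real CARD('n)"
 have C2: "\<bar>dd (1, 0) bd z * en z + (SUMU k. px k bd z * XE k z)\<bar> <= (Ce * M + (2 * (N * (N * (M * CP))) + 2 * (Cn * Ce))) * bd z"
  if z: "z : G" "bd z < d0 / 4" for z
 proof -
  note zs = strip_near[OF z] and zD = G_D[OF z(1)]
  have b0: "bd z > 0" by (rule bd_pos[OF zD])
  have e: "dd (1, 0) bd z * en z + (SUMU k. px k bd z * XE k z) =
    en z * dd (1, V z) bd z + (2 * (SUMU k. px k bd z * YY k z) + 2 * (cc * (bn z * HH z)))"
  proof -
   have "(SUMU k. px k bd z * XE k z) = en z * (SUMU k. px k bd z * Vc k z) + (2 * (SUMU k. px k bd z * YY k z)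
     - 2 * cc * HH z * (SUMU k. px k bd z * Bc k z))"
    by (simp only: XE_def sum_distrib_left sum.distrib[symmetric] sum_subtractf[symmetric]) (intro sum.cong refl, simp add: algebra_simps)
   then show ?thesis unfolding flux_bd(2)[OF zs] flux_bd(3)[OF zs, symmetric] by (simp add: algebra_simps)
  qed
  have "\<bar>en z * dd (1, V z) bd z\<bar> <= Ce * (M * bd z)"
   unfolding abs_mult using Ce(1,2) zD abs_material_bd[OF zs] by (intro mult_mono) auto
  moreover have "\<bar>cc * (bn z * HH z)\<bar> <= 1 * ((Cn * bd z) * Ce)"
   unfolding abs_mult using cc Cn z Ce(3)[OF zD] b0 by (intro mult_mono mult_nonneg_nonneg) auto
  moreover have "\<bar>SUMU k. px k bd z * YY k z\<bar> <= N * (N * (M * (CP * bd z)))"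
   unfolding N_def
  proof (rule abs_sum_le_card)
   fix k
   have "YY k z = (SUMU j. dV j k z * (SUMU i. qq i j z * px i P z))"
    unfolding YY_def by (subst sum.swap) (simp add: sum_distrib_left mult_ac)
   also have "\<bar>...\<bar> <= real CARD('n) * (M * (CP * bd z))"
   proof (rule abs_sum_le_card)
    fix j
    have "\<bar>dV j k z\<bar> <= M"
     using abs_dV_le[of j k z] real_sqrt_le_mono[OF gV_le[OF zD]] M_pos by simp
    then show "\<bar>dV j k z * (SUMU i. qq i j z * px i P z)\<bar> <= M * (CP * bd z)"
     unfolding abs_mult using CP(2)[OF z, of j] M_pos by (intro mult_mono) auto
   qed
   finally have "\<bar>px k bd z * YY k z\<bar> <= 1 * (real CARD('n) * (M * (CP * bd z)))"
    unfolding abs_mult using px_bd[OF zs, of k] abs_nn_le[OF zD, of k] by (intro mult_mono) auto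
   then show "\<bar>px k bd z * YY k z\<bar> <= real CARD('n) * (M * (CP * bd z))" by simp
  qed
  ultimately have "\<bar>en z * dd (1, V z) bd z + (2 * (SUMU k. px k bd z * YY k z) + 2 * (cc * (bn z * HH z)))\<bar>
    <= Ce * (M * bd z) + (2 * (N * (N * (M * (CP * bd z)))) + 2 * ((Cn * bd z) * Ce))" by linarith
  then show ?thesis unfolding e by (simp add: algebra_simps)
 qed
 have d4: "d0 / 4 > 0" using d0 by simp
 show ?thesis unfolding JJ_def[abs_def]
  by (rule transport[OF continuous_en(2) Ck_en_HH_YY(1) Ce(2) Ck_en_HH_YY(4) C1 C2 d4 t])
qed

text \<open>The pointwise bound on \<open>RR\<close> is integrated over the slice. Both layer terms
  return to the integrals of \<open>gV\<close> and \<open>gB\<close>, by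
  \<open>strip_gradient_P\<close> and \<open>poincare\<close>, and coercivity turns these into the
  energy itself.\<close>

lemma JJ_le:
 assumes t: "t : {0<..<T}"
 shows "JJ t <= growth_const TYPE('n) d0 \<eta> * M * (integral (slice D t) (%x. en (t, x))
  + K\<^sup>2 * (measure lebesgue (slice D t) + energy0 (slice D t) (v t) (B t)))"
proof -
 define A c0 k SC N where "A = en_const TYPE('n) d0 \<eta>" and "c0 = cut_deriv_bound \<eta>" and "k = real mm / 2 * (d0 / 16) ^ (mm - 1)"
  and "SC = strip_const TYPE('n) d0 \<eta>" and "N = real CARD('n)"
 have A: "0 < A" and SC: "0 <= SC" and c0: "0 < c0"
  unfolding A_def SC_def c0_def by (rule en_const_pos[OF d0 cutoff_\<eta>] strip_const_nonneg[OF d0 cutoff_\<eta>] cut_deriv_bound(1)[OF cutoff_\<eta>])+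
 have k: "k > 0" using mm d0 by (simp add: k_def)
 let ?I = "%f. integral (slice D t) (%x. f (t, x))"
 define E where "E = ?I en"
 obtain C1 where C1: "C1 > 0" "!!z. z : G ==> \<bar>gV z\<bar> <= C1" by (rule bounded_on_G[OF Ck_gV]) blast
 obtain C2 where C2: "C2 > 0" "!!z. z : G ==> \<bar>gB z\<bar> <= C2" by (rule bounded_on_G[OF Ck_gB]) blast
 obtain C3 where C3: "C3 > 0" "!!z. z : G ==> \<bar>f0 z\<bar> <= C3" by (rule bounded_on_G[OF Ck_f0]) blast
 obtain C4 where C4: "C4 > 0" "!!z. z : D ==> \<bar>en z\<bar> <= C4" by (rule bounded_en) blast
 obtain C5 where C5: "!!z. z : G ==> \<bar>dd (1, 0) en z + (SUMU k. px k (XE k) z)\<bar> <= C5" using RR_bounded by blast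
 have iV: "(%x. gV (t, x)) integrable_on slice D t" by (rule integrable_on_slice[OF continuous_on_dom_G[OF Ck_gV] C1(2) t])
 have iB: "(%x. gB (t, x)) integrable_on slice D t" by (rule integrable_on_slice[OF continuous_on_dom_G[OF Ck_gB] C2(2) t])
 have i0: "(%x. f0 (t, x)) integrable_on slice D t" by (rule integrable_on_slice[OF continuous_on_dom_G[OF Ck_f0] C3(2) t])
 have ien: "(%x. en (t, x)) integrable_on slice D t"
  by (rule integrable_on_slice[OF Ck_on_cont[OF Ck_en_HH_YY(1)] C4(2)[OF G_D] t])
 have iJ: "(%x. dd (1, 0) en (t, x) + (SUMU k. px k (XE k) (t, x))) integrable_on slice D t"
  by (rule integrable_on_slice[OF _ C5 t]) (intro continuous_intros Ck1_continuous_dd[OF Ck_en_HH_YY(1)] Ck1_continuous_dd[OF Ck_en_HH_YY(4)])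
 have lm: "slice D t : lmeasurable" by (rule lmeasurable_open[OF bounded_slice open_slice])
 have i1: "((%x. 1) has_integral measure lebesgue (slice D t)) (slice D t)"
  using integrable_integral[of "%x. 1 :: real" "slice D t"] lm lmeasure_integral[OF lm] by (simp add: lmeasurable_iff_integrable_on)
 define Z where "Z = ?I gV + ?I gB"
 have Zpos: "0 <= ?I gV" "0 <= ?I gB" by (auto intro!: integral_nonneg iV iB gV_nonneg gB_nonneg)
 have ZE: "Z <= 4 * pi * (3 * N + 4) * E"
 proof -
  have "Z = integral (slice D t) (%x. gV (t, x) + gB (t, x))" unfolding Z_def by (rule integral_add[OF iV iB, symmetric])
  also have "... <= integral (slice D t) (%x. 4 * pi * (3 * N + 4) * en (t, x))"
   by (rule integral_le[OF integrable_add[OF iV iB] integrable_on_mult_right[OF ien]]) (use en_coercive t in \<open>auto simp: N_def\<close>)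
  finally show ?thesis by (simp add: E_def)
 qed
 have LZ: "integral (slice D t) (%x. \<bar>LapP (t, x)\<bar>) <= Z"
 proof -
  have "integral (slice D t) (%x. \<bar>LapP (t, x)\<bar>) <= integral (slice D t) (%x. gV (t, x) + gB (t, x))"
   by (rule integral_le[OF kato(2)[OF t] integrable_add[OF iV iB]]) (use abs_LapP_le slice_G t in auto)
  then show ?thesis unfolding Z_def using integral_add[OF iV iB] by simp
 qed
 define Ip where "Ip i = integral (slice D t) (%x. ee (t, x) * \<bar>px i P (t, x)\<bar>)" for i
 define Ik where "Ik = integral (slice D t) (%x. kap (bd (t, x)) * (bn (t, x))\<^sup>2)"
 have hp: "((%x. ee (t, x) * \<bar>px i P (t, x)\<bar>) has_integral Ip i) (slice D t)" for i
  unfolding Ip_def ee_def by (rule integrable_integral[OF strip_gradient_P(1)[OF t]])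
 have Ip: "Ip i <= SC * Z" for i
  using strip_gradient_P(2)[OF t, of i] mult_left_mono[OF LZ SC] by (simp add: Ip_def ee_def SC_def)
 have hk: "((%x. kap (bd (t, x)) * (bn (t, x))\<^sup>2) has_integral Ik) (slice D t)"
  unfolding Ik_def by (rule integrable_integral[OF poincare(1)[OF t]])
 have Ik: "Ik <= 2 * bb ^ (mm + 1) * Z"
 proof -
  have "Ik <= 2 * bb ^ (mm + 1) * ?I gB" unfolding Ik_def by (rule poincare(2)[OF t])
  also have "... <= 2 * bb ^ (mm + 1) * Z" using Zpos bb by (intro mult_left_mono) (auto simp: Z_def)
  finally show ?thesis .
 qed
 have ptw: "dd (1, 0) en z + (SUMU k. px k (XE k) z) <= A * M * (gV z + gB z + K\<^sup>2 * 1 + 8 * pi * K\<^sup>2 * f0 z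
   + (SUMU i. ee z * \<bar>px i P z\<bar>) + c0 / k * (kap (bd z) * (bn z)\<^sup>2))" if z: "z : G" for z
 proof -
  have "(norm (Bm z))\<^sup>2 <= 8 * pi * f0 z" using pi_gt3 by (simp add: f0_def field_simps)
  then have 1: "K\<^sup>2 * (norm (Bm z))\<^sup>2 <= 8 * pi * K\<^sup>2 * f0 z" using mult_left_mono[of _ _ "K\<^sup>2"] by (fastforce simp: mult_ac)
  \<comment> \<open>The derivative of the cutoff lives at distances at most \<open>d0 / 2\<close>,
    where the weight of the Poincare inequality is at least \<open>k\<close>.\<close>
  have "ee z <= c0 / k * kap (bd z)"
  proof (cases "bd z <= d0 / 2")
   case True
   then have "k <= kap (bd z)" unfolding k_def using d0 by (intro kap_ge) auto
   then have "c0 * 1 <= c0 * (kap (bd z) / k)" using k c0 by (intro mult_left_mono) auto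
   then show ?thesis using ee[of z] by (simp add: c0_def)
  next
   case False
   then have "ee z = 0" using eta_zero by (simp add: ee_def)
   then show ?thesis using kap_nonneg[of "bd z"] c0 k by simp
  qed
  from mult_right_mono[OF this, of "(bn z)\<^sup>2"] have 2: "ee z * (bn z)\<^sup>2 <= c0 / k * (kap (bd z) * (bn z)\<^sup>2)" by (simp add: mult.assoc)
  have "dd (1, 0) en z + (SUMU k. px k (XE k) z) <= A * (M * gV z + M * gB z + M * K\<^sup>2 + M * (K\<^sup>2 * (norm (Bm z))\<^sup>2)
   + M * (ee z * (SUMU i. \<bar>px i P z\<bar>)) + M * (ee z * (bn z)\<^sup>2))"
   unfolding energy_identity[OF z] A_def using RR_bound[OF z] by linarith
  also have "... = A * M * (gV z + gB z + K\<^sup>2 * 1 + K\<^sup>2 * (norm (Bm z))\<^sup>2 + (SUMU i. ee z * \<bar>px i P z\<bar>) + ee z * (bn z)\<^sup>2)"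
   by (simp add: sum_distrib_left algebra_simps)
  also have "... <= A * M * (gV z + gB z + K\<^sup>2 * 1 + 8 * pi * K\<^sup>2 * f0 z + (SUMU i. ee z * \<bar>px i P z\<bar>) + c0 / k * (kap (bd z) * (bn z)\<^sup>2))"
   using 1 2 A M_pos by (intro mult_left_mono add_mono order_refl) auto
  finally show ?thesis .
 qed
 define Vol E0 where "Vol = measure lebesgue (slice D t)" and "E0 = ?I f0"
 have E0: "0 <= E0" unfolding E0_def by (intro integral_nonneg i0) (auto simp: f0_def)
 have Vol: "0 <= Vol" by (simp add: Vol_def)
 have hR: "((%x. A * M * (gV (t, x) + gB (t, x) + K\<^sup>2 * 1 + 8 * pi * K\<^sup>2 * f0 (t, x) + (SUMU i. ee (t, x) * \<bar>px i P (t, x)\<bar>)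
   + c0 / k * (kap (bd (t, x)) * (bn (t, x))\<^sup>2))) has_integral
   A * M * (?I gV + ?I gB + K\<^sup>2 * Vol + 8 * pi * K\<^sup>2 * E0 + (SUMU i. Ip i) + c0 / k * Ik)) (slice D t)"
  unfolding E0_def Vol_def
  by (intro has_integral_mult_right has_integral_add has_integral_sum integrable_integral iV iB i0 i1 hp hk finite)
 have "JJ t <= A * M * (?I gV + ?I gB + K\<^sup>2 * Vol + 8 * pi * K\<^sup>2 * E0 + (SUMU i. Ip i) + c0 / k * Ik)"
  unfolding JJ_def by (rule has_integral_le[OF integrable_integral[OF iJ] hR]) (use ptw slice_G t in auto)
 also have "... <= A * M * (((1 + N * SC + c0 / k * (2 * bb ^ (mm + 1))) * (4 * pi * (3 * N + 4)) + 8 * pi) * (E + K\<^sup>2 * (Vol + E0)))"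
 proof (rule mult_left_mono)
  define w where "w = 1 + N * SC + c0 / k * (2 * bb ^ (mm + 1))"
  have w: "0 <= w" unfolding w_def N_def using SC c0 k bb by (intro add_nonneg_nonneg mult_nonneg_nonneg) auto
  have "(SUMU i. Ip i) <= N * (SC * Z)" unfolding N_def using sum_bounded_above[of UNIV Ip "SC * Z"] Ip by simp
  moreover have "c0 / k * Ik <= c0 / k * (2 * bb ^ (mm + 1) * Z)" using Ik c0 k by (intro mult_left_mono) auto
  ultimately have "?I gV + ?I gB + (SUMU i. Ip i) + c0 / k * Ik <= Z + N * (SC * Z) + c0 / k * (2 * bb ^ (mm + 1) * Z)"
   unfolding Z_def[symmetric] by linarith
  also have "... = w * Z" by (simp add: w_def algebra_simps)
  also have "... <= w * (4 * pi * (3 * N + 4) * E)" using ZE w by (intro mult_left_mono)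
  finally have 1: "?I gV + ?I gB + (SUMU i. Ip i) + c0 / k * Ik <= (w * (4 * pi * (3 * N + 4))) * E" by (simp add: mult_ac)
  have Kp: "0 <= K\<^sup>2 * (Vol + E0)" using Vol E0 by simp
  have E': "0 <= E"
  proof -
   have "0 <= 4 * pi * (3 * N + 4) * E" using ZE Zpos unfolding Z_def by linarith
   moreover have "0 < 4 * pi * (3 * N + 4)" by (simp add: N_def add_nonneg_pos)
   ultimately show ?thesis by (meson zero_le_mult_iff not_less)
  qed
  define W where "W = w * (4 * pi * (3 * N + 4))"
  have W: "0 <= W" unfolding W_def using w by (simp add: N_def)
  have "K\<^sup>2 * Vol <= 8 * pi * (K\<^sup>2 * Vol)" using pi_gt3 Vol mult_right_mono[of 1 "8 * pi" "K\<^sup>2 * Vol"] by simp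
  then have 2: "K\<^sup>2 * Vol + 8 * pi * K\<^sup>2 * E0 <= 8 * pi * (K\<^sup>2 * (Vol + E0))" by (simp add: algebra_simps)
  have 3: "0 <= 8 * pi * E" "0 <= W * (K\<^sup>2 * (Vol + E0))" using E' W Kp by simp_all
  have "?I gV + ?I gB + K\<^sup>2 * Vol + 8 * pi * K\<^sup>2 * E0 + (SUMU i. Ip i) + c0 / k * Ik
    <= W * E + 8 * pi * (K\<^sup>2 * (Vol + E0)) + 8 * pi * E + W * (K\<^sup>2 * (Vol + E0))"
   using 1 2 3 unfolding W_def[symmetric] by linarith
  also have "... = (W + 8 * pi) * (E + K\<^sup>2 * (Vol + E0))" by (simp only: distrib_left distrib_right)
  finally show "?I gV + ?I gB + K\<^sup>2 * Vol + 8 * pi * K\<^sup>2 * E0 + (SUMU i. Ip i) + c0 / k * Ik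
    <= ((1 + N * SC + c0 / k * (2 * bb ^ (mm + 1))) * (4 * pi * (3 * N + 4)) + 8 * pi) * (E + K\<^sup>2 * (Vol + E0))"
   unfolding W_def w_def .
 qed (use A M_pos in simp)
 also have "... = growth_const TYPE('n) d0 \<eta> * M * (E + K\<^sup>2 * (Vol + E0))"
  unfolding growth_const_def Let_def A_def N_def SC_def c0_def k_def bb_def mm_def by (simp only: mult_ac)
 finally show ?thesis by (simp add: E_def Vol_def E0_def energy0_eq)
qed

lemma energy_estimate:
 assumes t: "t : {0..T}" and C: "growth_const TYPE('n) d0 \<eta> <= C" "1 <= C"
 shows "energy1 \<eta> (slice D t) (v t) (B t) <= 2 * exp (C * M * t) * energy1 \<eta> (slice D 0) (v 0) (B 0) +
  C * K\<^sup>2 * (measure lebesgue (slice D t) + energy0 (slice D 0) (v 0) (B 0)) * (exp (C * M * t) - 1)"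
proof -
 define g where "g = growth_const TYPE('n) d0 \<eta>"
 have g: "0 < g" unfolding g_def by (rule growth_const_pos[OF d0 cutoff_\<eta>])
 define e where "e s = integral (slice D s) (%x. en (s, x))" for s
 define m where "m = K\<^sup>2 * (measure lebesgue (slice D 0) + energy0 (slice D 0) (v 0) (B 0))"
 have "0 <= energy0 (slice D 0) (v 0) (B 0)" unfolding energy0_def
  by (cases "(%x. (norm (v 0 x))\<^sup>2 / 2 + (norm (B 0 x))\<^sup>2 / (8 * pi)) integrable_on slice D 0") (auto intro!: integral_nonneg simp: not_integrable_integral)
 then have m: "0 <= m" by (simp add: m_def)
 \<comment> \<open>Gronwall is applied to the energy plus \<open>m\<close>: by conservation of
   volume and of \<open>E_0\<close> the inhomogeneous term is constant in time, and adding a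
   constant leaves the increments unchanged.\<close>
 have "e t + m <= (e 0 + m) * exp (g * M * t)"
 proof (rule gronwall_integral[where T = T and J = JJ])
  fix s assume s: "0 < s" "s < T"
  then have "JJ s <= g * M * (e s + K\<^sup>2 * (measure lebesgue (slice D s) + energy0 (slice D s) (v s) (B s)))"
   unfolding g_def e_def by (intro JJ_le) auto
  then show "JJ s <= g * M * (e s + m)" using volume_conserved[of s] energy0_conserved[of s] s by (simp add: m_def)
 qed (use energy_growth g M_pos t in \<open>auto simp: e_def\<close>)
 have e0: "0 <= e 0"
 proof -
  have "0 <= en (0, x)" if "(0, x) : D" for x
  proof -
   have "gV (0, x) + gB (0, x) <= 4 * pi * (3 * real CARD('n) + 4) * en (0, x)" using en_coercive[OF that] T_pos by simp
   then have "0 <= 4 * pi * (3 * real CARD('n) + 4) * en (0, x)"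
    using gV_nonneg[of "(0, x)"] gB_nonneg[of "(0, x)"] by linarith
   moreover have "0 < 4 * pi * (3 * real CARD('n) + 4)" by (simp add: add_nonneg_pos)
   ultimately show ?thesis by (meson zero_le_mult_iff not_less)
  qed
  then show ?thesis unfolding e_def
   by (cases "(%x. en (0, x)) integrable_on slice D 0") (auto intro!: integral_nonneg simp: not_integrable_integral)
 qed
 define X where "X = exp (C * M * t)"
 have gX: "exp (g * M * t) <= X" using C t M_pos unfolding X_def g_def by (auto intro!: mult_right_mono)
 have X1: "1 <= X" using C t M_pos unfolding X_def by simp
 have "e t + m <= (e 0 + m) * X" using \<open>e t + m <= _\<close> mult_left_mono[OF gX, of "e 0 + m"] e0 m by linarith
 then have "e t <= X * e 0 + m * (X - 1)" by (simp add: algebra_simps)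
 also have "X * e 0 <= 2 * X * e 0" using X1 e0 by simp
 also have "m * (X - 1) <= C * (m * (X - 1))" using C m X1 mult_right_mono[of 1 C "m * (X - 1)"] by simp
 finally show ?thesis using energy1_eq[OF t] energy1_eq[of 0] T_pos volume_conserved[OF t] by (simp add: e_def m_def X_def mult_ac)
qed

end

theorem theorem1p1:
  fixes d0 :: real and \<eta> :: "real \<Rightarrow> real"
  assumes "CARD('n::finite) = 2 \<or> CARD('n) = 3"
    and "d0 > 0" and "cutoff d0 \<eta>"
  shows "\<exists>C>0. \<forall>(T::real) (M::real) (K::real) (\<sigma>::real) (D0 :: (real^'n) set) v0 B0 D v B p.
    T > 0 \<longrightarrow> M > 0 \<longrightarrow> K > 0 \<longrightarrow> \<sigma> \<ge> 0 \<longrightarrow>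
    mhd_solution T \<sigma> D0 v0 B0 D v B p \<longrightarrow>
    (\<forall>t\<in>{0..T}. d0 < inj_radius (slice D t)) \<longrightarrow>
    (\<forall>t\<in>{0..T}. \<forall>x\<in>slice D t.
       norm (grad (total_pressure p B t) x) \<le> M \<and> norm (grad (v t) x) \<le> M) \<longrightarrow>
    (\<forall>t\<in>{0..T}. \<forall>x\<in>frontier (slice D t).
       norm (second_ff (slice D t) x) + norm (grad (v t) x) + 1 / inj_radius (slice D t) \<le> K) \<longrightarrow>
    (\<forall>t\<in>{0..T}.
       energy1 \<eta> (slice D t) (v t) (B t) \<le>
         2 * exp (C * M * t) * energy1 \<eta> (slice D 0) (v 0) (B 0) +
         C * K\<^sup>2 * (measure lebesgue (slice D t) + energy0 (slice D 0) (v 0) (B 0)) *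
           (exp (C * M * t) - 1))"
\<comment> \<open>The constant is taken to be at least 1 because Gronwall's inequality yields the
  second term with coefficient 1, whereas the claim has the factor \<open>C\<close> in front of
  it.\<close>
proof (rule exI[of _ "max 1 (growth_const TYPE('n) d0 \<eta>)"], intro conjI allI impI ballI)
 fix T M K \<sigma> :: real and D0 :: "(real^'n) set" and v0 B0 D v B p t
 assume hyps: "T > 0" "M > 0" "K > 0" "mhd_solution T \<sigma> D0 v0 B0 D v B p"
  and inj: "\<forall>t\<in>{0..T}. d0 < inj_radius (slice D t)"
  and int: "\<forall>t\<in>{0..T}. \<forall>x\<in>slice D t. norm (grad (total_pressure p B t) x) <= M & norm (grad (v t) x) <= M"
  and bdry: "\<forall>t\<in>{0..T}. \<forall>x\<in>frontier (slice D t).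
    norm (second_ff (slice D t) x) + norm (grad (v t) x) + 1 / inj_radius (slice D t) <= K"
  and t: "t : {0..T}"
 have "smooth_moving_domain T D" using hyps(4) unfolding mhd_solution_def by blast
 then interpret mhd_flow T D d0 \<sigma> M K \<eta> D0 v0 B0 v B p
  using hyps inj int bdry assms by unfold_locales auto
 show "energy1 \<eta> (slice D t) (v t) (B t) <=
   2 * exp (max 1 (growth_const TYPE('n) d0 \<eta>) * M * t) * energy1 \<eta> (slice D 0) (v 0) (B 0) +
   max 1 (growth_const TYPE('n) d0 \<eta>) * K\<^sup>2 * (measure lebesgue (slice D t) + energy0 (slice D 0) (v 0) (B 0)) *
   (exp (max 1 (growth_const TYPE('n) d0 \<eta>) * M * t) - 1)"
  by (rule energy_estimate[OF t]) auto
qed simp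

end
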